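(* Let $\Bbbk$ be an infinite field, $S=\Bbbk[x_1,\dots,x_n]$, $\mathfrak m=(x_1,\dots,x_n)$. Let $M$ be a squarefree $S$-module and let $\Theta=\theta_1,\dots,\theta_m$ be a sequence of generic linear forms in $S$. For $F\in\{0,1\}^n$ let $H^j_F(M):=H^j_{\mathfrak m}(M)_{-F}$ be the $\mathbb Z^n$-graded piece of the $j$-th local cohomology of $M$ in degree $-F$. Then, for every $\ell$, for all $i\gg0$, $$\dim_\Bbbk H^\ell_{\mathfrak m}(M/\Theta M)_{-i}=\sum_{F\in\{0,1\}^n}\binom{i-1}{|F|-m-1}\cdot\dim_\Bbbk H^{\ell+m}_F(M).$$
   Context: $S$ is $\mathbb Z^n$-graded with $\deg x_t=e_t$, the $t$-th standard basis vector; this refines the standard $\mathbb Z$-grading with $\deg x_t=1$. A finitely generated $\mathbb Z^n$-graded $S$-module is squarefree if its (minimal) generators and relations all lie in squarefree degrees, i.e. degrees in $\{0,1\}^n\subset\mathbb Z^n$. For $F\in\{0,1\}^n$, $|F|$ is the sum of its coordinates. On the left-hand side the subscript $-i$ is the standard $\mathbb Z$-graded degree, and $\Theta M=\theta_1M+\cdots+\theta_mM$. Convention: $\binom ab=0$ if $b<0$. "For all $i\gg0$" means for all $i$ larger than some integer. Genericity: given $M$, the assertion holds for generic linear forms $\theta_p=\sum_t a_{t,p}x_t$ ($1\le p\le m$) if there is a nonempty Zariski-open subset of the space $\Bbbk^{n\times m}$ of coefficient matrices such that it holds for every choice of coefficients in this subset. *)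

theory Defs
  imports
    "HOL-Library.Poly_Mapping"
    "HOL-Library.Function_Algebras"
    "HOL-Library.Extended_Nat"
    "HOL-Algebra.Algebraic_Closure_Type"
    "Jordan_Normal_Form.Missing_VectorSpace"
begin

section \<open>The polynomial ring\<close>

text \<open>Polynomials with coefficients in \<open>'k\<close> and variables indexed by \<open>'n\<close> are finitely supported
  functions on exponent vectors. The linear order that is later required of \<open>'n\<close> is the order
  of the variables \<open>x\<^sub>1, \<dots>, x\<^sub>n\<close>; it only enters the signs of the Cech complex.\<close>

type_synonym ('n, 'k) mpoly = "('n \<Rightarrow>\<^sub>0 nat) \<Rightarrow>\<^sub>0 'k"

abbreviation poly_ring :: "('n, 'k::comm_ring_1) mpoly ring"
  where "poly_ring \<equiv> ring_of_type_algebra"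

abbreviation scalars :: "'k::field ring"
  where "scalars \<equiv> ring_of_type_algebra"

definition Const :: "'k::comm_ring_1 \<Rightarrow> ('n, 'k) mpoly"
  where "Const c = Poly_Mapping.single 0 c"

definition Var :: "'n \<Rightarrow> ('n, 'k::comm_ring_1) mpoly"
  where "Var t = Poly_Mapping.single (Poly_Mapping.single t 1) 1"

definition var_prod :: "'n set \<Rightarrow> ('n, 'k::comm_ring_1) mpoly"
  where "var_prod A = (\<Prod>t\<in>A. Var t)"

definition poly_eval :: "('v, 'k::comm_ring_1) mpoly \<Rightarrow> ('v \<Rightarrow> 'k) \<Rightarrow> 'k"
  where "poly_eval f a =
    (\<Sum>p\<in>Poly_Mapping.keys f. Poly_Mapping.lookup f p *
       (\<Prod>v\<in>Poly_Mapping.keys p. a v ^ Poly_Mapping.lookup p v))"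

text \<open>Zariski-open subsets of the affine space with coordinates indexed by \<open>I\<close>, whose points are
  the extensional functions on \<open>I\<close>.\<close>

definition zariski_open :: "'v set \<Rightarrow> ('v \<Rightarrow> 'k::field) set \<Rightarrow> bool"
  where "zariski_open I U \<longleftrightarrow>
    (\<exists>P :: ('v, 'k) mpoly set.
       (\<forall>f\<in>P. \<forall>p\<in>Poly_Mapping.keys f. Poly_Mapping.keys p \<subseteq> I) \<and>
       U = {a \<in> I \<rightarrow>\<^sub>E UNIV. \<exists>f\<in>P. poly_eval f a \<noteq> 0})"


section \<open>Graded modules\<close>

text \<open>A grading of the polynomial ring is given by the degrees of the monomials.\<close>

definition fine_deg :: "('n \<Rightarrow>\<^sub>0 nat) \<Rightarrow> 'n \<Rightarrow> int"
  where "fine_deg p = (\<lambda>t. int (Poly_Mapping.lookup p t))"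

definition total_deg :: "('n::finite \<Rightarrow>\<^sub>0 nat) \<Rightarrow> int"
  where "total_deg p = (\<Sum>t\<in>UNIV. int (Poly_Mapping.lookup p t))"

text \<open>\<open>gr a\<close> is the homogeneous component of degree \<open>a\<close>.\<close>

definition graded_module ::
    "(('n \<Rightarrow>\<^sub>0 nat) \<Rightarrow> 'g::ab_group_add) \<Rightarrow> (('n, 'k::field) mpoly, 'm) module \<Rightarrow> ('g \<Rightarrow> 'm set) \<Rightarrow> bool"
  where "graded_module dg M gr \<longleftrightarrow>
    Module.module poly_ring M \<and>
    (\<forall>a. additive_subgroup (gr a) M) \<and>
    (\<forall>v\<in>carrier M. \<exists>!f. (\<forall>a. f a \<in> gr a) \<and> finite {a. f a \<noteq> \<zero>\<^bsub>M\<^esub>} \<and>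
        v = (\<Oplus>\<^bsub>M\<^esub> a\<in>{a. f a \<noteq> \<zero>\<^bsub>M\<^esub>}. f a)) \<and>
    (\<forall>p c a. \<forall>v\<in>gr a. Poly_Mapping.single p c \<odot>\<^bsub>M\<^esub> v \<in> gr (dg p + a))"

definition coarsen :: "('a, 'm) module \<Rightarrow> (('n::finite \<Rightarrow> int) \<Rightarrow> 'm set) \<Rightarrow> int \<Rightarrow> 'm set"
  where "coarsen M gr i =
    {(\<Oplus>\<^bsub>M\<^esub> a\<in>D. f a) | D f. finite D \<and> (\<forall>a\<in>D. (\<Sum>t\<in>UNIV. a t) = i \<and> f a \<in> gr a)}"

definition squarefree_degrees :: "('n \<Rightarrow> int) set"
  where "squarefree_degrees = {F. \<forall>t. F t \<in> {0, 1}}"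

lemma finite_squarefree_degrees: "finite (squarefree_degrees :: ('n::finite \<Rightarrow> int) set)"
proof -
  have "squarefree_degrees = (\<Pi>\<^sub>E t\<in>(UNIV :: 'n set). {0, 1 :: int})"
    by (auto simp: squarefree_degrees_def PiE_def)
  then show ?thesis
    using finite_PiE[of UNIV] by (metis finite.emptyI finite.insertI finite_class.finite_UNIV)
qed

definition relations :: "(('n, 'k::field) mpoly, 'm) module \<Rightarrow> 'm set \<Rightarrow> ('m \<Rightarrow> ('n, 'k) mpoly) set"
  where "relations M G = {s \<in> G \<rightarrow>\<^sub>E UNIV. (\<Oplus>\<^bsub>M\<^esub> g\<in>G. s g \<odot>\<^bsub>M\<^esub> g) = \<zero>\<^bsub>M\<^esub>}"

text \<open>A relation \<open>r\<close> on generators \<open>g\<close> of degrees \<open>\<delta> g\<close> is homogeneous of degree \<open>d\<close> if it lies in the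
  degree \<open>d\<close> component of the free module \<open>\<Oplus>\<^sub>g S(-\<delta> g)\<close>. The presentation is not required to be
  minimal: the degrees of a minimal one occur among those of any other.\<close>

definition homogeneous_relation ::
    "('m \<Rightarrow> 'n \<Rightarrow> int) \<Rightarrow> 'm set \<Rightarrow> ('n \<Rightarrow> int) \<Rightarrow> ('m \<Rightarrow> ('n, 'k::field) mpoly) \<Rightarrow> bool"
  where "homogeneous_relation \<delta> G d r \<longleftrightarrow>
    (\<forall>g\<in>G. \<forall>p\<in>Poly_Mapping.keys (r g). fine_deg p + \<delta> g = d)"

definition squarefree_module ::
    "(('n, 'k::field) mpoly, 'm) module \<Rightarrow> (('n \<Rightarrow> int) \<Rightarrow> 'm set) \<Rightarrow> bool"
  where "squarefree_module M gr \<longleftrightarrow>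
    graded_module fine_deg M gr \<and>
    (\<exists>G \<delta>. finite G \<and> G \<subseteq> carrier M \<and>
       (\<forall>g\<in>G. \<delta> g \<in> squarefree_degrees \<and> g \<in> gr (\<delta> g)) \<and>
       LinearCombinations.module.span poly_ring M G = carrier M \<and>
       (\<forall>s\<in>relations M G. \<exists>R c. finite R \<and>
          R \<subseteq> {r \<in> relations M G. \<exists>d\<in>squarefree_degrees. homogeneous_relation \<delta> G d r} \<and>
          (\<forall>g\<in>G. s g = (\<Sum>r\<in>R. c r * r g))))"


section \<open>Quotients, products and localizations of modules\<close>

text \<open>The fields \<open>mult\<close> and \<open>one\<close> of a module record play no role.\<close>

definition quot_module :: "('a, 'm) module \<Rightarrow> 'm set \<Rightarrow> ('a, 'm set) module"
  where "quot_module M N = \<lparr>carrier = a_rcosets\<^bsub>M\<^esub> N, monoid.mult = undefined, one = undefined,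
    ring.zero = N, add = set_add M,
    module.smult = (\<lambda>s C. set_add M N ((\<lambda>x. s \<odot>\<^bsub>M\<^esub> x) ` C))\<rparr>"

definition quot_grading :: "('a, 'm) module \<Rightarrow> 'm set \<Rightarrow> ('g \<Rightarrow> 'm set) \<Rightarrow> 'g \<Rightarrow> 'm set set"
  where "quot_grading M N gr a = (\<lambda>v. N +>\<^bsub>M\<^esub> v) ` gr a"

definition prod_module :: "'i set \<Rightarrow> ('i \<Rightarrow> ('a, 'm) module) \<Rightarrow> ('a, 'i \<Rightarrow> 'm) module"
  where "prod_module I N = \<lparr>carrier = (\<Pi>\<^sub>E A\<in>I. carrier (N A)), monoid.mult = undefined, one = undefined,
    ring.zero = (\<lambda>A\<in>I. \<zero>\<^bsub>N A\<^esub>), add = (\<lambda>c d. \<lambda>A\<in>I. c A \<oplus>\<^bsub>N A\<^esub> d A),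
    module.smult = (\<lambda>s c. \<lambda>A\<in>I. s \<odot>\<^bsub>N A\<^esub> c A)\<rparr>"

text \<open>In the localization of \<open>M\<close> at the powers of \<open>f\<close>, the pair \<open>(u, k)\<close> represents \<open>u / f\<^sup>k\<close>.\<close>

definition frac_rel :: "('s::comm_ring_1, 'm) module \<Rightarrow> 's \<Rightarrow> (('m \<times> nat) \<times> ('m \<times> nat)) set"
  where "frac_rel M f = {((u, k), (v, l)). u \<in> carrier M \<and> v \<in> carrier M \<and>
    (\<exists>q. f ^ q \<odot>\<^bsub>M\<^esub> (f ^ l \<odot>\<^bsub>M\<^esub> u) = f ^ q \<odot>\<^bsub>M\<^esub> (f ^ k \<odot>\<^bsub>M\<^esub> v))}"

definition frac :: "('s::comm_ring_1, 'm) module \<Rightarrow> 's \<Rightarrow> 'm \<Rightarrow> nat \<Rightarrow> ('m \<times> nat) set"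
  where "frac M f u k = frac_rel M f `` {(u, k)}"

definition localization :: "('s::comm_ring_1, 'm) module \<Rightarrow> 's \<Rightarrow> ('s, ('m \<times> nat) set) module"
  where "localization M f = \<lparr>carrier = (carrier M \<times> UNIV) // frac_rel M f,
    monoid.mult = undefined, one = undefined,
    ring.zero = frac M f \<zero>\<^bsub>M\<^esub> 0,
    add = (\<lambda>C D. \<Union>(u, k)\<in>C. \<Union>(v, l)\<in>D. frac M f (f ^ l \<odot>\<^bsub>M\<^esub> u \<oplus>\<^bsub>M\<^esub> f ^ k \<odot>\<^bsub>M\<^esub> v) (k + l)),
    module.smult = (\<lambda>s C. \<Union>(u, k)\<in>C. frac M f (s \<odot>\<^bsub>M\<^esub> u) k)\<rparr>"

text \<open>The canonical map from the localization at \<open>f\<close> to the localization at \<open>f * g\<close>.\<close>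

definition loc_map :: "('s::comm_ring_1, 'm) module \<Rightarrow> 's \<Rightarrow> 's \<Rightarrow> ('m \<times> nat) set \<Rightarrow> ('m \<times> nat) set"
  where "loc_map M f g C = (\<Union>(u, k)\<in>C. frac M (f * g) (g ^ k \<odot>\<^bsub>M\<^esub> u) k)"

text \<open>Homogeneous components of the localization at \<open>var_prod A\<close>; note that
  \<open>\<Sum>t\<in>A. single t k\<close> is the exponent vector of \<open>var_prod A ^ k\<close>.\<close>

definition loc_grading ::
    "(('n \<Rightarrow>\<^sub>0 nat) \<Rightarrow> 'g::ab_group_add) \<Rightarrow> (('n, 'k::field) mpoly, 'm) module \<Rightarrow> ('g \<Rightarrow> 'm set)
      \<Rightarrow> 'n set \<Rightarrow> 'g \<Rightarrow> ('m \<times> nat) set set"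
  where "loc_grading dg M gr A a =
    {frac M (var_prod A) u k | u k. u \<in> gr (a + dg (\<Sum>t\<in>A. Poly_Mapping.single t k))}"


section \<open>Local cohomology\<close>

text \<open>Local cohomology with support in the ideal generated by all variables is the cohomology of
  the Cech complex \<open>C\<^sup>j = \<Oplus>\<^sub>A M[1 / var_prod A]\<close>, where \<open>A\<close> ranges over the sets of \<open>j\<close> variables. The complex
  is indexed by the integers and vanishes in negative degrees, since then the index set is empty.\<close>

definition cech :: "(('n, 'k::field) mpoly, 'm) module \<Rightarrow> int
      \<Rightarrow> (('n, 'k) mpoly, 'n set \<Rightarrow> ('m \<times> nat) set) module"
  where "cech M j = prod_module {A. int (card A) = j} (\<lambda>A. localization M (var_prod A))"

definition cech_diff :: "(('n::linorder, 'k::field) mpoly, 'm) module \<Rightarrow> int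
      \<Rightarrow> ('n set \<Rightarrow> ('m \<times> nat) set) \<Rightarrow> 'n set \<Rightarrow> ('m \<times> nat) set"
  where "cech_diff M j c = (\<lambda>B\<in>{B. int (card B) = j + 1}.
    (\<Oplus>\<^bsub>localization M (var_prod B)\<^esub> t\<in>B.
      (-1) ^ card {s \<in> B. s < t} \<odot>\<^bsub>localization M (var_prod B)\<^esub>
        loc_map M (var_prod (B - {t})) (Var t) (c (B - {t}))))"

definition cocycles :: "(('n::linorder, 'k::field) mpoly, 'm) module \<Rightarrow> int
      \<Rightarrow> ('n set \<Rightarrow> ('m \<times> nat) set) set"
  where "cocycles M j = {c \<in> carrier (cech M j). cech_diff M j c = \<zero>\<^bsub>cech M (j + 1)\<^esub>}"

definition coboundaries :: "(('n::linorder, 'k::field) mpoly, 'm) module \<Rightarrow> int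
      \<Rightarrow> ('n set \<Rightarrow> ('m \<times> nat) set) set"
  where "coboundaries M j = cech_diff M (j - 1) ` carrier (cech M (j - 1))"

definition local_cohomology :: "(('n::linorder, 'k::field) mpoly, 'm) module \<Rightarrow> int
      \<Rightarrow> (('n, 'k) mpoly, ('n set \<Rightarrow> ('m \<times> nat) set) set) module"
  where "local_cohomology M j =
    quot_module ((cech M j)\<lparr>carrier := cocycles M j\<rparr>) (coboundaries M j)"

text \<open>The degree \<open>a\<close> component consists of the classes of homogeneous cocycles of degree \<open>a\<close>.\<close>

definition local_cohomology_grading ::
    "(('n \<Rightarrow>\<^sub>0 nat) \<Rightarrow> 'g::ab_group_add) \<Rightarrow> (('n::linorder, 'k::field) mpoly, 'm) module \<Rightarrow> ('g \<Rightarrow> 'm set)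
      \<Rightarrow> int \<Rightarrow> 'g \<Rightarrow> ('n set \<Rightarrow> ('m \<times> nat) set) set set"
  where "local_cohomology_grading dg M gr j =
    quot_grading ((cech M j)\<lparr>carrier := cocycles M j\<rparr>) (coboundaries M j)
      (\<lambda>a. cocycles M j \<inter> (\<Pi>\<^sub>E A\<in>{A. int (card A) = j}. loc_grading dg M gr A a))"

text \<open>The dimension over the coefficient field of a subspace \<open>W\<close> of a module over the polynomial
  ring. It is \<open>\<infinity>\<close> if \<open>W\<close> is not finite-dimensional, where the library's \<open>vectorspace.dim\<close> is not
  meaningful.\<close>

definition as_vectorspace :: "(('n, 'k::field) mpoly, 'm) module \<Rightarrow> 'm set \<Rightarrow> ('k, 'm) module"
  where "as_vectorspace M W = \<lparr>carrier = W, monoid.mult = undefined, one = undefined,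
    ring.zero = \<zero>\<^bsub>M\<^esub>, add = add M, module.smult = (\<lambda>c v. Const c \<odot>\<^bsub>M\<^esub> v)\<rparr>"

definition kdim :: "(('n, 'k::field) mpoly, 'm) module \<Rightarrow> 'm set \<Rightarrow> enat"
  where "kdim M W =
    (if vectorspace.fin_dim scalars (as_vectorspace M W)
     then enat (vectorspace.dim scalars (as_vectorspace M W)) else \<infinity>)"

definition local_cohomology_dim ::
    "(('n \<Rightarrow>\<^sub>0 nat) \<Rightarrow> 'g::ab_group_add) \<Rightarrow> (('n::linorder, 'k::field) mpoly, 'm) module \<Rightarrow> ('g \<Rightarrow> 'm set)
      \<Rightarrow> int \<Rightarrow> 'g \<Rightarrow> enat"
  where "local_cohomology_dim dg M gr j a =
    kdim (local_cohomology M j) (local_cohomology_grading dg M gr j a)"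


section \<open>Linear forms\<close>

text \<open>The entry \<open>a (t, p)\<close> is the coefficient of the variable \<open>t\<close> in the \<open>p\<close>-th form.\<close>

definition linear_form :: "('n::finite \<times> nat \<Rightarrow> 'k::field) \<Rightarrow> nat \<Rightarrow> ('n, 'k) mpoly"
  where "linear_form a p = (\<Sum>t\<in>UNIV. Const (a (t, p)) * Var t)"

definition forms_submodule :: "nat \<Rightarrow> (nat \<Rightarrow> 's) \<Rightarrow> ('s, 'm) module \<Rightarrow> 'm set"
  where "forms_submodule m \<theta> M =
    {(\<Oplus>\<^bsub>M\<^esub> p\<in>{1..m}. \<theta> p \<odot>\<^bsub>M\<^esub> v p) | v. v \<in> {1..m} \<rightarrow> carrier M}"

text \<open>The convention is that the coefficient vanishes for negative \<open>b\<close>; it is only used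
  for \<open>a \<ge> 0\<close>.\<close>

definition binom :: "int \<Rightarrow> int \<Rightarrow> nat"
  where "binom a b = (if b < 0 then 0 else nat a choose nat b)"

end

theory Submission
  imports Defs "Jordan_Normal_Form.Determinant" "HOL-Computational_Algebra.Polynomial"
begin

text \<open>Choose a presentation of \<open>M\<close> by generators and relations in squarefree degrees. The component of
  degree \<open>x\<close> of a localization of \<open>M\<close> then only depends on the sets of positive and of negative entries of
  \<open>x\<close>, and so does the Cech complex of \<open>M\<close> in degree \<open>x\<close>. Filtering by the number of positive entries
  reduces a localization to free modules over polynomial rings in subsets \<open>G\<close> of the variables; there, the
  first \<open>card G\<close> forms of a sequence in general position are a regular sequence, and beyond that the
  quotient vanishes because one of the variables in \<open>G\<close> is invertible. Hence the forms are regular on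
  the Cech complex in negative degrees, where the non-localized term vanishes. The local cohomology of \<open>M\<close>
  in very negative degrees is filtered dually, with graded duals of polynomial rings as layers, so that the
  next form always maps the common kernel of the previous ones onto itself. The long
  exact sequences of \<open>M/(\<theta>\<^sub>1, \<dots>, \<theta>\<^sub>r)M\<close> therefore break up: with \<open>h r j i\<close> the dimension of its
  \<open>j\<close>-th local cohomology in degree \<open>-i\<close>, one has \<open>h (r + 1) j i = h r (j + 1) (i + 1) - h r (j + 1) i\<close>, and Pascal's rule
  reduces the claim to \<open>m = 0\<close>. There it says that a set of \<open>f\<close> coordinates is the negative support
  of \<open>binom (i - 1) (f - 1)\<close> vectors with nonpositive entries of sum \<open>-i\<close>.\<close>

section \<open>Linear algebra of pairs of nested subspaces\<close>

section \<open>Dimensions of subquotients\<close>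

text \<open>Two different facts about the forms are needed. Regularity concerns cochains: it yields
  a connecting map from the cohomology modulo \<open>r + 1\<close> forms to the cohomology modulo
  \<open>r\<close> forms, one step up and one degree down, whose image is the kernel of the form
  \<open>r + 1\<close>. Surjectivity concerns cohomology: it makes that map injective and gives the
  rank of the form. Regularity is available for all \<open>r\<close> at once, but surjectivity has
  to be carried from \<open>r\<close> to \<open>r + 1\<close> along the connecting map; therefore it
  is stated for common kernels of several forms. The degrees must be very negative because of sets
  \<open>G\<close> with at most \<open>r\<close> variables: modulo \<open>r\<close> forms the
  polynomial ring in \<open>G\<close> shrinks to the constants, whose dual sits in degree
  \<open>- card G\<close>, and only below it is nothing left to divide. No quotient is formed in
  these computations. Elements are functions from exponent vectors to coefficients of generators,
  relations are a second subspace of the same function space, and cohomology is a subquotient there.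
  The records in the statement are identified with this model at the end.\<close>

definition subquot_dim :: "('a::field \<Rightarrow> 'b::ab_group_add \<Rightarrow> 'b) \<Rightarrow> 'b set \<Rightarrow> 'b set \<Rightarrow> nat \<Rightarrow> bool"
  where "subquot_dim scale V W d \<longleftrightarrow>
    module.subspace scale V \<and> module.subspace scale W \<and> W \<subseteq> V \<and>
    (\<exists>b. (\<forall>j<d. b j \<in> V) \<and>
       (\<forall>v\<in>V. \<exists>c. v - (\<Sum>j<d. scale (c j) (b j)) \<in> W) \<and>
       (\<forall>c. (\<Sum>j<d. scale (c j) (b j)) \<in> W \<longrightarrow> (\<forall>j<d. c j = 0)))"

context vector_space
begin

lemma subquot_dimI:
  assumes "subspace V" "subspace W" "W \<subseteq> V" "\<And>j. j < d \<Longrightarrow> b j \<in> V"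
    and "\<And>v. v \<in> V \<Longrightarrow> \<exists>c. v - (\<Sum>j<d. scale (c j) (b j)) \<in> W"
    and "\<And>c j. (\<Sum>j<d. scale (c j) (b j)) \<in> W \<Longrightarrow> j < d \<Longrightarrow> c j = 0"
  shows "subquot_dim scale V W d"
  unfolding subquot_dim_def using assms by blast

lemma subquot_dimE:
  assumes "subquot_dim scale V W d"
  obtains b where "subspace V" "subspace W" "W \<subseteq> V" "\<And>j. j < d \<Longrightarrow> b j \<in> V"
    "\<And>v. v \<in> V \<Longrightarrow> \<exists>c. v - (\<Sum>j<d. scale (c j) (b j)) \<in> W"
    "\<And>c j. (\<Sum>j<d. scale (c j) (b j)) \<in> W \<Longrightarrow> j < d \<Longrightarrow> c j = 0"
  using assms unfolding subquot_dim_def by blast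

lemma subquot_dim_self: "subspace V \<Longrightarrow> subquot_dim scale V V 0"
  by (rule subquot_dimI) auto

lemma sum_lessThan_add:
  fixes f :: "nat \<Rightarrow> 'b"
  shows "(\<Sum>j<m + n. f j) = (\<Sum>j<m. f j) + (\<Sum>j<n. f (m + j))"
  by (induction n) (auto simp: algebra_simps)

lemma subquot_dim_trans:
  assumes "subquot_dim scale V V' d1" "subquot_dim scale V' W d2"
  shows "subquot_dim scale V W (d1 + d2)"
proof -
  obtain b1 where b1: "subspace V" "subspace V'" "V' \<subseteq> V" "\<And>j. j < d1 \<Longrightarrow> b1 j \<in> V"
    "\<And>v. v \<in> V \<Longrightarrow> \<exists>c. v - (\<Sum>j<d1. scale (c j) (b1 j)) \<in> V'"
    "\<And>c j. (\<Sum>j<d1. scale (c j) (b1 j)) \<in> V' \<Longrightarrow> j < d1 \<Longrightarrow> c j = 0"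
    using assms(1) by (rule subquot_dimE) blast
  obtain b2 where b2: "subspace W" "W \<subseteq> V'" "\<And>j. j < d2 \<Longrightarrow> b2 j \<in> V'"
    "\<And>v. v \<in> V' \<Longrightarrow> \<exists>c. v - (\<Sum>j<d2. scale (c j) (b2 j)) \<in> W"
    "\<And>c j. (\<Sum>j<d2. scale (c j) (b2 j)) \<in> W \<Longrightarrow> j < d2 \<Longrightarrow> c j = 0"
    using assms(2) by (rule subquot_dimE) blast
  define b where "b j = (if j < d1 then b1 j else b2 (j - d1))" for j
  have sum_b: "(\<Sum>j<d1 + d2. scale (c j) (b j)) =
      (\<Sum>j<d1. scale (c j) (b1 j)) + (\<Sum>j<d2. scale (c (d1 + j)) (b2 j))" for c
    by (simp add: sum_lessThan_add b_def)
  show ?thesis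
  proof (rule subquot_dimI[where b = b])
    show "b j \<in> V" if "j < d1 + d2" for j
      using that b1(3,4) b2(3) by (auto simp: b_def)
  next
    fix v assume "v \<in> V"
    obtain c1 where c1: "v - (\<Sum>j<d1. scale (c1 j) (b1 j)) \<in> V'"
      using b1(5)[OF \<open>v \<in> V\<close>] by blast
    obtain c2 where c2: "v - (\<Sum>j<d1. scale (c1 j) (b1 j)) - (\<Sum>j<d2. scale (c2 j) (b2 j)) \<in> W"
      using b2(4)[OF c1] by blast
    show "\<exists>c. v - (\<Sum>j<d1 + d2. scale (c j) (b j)) \<in> W"
      using c2 by (intro exI[of _ "\<lambda>j. if j < d1 then c1 j else c2 (j - d1)"])
        (simp add: sum_b algebra_simps)
  next
    fix c j assume W: "(\<Sum>j<d1 + d2. scale (c j) (b j)) \<in> W" and j: "j < d1 + d2"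
    have 2: "(\<Sum>j<d2. scale (c (d1 + j)) (b2 j)) \<in> V'"
      using b1(2) b2(3) by (intro subspace_sum subspace_scale) auto
    have 1: "(\<Sum>j<d1. scale (c j) (b1 j)) \<in> V'"
      using subspace_diff[OF b1(2) _ 2] W b2(2) by (auto simp: sum_b) (metis add_diff_cancel_right' subsetD)
    have z: "c j = 0" if "j < d1" for j
      using b1(6)[OF 1 that] .
    then have "(\<Sum>j<d2. scale (c (d1 + j)) (b2 j)) \<in> W"
      using W by (simp add: sum_b)
    then have "c (d1 + i) = 0" if "i < d2" for i
      using b2(5)[of "\<lambda>i. c (d1 + i)"] that by blast
    then show "c j = 0"
      using z j by (cases "j < d1") (metis le_Suc_ex nat_add_left_cancel_less not_less)+
  qed (use b1 b2 in auto)
qed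

lemma subquot_dim_one:
  assumes "subspace V" "subspace W" "W \<subseteq> V" "b \<in> V"
    and "\<And>v. v \<in> V \<Longrightarrow> \<exists>r. v - scale r b \<in> W" "\<And>r. scale r b \<in> W \<Longrightarrow> r = 0"
  shows "subquot_dim scale V W (Suc 0)"
proof (rule subquot_dimI[where b = "\<lambda>_. b"])
  fix v assume "v \<in> V"
  then obtain r where "v - scale r b \<in> W" using assms(5) by blast
  then show "\<exists>c. v - (\<Sum>j<Suc 0. scale (c j) b) \<in> W"
    by (intro exI[of _ "\<lambda>_. r"]) (simp add: lessThan_Suc)
qed (use assms in auto)

text \<open>Intersect with the hyperplane \<open>V0\<close> of \<open>V\<close> spanned over
  \<open>W\<close> by all basis vectors but the last. If \<open>K\<close> lies in it, the last
  vector counts for \<open>V\<close> over \<open>K\<close>. Otherwise some \<open>k\<close> in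
  \<open>K\<close> can replace the last vector; it counts for \<open>K\<close> over
  \<open>W\<close>, and \<open>V\<close> over \<open>K\<close> is the same as \<open>V0\<close> over
  its intersection with \<open>K\<close>.\<close>

lemma subquot_dim_split:
  assumes "subquot_dim scale V W d" "subspace K" "W \<subseteq> K" "K \<subseteq> V"
  shows "\<exists>e\<le>d. subquot_dim scale K W e \<and> subquot_dim scale V K (d - e)"
  using assms
proof (induction d arbitrary: V K)
  case 0
  then have "V \<subseteq> W"
    by (auto simp: subquot_dim_def)
  then have "K = W" "V = W"
    using 0 by auto
  then show ?case
    using 0 by auto
next
  case (Suc d)
  obtain b where b: "subspace V" "subspace W" "W \<subseteq> V" "\<And>j. j < Suc d \<Longrightarrow> b j \<in> V"
    "\<And>v. v \<in> V \<Longrightarrow> \<exists>c. v - (\<Sum>j<Suc d. scale (c j) (b j)) \<in> W"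
    "\<And>c j. (\<Sum>j<Suc d. scale (c j) (b j)) \<in> W \<Longrightarrow> j < Suc d \<Longrightarrow> c j = 0"
    using Suc.prems(1) by (rule subquot_dimE) blast
  define V0 where "V0 = {v\<in>V. \<exists>c. v - (\<Sum>j<d. scale (c j) (b j)) \<in> W}"
  have V0: "subspace V0"
  proof (rule subspaceI)
    show "0 \<in> V0"
      using b(1,2) by (auto simp: V0_def subspace_0 intro!: exI[of _ "\<lambda>_. 0"])
  next
    fix x y assume "x \<in> V0" "y \<in> V0"
    then obtain c1 c2 where "x \<in> V" "y \<in> V" "x - (\<Sum>j<d. scale (c1 j) (b j)) \<in> W"
      "y - (\<Sum>j<d. scale (c2 j) (b j)) \<in> W"
      by (auto simp: V0_def)
    then have "x + y \<in> V" "(x + y) - (\<Sum>j<d. scale (c1 j + c2 j) (b j)) \<in> W"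
      using subspace_add[OF b(2)] subspace_add[OF b(1)]
      by (simp_all add: scale_left_distrib sum.distrib add_diff_add)
    then show "x + y \<in> V0"
      unfolding V0_def by (intro CollectI conjI exI)
  next
    fix r x assume "x \<in> V0"
    then obtain c1 where x: "x \<in> V" "x - (\<Sum>j<d. scale (c1 j) (b j)) \<in> W"
      by (auto simp: V0_def)
    have "scale r (x - (\<Sum>j<d. scale (c1 j) (b j))) \<in> W"
      using x b(2) by (intro subspace_scale)
    then show "scale r x \<in> V0"
      using x b(1) by (auto simp: V0_def subspace_scale scale_right_diff_distrib scale_sum_right
        intro!: exI[of _ "\<lambda>j. r * c1 j"])
  qed
  have "b j \<in> V0" if "j < d" for j
  proof -
    have "(\<Sum>i<d. scale (if i = j then 1 else 0) (b i)) = (\<Sum>i<d. if i = j then b i else 0)"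
      by (rule sum.cong) auto
    then have "b j - (\<Sum>i<d. scale (if i = j then 1 else 0) (b i)) = 0"
      using that by simp
    then show ?thesis
      using b(2,4) that unfolding V0_def
      by (auto simp: subspace_0 simp del: right_minus_eq intro!: exI[of _ "\<lambda>i. if i = j then 1 else 0"])
  qed
  then have hV0: "subquot_dim scale V0 W d"
  proof (intro subquot_dimI[where b = b])
    show "W \<subseteq> V0"
      using b(3) by (auto simp: V0_def intro!: exI[of _ "\<lambda>_. 0"])
  next
    fix c j assume "(\<Sum>j<d. scale (c j) (b j)) \<in> W" "j < d"
    then show "c j = 0"
      using b(6)[of "\<lambda>i. if i < d then c i else 0" j] by simp
  qed (use b V0 in \<open>auto simp: V0_def\<close>)
  have K0: "subspace (K \<inter> V0)"
    using V0 Suc.prems(2) by (rule subspace_inter[rotated])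
  obtain e where e: "e \<le> d" "subquot_dim scale (K \<inter> V0) W e" "subquot_dim scale V0 (K \<inter> V0) (d - e)"
    using Suc.IH[OF hV0 K0] Suc.prems hV0 by (auto simp: subquot_dim_def)
  obtain b0 where b0: "\<And>j. j < d - e \<Longrightarrow> b0 j \<in> V0"
    "\<And>v. v \<in> V0 \<Longrightarrow> \<exists>c. v - (\<Sum>j<d - e. scale (c j) (b0 j)) \<in> K \<inter> V0"
    "\<And>c j. (\<Sum>j<d - e. scale (c j) (b0 j)) \<in> K \<inter> V0 \<Longrightarrow> j < d - e \<Longrightarrow> c j = 0"
    using e(3) by (rule subquot_dimE) blast
  have dec: "\<exists>r. v - scale r (b d) \<in> V0" if v: "v \<in> V" for v
  proof -
    obtain c where "v - (\<Sum>j<Suc d. scale (c j) (b j)) \<in> W"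
      using b(5)[OF v] by blast
    then have "v - scale (c d) (b d) \<in> V0"
      using v b(1,4) by (auto simp: V0_def algebra_simps intro!: exI[of _ c] subspace_diff subspace_scale)
    then show ?thesis ..
  qed
  have bd: "r = 0" if r: "scale r (b d) \<in> V0" for r
  proof -
    obtain c where "scale r (b d) - (\<Sum>j<d. scale (c j) (b j)) \<in> W"
      using r unfolding V0_def by blast
    then have "(\<Sum>j<Suc d. scale (if j = d then r else - c j) (b j)) \<in> W"
      by (simp add: sum_negf)
    then show ?thesis
      using b(6)[of "\<lambda>j. if j = d then r else - c j" d] by simp
  qed
  have V0V: "V0 \<subseteq> V" by (auto simp: V0_def)
  show ?case
  proof (cases "K \<subseteq> V0")
    case True
    then have KK: "K \<inter> V0 = K" by auto
    have "subquot_dim scale V V0 (Suc 0)"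
      by (rule subquot_dim_one[where b = "b d"]) (use b(1,4) V0 V0V dec bd in auto)
    then have "subquot_dim scale V K (Suc 0 + (d - e))"
      using subquot_dim_trans e(3) KK by metis
    then show ?thesis
      using e KK by (intro exI[of _ e]) (auto simp: Suc_diff_le)
  next
    case False
    then obtain k where k: "k \<in> K" "k \<notin> V0" by auto
    obtain r where r: "k - scale r (b d) \<in> V0"
      using dec k Suc.prems(4) by blast
    then have r0: "r \<noteq> 0"
      using k by auto
    have dk: "\<exists>s. v - scale s k \<in> V0" if "v \<in> V" for v
    proof -
      obtain s where s: "v - scale s (b d) \<in> V0" using dec \<open>v \<in> V\<close> by blast
      have "v - scale s (b d) - scale (s / r) (k - scale r (b d)) \<in> V0"
        by (rule subspace_diff[OF V0 s subspace_scale[OF V0 r]])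
      then have "v - scale (s / r) k \<in> V0"
        using r0 by (simp add: scale_right_diff_distrib)
      then show ?thesis ..
    qed
    have sk: "s = 0" if "scale s k \<in> V0" for s
    proof (rule ccontr)
      assume "s \<noteq> 0"
      then have "scale (inverse s) (scale s k) \<in> V0 \<longleftrightarrow> k \<in> V0" by simp
      then show False using subspace_scale[OF V0 that] k by blast
    qed
    have "subquot_dim scale K (K \<inter> V0) (Suc 0)"
    proof (rule subquot_dim_one[where b = k])
      fix v assume v: "v \<in> K"
      obtain s where "v - scale s k \<in> V0" using dk v Suc.prems(4) by blast
      moreover have "v - scale s k \<in> K"
        using v k by (intro subspace_diff[OF Suc.prems(2)] subspace_scale[OF Suc.prems(2)])
      ultimately show "\<exists>s. v - scale s k \<in> K \<inter> V0" by blast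
    qed (use K0 k Suc.prems sk in auto)
    then have 1: "subquot_dim scale K W (Suc e)"
      using subquot_dim_trans e(2) by (metis plus_1_eq_Suc One_nat_def)
    have 2: "subquot_dim scale V K (d - e)"
    proof (rule subquot_dimI[where b = b0])
      fix v assume v: "v \<in> V"
      obtain s where "v - scale s k \<in> V0" using dk v by blast
      then obtain c where "v - scale s k - (\<Sum>j<d - e. scale (c j) (b0 j)) \<in> K \<inter> V0"
        using b0(2) by blast
      then have "v - scale s k - (\<Sum>j<d - e. scale (c j) (b0 j)) + scale s k \<in> K"
        using Suc.prems(2) k by (intro subspace_add subspace_scale) auto
      then show "\<exists>c. v - (\<Sum>j<d - e. scale (c j) (b0 j)) \<in> K"
        by (auto simp: algebra_simps)
    next
      fix c j assume *: "(\<Sum>j<d - e. scale (c j) (b0 j)) \<in> K" "j < d - e"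
      have "(\<Sum>j<d - e. scale (c j) (b0 j)) \<in> V0"
        using V0 b0(1) by (intro subspace_sum subspace_scale) auto
      then show "c j = 0" using b0(3)[of c j] * by auto
    qed (use b0 V0V Suc.prems b(1) in auto)
    show ?thesis
      using e 1 2 by (intro exI[of _ "Suc e"]) auto
  qed
qed

end

text \<open>An isomorphism of subquotients, given by a linear relation instead of a map, because
  connecting homomorphisms and inverses of surjections are determined only up to choices. Applied to
  differences, the hypothesis \<open>iff\<close> says at once that the relation is single-valued and
  injective modulo \<open>W\<close> and \<open>W'\<close>.\<close>

lemma subquot_dim_transport:
  assumes "vector_space s1" "vector_space s2"
    and dim: "subquot_dim s1 V W d"
    and V': "module.subspace s2 V'" and W': "module.subspace s2 W'" and sub: "W' \<subseteq> V'"
    and add: "\<And>u v u' v'. r u u' \<Longrightarrow> r v v' \<Longrightarrow> r (u + v) (u' + v')"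
    and scl: "\<And>c v v'. r v v' \<Longrightarrow> r (s1 c v) (s2 c v')"
    and total: "\<And>v. v \<in> V \<Longrightarrow> \<exists>v'\<in>V'. r v v'"
    and onto: "\<And>v'. v' \<in> V' \<Longrightarrow> \<exists>v\<in>V. r v v'"
    and iff: "\<And>v v'. r v v' \<Longrightarrow> v \<in> V \<Longrightarrow> v' \<in> V' \<Longrightarrow> v \<in> W \<longleftrightarrow> v' \<in> W'"
  shows "subquot_dim s2 V' W' d"
proof -
  interpret v1: vector_space s1 by fact
  interpret v2: vector_space s2 by fact
  obtain b where b: "v1.subspace V" "v1.subspace W" "W \<subseteq> V" "\<And>j. j < d \<Longrightarrow> b j \<in> V"
    "\<And>v. v \<in> V \<Longrightarrow> \<exists>c. v - (\<Sum>j<d. s1 (c j) (b j)) \<in> W"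
    "\<And>c j. (\<Sum>j<d. s1 (c j) (b j)) \<in> W \<Longrightarrow> j < d \<Longrightarrow> c j = 0"
    using dim by (rule v1.subquot_dimE) blast
  have "\<forall>j\<in>{..<d}. \<exists>y. y \<in> V' \<and> r (b j) y"
    using total b(4) by blast
  then have "\<exists>f. \<forall>j\<in>{..<d}. f j \<in> V' \<and> r (b j) (f j)"
    by (rule bchoice)
  then obtain f where f: "\<And>j. j < d \<Longrightarrow> f j \<in> V'" "\<And>j. j < d \<Longrightarrow> r (b j) (f j)"
    by blast
  have zero: "r 0 0"
  proof -
    obtain v' where "r 0 v'" using total[OF v1.subspace_0[OF b(1)]] by blast
    from scl[OF this, of 0] show ?thesis by simp
  qed
  have sum: "r (\<Sum>j\<in>J. s1 (c j) (b j)) (\<Sum>j\<in>J. s2 (c j) (f j))" if "J \<subseteq> {..<d}" for c J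
    using finite_subset[OF that finite_lessThan] that
  proof (induction J rule: finite_induct)
    case (insert j J)
    then show ?case using add[OF scl[OF f(2)[of j], of "c j"] insert.IH] by simp
  qed (use zero in simp)
  have neg: "r (- u) (- u')" if "r u u'" for u u'
    using scl[OF that, of "-1"] by simp
  have sumV: "(\<Sum>j<d. s1 (c j) (b j)) \<in> V" for c
    using b(1,4) by (intro v1.subspace_sum v1.subspace_scale) auto
  have sumV': "(\<Sum>j<d. s2 (c j) (f j)) \<in> V'" for c
    using V' f by (intro v2.subspace_sum v2.subspace_scale) auto
  show ?thesis
  proof (rule v2.subquot_dimI[where b = f])
    fix v' assume v': "v' \<in> V'"
    obtain v where v: "v \<in> V" "r v v'" using onto v' by blast
    obtain c where c: "v - (\<Sum>j<d. s1 (c j) (b j)) \<in> W" using b(5) v by blast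
    have "r (v - (\<Sum>j<d. s1 (c j) (b j))) (v' - (\<Sum>j<d. s2 (c j) (f j)))"
      using add[OF v(2) neg[OF sum[of "{..<d}" c]]] by simp
    from iff[OF this subsetD[OF b(3) c] v2.subspace_diff[OF V' v' sumV']] c
    show "\<exists>c. v' - (\<Sum>j<d. s2 (c j) (f j)) \<in> W'" by (intro exI[of _ c]) simp
  next
    fix c j assume "(\<Sum>j<d. s2 (c j) (f j)) \<in> W'" "j < d"
    then show "c j = 0"
      using iff[OF sum[OF subset_refl] sumV sumV', of c] by (intro b(6)) simp_all
  qed (use V' W' sub f in auto)
qed

subsection \<open>Spaces of functions\<close>

definition fscale :: "'k::field \<Rightarrow> ('x \<Rightarrow> 'k) \<Rightarrow> 'x \<Rightarrow> 'k"
  where "fscale c f = (\<lambda>x. c * f x)"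

lemma fscale_apply [simp]: "fscale c f x = c * f x"
  by (simp add: fscale_def)

interpretation fun_vs: vector_space fscale
  by unfold_locales (auto simp: fun_eq_iff algebra_simps)

lemma sum_fun_apply: "(\<Sum>i\<in>I. f i) x = (\<Sum>i\<in>I. f i x)"
  by (induction I rule: infinite_finite_induct) auto

text \<open>The matrix \<open>A\<close> expresses the vectors \<open>b'\<close> through the vectors
  \<open>b\<close> modulo \<open>W\<close>. A linear dependence between its rows would be one
  between the \<open>b'\<close> modulo \<open>W\<close>, so there are \<open>d'\<close> independent
  rows in a space spanned by \<open>d\<close> vectors.\<close>

lemma (in vector_space) subquot_dim_unique_le:
  assumes "subquot_dim scale V W d" "subquot_dim scale V W d'"
  shows "d' \<le> d"
proof -
  obtain b where b: "subspace V" "subspace W" "W \<subseteq> V" "\<And>j. j < d \<Longrightarrow> b j \<in> V"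
    "\<And>v. v \<in> V \<Longrightarrow> \<exists>c. v - (\<Sum>j<d. scale (c j) (b j)) \<in> W"
    "\<And>c j. (\<Sum>j<d. scale (c j) (b j)) \<in> W \<Longrightarrow> j < d \<Longrightarrow> c j = 0"
    using assms(1) by (rule subquot_dimE) blast
  obtain b' where b': "\<And>j. j < d' \<Longrightarrow> b' j \<in> V"
    "\<And>c j. (\<Sum>j<d'. scale (c j) (b' j)) \<in> W \<Longrightarrow> j < d' \<Longrightarrow> c j = 0"
    using assms(2) by (rule subquot_dimE) blast
  have "\<exists>A. \<forall>i<d'. b' i - (\<Sum>j<d. scale (A i j) (b j)) \<in> W"
    using b(5)[OF b'(1)] by (intro choice allI) blast
  then obtain A where A: "\<And>i. i < d' \<Longrightarrow> b' i - (\<Sum>j<d. scale (A i j) (b j)) \<in> W"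
    by blast
  \<comment> \<open>Rows are continued by zero, so that they are functions on all of
    \<open>nat\<close> and lie in the span of the first \<open>d\<close> unit vectors
    \<open>E\<close>.\<close>
  define A' where "A' i = (\<lambda>j. if j < d then A i j else 0)" for i
  define E where "E i = (\<lambda>j. if j = i then 1 else 0 :: 'a)" for i :: nat
  have zero: "c i = 0" if z: "(\<Sum>i<d'. fscale (c i) (A' i)) = 0" and i: "i < d'" for c i
  proof -
    have "(\<Sum>i<d'. c i * A i j) = 0" if "j < d" for j
      using fun_cong[OF z, of j] that by (simp add: sum_fun_apply A'_def)
    then have "(\<Sum>j<d. scale (\<Sum>i<d'. c i * A i j) (b j)) = 0"
      by simp
    then have "(\<Sum>i<d'. scale (c i) (\<Sum>j<d. scale (A i j) (b j))) = 0"
      by (subst (asm) scale_sum_left, subst (asm) sum.swap) (simp add: scale_sum_right)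
    moreover have "(\<Sum>i<d'. scale (c i) (b' i - (\<Sum>j<d. scale (A i j) (b j)))) \<in> W"
      using A b(2) by (intro subspace_sum subspace_scale) auto
    ultimately have "(\<Sum>i<d'. scale (c i) (b' i)) \<in> W"
      by (simp add: scale_right_diff_distrib sum_subtractf)
    then show ?thesis using b'(2) i by blast
  qed
  \<comment> \<open>Independence is a property of the set of rows, so two equal rows have to be
    excluded separately, by the dependence with coefficients 1 and -1.\<close>
  have inj: "inj_on A' {..<d'}"
  proof (rule inj_onI, rule ccontr)
    fix x y assume *: "x \<in> {..<d'}" "y \<in> {..<d'}" "A' x = A' y" "x \<noteq> y"
    have "(\<Sum>i<d'. fscale (if i = x then 1 else if i = y then -1 else 0) (A' i)) =
      (\<Sum>i<d'. (if i = x then A' x else 0) + (if i = y then - A' y else 0))"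
      using *(4) by (intro sum.cong) (auto simp: fun_eq_iff)
    also have "\<dots> = A' x - A' y"
      using *(1,2) by (simp add: sum.distrib)
    also have "\<dots> = 0" by (simp only: *(3) diff_self)
    finally show False using zero[of "\<lambda>i. if i = x then 1 else if i = y then -1 else 0" x] *(1) by simp
  qed
  have "fun_vs.independent (A' ` {..<d'})"
  proof (rule fun_vs.independent_if_scalars_zero)
    fix f x assume f: "(\<Sum>x\<in>A' ` {..<d'}. fscale (f x) x) = 0" and x: "x \<in> A' ` {..<d'}"
    then have "(\<Sum>i<d'. fscale (f (A' i)) (A' i)) = 0"
      by (simp add: sum.reindex[OF inj])
    then show "f x = 0" using zero[of "f \<circ> A'"] x by auto
  qed auto
  moreover have "A' ` {..<d'} \<subseteq> fun_vs.span (E ` {..<d})"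
  proof
    fix x assume "x \<in> A' ` {..<d'}"
    then obtain i where x: "x = A' i" by auto
    have "A' i = (\<Sum>j<d. fscale (A i j) (E j))"
    proof
      fix l
      have "(\<Sum>j<d. A i j * E j l) = (\<Sum>j<d. if j = l then A i j else 0)"
        by (rule sum.cong) (auto simp: E_def)
      then show "A' i l = (\<Sum>j<d. fscale (A i j) (E j)) l"
        by (simp add: A'_def sum_fun_apply)
    qed
    then show "x \<in> fun_vs.span (E ` {..<d})"
      unfolding x by (simp only:) (intro fun_vs.span_sum fun_vs.span_scale fun_vs.span_base imageI)
  qed
  ultimately have "card (A' ` {..<d'}) \<le> card (E ` {..<d})"
    using fun_vs.independent_span_bound[of "E ` {..<d}" "A' ` {..<d'}"] by auto
  also have "\<dots> \<le> d" using card_image_le[of "{..<d}" E] by simp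
  finally show ?thesis using card_image[OF inj] by simp
qed

lemma (in vector_space) subquot_dim_unique:
  "subquot_dim scale V W d \<Longrightarrow> subquot_dim scale V W d' \<Longrightarrow> d = d'"
  using subquot_dim_unique_le le_antisym by blast

text \<open>Rank and nullity: if \<open>K\<close> over \<open>W\<close> is the kernel of a map on
  \<open>V\<close> over \<open>W\<close> and \<open>e\<close> is the rank of this map, then
  \<open>d - e\<close> remains for the kernel. Uniqueness of dimensions identifies \<open>e\<close>
  with the number that \<open>subquot_dim_split\<close> produces.\<close>

lemma (in vector_space) subquot_dim_kernel:
  assumes "subquot_dim scale V W d" "subquot_dim scale V K e" "W \<subseteq> K"
  shows "e \<le> d \<and> subquot_dim scale K W (d - e)"
proof -
  have "subspace K" "K \<subseteq> V" using assms(2) by (auto simp: subquot_dim_def)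
  then obtain f where f: "f \<le> d" "subquot_dim scale K W f" "subquot_dim scale V K (d - f)"
    using subquot_dim_split[OF assms(1)] assms(3) by blast
  then show ?thesis using subquot_dim_unique[OF assms(2) f(3)] by auto
qed

section \<open>Polynomials and linear forms\<close>

lemma Const_add: "Const (a + b) = Const a + Const b"
  and Const_mult: "Const (a * b) = Const a * Const b"
  and Const_0 [simp]: "Const 0 = 0"
  and Const_1 [simp]: "Const 1 = 1"
  and Const_uminus: "Const (- a) = - Const a"
  by (simp_all add: Const_def single_add mult_single single_uminus)

lemma single_eq_Const_mult: "Poly_Mapping.single p c = Const c * Poly_Mapping.single p 1"
  by (simp add: Const_def mult_single)

lemma lookup_Const_mult: "Poly_Mapping.lookup (Const c * f) p = c * Poly_Mapping.lookup f p"
  unfolding Const_def by (simp add: mult_map_scale_conv_mult[symmetric] Poly_Mapping.map.rep_eq when_def)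

lemma poly_mapping_sum_single:
  "(\<Sum>p\<in>Poly_Mapping.keys f. Poly_Mapping.single p (Poly_Mapping.lookup f p)) = f"
proof (rule poly_mapping_eqI)
  fix q
  have "Poly_Mapping.lookup (\<Sum>p\<in>Poly_Mapping.keys f. Poly_Mapping.single p (Poly_Mapping.lookup f p)) q =
      (\<Sum>p\<in>Poly_Mapping.keys f. if p = q then Poly_Mapping.lookup f p else 0)"
    by (simp add: lookup_sum lookup_single when_def)
  also have "\<dots> = Poly_Mapping.lookup f q"
    by (simp add: in_keys_iff)
  finally show "Poly_Mapping.lookup (\<Sum>p\<in>Poly_Mapping.keys f. Poly_Mapping.single p (Poly_Mapping.lookup f p)) q =
    Poly_Mapping.lookup f q" .
qed

subsection \<open>Substitution\<close>

definition mono_subst :: "('v \<Rightarrow> 'r::comm_ring_1) \<Rightarrow> ('v \<Rightarrow>\<^sub>0 nat) \<Rightarrow> 'r"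
  where "mono_subst \<sigma> p = (\<Prod>v\<in>Poly_Mapping.keys p. \<sigma> v ^ Poly_Mapping.lookup p v)"

text \<open>Coefficients pass through \<open>h\<close>, so that one definition covers evaluation at
  a point (\<open>h\<close> the identity) and substitution of polynomials for variables
  (\<open>h\<close> the embedding \<open>Const\<close>).\<close>

definition poly_subst :: "('k::comm_ring_1 \<Rightarrow> 'r::comm_ring_1) \<Rightarrow> ('v \<Rightarrow> 'r) \<Rightarrow> ('v, 'k) mpoly \<Rightarrow> 'r"
  where "poly_subst h \<sigma> f = (\<Sum>p\<in>Poly_Mapping.keys f. h (Poly_Mapping.lookup f p) * mono_subst \<sigma> p)"

lemma poly_eval_eq: "poly_eval f a = poly_subst (\<lambda>x. x) a f"
  by (simp add: poly_eval_def poly_subst_def mono_subst_def)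

lemma mono_subst_superset:
  assumes "finite V" "Poly_Mapping.keys p \<subseteq> V"
  shows "mono_subst \<sigma> p = (\<Prod>v\<in>V. \<sigma> v ^ Poly_Mapping.lookup p v)"
  unfolding mono_subst_def using assms
  by (intro prod.mono_neutral_left) (auto simp: in_keys_iff)

lemma mono_subst_add: "mono_subst \<sigma> (p + q) = mono_subst \<sigma> p * mono_subst \<sigma> q"
proof -
  let ?V = "Poly_Mapping.keys p \<union> Poly_Mapping.keys q"
  have "Poly_Mapping.keys (p + q) \<subseteq> ?V"
    by (rule keys_add)
  then show ?thesis
    by (simp add: mono_subst_superset[of ?V] lookup_add power_add prod.distrib)
qed

lemma mono_subst_0 [simp]: "mono_subst \<sigma> 0 = 1"
  by (simp add: mono_subst_def)

lemma mono_subst_single [simp]: "mono_subst \<sigma> (Poly_Mapping.single v n) = \<sigma> v ^ n"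
  by (simp add: mono_subst_def)

locale coeff_hom =
  fixes h :: "'k::comm_ring_1 \<Rightarrow> 'r::comm_ring_1"
  assumes h_add: "h (a + b) = h a + h b" and h_mult: "h (a * b) = h a * h b" and h_1: "h 1 = 1"
begin

lemma h_0: "h 0 = 0"
  using h_add[of 0 0] by simp

lemma poly_subst_superset:
  assumes "finite K" "Poly_Mapping.keys f \<subseteq> K"
  shows "poly_subst h \<sigma> f = (\<Sum>p\<in>K. h (Poly_Mapping.lookup f p) * mono_subst \<sigma> p)"
  unfolding poly_subst_def using assms
  by (intro sum.mono_neutral_left) (auto simp: in_keys_iff h_0)

lemma poly_subst_add: "poly_subst h \<sigma> (f + g) = poly_subst h \<sigma> f + poly_subst h \<sigma> g"
proof -
  let ?K = "Poly_Mapping.keys f \<union> Poly_Mapping.keys g"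
  have "Poly_Mapping.keys (f + g) \<subseteq> ?K"
    by (rule keys_add)
  then show ?thesis
    by (simp add: poly_subst_superset[of ?K] lookup_add h_add sum.distrib distrib_right)
qed

lemma poly_subst_0 [simp]: "poly_subst h \<sigma> 0 = 0"
  by (simp add: poly_subst_def)

lemma poly_subst_sum: "poly_subst h \<sigma> (\<Sum>i\<in>I. f i) = (\<Sum>i\<in>I. poly_subst h \<sigma> (f i))"
  by (induction I rule: infinite_finite_induct) (simp_all add: poly_subst_add)

lemma poly_subst_single: "poly_subst h \<sigma> (Poly_Mapping.single p c) = h c * mono_subst \<sigma> p"
  by (cases "c = 0") (simp_all add: poly_subst_def h_0)

lemma poly_subst_Const [simp]: "poly_subst h \<sigma> (Const c) = h c"
  by (simp add: Const_def poly_subst_single)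

lemma poly_subst_Var [simp]: "poly_subst h \<sigma> (Var v) = \<sigma> v"
  by (simp add: Var_def poly_subst_single h_1)

lemma poly_subst_mult: "poly_subst h \<sigma> (f * g) = poly_subst h \<sigma> f * poly_subst h \<sigma> g"
proof -
  have "f * g = (\<Sum>p\<in>Poly_Mapping.keys f. \<Sum>q\<in>Poly_Mapping.keys g.
      Poly_Mapping.single (p + q) (Poly_Mapping.lookup f p * Poly_Mapping.lookup g q))"
    by (subst (1 2) poly_mapping_sum_single[symmetric]) (simp only: sum_product mult_single)
  then have "poly_subst h \<sigma> (f * g) = (\<Sum>p\<in>Poly_Mapping.keys f. \<Sum>q\<in>Poly_Mapping.keys g.
      (h (Poly_Mapping.lookup f p) * mono_subst \<sigma> p) * (h (Poly_Mapping.lookup g q) * mono_subst \<sigma> q))"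
    by (simp only: poly_subst_sum poly_subst_single h_mult mono_subst_add mult_ac)
  also have "\<dots> = poly_subst h \<sigma> f * poly_subst h \<sigma> g"
    by (simp only: poly_subst_def sum_product)
  finally show ?thesis .
qed

lemma poly_subst_1 [simp]: "poly_subst h \<sigma> 1 = 1"
  using poly_subst_Const[of \<sigma> 1] by (simp add: h_1)

lemma poly_subst_prod: "poly_subst h \<sigma> (\<Prod>i\<in>I. f i) = (\<Prod>i\<in>I. poly_subst h \<sigma> (f i))"
  by (induction I rule: infinite_finite_induct) (simp_all add: poly_subst_mult)

end

interpretation eval_hom: coeff_hom "\<lambda>x. x"
  by unfold_locales auto

interpretation Const_hom: coeff_hom Const
  by unfold_locales (simp_all add: Const_add Const_mult)

lemma single_power: "Poly_Mapping.single p (1::'k::comm_ring_1) ^ n =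
    Poly_Mapping.single (\<Sum>i<n. p) 1"
  by (induction n) (simp_all add: mult_single add.commute)

lemma sum_const_single: "(\<Sum>i<n. Poly_Mapping.single t (1::nat)) = Poly_Mapping.single t n"
  by (induction n) (simp_all add: single_add[symmetric])

lemma single_eq_sum_keys:
  "(\<Sum>v\<in>Poly_Mapping.keys p. Poly_Mapping.single v (Poly_Mapping.lookup p v)) = p"
  by (rule poly_mapping_sum_single)

lemma single_sum_eq_prod:
  "finite I \<Longrightarrow> Poly_Mapping.single (\<Sum>i\<in>I. p i) (1::'k::comm_ring_1) = (\<Prod>i\<in>I. Poly_Mapping.single (p i) 1)"
proof (induction I rule: finite_induct)
  case (insert i I)
  then show ?case
    by (simp add: mult_single flip: insert.IH)
qed simp

lemma mono_subst_Var: "mono_subst Var p = Poly_Mapping.single p (1::'k::comm_ring_1)"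
proof -
  have "mono_subst Var p = (\<Prod>v\<in>Poly_Mapping.keys p. Poly_Mapping.single (Poly_Mapping.single v (Poly_Mapping.lookup p v)) (1::'k))"
    unfolding mono_subst_def Var_def by (simp only: single_power sum_const_single)
  also have "\<dots> = Poly_Mapping.single (\<Sum>v\<in>Poly_Mapping.keys p. Poly_Mapping.single v (Poly_Mapping.lookup p v)) 1"
    by (rule single_sum_eq_prod[symmetric]) simp
  also have "\<dots> = Poly_Mapping.single p 1"
    by (simp only: single_eq_sum_keys)
  finally show ?thesis .
qed

lemma poly_subst_Const_Var: "poly_subst Const Var f = f"
  unfolding poly_subst_def mono_subst_Var single_eq_Const_mult[symmetric]
  by (rule poly_mapping_sum_single)

lemma dvd_diff_mult:
  fixes a b :: "'r::comm_ring_1"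
  assumes "d dvd a - b" "d dvd a' - b'"
  shows "d dvd a * a' - b * b'"
using assms by (fastforce simp: algebra_simps)

lemma dvd_diff_power:
  fixes a b :: "'r::comm_ring_1"
  assumes "d dvd a - b"
  shows "d dvd a ^ n - b ^ n"
  by (induction n) (auto intro: dvd_diff_mult assms)

lemma dvd_diff_mono_subst:
  assumes "\<And>v. d dvd \<sigma> v - \<tau> v"
  shows "d dvd mono_subst \<sigma> p - mono_subst \<tau> p"
proof -
  have "d dvd (\<Prod>v\<in>V. \<sigma> v ^ Poly_Mapping.lookup p v) - (\<Prod>v\<in>V. \<tau> v ^ Poly_Mapping.lookup p v)" if "finite V" for V
    using that by (induction V rule: finite_induct) (auto intro!: dvd_diff_mult dvd_diff_power assms)
  then show ?thesis
    by (simp add: mono_subst_def)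
qed

text \<open>Sums, products and powers respect congruences, so a substitution that changes each
  variable by a multiple of \<open>d\<close> changes each polynomial by a multiple of
  \<open>d\<close>. With \<open>d\<close> a linear form this bounds the effect of eliminating a
  variable.\<close>

lemma dvd_diff_poly_subst:
  assumes "\<And>v. d dvd \<sigma> v - Var v"
  shows "d dvd poly_subst Const \<sigma> f - f"
proof -
  have "poly_subst Const \<sigma> f - poly_subst Const Var f =
    (\<Sum>p\<in>Poly_Mapping.keys f. Const (Poly_Mapping.lookup f p) * (mono_subst \<sigma> p - mono_subst Var p))"
    by (simp add: poly_subst_def sum_subtractf right_diff_distrib)
  then show ?thesis
    unfolding poly_subst_Const_Var by (auto intro!: dvd_sum dvd_mult dvd_diff_mono_subst assms)
qed

subsection \<open>Linear forms\<close>

definition lin :: "('n::finite \<Rightarrow> 'k::field) \<Rightarrow> ('n, 'k) mpoly"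
  where "lin c = (\<Sum>t\<in>UNIV. Const (c t) * Var t)"

lemma lin_add: "lin (\<lambda>t. c t + d t) = lin c + lin d"
  by (simp add: lin_def Const_add distrib_right sum.distrib)

lemma lin_scale: "lin (\<lambda>t. r * c t) = Const r * lin c"
  by (simp add: lin_def Const_mult sum_distrib_left mult.assoc)

lemma lin_zero [simp]: "lin (\<lambda>t. 0) = 0"
  by (simp add: lin_def)

lemma lin_sum: "lin (\<lambda>t. \<Sum>i\<in>I. c i t) = (\<Sum>i\<in>I. lin (c i))"
  by (induction I rule: infinite_finite_induct) (simp_all add: lin_add)

lemma lookup_Const_Var:
  "Poly_Mapping.lookup (Const c * Var s) (Poly_Mapping.single t (Suc 0)) = (if s = t then c else 0)"
proof -
  have "Poly_Mapping.single s (Suc 0) = Poly_Mapping.single t (Suc 0) \<longleftrightarrow> s = t"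
    by (metis lookup_single_eq lookup_single_not_eq nat.distinct(1))
  then show ?thesis
    by (simp add: lookup_Const_mult Var_def lookup_single when_def)
qed

lemma lin_nonzero:
  assumes "c t \<noteq> 0"
  shows "lin c \<noteq> 0"
proof
  assume "lin c = 0"
  then have "Poly_Mapping.lookup (lin c) (Poly_Mapping.single t (Suc 0)) = 0"
    by simp
  then show False
    using assms by (simp add: lin_def lookup_sum lookup_Const_Var)
qed

lemma poly_subst_lin: "poly_subst Const \<sigma> (lin c) = (\<Sum>t\<in>UNIV. Const (c t) * \<sigma> t)"
  by (simp add: lin_def Const_hom.poly_subst_sum Const_hom.poly_subst_mult)

text \<open>Such a \<open>\<phi>\<close> realizes the quotient by the ideal of the first
  \<open>p\<close> linear forms inside the polynomial ring itself: it kills the ideal and moves each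
  polynomial only within its residue class. Thus \<open>\<phi> f = 0\<close> characterizes the
  ideal, and cancellation in the quotient becomes cancellation in a domain. The last clause keeps
  linear forms linear, so that the construction can be continued with the next form.\<close>

definition eliminates :: "(('n::finite, 'k::field) mpoly \<Rightarrow> ('n, 'k) mpoly) \<Rightarrow> (nat \<Rightarrow> 'n \<Rightarrow> 'k) \<Rightarrow> nat \<Rightarrow> bool"
  where "eliminates \<phi> w p \<longleftrightarrow>
    (\<forall>f g. \<phi> (f + g) = \<phi> f + \<phi> g) \<and> (\<forall>f g. \<phi> (f * g) = \<phi> f * \<phi> g) \<and>
    (\<forall>c. \<phi> (Const c) = Const c) \<and> (\<forall>q\<in>{1..p}. \<phi> (lin (w q)) = 0) \<and>
    (\<forall>f. \<exists>h. f - \<phi> f = (\<Sum>q\<in>{1..p}. lin (w q) * h q)) \<and>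
    (\<forall>c. \<exists>\<nu>. \<phi> (lin c) = lin (\<lambda>t. c t + (\<Sum>q\<in>{1..p}. \<nu> q * w q t)))"

lemma eliminatesD:
  assumes "eliminates \<phi> w p"
  shows "\<phi> (f + g) = \<phi> f + \<phi> g" "\<phi> (f * g) = \<phi> f * \<phi> g" "\<phi> (Const c) = Const c"
    "q \<in> {1..p} \<Longrightarrow> \<phi> (lin (w q)) = 0"
    "\<exists>h. f - \<phi> f = (\<Sum>q\<in>{1..p}. lin (w q) * h q)"
    "\<exists>\<nu>. \<phi> (lin d) = lin (\<lambda>t. d t + (\<Sum>q\<in>{1..p}. \<nu> q * w q t))"
  using assms unfolding eliminates_def by (simp_all del: atLeastAtMost_iff)

text \<open>Each step of the construction eliminates one variable that occurs in the next linear form.\<close>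

lemma linear_elimination:
  fixes w :: "nat \<Rightarrow> 'n::finite \<Rightarrow> 'k::field"
  assumes "\<And>r \<nu>. r < p \<Longrightarrow> \<exists>t. w (Suc r) t + (\<Sum>q\<in>{1..r}. \<nu> q * w q t) \<noteq> 0"
  shows "\<exists>\<phi>. eliminates \<phi> w p"
  using assms
proof (induction p)
  case 0
  show ?case
    by (intro exI[of _ "\<lambda>f. f"]) (simp add: eliminates_def)
next
  case (Suc p)
  have "\<exists>\<phi>. eliminates \<phi> w p"
    by (rule Suc.IH, rule Suc.prems) simp
  then obtain \<phi> where "eliminates \<phi> w p"
    by (rule exE)
  note \<phi> = eliminatesD[OF this]
  obtain \<nu> where \<nu>: "\<phi> (lin (w (Suc p))) = lin (\<lambda>t. w (Suc p) t + (\<Sum>q\<in>{1..p}. \<nu> q * w q t))"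
    using \<phi>(6) by metis
  define d where "d t = w (Suc p) t + (\<Sum>q\<in>{1..p}. \<nu> q * w q t)" for t
  obtain t where t: "d t \<noteq> 0"
    using Suc.prems[of p \<nu>] by (auto simp: d_def)
  \<comment> \<open>This solves \<open>lin d = 0\<close> for the variable \<open>t\<close>: since
    \<open>d t\<close> is nonzero, the value substituted for \<open>Var t\<close> no longer contains
    \<open>Var t\<close>, and \<open>lin d\<close> is sent to zero.\<close>
  define \<sigma> where "\<sigma> s = (if s = t then Var s - Const (inverse (d t)) * lin d else Var s)" for s
  define \<psi> where "\<psi> = poly_subst Const \<sigma>"
  have \<psi>_lin: "\<psi> (lin c) = lin (\<lambda>s. c s + (- c t / d t) * d s)" for c
  proof -
    have "\<psi> (lin c) = (\<Sum>s\<in>UNIV. Const (c s) * Var s - (if s = t then Const (c t) * (Const (inverse (d t)) * lin d) else 0))"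
      unfolding \<psi>_def poly_subst_lin by (intro sum.cong) (auto simp: \<sigma>_def right_diff_distrib)
    also have "\<dots> = lin c - Const (c t) * (Const (inverse (d t)) * lin d)"
      by (simp add: sum_subtractf lin_def)
    also have "\<dots> = lin c + Const (- c t / d t) * lin d"
      by (simp add: Const_mult[symmetric] mult.assoc[symmetric] Const_uminus divide_inverse)
    finally show ?thesis
      by (simp only: lin_add lin_scale)
  qed
  have d: "lin d = lin (w (Suc p)) + (\<Sum>q\<in>{1..p}. lin (w q) * Const (\<nu> q))"
    unfolding d_def lin_add lin_sum lin_scale by (simp add: mult.commute)
  have dvd: "lin d dvd \<psi> f - f" for f
    unfolding \<psi>_def by (rule dvd_diff_poly_subst) (auto simp: \<sigma>_def)
  have sum_Suc: "(\<Sum>q\<in>{1..Suc p}. g q) = (\<Sum>q\<in>{1..p}. g q) + g (Suc p)" for g :: "nat \<Rightarrow> ('n, 'k) mpoly"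
    by (simp add: atLeastAtMostSuc_conv add.commute)
  show ?case
    unfolding eliminates_def
  proof (intro exI[of _ "\<lambda>f. \<psi> (\<phi> f)"] conjI allI ballI)
    show "\<psi> (\<phi> (lin (w q))) = 0" if q: "q \<in> {1..Suc p}" for q
    proof (cases "q = Suc p")
      case True
      have "\<psi> (lin d) = 0"
        using t by (simp add: \<psi>_lin)
      then show ?thesis using True \<nu> by (simp add: d_def[abs_def])
    next
      case False
      then show ?thesis using q \<phi>(4)[of q] by (simp add: \<psi>_def)
    qed
  next
    fix f
    obtain h where h: "f - \<phi> f = (\<Sum>q\<in>{1..p}. lin (w q) * h q)"
      using \<phi>(5) by blast
    obtain g where g: "\<psi> (\<phi> f) - \<phi> f = lin d * g"
      using dvd by (auto elim: dvdE)
    have "f - \<psi> (\<phi> f) = (f - \<phi> f) - (\<psi> (\<phi> f) - \<phi> f)"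
      by simp
    also have "\<dots> = (\<Sum>q\<in>{1..p}. lin (w q) * (h q - Const (\<nu> q) * g)) + lin (w (Suc p)) * - g"
      unfolding h g d by (simp add: algebra_simps sum_subtractf sum_distrib_left sum_distrib_right sum.distrib)
    also have "\<dots> = (\<Sum>q\<in>{1..Suc p}. lin (w q) * (if q = Suc p then - g else h q - Const (\<nu> q) * g))"
      unfolding sum_Suc by simp
    finally show "\<exists>h. f - \<psi> (\<phi> f) = (\<Sum>q\<in>{1..Suc p}. lin (w q) * h q)"
      by (intro exI[of _ "\<lambda>q. if q = Suc p then - g else h q - Const (\<nu> q) * g"])
  next
    fix c
    obtain \<mu> where \<mu>: "\<phi> (lin c) = lin (\<lambda>t. c t + (\<Sum>q\<in>{1..p}. \<mu> q * w q t))"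
      using \<phi>(6) by blast
    let ?c = "\<lambda>t. c t + (\<Sum>q\<in>{1..p}. \<mu> q * w q t)"
    define r where "r = - ?c t / d t"
    have "\<psi> (\<phi> (lin c)) = lin (\<lambda>s. ?c s + r * d s)"
      unfolding \<mu> \<psi>_lin r_def ..
    also have "(\<lambda>s. ?c s + r * d s) =
        (\<lambda>s. c s + (\<Sum>q\<in>{1..Suc p}. (if q = Suc p then r else \<mu> q + r * \<nu> q) * w q s))"
      by (simp add: fun_eq_iff atLeastAtMostSuc_conv d_def algebra_simps sum.distrib sum_distrib_left)
    finally show "\<exists>\<nu>. \<psi> (\<phi> (lin c)) = lin (\<lambda>t. c t + (\<Sum>q\<in>{1..Suc p}. \<nu> q * w q t))"
      by (intro exI[of _ "\<lambda>q. if q = Suc p then r else \<mu> q + r * \<nu> q"])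
  qed (simp_all add: \<psi>_def \<phi> Const_hom.poly_subst_add Const_hom.poly_subst_mult)
qed

subsection \<open>Forms in general position\<close>

definition restr_form :: "('n::finite \<times> nat \<Rightarrow> 'k::field) \<Rightarrow> 'n set \<Rightarrow> nat \<Rightarrow> ('n, 'k) mpoly"
  where "restr_form a G q = lin (\<lambda>t. if t \<in> G then a (t, q) else 0)"

text \<open>On the variables in \<open>G\<close>, the first \<open>p + 1\<close> forms are linearly independent if there are enough variables, and
  otherwise the first \<open>p\<close> forms span all variables.\<close>

definition general_position :: "nat \<Rightarrow> ('n::finite \<times> nat \<Rightarrow> 'k::field) \<Rightarrow> bool"
  where "general_position m a \<longleftrightarrow> (\<forall>G. \<forall>p<m.
    (p < card G \<longrightarrow> (\<forall>\<nu>. \<exists>t\<in>G. a (t, Suc p) + (\<Sum>q\<in>{1..p}. \<nu> q * a (t, q)) \<noteq> 0)) \<and>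
    (card G \<le> p \<longrightarrow> (\<forall>t\<in>G. \<exists>c. \<forall>s\<in>G. (\<Sum>q\<in>{1..p}. c q * a (s, q)) = (if s = t then 1 else 0))))"

lemma general_position_elimination:
  fixes a :: "'n::finite \<times> nat \<Rightarrow> 'k::field"
  assumes gp: "general_position m a" and p: "p < m" "p < card G"
  obtains \<phi> where "\<And>f g. \<phi> (f + g) = \<phi> f + \<phi> g" "\<And>f g. \<phi> (f * g) = \<phi> f * \<phi> g"
    "\<And>c. \<phi> (Const c) = Const c" "\<And>q. q \<in> {1..p} \<Longrightarrow> \<phi> (restr_form a G q) = 0"
    "\<And>f. \<exists>h. f - \<phi> f = (\<Sum>q\<in>{1..p}. restr_form a G q * h q)"
    "\<phi> (restr_form a G (Suc p)) \<noteq> 0"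
proof -
  let ?w = "\<lambda>q t. if t \<in> G then a (t, q) else 0"
  have indep: "\<exists>t. ?w (Suc r) t + (\<Sum>q\<in>{1..r}. \<nu> q * ?w q t) \<noteq> 0" if "r \<le> p" for r \<nu>
  proof -
    have "r < m" "r < card G" using \<open>r \<le> p\<close> p by auto
    then obtain t where "t \<in> G" "a (t, Suc r) + (\<Sum>q\<in>{1..r}. \<nu> q * a (t, q)) \<noteq> 0"
      using gp unfolding general_position_def by blast
    then show ?thesis by (intro exI[of _ t]) simp
  qed
  have "\<exists>\<phi>. eliminates \<phi> ?w p"
    by (rule linear_elimination, rule indep) simp
  then obtain \<phi> where "eliminates \<phi> ?w p"
    by (rule exE)
  note \<phi> = eliminatesD[OF this]
  obtain \<nu> where \<nu>: "\<phi> (lin (?w (Suc p))) = lin (\<lambda>t. ?w (Suc p) t + (\<Sum>q\<in>{1..p}. \<nu> q * ?w q t))"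
    using \<phi>(6) by blast
  have "\<phi> (lin (?w (Suc p))) \<noteq> 0"
    unfolding \<nu> using indep[of p \<nu>] lin_nonzero by fastforce
  then show thesis
    by (intro that[of \<phi>] \<phi>(1-3) \<phi>(4,5)[folded restr_form_def]) (simp_all only: restr_form_def simp_thms)
qed

lemma Var_in_restr_forms:
  fixes a :: "'n::finite \<times> nat \<Rightarrow> 'k::field"
  assumes gp: "general_position m a" and p: "p < m" "card G \<le> p" "t \<in> G"
  obtains c where "Var t = (\<Sum>q\<in>{1..p}. restr_form a G q * Const (c q))"
proof -
  have "\<exists>c. \<forall>s\<in>G. (\<Sum>q\<in>{1..p}. c q * a (s, q)) = (if s = t then 1 else 0)"
    by (rule gp[unfolded general_position_def, THEN spec, THEN spec, THEN mp, OF p(1), THEN conjunct2,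
          THEN mp, OF p(2), THEN bspec, OF p(3)])
  then obtain c where c: "\<And>s. s \<in> G \<Longrightarrow> (\<Sum>q\<in>{1..p}. c q * a (s, q)) = (if s = t then 1 else 0)"
    by metis
  have "(\<Sum>q\<in>{1..p}. restr_form a G q * Const (c q)) =
      lin (\<lambda>s. \<Sum>q\<in>{1..p}. c q * (if s \<in> G then a (s, q) else 0))"
    unfolding restr_form_def lin_sum lin_scale by (simp add: mult.commute)
  also have "(\<lambda>s. \<Sum>q\<in>{1..p}. c q * (if s \<in> G then a (s, q) else 0)) = (\<lambda>s. if s = t then 1 else 0)"
  proof
    fix s
    show "(\<Sum>q\<in>{1..p}. c q * (if s \<in> G then a (s, q) else 0)) = (if s = t then 1 else 0)"
      using c[of s] p(3) by (cases "s \<in> G") auto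
  qed
  also have "lin (\<lambda>s. if s = t then 1 else 0) = Var t"
    by (simp add: lin_def if_distrib[of Const] if_distrib[of "\<lambda>x. x * _"] cong: if_cong)
  finally show thesis
    using that by metis
qed

text \<open>If there are more than \<open>p\<close> variables, already \<open>f\<close> lies in the
  ideal of the first \<open>p\<close> forms, because modulo this ideal the ring is a domain in which
  the next form is nonzero. Otherwise the ideal contains \<open>Var t\<close>. The factor
  \<open>Var t\<close> unites both cases; it costs nothing where the variable \<open>t\<close> is
  invertible.\<close>

lemma restr_forms_regular:
  fixes a :: "'n::{finite, linorder} \<times> nat \<Rightarrow> 'k::field"
  assumes gp: "general_position m a" and p: "p < m" and t: "t \<in> G"
    and eq: "restr_form a G (Suc p) * f = (\<Sum>q\<in>{1..p}. restr_form a G q * g q)"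
  shows "\<exists>h. Var t * f = (\<Sum>q\<in>{1..p}. restr_form a G q * h q)"
proof (cases "p < card G")
  case True
  obtain \<phi> where \<phi>: "\<And>f g. \<phi> (f + g) = \<phi> f + \<phi> g" "\<And>f g. \<phi> (f * g) = \<phi> f * \<phi> g"
    "\<And>c. \<phi> (Const c) = Const c" "\<And>q. q \<in> {1..p} \<Longrightarrow> \<phi> (restr_form a G q) = 0"
    "\<And>f. \<exists>h. f - \<phi> f = (\<Sum>q\<in>{1..p}. restr_form a G q * h q)"
    "\<phi> (restr_form a G (Suc p)) \<noteq> 0"
    by (rule general_position_elimination[OF gp p True]) blast
  have \<phi>0: "\<phi> 0 = 0" using \<phi>(3)[of 0] by simp
  have "\<phi> (\<Sum>q\<in>Q. restr_form a G q * g q) = 0" if "finite Q" "Q \<subseteq> {1..p}" for Q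
    using that by (induction Q rule: finite_induct) (auto simp: \<phi>0 \<phi>(1,2,4))
  then have "\<phi> (restr_form a G (Suc p)) * \<phi> f = 0"
    unfolding \<phi>(2)[symmetric] eq by simp
  then have "\<phi> f = 0" using \<phi>(6) by simp
  then obtain h where "f = (\<Sum>q\<in>{1..p}. restr_form a G q * h q)"
    using \<phi>(5)[of f] by auto
  then have "Var t * f = (\<Sum>q\<in>{1..p}. restr_form a G q * (Var t * h q))"
    by (simp add: sum_distrib_left mult_ac)
  then show ?thesis by (intro exI[of _ "\<lambda>q. Var t * h q"])
next
  case False
  then obtain c where c: "Var t = (\<Sum>q\<in>{1..p}. restr_form a G q * Const (c q))"
    using Var_in_restr_forms[OF gp p _ t] by (metis not_less)
  have "Var t * f = (\<Sum>q\<in>{1..p}. restr_form a G q * (Const (c q) * f))"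
    unfolding c by (simp only: sum_distrib_right mult.assoc)
  then show ?thesis
    by (intro exI[of _ "\<lambda>q. Const (c q) * f"])
qed

abbreviation pscale :: "'k::field \<Rightarrow> ('n, 'k) mpoly \<Rightarrow> ('n, 'k) mpoly"
  where "pscale c f \<equiv> Const c * f"

lemma vector_space_pscale: "vector_space pscale"
  by unfold_locales (simp_all add: algebra_simps Const_add Const_mult)

text \<open>The dual of the preceding regularity: \<open>U\<close> is a family of functionals that the first \<open>p\<close> forms
  annihilate, and it is to be divided by the next form.\<close>

lemma restr_forms_coregular:
  fixes a :: "'n::{finite, linorder} \<times> nat \<Rightarrow> 'k::field"
    and scale :: "'k \<Rightarrow> 'b::ab_group_add \<Rightarrow> 'b" and U :: "('n, 'k) mpoly \<Rightarrow> 'b"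
  assumes gp: "general_position m a" and p: "p < m" "p < card G"
    and U: "Vector_Spaces.linear pscale scale U"
    and ann: "\<And>q f. q \<in> {1..p} \<Longrightarrow> U (restr_form a G q * f) = 0"
  shows "\<exists>W. Vector_Spaces.linear pscale scale W \<and> (\<forall>f. W (restr_form a G (Suc p) * f) = U f) \<and>
    (\<forall>q\<in>{1..p}. \<forall>f. W (restr_form a G q * f) = 0)"
proof -
  interpret U: Vector_Spaces.linear pscale scale U by (rule U)
  interpret P: vector_space_pair pscale pscale
    by (intro vector_space_pair.intro vector_space_pscale)
  obtain \<phi> where \<phi>: "\<And>f g. \<phi> (f + g) = \<phi> f + \<phi> g" "\<And>f g. \<phi> (f * g) = \<phi> f * \<phi> g"
    "\<And>c. \<phi> (Const c) = Const c" "\<And>q. q \<in> {1..p} \<Longrightarrow> \<phi> (restr_form a G q) = 0"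
    "\<And>f. \<exists>h. f - \<phi> f = (\<Sum>q\<in>{1..p}. restr_form a G q * h q)"
    "\<phi> (restr_form a G (Suc p)) \<noteq> 0"
    by (rule general_position_elimination[OF gp p]) blast
  \<comment> \<open>On the image of \<open>\<phi>\<close> the next form acts as multiplication by
    \<open>\<theta>\<close>. This is injective in a domain, hence has a linear left inverse
    \<open>g\<close>, and composing \<open>U\<close> with \<open>g\<close> and \<open>\<phi>\<close>
    divides \<open>U\<close> by the form.\<close>
  define \<theta> where "\<theta> = \<phi> (restr_form a G (Suc p))"
  have "Vector_Spaces.linear pscale pscale ((*) \<theta>)"
    using vector_space_pscale
    by (simp add: Vector_Spaces.linear_iff algebra_simps)
  moreover have "inj ((*) \<theta>)"
    using \<phi>(6) by (auto simp: inj_def \<theta>_def)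
  ultimately obtain g where g: "Vector_Spaces.linear pscale pscale g" "g \<circ> (*) \<theta> = id"
    using P.linear_injective_left_inverse by blast
  have g\<theta>: "g (\<theta> * f) = f" for f
    using g(2) by (simp add: fun_eq_iff)
  have \<phi>lin: "Vector_Spaces.linear pscale pscale \<phi>"
    using vector_space_pscale by (simp add: Vector_Spaces.linear_iff \<phi>)
  have lin: "Vector_Spaces.linear pscale scale (U \<circ> (g \<circ> \<phi>))"
    by (intro Vector_Spaces.linear_compose[OF _ U] Vector_Spaces.linear_compose[OF \<phi>lin g(1)])
  have g0: "g 0 = 0" using g\<theta>[of 0] by simp
  have U0: "U 0 = 0" by (rule U.zero)
  \<comment> \<open>The functional kills the ideal of the first \<open>p\<close> forms, so it does
    not distinguish \<open>f\<close> from \<open>\<phi> f\<close>.\<close>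
  have U\<phi>: "U (\<phi> f) = U f" for f
  proof -
    obtain h where h: "f - \<phi> f = (\<Sum>q\<in>{1..p}. restr_form a G q * h q)"
      using \<phi>(5) by blast
    have "U (f - \<phi> f) = 0"
      unfolding h by (simp add: U.sum ann)
    then show ?thesis by (simp add: U.diff)
  qed
  show ?thesis
    by (intro exI[of _ "U \<circ> (g \<circ> \<phi>)"] conjI lin)
      (auto simp: \<phi>(2,4) g0 U0 U\<phi> g\<theta> simp flip: \<theta>_def)
qed

section \<open>Division by commuting operators along filtrations\<close>

section \<open>Regular and coregular sequences of operators\<close>

locale commuting_ops =
  fixes \<theta> :: "nat \<Rightarrow> 'c::ab_group_add \<Rightarrow> 'c"
  assumes \<theta>_add: "\<theta> q (x + y) = \<theta> q x + \<theta> q y"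
    and \<theta>_comm: "\<theta> q (\<theta> r x) = \<theta> r (\<theta> q x)"
begin

lemma \<theta>_0 [simp]: "\<theta> q 0 = 0"
  using \<theta>_add[of q 0 0] by simp

lemma \<theta>_minus: "\<theta> q (- x) = - \<theta> q x"
  using \<theta>_add[of q x "- x"] by (simp add: eq_neg_iff_add_eq_0 add.commute)

lemma \<theta>_diff: "\<theta> q (x - y) = \<theta> q x - \<theta> q y"
  using \<theta>_add[of q x "- y"] by (simp add: \<theta>_minus)

lemma \<theta>_sum: "\<theta> q (\<Sum>i\<in>I. f i) = (\<Sum>i\<in>I. \<theta> q (f i))"
  by (induction I rule: infinite_finite_induct) (simp_all add: \<theta>_add)

definition stable :: "'c set \<Rightarrow> bool"
  where "stable L \<longleftrightarrow> 0 \<in> L \<and> (\<forall>x\<in>L. \<forall>y\<in>L. x - y \<in> L) \<and> (\<forall>q. \<forall>x\<in>L. \<theta> q x \<in> L)"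

lemma stableD:
  assumes "stable L"
  shows "0 \<in> L" "x \<in> L \<Longrightarrow> y \<in> L \<Longrightarrow> x - y \<in> L" "x \<in> L \<Longrightarrow> \<theta> q x \<in> L"
    "x \<in> L \<Longrightarrow> - x \<in> L" "x \<in> L \<Longrightarrow> y \<in> L \<Longrightarrow> x + y \<in> L"
proof -
  show *: "0 \<in> L" "x \<in> L \<Longrightarrow> y \<in> L \<Longrightarrow> x - y \<in> L" "x \<in> L \<Longrightarrow> \<theta> q x \<in> L" for x y
    using assms by (auto simp: stable_def)
  show neg: "- x \<in> L" if "x \<in> L" for x
    using *(2)[OF *(1) that] by simp
  show "x + y \<in> L" if "x \<in> L" "y \<in> L"
    using *(2)[OF that(1) neg[OF that(2)]] by simp
qed

text \<open>A regular sequence on \<open>L\<close> modulo \<open>K\<close>, without the condition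
  that something nonzero is left at the end. It is stated with representatives in one ambient group
  because the steps of a filtration have to be composed there.\<close>

definition regular_mod :: "nat \<Rightarrow> 'c set \<Rightarrow> 'c set \<Rightarrow> bool"
  where "regular_mod m L K \<longleftrightarrow> (\<forall>r<m. \<forall>u\<in>L. \<forall>k\<in>K. \<forall>v. (\<forall>q. v q \<in> L) \<longrightarrow>
    \<theta> (Suc r) u = k + (\<Sum>q\<in>{1..r}. \<theta> q (v q)) \<longrightarrow>
    (\<exists>k'\<in>K. \<exists>w. (\<forall>q. w q \<in> L) \<and> u = k' + (\<Sum>q\<in>{1..r}. \<theta> q (w q))))"

lemma regular_modD:
  assumes "regular_mod m L K" "r < m" "u \<in> L" "k \<in> K" "\<And>q. v q \<in> L"
    "\<theta> (Suc r) u = k + (\<Sum>q\<in>{1..r}. \<theta> q (v q))"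
  obtains k' w where "k' \<in> K" "\<And>q. w q \<in> L" "u = k' + (\<Sum>q\<in>{1..r}. \<theta> q (w q))"
proof -
  have "\<exists>k'\<in>K. \<exists>w. (\<forall>q. w q \<in> L) \<and> u = k' + (\<Sum>q\<in>{1..r}. \<theta> q (w q))"
    by (rule assms(1)[unfolded regular_mod_def, rule_format, OF assms(2-5) assms(6)])
  then show thesis using that by metis
qed

lemma sum_Suc: "(\<Sum>q\<in>{1..Suc r}. f q) = (\<Sum>q\<in>{1..r}. f q) + f (Suc r)"
  for f :: "nat \<Rightarrow> 'a::comm_monoid_add"
  by (simp add: atLeastAtMostSuc_conv add.commute)

text \<open>A regular sequence on \<open>L\<close> modulo \<open>K\<close> keeps the inclusion of
  \<open>K\<close> in \<open>L\<close> injective after dividing both by the multiples of the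
  operators. By regularity the coefficient of the last operator is an element \<open>l\<close> of
  \<open>K\<close> up to multiples of the earlier operators, and these are absorbed in the earlier
  coefficients since the operators commute.\<close>

lemma regular_mod_inter:
  assumes reg: "regular_mod m L K" and L: "stable L" and K: "stable K" and sub: "K \<subseteq> L"
  shows "r \<le> m \<Longrightarrow> (\<And>q. y q \<in> L) \<Longrightarrow> (\<Sum>q\<in>{1..r}. \<theta> q (y q)) \<in> K \<Longrightarrow>
    \<exists>y'. (\<forall>q. y' q \<in> K) \<and> (\<Sum>q\<in>{1..r}. \<theta> q (y q)) = (\<Sum>q\<in>{1..r}. \<theta> q (y' q))"
proof (induction r arbitrary: y)
  case 0
  then show ?case using stableD(1)[OF K] by (intro exI[of _ "\<lambda>_. 0"]) simp
next
  case (Suc r)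
  let ?k = "(\<Sum>q\<in>{1..Suc r}. \<theta> q (y q))"
  have "\<theta> (Suc r) (y (Suc r)) = ?k + (\<Sum>q\<in>{1..r}. \<theta> q (- y q))"
    by (simp only: sum_Suc \<theta>_minus sum_negf) simp
  then obtain l z where l: "l \<in> K" and z: "\<And>q. z q \<in> L"
    and y: "y (Suc r) = l + (\<Sum>q\<in>{1..r}. \<theta> q (z q))"
    using regular_modD[OF reg, of r "y (Suc r)" ?k "\<lambda>q. - y q"] Suc.prems stableD(4)[OF L]
    by (metis Suc_le_lessD)
  have \<theta>y: "\<theta> (Suc r) (y (Suc r)) = \<theta> (Suc r) l + (\<Sum>q\<in>{1..r}. \<theta> q (\<theta> (Suc r) (z q)))"
    unfolding y by (simp add: \<theta>_add \<theta>_sum \<theta>_comm[of "Suc r"])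
  have eq: "(\<Sum>q\<in>{1..r}. \<theta> q (y q + \<theta> (Suc r) (z q))) = ?k - \<theta> (Suc r) l"
    by (simp only: sum_Suc \<theta>y \<theta>_add sum.distrib) simp
  have "?k - \<theta> (Suc r) l \<in> K"
    by (intro stableD(2)[OF K] stableD(3)[OF K] Suc.prems l)
  then obtain y' where y': "\<And>q. y' q \<in> K" "?k - \<theta> (Suc r) l = (\<Sum>q\<in>{1..r}. \<theta> q (y' q))"
    using Suc.IH[of "\<lambda>q. y q + \<theta> (Suc r) (z q)"] Suc.prems z stableD(3,5)[OF L] unfolding eq
    by (metis Suc_leD)
  have "?k = (\<Sum>q\<in>{1..Suc r}. \<theta> q (if q = Suc r then l else y' q))"
    using y'(2) unfolding sum_Suc[of _ r] by (simp add: algebra_simps)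
  then show ?case
    using y'(1) l by (intro exI[of _ "\<lambda>q. if q = Suc r then l else y' q"]) simp
qed

text \<open>Division in \<open>L\<close> modulo \<open>K\<close> leaves an element \<open>k\<close>
  of \<open>K\<close>. The multiples that then occur in the equation for \<open>k\<close> have
  coefficients in \<open>L\<close> only; as their sum lies in \<open>K\<close>,
  \<open>regular_mod_inter\<close> replaces these by coefficients in \<open>K\<close>, and
  regularity on \<open>K\<close> modulo \<open>J\<close> applies.\<close>

lemma regular_mod_trans:
  assumes LK: "regular_mod m L K" and KJ: "regular_mod m K J"
    and L: "stable L" and K: "stable K" and sub: "K \<subseteq> L" "J \<subseteq> K"
  shows "regular_mod m L J"
  unfolding regular_mod_def
proof (intro allI impI ballI)
  fix r u j v
  assume r: "r < m" and u: "u \<in> L" and j: "j \<in> J" and v: "\<forall>q. v q \<in> L"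
    and eq: "\<theta> (Suc r) u = j + (\<Sum>q\<in>{1..r}. \<theta> q (v q))"
  obtain k w where k: "k \<in> K" and w: "\<And>q. w q \<in> L" and uk: "u = k + (\<Sum>q\<in>{1..r}. \<theta> q (w q))"
    using regular_modD[OF LK r u _ _ eq] v j sub by blast
  have eq2: "\<theta> (Suc r) k = j + (\<Sum>q\<in>{1..r}. \<theta> q (v q - \<theta> (Suc r) (w q)))"
    using eq unfolding uk by (simp add: \<theta>_add \<theta>_sum \<theta>_diff sum_subtractf \<theta>_comm[of "Suc r"] algebra_simps)
  then have "(\<Sum>q\<in>{1..r}. \<theta> q (v q - \<theta> (Suc r) (w q))) = \<theta> (Suc r) k - j"
    by simp
  also have "\<dots> \<in> K"
    using j k sub by (intro stableD(2)[OF K] stableD(3)[OF K]) auto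
  finally obtain y where y: "\<And>q. y q \<in> K"
    "(\<Sum>q\<in>{1..r}. \<theta> q (v q - \<theta> (Suc r) (w q))) = (\<Sum>q\<in>{1..r}. \<theta> q (y q))"
    using regular_mod_inter[OF LK L K sub(1), of r "\<lambda>q. v q - \<theta> (Suc r) (w q)"] r v w
      stableD(2,3)[OF L] by (metis less_imp_le)
  obtain j' w' where j': "j' \<in> J" and w': "\<And>q. w' q \<in> K" and kj: "k = j' + (\<Sum>q\<in>{1..r}. \<theta> q (w' q))"
    using regular_modD[OF KJ r k j, of y] y eq2 by metis
  have "u = j' + (\<Sum>q\<in>{1..r}. \<theta> q (w' q + w q))"
    unfolding uk kj by (simp add: \<theta>_add sum.distrib add.assoc)
  then show "\<exists>k'\<in>J. \<exists>w. (\<forall>q. w q \<in> L) \<and> u = k' + (\<Sum>q\<in>{1..r}. \<theta> q (w q))"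
    using j' w subsetD[OF sub(1) w'] stableD(5)[OF L] by (intro bexI[of _ j'] exI[of _ "\<lambda>q. w' q + w q"]) auto
qed

definition graded_stable :: "(int \<Rightarrow> 'c set) \<Rightarrow> bool"
  where "graded_stable Z \<longleftrightarrow>
    (\<forall>e. 0 \<in> Z e \<and> (\<forall>x\<in>Z e. \<forall>y\<in>Z e. x - y \<in> Z e) \<and> (\<forall>q. \<forall>x\<in>Z e. \<theta> q x \<in> Z (e + 1)))"

lemma graded_stableD:
  assumes "graded_stable Z"
  shows "0 \<in> Z e" "x \<in> Z e \<Longrightarrow> y \<in> Z e \<Longrightarrow> x - y \<in> Z e" "x \<in> Z e \<Longrightarrow> \<theta> q x \<in> Z (e + 1)"
    "x \<in> Z e \<Longrightarrow> - x \<in> Z e" "x \<in> Z e \<Longrightarrow> y \<in> Z e \<Longrightarrow> x + y \<in> Z e"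
    "x \<in> Z (e - 1) \<Longrightarrow> \<theta> q x \<in> Z e"
proof -
  show *: "0 \<in> Z e" "x \<in> Z e \<Longrightarrow> y \<in> Z e \<Longrightarrow> x - y \<in> Z e" "x \<in> Z e \<Longrightarrow> \<theta> q x \<in> Z (e + 1)" for x y e
    using assms by (auto simp: graded_stable_def)
  show neg: "- x \<in> Z e" if "x \<in> Z e" for x
    using *(2)[OF *(1) that] by simp
  show "x + y \<in> Z e" if "x \<in> Z e" "y \<in> Z e"
    using *(2)[OF that(1) neg[OF that(2)]] by simp
  show "x \<in> Z (e - 1) \<Longrightarrow> \<theta> q x \<in> Z e"
    using *(3)[of x "e - 1"] by simp
qed

text \<open>In very negative degrees the forms are, one after the other, surjective on the common kernel of the
  forms before them; the forms up to \<open>k\<close> are disregarded.\<close>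

definition coregular_mod :: "nat \<Rightarrow> nat \<Rightarrow> (int \<Rightarrow> 'c set) \<Rightarrow> (int \<Rightarrow> 'c set) \<Rightarrow> bool"
  where "coregular_mod k m Z B \<longleftrightarrow> (\<forall>r. k \<le> r \<longrightarrow> r < m \<longrightarrow> (\<exists>e0. \<forall>e<e0. \<forall>u\<in>Z e.
    (\<forall>q\<in>{k<..r}. \<theta> q u \<in> B (e + 1)) \<longrightarrow>
    (\<exists>w\<in>Z (e - 1). (\<forall>q\<in>{k<..r}. \<theta> q w \<in> B e) \<and> u - \<theta> (Suc r) w \<in> B e)))"

lemma coregular_modD:
  assumes "coregular_mod k m Z B" "k \<le> r" "r < m"
  obtains e0 where "\<And>e u. e < e0 \<Longrightarrow> u \<in> Z e \<Longrightarrow> (\<And>q. q \<in> {k<..r} \<Longrightarrow> \<theta> q u \<in> B (e + 1)) \<Longrightarrow>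
    \<exists>w\<in>Z (e - 1). (\<forall>q\<in>{k<..r}. \<theta> q w \<in> B e) \<and> u - \<theta> (Suc r) w \<in> B e"
using assms by (fastforce simp: coregular_mod_def)

lemma coregular_modI:
  assumes "\<And>r. k \<le> r \<Longrightarrow> r < m \<Longrightarrow> \<exists>e0. \<forall>e<e0. \<forall>u\<in>Z e.
    (\<forall>q\<in>{k<..r}. \<theta> q u \<in> B (e + 1)) \<longrightarrow>
    (\<exists>w\<in>Z (e - 1). (\<forall>q\<in>{k<..r}. \<theta> q w \<in> B e) \<and> u - \<theta> (Suc r) w \<in> B e)"
  shows "coregular_mod k m Z B"
  unfolding coregular_mod_def by (intro allI impI assms)

text \<open>The dual of \<open>regular_mod_inter\<close>: passing to common kernels stays surjective
  from \<open>Z\<close> to \<open>Z\<close> modulo \<open>Y\<close>. After a correction for the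
  earlier operators, the next operator sends \<open>u1\<close> into \<open>Y\<close>, and this
  obstruction is annihilated by the earlier operators. Coregularity on \<open>Y\<close> modulo
  \<open>B\<close> writes it as the image of some annihilated \<open>w\<close>, and
  \<open>u1 - w\<close> is the lift.\<close>

lemma coregular_mod_lift:
  assumes YB: "coregular_mod k m Y B"
    and Z: "graded_stable Z" and Y: "graded_stable Y" and B: "graded_stable B"
    and sub: "\<And>e. Y e \<subseteq> Z e" "\<And>e. B e \<subseteq> Y e"
  shows "k \<le> r \<Longrightarrow> r \<le> m \<Longrightarrow> \<exists>e0. \<forall>e<e0. \<forall>u\<in>Z e. (\<forall>q\<in>{k<..r}. \<theta> q u \<in> Y (e + 1)) \<longrightarrow>
    (\<exists>u'\<in>Z e. u - u' \<in> Y e \<and> (\<forall>q\<in>{k<..r}. \<theta> q u' \<in> B (e + 1)))"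
proof (induction r rule: dec_induct)
  case base
  then show ?case
    using graded_stableD(1)[OF Y] by (intro exI[of _ 0] allI impI ballI bexI conjI) auto
next
  case (step r)
  obtain e0 where e0: "\<And>e u. e < e0 \<Longrightarrow> u \<in> Z e \<Longrightarrow> (\<And>q. q \<in> {k<..r} \<Longrightarrow> \<theta> q u \<in> Y (e + 1)) \<Longrightarrow>
    \<exists>u'\<in>Z e. u - u' \<in> Y e \<and> (\<forall>q\<in>{k<..r}. \<theta> q u' \<in> B (e + 1))"
    using step by (metis Suc_leD)
  obtain e1 where e1: "\<And>e u. e < e1 \<Longrightarrow> u \<in> Y e \<Longrightarrow> (\<And>q. q \<in> {k<..r} \<Longrightarrow> \<theta> q u \<in> B (e + 1)) \<Longrightarrow>
    \<exists>w\<in>Y (e - 1). (\<forall>q\<in>{k<..r}. \<theta> q w \<in> B e) \<and> u - \<theta> (Suc r) w \<in> B e"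
    using coregular_modD[OF YB, of r] step by (metis Suc_le_lessD)
  show ?case
  \<comment> \<open>The obstruction \<open>y\<close> lives in degree \<open>e + 1\<close>, so the
    bound for \<open>Y\<close> is applied one degree higher.\<close>
  proof (intro exI[of _ "min e0 e1 - 1"] allI impI ballI)
    fix e u assume "e < min e0 e1 - 1" and u: "u \<in> Z e"
      and uY: "\<forall>q\<in>{k<..Suc r}. \<theta> q u \<in> Y (e + 1)"
    then have e: "e < e0" "e + 1 < e1" by simp_all
    have "\<theta> q u \<in> Y (e + 1)" if "q \<in> {k<..r}" for q
      using uY that by auto
    then obtain u1 where u1: "u1 \<in> Z e" "u - u1 \<in> Y e" "\<And>q. q \<in> {k<..r} \<Longrightarrow> \<theta> q u1 \<in> B (e + 1)"
      using e0[OF e(1) u] by blast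
    define y where "y = \<theta> (Suc r) u1"
    have "\<theta> (Suc r) u \<in> Y (e + 1)" using uY step by auto
    then have "\<theta> (Suc r) u - \<theta> (Suc r) (u - u1) \<in> Y (e + 1)"
      by (rule graded_stableD(2)[OF Y _ graded_stableD(3)[OF Y u1(2)]])
    then have y: "y \<in> Y (e + 1)"
      by (simp add: \<theta>_diff y_def)
    have "\<theta> q y \<in> B (e + 1 + 1)" if "q \<in> {k<..r}" for q
      unfolding y_def \<theta>_comm[of q] by (intro graded_stableD(3)[OF B] u1 that)
    then obtain w where w: "w \<in> Y (e + 1 - 1)" "\<And>q. q \<in> {k<..r} \<Longrightarrow> \<theta> q w \<in> B (e + 1)"
      "y - \<theta> (Suc r) w \<in> B (e + 1)"
      using e1[OF e(2) y] by blast
    have w: "w \<in> Y e" "\<And>q. q \<in> {k<..r} \<Longrightarrow> \<theta> q w \<in> B (e + 1)" "y - \<theta> (Suc r) w \<in> B (e + 1)"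
      using w by simp_all
    show "\<exists>u'\<in>Z e. u - u' \<in> Y e \<and> (\<forall>q\<in>{k<..Suc r}. \<theta> q u' \<in> B (e + 1))"
    proof (intro bexI[of _ "u1 - w"] conjI ballI)
      show "u1 - w \<in> Z e"
        using u1 w sub by (intro graded_stableD(2)[OF Z]) auto
      have "u - u1 + w \<in> Y e"
        by (intro graded_stableD(5)[OF Y] u1 w)
      then show "u - (u1 - w) \<in> Y e" by (simp add: algebra_simps)
      fix q assume q: "q \<in> {k<..Suc r}"
      show "\<theta> q (u1 - w) \<in> B (e + 1)"
      proof (cases "q = Suc r")
        case True
        then show ?thesis using w(3) by (simp add: \<theta>_diff y_def)
      next
        case False
        then have "q \<in> {k<..r}" using q by auto
        then show ?thesis
          unfolding \<theta>_diff by (intro graded_stableD(2)[OF B] u1 w)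
      qed
    qed
  qed
qed

text \<open>A preimage \<open>w\<close> modulo \<open>Y\<close> is first lifted to one that is
  annihilated modulo \<open>B\<close>. The remaining error then lies in \<open>Y\<close> and is
  annihilated modulo \<open>B\<close> too, so it can be divided inside \<open>Y\<close>.\<close>

lemma coregular_mod_trans:
  assumes ZY: "coregular_mod k m Z Y" and YB: "coregular_mod k m Y B"
    and Z: "graded_stable Z" and Y: "graded_stable Y" and B: "graded_stable B"
    and sub: "\<And>e. Y e \<subseteq> Z e" "\<And>e. B e \<subseteq> Y e"
  shows "coregular_mod k m Z B"
proof (rule coregular_modI)
  fix r assume r: "k \<le> r" "r < m"
  obtain e0 where e0: "\<And>e u. e < e0 \<Longrightarrow> u \<in> Z e \<Longrightarrow> (\<And>q. q \<in> {k<..r} \<Longrightarrow> \<theta> q u \<in> Y (e + 1)) \<Longrightarrow>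
    \<exists>w\<in>Z (e - 1). (\<forall>q\<in>{k<..r}. \<theta> q w \<in> Y e) \<and> u - \<theta> (Suc r) w \<in> Y e"
    using coregular_modD[OF ZY r] by metis
  obtain e1 where e1: "\<And>e u. e < e1 \<Longrightarrow> u \<in> Y e \<Longrightarrow> (\<And>q. q \<in> {k<..r} \<Longrightarrow> \<theta> q u \<in> B (e + 1)) \<Longrightarrow>
    \<exists>w\<in>Y (e - 1). (\<forall>q\<in>{k<..r}. \<theta> q w \<in> B e) \<and> u - \<theta> (Suc r) w \<in> B e"
    using coregular_modD[OF YB r] by metis
  obtain e2 where e2: "\<And>e u. e < e2 \<Longrightarrow> u \<in> Z e \<Longrightarrow> (\<And>q. q \<in> {k<..r} \<Longrightarrow> \<theta> q u \<in> Y (e + 1)) \<Longrightarrow>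
    \<exists>u'\<in>Z e. u - u' \<in> Y e \<and> (\<forall>q\<in>{k<..r}. \<theta> q u' \<in> B (e + 1))"
    using coregular_mod_lift[OF YB Z Y B sub r(1)] r by (metis less_imp_le)
  show "\<exists>e0. \<forall>e<e0. \<forall>u\<in>Z e. (\<forall>q\<in>{k<..r}. \<theta> q u \<in> B (e + 1)) \<longrightarrow>
    (\<exists>w\<in>Z (e - 1). (\<forall>q\<in>{k<..r}. \<theta> q w \<in> B e) \<and> u - \<theta> (Suc r) w \<in> B e)"
  proof (intro exI[of _ "min e0 (min e1 e2)"] allI impI ballI)
    fix e u assume e: "e < min e0 (min e1 e2)" and u: "u \<in> Z e"
      and uB: "\<forall>q\<in>{k<..r}. \<theta> q u \<in> B (e + 1)"
    have "\<theta> q u \<in> Y (e + 1)" if "q \<in> {k<..r}" for q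
      using uB sub that by blast
    then obtain w where w: "w \<in> Z (e - 1)" "\<And>q. q \<in> {k<..r} \<Longrightarrow> \<theta> q w \<in> Y e" "u - \<theta> (Suc r) w \<in> Y e"
      using e0[of e u] e u by auto
    then obtain w' where w': "w' \<in> Z (e - 1)" "w - w' \<in> Y (e - 1)" "\<And>q. q \<in> {k<..r} \<Longrightarrow> \<theta> q w' \<in> B e"
      using e2[of "e - 1" w] e by auto
    define x where "x = u - \<theta> (Suc r) w'"
    have "u - \<theta> (Suc r) w + \<theta> (Suc r) (w - w') \<in> Y e"
      by (intro graded_stableD(5)[OF Y] graded_stableD(6)[OF Y] w w')
    then have x: "x \<in> Y e" by (simp add: x_def \<theta>_diff)
    have "\<theta> q x \<in> B (e + 1)" if "q \<in> {k<..r}" for q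
      unfolding x_def \<theta>_diff \<theta>_comm[of q "Suc r"]
      using graded_stableD(3)[OF B w'(3)[OF that]] uB that by (intro graded_stableD(2)[OF B]) auto
    then obtain y where y: "y \<in> Y (e - 1)" "\<And>q. q \<in> {k<..r} \<Longrightarrow> \<theta> q y \<in> B e" "x - \<theta> (Suc r) y \<in> B e"
      using e1[of e x] e x by auto
    show "\<exists>w\<in>Z (e - 1). (\<forall>q\<in>{k<..r}. \<theta> q w \<in> B e) \<and> u - \<theta> (Suc r) w \<in> B e"
    proof (intro bexI[of _ "w' + y"] conjI ballI)
      show "w' + y \<in> Z (e - 1)"
        using w' y sub by (intro graded_stableD(5)[OF Z]) auto
      show "\<theta> q (w' + y) \<in> B e" if "q \<in> {k<..r}" for q
        unfolding \<theta>_add by (intro graded_stableD(5)[OF B] w' y that)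
      show "u - \<theta> (Suc r) (w' + y) \<in> B e"
        using y(3) by (simp add: x_def \<theta>_add algebra_simps)
    qed
  qed
qed

end

section \<open>The long exact sequence of a form, with explicit representatives\<close>

section \<open>Cohomology of a complex modulo a regular sequence\<close>

text \<open>The complex meant is \<open>C j e\<close> modulo \<open>R j e\<close>, with
  \<open>j\<close> the cohomological and \<open>e\<close> the internal degree. The differential
  squares to zero on \<open>C\<close> itself, and \<open>d\<close> and \<open>\<theta>\<close> are
  maps of one ambient space, so all residue classes can be handled through representatives.\<close>

locale cochain_system = vector_space scale + commuting_ops \<theta>
  for scale :: "'k::field \<Rightarrow> 'c::ab_group_add \<Rightarrow> 'c" and \<theta> :: "nat \<Rightarrow> 'c \<Rightarrow> 'c" +
  fixes d :: "'c \<Rightarrow> 'c" and C R :: "int \<Rightarrow> int \<Rightarrow> 'c set" and m :: nat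
  assumes \<theta>_scale: "\<theta> q (scale c x) = scale c (\<theta> q x)"
    and d_add: "d (x + y) = d x + d y" and d_scale: "d (scale c x) = scale c (d x)"
    and d_\<theta>: "d (\<theta> q x) = \<theta> q (d x)"
    and C_subspace: "subspace (C j e)" and R_subspace: "subspace (R j e)"
    and R_sub: "R j e \<subseteq> C j e"
    and d_C: "x \<in> C j e \<Longrightarrow> d x \<in> C (j + 1) e" and d_R: "x \<in> R j e \<Longrightarrow> d x \<in> R (j + 1) e"
    and \<theta>_C: "x \<in> C j e \<Longrightarrow> \<theta> q x \<in> C j (e + 1)" and \<theta>_R: "x \<in> R j e \<Longrightarrow> \<theta> q x \<in> R j (e + 1)"
    and d_d: "x \<in> C j e \<Longrightarrow> d (d x) = 0"
begin

definition forms_part :: "nat \<Rightarrow> int \<Rightarrow> int \<Rightarrow> 'c set"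
  where "forms_part r j e = {x + (\<Sum>q\<in>{1..r}. \<theta> q (v q)) | x v. x \<in> R j e \<and> (\<forall>q. v q \<in> C j (e - 1))}"

definition cocycles_mod :: "nat \<Rightarrow> int \<Rightarrow> int \<Rightarrow> 'c set"
  where "cocycles_mod r j e = {c \<in> C j e. d c \<in> forms_part r (j + 1) e}"

definition coboundaries_mod :: "nat \<Rightarrow> int \<Rightarrow> int \<Rightarrow> 'c set"
  where "coboundaries_mod r j e = {d b + t | b t. b \<in> C (j - 1) e \<and> t \<in> forms_part r j e}"

lemma d_0 [simp]: "d 0 = 0"
  using d_add[of 0 0] by simp

lemma d_diff: "d (x - y) = d x - d y"
  using d_add[of "x - y" y] by simp

lemma d_sum: "d (\<Sum>i\<in>I. f i) = (\<Sum>i\<in>I. d (f i))"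
  by (induction I rule: infinite_finite_induct) (simp_all add: d_add)

lemma \<theta>_C': "x \<in> C j (e - 1) \<Longrightarrow> \<theta> q x \<in> C j e"
  using \<theta>_C[of x j "e - 1"] by simp

lemma forms_part_subspace: "subspace (forms_part r j e)"
proof (rule subspaceI)
  show "0 \<in> forms_part r j e"
    using subspace_0[OF R_subspace] subspace_0[OF C_subspace]
    by (auto simp: forms_part_def intro!: exI[of _ 0] exI[of _ "\<lambda>_. 0"])
next
  fix x y assume "x \<in> forms_part r j e" "y \<in> forms_part r j e"
  then obtain x0 v y0 w where "x = x0 + (\<Sum>q\<in>{1..r}. \<theta> q (v q))" "y = y0 + (\<Sum>q\<in>{1..r}. \<theta> q (w q))"
    "x0 \<in> R j e" "y0 \<in> R j e" "\<forall>q. v q \<in> C j (e - 1)" "\<forall>q. w q \<in> C j (e - 1)"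
    by (auto simp: forms_part_def)
  then show "x + y \<in> forms_part r j e"
    unfolding forms_part_def using subspace_add[OF R_subspace] subspace_add[OF C_subspace]
    by (intro CollectI exI[of _ "x0 + y0"] exI[of _ "\<lambda>q. v q + w q"]) (simp add: \<theta>_add sum.distrib algebra_simps)
next
  fix c x assume "x \<in> forms_part r j e"
  then obtain x0 v where "x = x0 + (\<Sum>q\<in>{1..r}. \<theta> q (v q))" "x0 \<in> R j e" "\<forall>q. v q \<in> C j (e - 1)"
    by (auto simp: forms_part_def)
  then show "scale c x \<in> forms_part r j e"
    unfolding forms_part_def using subspace_scale[OF R_subspace] subspace_scale[OF C_subspace]
    by (intro CollectI exI[of _ "scale c x0"] exI[of _ "\<lambda>q. scale c (v q)"])
      (simp add: \<theta>_scale scale_right_distrib scale_sum_right)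
qed

lemma forms_part_0: "forms_part 0 j e = R j e"
  unfolding forms_part_def using subspace_0[OF C_subspace] by (auto intro!: exI[of _ "\<lambda>_. 0"])

lemma forms_part_Suc:
  "x \<in> forms_part (Suc r) j e \<longleftrightarrow> (\<exists>y\<in>forms_part r j e. \<exists>v\<in>C j (e - 1). x = y + \<theta> (Suc r) v)"
proof
  assume "x \<in> forms_part (Suc r) j e"
  then obtain x0 v where v: "x = x0 + (\<Sum>q\<in>{1..Suc r}. \<theta> q (v q))" "x0 \<in> R j e" "\<forall>q. v q \<in> C j (e - 1)"
    by (auto simp: forms_part_def)
  have "x = (x0 + (\<Sum>q\<in>{1..r}. \<theta> q (v q))) + \<theta> (Suc r) (v (Suc r))"
    unfolding v(1) sum_Suc by (simp add: add.assoc)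
  moreover have "x0 + (\<Sum>q\<in>{1..r}. \<theta> q (v q)) \<in> forms_part r j e"
    using v by (auto simp: forms_part_def)
  ultimately show "\<exists>y\<in>forms_part r j e. \<exists>v\<in>C j (e - 1). x = y + \<theta> (Suc r) v"
    using v(3) by blast
next
  assume "\<exists>y\<in>forms_part r j e. \<exists>v\<in>C j (e - 1). x = y + \<theta> (Suc r) v"
  then obtain x0 v w where v: "x = x0 + (\<Sum>q\<in>{1..r}. \<theta> q (v q)) + \<theta> (Suc r) w" "x0 \<in> R j e"
    "\<forall>q. v q \<in> C j (e - 1)" "w \<in> C j (e - 1)"
    by (auto simp: forms_part_def)
  have "x = x0 + (\<Sum>q\<in>{1..Suc r}. \<theta> q (if q = Suc r then w else v q))"
    unfolding v(1) sum_Suc by (simp add: add.assoc)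
  then show "x \<in> forms_part (Suc r) j e"
    unfolding forms_part_def using v
    by (intro CollectI exI[of _ x0] exI[of _ "\<lambda>q. if q = Suc r then w else v q"]) simp
qed

lemma forms_part_mono: "x \<in> forms_part r j e \<Longrightarrow> x \<in> forms_part (Suc r) j e"
  unfolding forms_part_Suc using subspace_0[OF C_subspace] by (intro bexI[of _ x] bexI[of _ 0]) auto

lemma \<theta>_forms_part_Suc: "v \<in> C j (e - 1) \<Longrightarrow> \<theta> (Suc r) v \<in> forms_part (Suc r) j e"
  unfolding forms_part_Suc using subspace_0[OF forms_part_subspace]
  by (intro bexI[of _ 0] bexI[of _ v]) auto

lemma forms_part_sub: "x \<in> forms_part r j e \<Longrightarrow> x \<in> C j e"
  unfolding forms_part_def using R_sub
  by (auto intro!: subspace_add[OF C_subspace] subspace_sum[OF C_subspace] \<theta>_C')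

lemma \<theta>_forms_part: "x \<in> forms_part r j e \<Longrightarrow> \<theta> q x \<in> forms_part r j (e + 1)"
proof -
  assume "x \<in> forms_part r j e"
  then obtain x0 v where "x = x0 + (\<Sum>q\<in>{1..r}. \<theta> q (v q))" "x0 \<in> R j e" "\<forall>q. v q \<in> C j (e - 1)"
    by (auto simp: forms_part_def)
  then show "\<theta> q x \<in> forms_part r j (e + 1)"
    unfolding forms_part_def using \<theta>_R \<theta>_C'
    by (intro CollectI exI[of _ "\<theta> q x0"] exI[of _ "\<lambda>p. \<theta> q (v p)"]) (simp add: \<theta>_add \<theta>_sum \<theta>_comm[of q])
qed

lemma d_forms_part: "x \<in> forms_part r j e \<Longrightarrow> d x \<in> forms_part r (j + 1) e"
proof -
  assume "x \<in> forms_part r j e"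
  then obtain x0 v where "x = x0 + (\<Sum>q\<in>{1..r}. \<theta> q (v q))" "x0 \<in> R j e" "\<forall>q. v q \<in> C j (e - 1)"
    by (auto simp: forms_part_def)
  then show "d x \<in> forms_part r (j + 1) e"
    unfolding forms_part_def using d_R d_C
    by (intro CollectI exI[of _ "d x0"] exI[of _ "\<lambda>p. d (v p)"]) (simp add: d_add d_sum d_\<theta>)
qed

lemma cocycles_mod_subspace: "subspace (cocycles_mod r j e)"
  unfolding cocycles_mod_def
  by (rule subspaceI)
    (auto simp: d_add d_scale intro: subspace_0[OF C_subspace] subspace_add[OF C_subspace] subspace_scale[OF C_subspace]
      subspace_0[OF forms_part_subspace] subspace_add[OF forms_part_subspace] subspace_scale[OF forms_part_subspace])

lemma coboundaries_modI: "b \<in> C (j - 1) e \<Longrightarrow> t \<in> forms_part r j e \<Longrightarrow> d b + t \<in> coboundaries_mod r j e"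
  by (auto simp: coboundaries_mod_def)

lemma forms_part_coboundaries: "t \<in> forms_part r j e \<Longrightarrow> t \<in> coboundaries_mod r j e"
  using coboundaries_modI[OF subspace_0[OF C_subspace]] by simp

lemma coboundaries_modE:
  assumes "x \<in> coboundaries_mod r j e"
  obtains b t where "b \<in> C (j - 1) e" "t \<in> forms_part r j e" "x = d b + t"
  using assms by (auto simp: coboundaries_mod_def)

lemma coboundaries_mod_subspace: "subspace (coboundaries_mod r j e)"
proof (rule subspaceI)
  show "0 \<in> coboundaries_mod r j e"
    by (rule forms_part_coboundaries, rule subspace_0[OF forms_part_subspace])
next
  fix x y assume "x \<in> coboundaries_mod r j e" "y \<in> coboundaries_mod r j e"
  then obtain b t b' t' where "b \<in> C (j - 1) e" "t \<in> forms_part r j e" "x = d b + t"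
    "b' \<in> C (j - 1) e" "t' \<in> forms_part r j e" "y = d b' + t'"
    by (metis coboundaries_modE)
  then show "x + y \<in> coboundaries_mod r j e"
    using coboundaries_modI[OF subspace_add[OF C_subspace] subspace_add[OF forms_part_subspace], of b j e b' t r t']
    by (simp add: d_add algebra_simps)
next
  fix c x assume "x \<in> coboundaries_mod r j e"
  then obtain b t where "b \<in> C (j - 1) e" "t \<in> forms_part r j e" "x = d b + t"
    by (metis coboundaries_modE)
  then show "scale c x \<in> coboundaries_mod r j e"
    using coboundaries_modI[OF subspace_scale[OF C_subspace] subspace_scale[OF forms_part_subspace], of b j e t r c c]
    by (simp add: d_scale scale_right_distrib)
qed

lemma coboundaries_sub_cocycles: "coboundaries_mod r j e \<subseteq> cocycles_mod r j e"
proof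
  fix x assume "x \<in> coboundaries_mod r j e"
  then obtain b t where bt: "b \<in> C (j - 1) e" "t \<in> forms_part r j e" "x = d b + t"
    by (metis coboundaries_modE)
  have "d x \<in> forms_part r (j + 1) e"
    unfolding bt(3) d_add d_d[OF bt(1)] using d_forms_part[OF bt(2)] by simp
  moreover have "x \<in> C j e"
    unfolding bt(3) using d_C[OF bt(1)] forms_part_sub[OF bt(2)] by (intro subspace_add[OF C_subspace]) simp_all
  ultimately show "x \<in> cocycles_mod r j e" by (simp add: cocycles_mod_def)
qed

lemma \<theta>_cocycles: "x \<in> cocycles_mod r j e \<Longrightarrow> \<theta> q x \<in> cocycles_mod r j (e + 1)"
  by (auto simp: cocycles_mod_def d_\<theta> \<theta>_C \<theta>_forms_part)

lemma \<theta>_coboundaries: "x \<in> coboundaries_mod r j e \<Longrightarrow> \<theta> q x \<in> coboundaries_mod r j (e + 1)"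
  by (elim coboundaries_modE) (simp add: \<theta>_add coboundaries_modI \<theta>_C \<theta>_forms_part flip: d_\<theta>)

text \<open>\<open>connecting r j e z c\<close> says that the connecting homomorphism sends the class of \<open>z\<close> modulo
  \<open>r + 1\<close> forms to the class of \<open>c\<close> modulo \<open>r\<close> forms.\<close>

definition connecting :: "nat \<Rightarrow> int \<Rightarrow> int \<Rightarrow> 'c \<Rightarrow> 'c \<Rightarrow> bool"
  where "connecting r j e z c \<longleftrightarrow> z \<in> C j e \<and> c \<in> C (j + 1) (e - 1) \<and>
    d z - \<theta> (Suc r) c \<in> forms_part r (j + 1) e"

lemma connecting_add:
  "connecting r j e z c \<Longrightarrow> connecting r j e z' c' \<Longrightarrow> connecting r j e (z + z') (c + c')"
  unfolding connecting_def
  using subspace_add[OF forms_part_subspace, of "d z - \<theta> (Suc r) c" r "j + 1" e "d z' - \<theta> (Suc r) c'"]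
  by (auto simp: d_add \<theta>_add algebra_simps intro: subspace_add[OF C_subspace])

lemma connecting_scale: "connecting r j e z c \<Longrightarrow> connecting r j e (scale a z) (scale a c)"
  unfolding connecting_def
  using subspace_scale[OF forms_part_subspace, of "d z - \<theta> (Suc r) c" r "j + 1" e a]
  by (auto simp: d_scale \<theta>_scale scale_right_diff_distrib intro: subspace_scale[OF C_subspace])

lemma connecting_diff:
  "connecting r j e z c \<Longrightarrow> connecting r j e z' c' \<Longrightarrow> connecting r j e (z - z') (c - c')"
  using connecting_add[of r j e z c "scale (-1) z'" "scale (-1) c'"] connecting_scale[of r j e z' c' "-1"] by simp

lemma connecting_\<theta>: "connecting r j e z c \<Longrightarrow> connecting r j (e + 1) (\<theta> q z) (\<theta> q c)"
  unfolding connecting_def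
  using \<theta>_forms_part[of "d z - \<theta> (Suc r) c" r "j + 1" e q] \<theta>_C[of z j e q] \<theta>_C'[of c "j + 1" e q]
  by (auto simp: d_\<theta> \<theta>_diff \<theta>_comm[of q])

lemma connecting_left:
  "(\<exists>c. connecting r j e z c) \<longleftrightarrow> z \<in> cocycles_mod (Suc r) j e"
proof
  assume "\<exists>c. connecting r j e z c"
  then obtain c where c: "z \<in> C j e" "c \<in> C (j + 1) (e - 1)" "d z - \<theta> (Suc r) c \<in> forms_part r (j + 1) e"
    by (auto simp: connecting_def)
  have "d z = (d z - \<theta> (Suc r) c) + \<theta> (Suc r) c" by simp
  then have "d z \<in> forms_part (Suc r) (j + 1) e"
    unfolding forms_part_Suc using c by blast
  then show "z \<in> cocycles_mod (Suc r) j e" using c by (simp add: cocycles_mod_def)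
next
  assume "z \<in> cocycles_mod (Suc r) j e"
  then obtain y v where "z \<in> C j e" "y \<in> forms_part r (j + 1) e" "v \<in> C (j + 1) (e - 1)" "d z = y + \<theta> (Suc r) v"
    by (auto simp: cocycles_mod_def forms_part_Suc)
  then show "\<exists>c. connecting r j e z c"
    by (auto simp: connecting_def intro!: exI[of _ v])
qed

end

locale regular_cochain_system = cochain_system +
  assumes regular: "e < 0 \<Longrightarrow> r < m \<Longrightarrow> x \<in> C j (e - 1) \<Longrightarrow> \<theta> (Suc r) x \<in> forms_part r j e \<Longrightarrow>
    x \<in> forms_part r j (e - 1)"
begin

text \<open>Applying \<open>d\<close> to \<open>d z - \<theta> (Suc r) c\<close> leaves only
  \<open>- \<theta> (Suc r) (d c)\<close>, and regularity cancels the form. The second claim is the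
  exactness relation that the composite of the connecting map with the form is zero:
  \<open>\<theta> (Suc r) c\<close> is \<open>d z\<close> up to a relation.\<close>

lemma connecting_cocycle:
  assumes "connecting r j e z c" "e < 0" "r < m"
  shows "c \<in> cocycles_mod r (j + 1) (e - 1)" "\<theta> (Suc r) c \<in> coboundaries_mod r (j + 1) e"
proof -
  have c: "z \<in> C j e" "c \<in> C (j + 1) (e - 1)" "d z - \<theta> (Suc r) c \<in> forms_part r (j + 1) e"
    using assms(1) by (auto simp: connecting_def)
  have "- d (d z - \<theta> (Suc r) c) \<in> forms_part r (j + 1 + 1) e"
    by (intro subspace_neg[OF forms_part_subspace] d_forms_part c)
  then have "\<theta> (Suc r) (d c) \<in> forms_part r (j + 1 + 1) e"
    by (simp add: d_diff d_d[OF c(1)] d_\<theta>)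
  then have "d c \<in> forms_part r (j + 1 + 1) (e - 1)"
    using regular[OF assms(2,3)] d_C[OF c(2)] by blast
  then show "c \<in> cocycles_mod r (j + 1) (e - 1)"
    using c by (simp add: cocycles_mod_def)
  have "d z + - (d z - \<theta> (Suc r) c) \<in> coboundaries_mod r (j + 1) e"
    using c by (intro coboundaries_modI subspace_neg[OF forms_part_subspace]) simp_all
  then show "\<theta> (Suc r) c \<in> coboundaries_mod r (j + 1) e" by simp
qed

lemma connecting_right:
  assumes "c \<in> cocycles_mod r (j + 1) (e - 1)" "\<theta> (Suc r) c \<in> coboundaries_mod r (j + 1) e"
  shows "\<exists>z. connecting r j e z c"
proof -
  obtain b t where bt: "b \<in> C (j + 1 - 1) e" "t \<in> forms_part r (j + 1) e" "\<theta> (Suc r) c = d b + t"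
    using assms(2) by (rule coboundaries_modE)
  have "d b - \<theta> (Suc r) c \<in> forms_part r (j + 1) e"
    unfolding bt(3) using subspace_neg[OF forms_part_subspace bt(2)] by simp
  then show ?thesis
    using assms bt by (auto simp: connecting_def cocycles_mod_def intro!: exI[of _ b])
qed

text \<open>From left to right this is well-definedness of the connecting map, by cancelling the
  form once more. From right to left it is injectivity: after subtracting a multiple of the form,
  \<open>z\<close> is a cocycle modulo \<open>r\<close> forms, and \<open>surj\<close> makes it a
  multiple of the form up to a coboundary, hence trivial modulo \<open>r + 1\<close> forms.\<close>

lemma connecting_coboundary:
  assumes con: "connecting r j e z c" and e: "e < 0" and r: "r < m"
    and surj: "\<And>u. u \<in> cocycles_mod r j e \<Longrightarrow> \<exists>w\<in>cocycles_mod r j (e - 1). u - \<theta> (Suc r) w \<in> coboundaries_mod r j e"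
  shows "z \<in> coboundaries_mod (Suc r) j e \<longleftrightarrow> c \<in> coboundaries_mod r (j + 1) (e - 1)"
proof
  have c: "z \<in> C j e" "c \<in> C (j + 1) (e - 1)" "d z - \<theta> (Suc r) c \<in> forms_part r (j + 1) e"
    using con by (auto simp: connecting_def)
  {
    assume "z \<in> coboundaries_mod (Suc r) j e"
    then obtain b s where b: "b \<in> C (j - 1) e" "s \<in> forms_part (Suc r) j e" "z = d b + s"
      by (rule coboundaries_modE)
    then obtain t v where t: "t \<in> forms_part r j e" "v \<in> C j (e - 1)" "s = t + \<theta> (Suc r) v"
      by (auto simp: forms_part_Suc)
    have "d t - (d z - \<theta> (Suc r) c) \<in> forms_part r (j + 1) e"
      by (intro subspace_diff[OF forms_part_subspace] d_forms_part t c)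
    then have "\<theta> (Suc r) (c - d v) \<in> forms_part r (j + 1) e"
      by (simp add: b t d_add d_d[OF b(1)] d_\<theta> \<theta>_diff)
    then have "c - d v \<in> forms_part r (j + 1) (e - 1)"
      using regular[OF e r] d_C[OF t(2)] c(2) subspace_diff[OF C_subspace] by blast
    then have "d v + (c - d v) \<in> coboundaries_mod r (j + 1) (e - 1)"
      using t(2) by (intro coboundaries_modI) simp_all
    then show "c \<in> coboundaries_mod r (j + 1) (e - 1)" by simp
  }
  {
    assume "c \<in> coboundaries_mod r (j + 1) (e - 1)"
    then obtain v t where v: "v \<in> C (j + 1 - 1) (e - 1)" "t \<in> forms_part r (j + 1) (e - 1)" "c = d v + t"
      by (rule coboundaries_modE)
    have v': "v \<in> C j (e - 1)" using v by simp
    have "\<theta> (Suc r) t \<in> forms_part r (j + 1) e"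
      using \<theta>_forms_part[OF v(2)] by simp
    from subspace_add[OF forms_part_subspace c(3) this]
    have "d (z - \<theta> (Suc r) v) \<in> forms_part r (j + 1) e"
      by (simp add: v d_diff \<theta>_add d_\<theta> algebra_simps)
    then have "z - \<theta> (Suc r) v \<in> cocycles_mod r j e"
      using c(1) \<theta>_C'[OF v'] by (simp add: cocycles_mod_def subspace_diff[OF C_subspace])
    then obtain w where w: "w \<in> cocycles_mod r j (e - 1)" "z - \<theta> (Suc r) v - \<theta> (Suc r) w \<in> coboundaries_mod r j e"
      using surj by blast
    then obtain b s where b: "b \<in> C (j - 1) e" "s \<in> forms_part r j e" "z - \<theta> (Suc r) v - \<theta> (Suc r) w = d b + s"
      by (metis coboundaries_modE)
    have wC: "v + w \<in> C j (e - 1)"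
      using v' w(1) by (auto simp: cocycles_mod_def intro: subspace_add[OF C_subspace])
    have "s + \<theta> (Suc r) (v + w) \<in> forms_part (Suc r) j e"
      using b wC by (intro subspace_add[OF forms_part_subspace] forms_part_mono \<theta>_forms_part_Suc)
    then have "d b + (s + \<theta> (Suc r) (v + w)) \<in> coboundaries_mod (Suc r) j e"
      using b by (intro coboundaries_modI)
    moreover have "z = d b + (s + \<theta> (Suc r) (v + w))"
      using b(3) by (simp add: \<theta>_add algebra_simps)
    ultimately show "z \<in> coboundaries_mod (Suc r) j e" by simp
  }
qed

text \<open>The connecting map identifies the cohomology modulo \<open>r + 1\<close> forms with the
  kernel of form \<open>r + 1\<close> on the cohomology modulo \<open>r\<close> forms, one step up.
  The common kernel of the forms \<open>r + 2\<close> to \<open>s\<close> on the former is therefore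
  the common kernel of the forms \<open>r + 1\<close> to \<open>s\<close> on the latter. There the
  form \<open>s + 1\<close> is surjective by assumption, and the preimage is carried back.\<close>

lemma coregular_step:
  assumes r: "r < m" and co: "\<And>j. coregular_mod r m (cocycles_mod r j) (coboundaries_mod r j)"
  shows "coregular_mod (Suc r) m (cocycles_mod (Suc r) j) (coboundaries_mod (Suc r) j)"
proof (rule coregular_modI)
  fix s assume s: "Suc r \<le> s" "s < m"
  obtain e0 where e0: "\<And>e u. e < e0 \<Longrightarrow> u \<in> cocycles_mod r j e \<Longrightarrow>
      (\<And>q. q \<in> {r<..r} \<Longrightarrow> \<theta> q u \<in> coboundaries_mod r j (e + 1)) \<Longrightarrow>
    \<exists>w\<in>cocycles_mod r j (e - 1). (\<forall>q\<in>{r<..r}. \<theta> q w \<in> coboundaries_mod r j e) \<and>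
      u - \<theta> (Suc r) w \<in> coboundaries_mod r j e"
    by (rule coregular_modD[OF co[of j] order_refl r]) blast
  obtain e1 where e1: "\<And>e u. e < e1 \<Longrightarrow> u \<in> cocycles_mod r (j + 1) e \<Longrightarrow>
      (\<And>q. q \<in> {r<..s} \<Longrightarrow> \<theta> q u \<in> coboundaries_mod r (j + 1) (e + 1)) \<Longrightarrow>
    \<exists>w\<in>cocycles_mod r (j + 1) (e - 1). (\<forall>q\<in>{r<..s}. \<theta> q w \<in> coboundaries_mod r (j + 1) e) \<and>
      u - \<theta> (Suc s) w \<in> coboundaries_mod r (j + 1) e"
    by (rule coregular_modD[OF co[of "j + 1"] Suc_leD[OF s(1)] s(2)]) blast
  show "\<exists>e0. \<forall>e<e0. \<forall>u\<in>cocycles_mod (Suc r) j e.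
    (\<forall>q\<in>{Suc r<..s}. \<theta> q u \<in> coboundaries_mod (Suc r) j (e + 1)) \<longrightarrow>
    (\<exists>w\<in>cocycles_mod (Suc r) j (e - 1). (\<forall>q\<in>{Suc r<..s}. \<theta> q w \<in> coboundaries_mod (Suc r) j e) \<and>
      u - \<theta> (Suc s) w \<in> coboundaries_mod (Suc r) j e)"
  \<comment> \<open>The products \<open>\<theta> q u\<close> have degree \<open>e + 1\<close>, and
    injectivity of the connecting map is used for them as well; the slack of 2 covers this.\<close>
  proof (intro exI[of _ "min (min 0 e0) e1 - 2"] allI impI ballI)
    fix e u assume "e < min (min 0 e0) e1 - 2" and u: "u \<in> cocycles_mod (Suc r) j e"
      and uB: "\<forall>q\<in>{Suc r<..s}. \<theta> q u \<in> coboundaries_mod (Suc r) j (e + 1)"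
    then have e: "e + 1 < 0" "e + 1 < e0" "e - 1 < e1" by simp_all
    have iff: "z \<in> coboundaries_mod (Suc r) j e' \<longleftrightarrow> c \<in> coboundaries_mod r (j + 1) (e' - 1)"
      if "connecting r j e' z c" "e' \<le> e + 1" for z c e'
    proof (rule connecting_coboundary[OF that(1) _ r])
      show "e' < 0" using e that by simp
      fix u assume "u \<in> cocycles_mod r j e'"
      moreover have "e' < e0" using e that by simp
      ultimately show "\<exists>w\<in>cocycles_mod r j (e' - 1). u - \<theta> (Suc r) w \<in> coboundaries_mod r j e'"
        using e0[of e' u] by auto
    qed
    obtain c where c: "connecting r j e u c"
      using u connecting_left by blast
    have cZ: "c \<in> cocycles_mod r (j + 1) (e - 1)" "\<theta> (Suc r) c \<in> coboundaries_mod r (j + 1) e"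
      using connecting_cocycle[OF c _ r] e by auto
    have "\<theta> q c \<in> coboundaries_mod r (j + 1) (e - 1 + 1)" if q: "q \<in> {r<..s}" for q
    proof (cases "q = Suc r")
      case False
      then have "\<theta> q u \<in> coboundaries_mod (Suc r) j (e + 1)" using uB q by auto
      then show ?thesis using iff[OF connecting_\<theta>[OF c, of q]] by simp
    qed (use cZ in simp)
    then obtain w' where w': "w' \<in> cocycles_mod r (j + 1) (e - 1 - 1)"
      "\<And>q. q \<in> {r<..s} \<Longrightarrow> \<theta> q w' \<in> coboundaries_mod r (j + 1) (e - 1)"
      "c - \<theta> (Suc s) w' \<in> coboundaries_mod r (j + 1) (e - 1)"
      using e1[OF e(3) cZ(1)] by blast
    have "\<theta> (Suc r) w' \<in> coboundaries_mod r (j + 1) (e - 1)"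
      using w'(2) s by auto
    then obtain w where w: "connecting r j (e - 1) w w'"
      using connecting_right[OF w'(1)] by blast
    have con: "connecting r j e (\<theta> q w) (\<theta> q w')" for q
      using connecting_\<theta>[OF w] by simp
    show "\<exists>w\<in>cocycles_mod (Suc r) j (e - 1). (\<forall>q\<in>{Suc r<..s}. \<theta> q w \<in> coboundaries_mod (Suc r) j e) \<and>
      u - \<theta> (Suc s) w \<in> coboundaries_mod (Suc r) j e"
    proof (intro bexI[of _ w] conjI ballI)
      show "w \<in> cocycles_mod (Suc r) j (e - 1)" using w connecting_left by blast
      show "\<theta> q w \<in> coboundaries_mod (Suc r) j e" if "q \<in> {Suc r<..s}" for q
        using iff[OF con[of q]] w'(2)[of q] that by simp
      show "u - \<theta> (Suc s) w \<in> coboundaries_mod (Suc r) j e"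
        using iff[OF connecting_diff[OF c con[of "Suc s"]]] w'(3) by simp
    qed
  qed
qed

text \<open>The next form maps the cohomology in degree \<open>e - 1\<close> onto the one in degree
  \<open>e\<close>, so its kernel \<open>K\<close> has dimension \<open>D (e - 1) - D e\<close>. The
  connecting map is an isomorphism from the cohomology modulo one more form, one step lower, to
  \<open>K\<close>.\<close>

lemma dim_step:
  assumes r: "r < m" and co: "coregular_mod r m (cocycles_mod r j) (coboundaries_mod r j)"
      "coregular_mod r m (cocycles_mod r (j + 1)) (coboundaries_mod r (j + 1))"
    and dim: "\<forall>e<e2. subquot_dim scale (cocycles_mod r (j + 1) e) (coboundaries_mod r (j + 1) e) (D e)"
  shows "\<exists>e0. \<forall>e<e0. subquot_dim scale (cocycles_mod (Suc r) j e) (coboundaries_mod (Suc r) j e) (D (e - 1) - D e)"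
proof -
  obtain e0 where e0: "\<And>e u. e < e0 \<Longrightarrow> u \<in> cocycles_mod r j e \<Longrightarrow>
      (\<And>q. q \<in> {r<..r} \<Longrightarrow> \<theta> q u \<in> coboundaries_mod r j (e + 1)) \<Longrightarrow>
    \<exists>w\<in>cocycles_mod r j (e - 1). (\<forall>q\<in>{r<..r}. \<theta> q w \<in> coboundaries_mod r j e) \<and>
      u - \<theta> (Suc r) w \<in> coboundaries_mod r j e"
    by (rule coregular_modD[OF co(1) order_refl r]) blast
  obtain e1 where e1: "\<And>e u. e < e1 \<Longrightarrow> u \<in> cocycles_mod r (j + 1) e \<Longrightarrow>
      (\<And>q. q \<in> {r<..r} \<Longrightarrow> \<theta> q u \<in> coboundaries_mod r (j + 1) (e + 1)) \<Longrightarrow>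
    \<exists>w\<in>cocycles_mod r (j + 1) (e - 1). (\<forall>q\<in>{r<..r}. \<theta> q w \<in> coboundaries_mod r (j + 1) e) \<and>
      u - \<theta> (Suc r) w \<in> coboundaries_mod r (j + 1) e"
    by (rule coregular_modD[OF co(2) order_refl r]) blast
  show ?thesis
  proof (intro exI[of _ "min (min 0 e0) (min e1 e2)"] allI impI)
    fix e assume e: "e < min (min 0 e0) (min e1 e2)"
    let ?Z = "cocycles_mod r (j + 1) (e - 1)" and ?B = "coboundaries_mod r (j + 1) (e - 1)"
    define K where "K = {c \<in> ?Z. \<theta> (Suc r) c \<in> coboundaries_mod r (j + 1) e}"
    have K: "subspace K"
      unfolding K_def
      by (rule subspaceI) (auto simp: \<theta>_add \<theta>_scale intro: subspace_0[OF cocycles_mod_subspace]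
        subspace_add[OF cocycles_mod_subspace] subspace_scale[OF cocycles_mod_subspace]
        subspace_0[OF coboundaries_mod_subspace] subspace_add[OF coboundaries_mod_subspace]
        subspace_scale[OF coboundaries_mod_subspace])
    have BK: "?B \<subseteq> K"
      using coboundaries_sub_cocycles \<theta>_coboundaries[of _ r "j + 1" "e - 1" "Suc r"] by (auto simp: K_def)
    \<comment> \<open>The form is used as a relation in the reverse direction: an element is related
      to all its preimages up to coboundaries. Coregularity makes this total, and the preimages of
      zero make up \<open>K\<close>.\<close>
    have ZK: "subquot_dim scale ?Z K (D e)"
    proof (rule subquot_dim_transport[where r = "\<lambda>x y. y \<in> ?Z \<and> x - \<theta> (Suc r) y \<in> coboundaries_mod r (j + 1) e"])
      show "subquot_dim scale (cocycles_mod r (j + 1) e) (coboundaries_mod r (j + 1) e) (D e)"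
        using dim e by simp
    next
      fix u v u' v'
      assume "u' \<in> ?Z \<and> u - \<theta> (Suc r) u' \<in> coboundaries_mod r (j + 1) e"
        and "v' \<in> ?Z \<and> v - \<theta> (Suc r) v' \<in> coboundaries_mod r (j + 1) e"
      then show "u' + v' \<in> ?Z \<and> u + v - \<theta> (Suc r) (u' + v') \<in> coboundaries_mod r (j + 1) e"
        using subspace_add[OF coboundaries_mod_subspace, of "u - \<theta> (Suc r) u'" r "j + 1" e "v - \<theta> (Suc r) v'"]
        by (auto simp: \<theta>_add algebra_simps intro: subspace_add[OF cocycles_mod_subspace])
    next
      fix c v v' assume "v' \<in> ?Z \<and> v - \<theta> (Suc r) v' \<in> coboundaries_mod r (j + 1) e"
      then show "scale c v' \<in> ?Z \<and> scale c v - \<theta> (Suc r) (scale c v') \<in> coboundaries_mod r (j + 1) e"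
        using subspace_scale[OF coboundaries_mod_subspace, of "v - \<theta> (Suc r) v'" r "j + 1" e c]
        by (auto simp: \<theta>_scale scale_right_diff_distrib intro: subspace_scale[OF cocycles_mod_subspace])
    next
      fix v assume "v \<in> cocycles_mod r (j + 1) e"
      then show "\<exists>v'\<in>?Z. v' \<in> ?Z \<and> v - \<theta> (Suc r) v' \<in> coboundaries_mod r (j + 1) e"
        using e1[of e v] e by auto
    next
      fix v' assume "v' \<in> ?Z"
      then show "\<exists>v\<in>cocycles_mod r (j + 1) e. v' \<in> ?Z \<and> v - \<theta> (Suc r) v' \<in> coboundaries_mod r (j + 1) e"
        using \<theta>_cocycles[of v' r "j + 1" "e - 1" "Suc r"] subspace_0[OF coboundaries_mod_subspace]
        by (intro bexI[of _ "\<theta> (Suc r) v'"]) simp_all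
    next
      fix v v' assume *: "v' \<in> ?Z \<and> v - \<theta> (Suc r) v' \<in> coboundaries_mod r (j + 1) e"
      then show "v \<in> coboundaries_mod r (j + 1) e \<longleftrightarrow> v' \<in> K"
        using subspace_diff[OF coboundaries_mod_subspace, of v r "j + 1" e "v - \<theta> (Suc r) v'"]
          subspace_add[OF coboundaries_mod_subspace, of "v - \<theta> (Suc r) v'" r "j + 1" e "\<theta> (Suc r) v'"]
        by (auto simp: K_def)
    qed (use K cocycles_mod_subspace vector_space_axioms in \<open>auto simp: K_def\<close>)
    have "subquot_dim scale ?Z ?B (D (e - 1))"
      using dim e by simp
    then have KB: "subquot_dim scale K ?B (D (e - 1) - D e)"
      using subquot_dim_kernel[OF _ ZK BK] by blast
    show "subquot_dim scale (cocycles_mod (Suc r) j e) (coboundaries_mod (Suc r) j e) (D (e - 1) - D e)"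
    proof (rule subquot_dim_transport[OF vector_space_axioms vector_space_axioms KB cocycles_mod_subspace
          coboundaries_mod_subspace coboundaries_sub_cocycles, where r = "\<lambda>c z. connecting r j e z c"])
      show "\<exists>z\<in>cocycles_mod (Suc r) j e. connecting r j e z c" if "c \<in> K" for c
        using connecting_right[of c r j e] connecting_left[of r j e] that unfolding K_def by blast
      show "\<exists>c\<in>K. connecting r j e z c" if z: "z \<in> cocycles_mod (Suc r) j e" for z
      proof -
        obtain c where c: "connecting r j e z c" using z connecting_left by blast
        have "c \<in> K" using connecting_cocycle[OF c _ r] e by (simp add: K_def)
        then show ?thesis using c by blast
      qed
      show "c \<in> ?B \<longleftrightarrow> z \<in> coboundaries_mod (Suc r) j e" if "connecting r j e z c" for c z
      proof (rule connecting_coboundary[OF that _ r, symmetric])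
        show "e < 0" using e by simp
        show "\<exists>w\<in>cocycles_mod r j (e - 1). u - \<theta> (Suc r) w \<in> coboundaries_mod r j e"
          if "u \<in> cocycles_mod r j e" for u
          using e0[of e u] e that by auto
      qed
    qed (auto intro: connecting_add connecting_scale)
  qed
qed

fun iterated_dim :: "(int \<Rightarrow> int \<Rightarrow> nat) \<Rightarrow> nat \<Rightarrow> int \<Rightarrow> int \<Rightarrow> nat"
  where "iterated_dim D 0 j e = D j e"
  | "iterated_dim D (Suc r) j e = iterated_dim D r (j + 1) (e - 1) - iterated_dim D r (j + 1) e"

theorem dim_mod_forms:
  assumes co: "\<And>j. coregular_mod 0 m (cocycles_mod 0 j) (coboundaries_mod 0 j)"
    and dim: "\<And>j. \<exists>e0. \<forall>e<e0. subquot_dim scale (cocycles_mod 0 j e) (coboundaries_mod 0 j e) (D j e)"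
  shows "r \<le> m \<Longrightarrow> (\<forall>j. coregular_mod r m (cocycles_mod r j) (coboundaries_mod r j)) \<and>
    (\<forall>j. \<exists>e0. \<forall>e<e0. subquot_dim scale (cocycles_mod r j e) (coboundaries_mod r j e) (iterated_dim D r j e))"
proof (induction r)
  case (Suc r)
  then have r: "r < m" and co: "\<And>j. coregular_mod r m (cocycles_mod r j) (coboundaries_mod r j)"
    and dim: "\<And>j. \<exists>e0. \<forall>e<e0. subquot_dim scale (cocycles_mod r j e) (coboundaries_mod r j e) (iterated_dim D r j e)"
    by auto
  show ?case
  proof (intro conjI allI)
    fix j
    show "coregular_mod (Suc r) m (cocycles_mod (Suc r) j) (coboundaries_mod (Suc r) j)"
      by (rule coregular_step[OF r co])
    obtain e2 where e2: "\<forall>e<e2. subquot_dim scale (cocycles_mod r (j + 1) e) (coboundaries_mod r (j + 1) e) (iterated_dim D r (j + 1) e)"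
      using dim by blast
    show "\<exists>e0. \<forall>e<e0. subquot_dim scale (cocycles_mod (Suc r) j e) (coboundaries_mod (Suc r) j e) (iterated_dim D (Suc r) j e)"
      using dim_step[OF r co co e2] by simp
  qed
qed (use co dim in simp)

end

text \<open>\<open>\<pi>\<close> chooses representatives modulo \<open>W\<close> linearly and sends
  all of \<open>W\<close> to zero. It takes the place of the quotient map and turns congruences
  modulo \<open>W\<close> into equations without leaving the space.\<close>

lemma (in vector_space) exists_projection_along:
  assumes "subspace W"
  shows "\<exists>\<pi>. Vector_Spaces.linear scale scale \<pi> \<and> (\<forall>w\<in>W. \<pi> w = 0) \<and> (\<forall>c. c - \<pi> c \<in> W)"
proof -
  interpret P: vector_space_pair scale scale ..
  have "Vector_Spaces.linear scale scale (\<lambda>x. x)"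
    by (rule linear_ident)
  then obtain g where g: "range g \<subseteq> W" "Vector_Spaces.linear scale scale g" "\<And>w. w \<in> W \<Longrightarrow> g w = w"
    using P.linear_exists_left_inverse_on[of "\<lambda>x. x" W] assms by auto
  have "Vector_Spaces.linear scale scale (\<lambda>c. c - g c)"
    using g(2) by (simp add: Vector_Spaces.linear_iff algebra_simps scale_right_diff_distrib)
  then show ?thesis
    using g by (intro exI[of _ "\<lambda>c. c - g c"]) auto
qed

section \<open>Laurent polynomials as functions on exponent vectors\<close>

definition unit_exp :: "'n \<Rightarrow> 'n \<Rightarrow> int"
  where "unit_exp t = (\<lambda>s. if s = t then 1 else 0)"

lemma unit_exp_apply: "unit_exp t s = (if s = t then 1 else 0)"
  by (simp add: unit_exp_def)

definition pos :: "('n \<Rightarrow> int) \<Rightarrow> 'n set"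
  where "pos x = {t. 0 < x t}"

definition neg :: "('n \<Rightarrow> int) \<Rightarrow> 'n set"
  where "neg x = {t. x t < 0}"

text \<open>Multiplication of Laurent polynomials by the \<open>q\<close>-th form with only the variables in \<open>G\<close> retained.\<close>

definition form_op :: "('n::finite \<times> nat \<Rightarrow> 'k::field) \<Rightarrow> 'n set \<Rightarrow> nat \<Rightarrow> (('n \<Rightarrow> int) \<Rightarrow> 'k) \<Rightarrow> ('n \<Rightarrow> int) \<Rightarrow> 'k"
  where "form_op a G q f x = (\<Sum>t\<in>G. a (t, q) * f (x - unit_exp t))"

definition to_exp :: "('n::finite \<Rightarrow> int) \<Rightarrow> ('n \<Rightarrow>\<^sub>0 nat)"
  where "to_exp x = Abs_poly_mapping (\<lambda>t. nat (x t))"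

lemma lookup_to_exp [simp]: "Poly_Mapping.lookup (to_exp x) t = nat (x t)"
  by (simp add: to_exp_def)

text \<open>Polynomials become functions on integer vectors, where multiplication by a variable is a
  translation. The same type then holds Laurent polynomials, and clearing a monomial denominator is
  a translation too.\<close>

definition coeff_fun :: "('n::finite, 'k::field) mpoly \<Rightarrow> ('n \<Rightarrow> int) \<Rightarrow> 'k"
  where "coeff_fun p x = (if \<forall>t. 0 \<le> x t then Poly_Mapping.lookup p (to_exp x) else 0)"

lemma coeff_fun_add: "coeff_fun (p + q) x = coeff_fun p x + coeff_fun q x"
  and coeff_fun_0 [simp]: "coeff_fun 0 x = 0"
  and coeff_fun_Const_mult: "coeff_fun (Const c * p) x = c * coeff_fun p x"
  by (simp_all add: coeff_fun_def lookup_add lookup_Const_mult)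

lemma coeff_fun_sum: "coeff_fun (\<Sum>i\<in>I. p i) x = (\<Sum>i\<in>I. coeff_fun (p i) x)"
  by (induction I rule: infinite_finite_induct) (simp_all add: coeff_fun_add)

lemma to_exp_int: "to_exp (\<lambda>t. int (Poly_Mapping.lookup k t)) = k"
  by (rule poly_mapping_eqI) simp

lemma coeff_fun_inject:
  assumes "coeff_fun p = coeff_fun q"
  shows "p = q"
proof (rule poly_mapping_eqI)
  fix k
  show "Poly_Mapping.lookup p k = Poly_Mapping.lookup q k"
    using fun_cong[OF assms, of "\<lambda>t. int (Poly_Mapping.lookup k t)"] by (simp add: coeff_fun_def to_exp_int)
qed

lemma Var_mult_eq_sum:
  "Var s * p = (\<Sum>k\<in>Poly_Mapping.keys p. Poly_Mapping.single (Poly_Mapping.single s 1 + k) (Poly_Mapping.lookup p k))"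
proof -
  have "Var s * p = Var s * (\<Sum>k\<in>Poly_Mapping.keys p. Poly_Mapping.single k (Poly_Mapping.lookup p k))"
    by (simp only: poly_mapping_sum_single)
  then show ?thesis
    by (simp add: Var_def sum_distrib_left mult_single)
qed

lemma lookup_Var_mult_add: "Poly_Mapping.lookup (Var s * p) (Poly_Mapping.single s 1 + k) = Poly_Mapping.lookup p k"
by (auto simp: Var_mult_eq_sum lookup_sum lookup_single when_def in_keys_iff)

lemma lookup_Var_mult_0:
  assumes "Poly_Mapping.lookup q s = 0"
  shows "Poly_Mapping.lookup (Var s * p) q = 0"
proof -
  have "Poly_Mapping.single s 1 + k \<noteq> q" for k
    using assms by (auto simp: lookup_add)
  then show ?thesis
    unfolding Var_mult_eq_sum by (simp add: lookup_sum lookup_single when_def)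
qed

lemma coeff_fun_Var_mult: "coeff_fun (Var s * p) x = coeff_fun p (x - unit_exp s)"
proof (cases "(\<forall>t. 0 \<le> x t) \<and> 1 \<le> x s")
  case True
  have "to_exp x = Poly_Mapping.single s 1 + to_exp (x - unit_exp s)"
    using True by (intro poly_mapping_eqI) (auto simp: lookup_add lookup_single unit_exp_def when_def nat_diff_distrib)
  moreover have "\<forall>t. 0 \<le> (x - unit_exp s) t"
    using True by (auto simp: unit_exp_def)
  ultimately show ?thesis
    using True lookup_Var_mult_add[of s p "to_exp (x - unit_exp s)"] by (simp add: coeff_fun_def)
next
  case False
  have "\<not> (\<forall>t. 0 \<le> (x - unit_exp s) t)"
  proof
    assume *: "\<forall>t. 0 \<le> (x - unit_exp s) t"
    have "0 \<le> x t" for t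
      using spec[OF *, of t] by (auto simp: unit_exp_def split: if_splits)
    moreover have "1 \<le> x s"
      using spec[OF *, of s] by (simp add: unit_exp_def)
    ultimately show False using False by blast
  qed
  moreover have "Poly_Mapping.lookup (Var s * p) (to_exp x) = 0" if "\<forall>t. 0 \<le> x t"
    using False that by (intro lookup_Var_mult_0) auto
  ultimately show ?thesis
    by (simp only: coeff_fun_def if_False) simp
qed

lemma coeff_fun_restr_form: "coeff_fun (restr_form a G q * p) x = form_op a G q (coeff_fun p) x"
proof -
  have "restr_form a G q * p = (\<Sum>t\<in>UNIV. Const (if t \<in> G then a (t, q) else 0) * (Var t * p))"
    by (simp add: restr_form_def lin_def sum_distrib_right mult.assoc)
  then have "coeff_fun (restr_form a G q * p) x = (\<Sum>t\<in>UNIV. if t \<in> G then a (t, q) * coeff_fun p (x - unit_exp t) else 0)"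
    by (simp only: coeff_fun_sum coeff_fun_Const_mult coeff_fun_Var_mult) (intro sum.cong, auto)
  then show ?thesis
    by (simp add: form_op_def sum.If_cases)
qed

lemma coeff_fun_finite: "finite {x. coeff_fun p x \<noteq> 0}"
proof (rule finite_subset)
  show "{x. coeff_fun p x \<noteq> 0} \<subseteq> (\<lambda>k t. int (Poly_Mapping.lookup k t)) ` Poly_Mapping.keys p"
  proof
    fix x assume "x \<in> {x. coeff_fun p x \<noteq> 0}"
    then have x: "\<forall>t. 0 \<le> x t" "to_exp x \<in> Poly_Mapping.keys p"
      by (auto simp: coeff_fun_def in_keys_iff split: if_splits)
    then show "x \<in> (\<lambda>k t. int (Poly_Mapping.lookup k t)) ` Poly_Mapping.keys p"
      by (intro image_eqI[of _ _ "to_exp x"]) auto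
  qed
qed simp

lemma coeff_fun_nonneg: "coeff_fun p x \<noteq> 0 \<Longrightarrow> 0 \<le> x t"
  by (auto simp: coeff_fun_def split: if_splits)

lemma coeff_fun_surj:
  assumes "finite {x. f x \<noteq> 0}" "\<And>x t. f x \<noteq> 0 \<Longrightarrow> 0 \<le> x t"
  obtains p where "coeff_fun p = f"
proof
  let ?i = "\<lambda>(k :: 'a \<Rightarrow>\<^sub>0 nat) t. int (Poly_Mapping.lookup k t)"
  have inj: "inj ?i"
    by (rule injI) (auto intro!: poly_mapping_eqI dest: fun_cong)
  have fin: "finite {k. f (?i k) \<noteq> 0}"
    using finite_vimageI[OF assms(1) inj] by (simp add: vimage_def)
  show "coeff_fun (Abs_poly_mapping (\<lambda>k. f (?i k))) = f"
  using assms fin by (fastforce simp: coeff_fun_def Abs_poly_mapping_inverse)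
qed

lemma form_op_shift: "form_op a G q (\<lambda>x. f (x - b)) x = form_op a G q f (x - b)"
  unfolding form_op_def by (simp add: diff_diff_eq add.commute)

text \<open>All variables in \<open>A\<close> are invertible on the functions considered here, so that only finitely
  many denominators have to be cleared.\<close>

lemma form_ops_regular:
  fixes a :: "'n::{finite, linorder} \<times> nat \<Rightarrow> 'k::field"
  assumes gp: "general_position m a" and p: "p < m" and A: "A \<subseteq> G" "t \<in> A"
    and f: "finite {x. f x \<noteq> 0}" "\<And>x. f x \<noteq> 0 \<Longrightarrow> neg x \<subseteq> A"
    and g: "\<And>q. finite {x. g q x \<noteq> 0}" "\<And>q x. g q x \<noteq> 0 \<Longrightarrow> neg x \<subseteq> A"
    and eq: "\<And>x. form_op a G (Suc p) f x = (\<Sum>q\<in>{1..p}. form_op a G q (g q) x)"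
  shows "\<exists>h. (\<forall>q. finite {x. h q x \<noteq> 0}) \<and> (\<forall>q x. h q x \<noteq> 0 \<longrightarrow> neg x \<subseteq> A) \<and>
    (\<forall>x. f x = (\<Sum>q\<in>{1..p}. form_op a G q (h q) x))"
proof -
  define D where "D = {x. f x \<noteq> 0} \<union> (\<Union>q\<in>{1..p}. {x. g q x \<noteq> 0})"
  have D: "finite D" using f g by (simp add: D_def)
  define N where "N = (\<Sum>x\<in>D. \<Sum>t\<in>UNIV. \<bar>x t\<bar>)"
  have N: "\<bar>x t\<bar> \<le> N" if "x \<in> D" for x t
  proof -
    have "\<bar>x t\<bar> \<le> (\<Sum>t\<in>UNIV. \<bar>x t\<bar>)" by (rule member_le_sum) auto
    also have "\<dots> \<le> N" unfolding N_def using D that by (intro member_le_sum) (auto intro: sum_nonneg)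
    finally show ?thesis .
  qed
  \<comment> \<open>\<open>N\<close> bounds the absolute value of every entry of every exponent that
    occurs. Translation by \<open>b\<close>, which is multiplication by the \<open>N\<close>-th
    power of the product of the variables in \<open>A\<close>, therefore clears all
    denominators.\<close>
  define b where "b = (\<lambda>s. if s \<in> A then N else 0)"
  have ex: "\<exists>F. coeff_fun F = (\<lambda>x. f' (x - b))"
    if f': "finite {x. f' x \<noteq> 0}" "\<And>x. f' x \<noteq> 0 \<Longrightarrow> neg x \<subseteq> A" "{x. f' x \<noteq> 0} \<subseteq> D" for f'
  proof -
    have "finite {x. f' (x - b) \<noteq> 0}"
      using finite_vimageI[OF f'(1), of "\<lambda>x. x - b"] by (simp add: vimage_def inj_def)
    moreover have "0 \<le> x s" if "f' (x - b) \<noteq> 0" for x s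
    proof -
      have *: "x - b \<in> D" "neg (x - b) \<subseteq> A" using f' that by auto
      show ?thesis
      proof (cases "s \<in> A")
        case True
        then show ?thesis using N[OF *(1), of s] by (simp add: b_def)
      next
        case False
        then have "s \<notin> neg (x - b)" using *(2) by blast
        then show ?thesis using False by (simp add: neg_def b_def)
      qed
    qed
    ultimately show ?thesis using coeff_fun_surj by metis
  qed
  obtain F where F: "coeff_fun F = (\<lambda>x. f (x - b))"
    using ex[OF f] by (auto simp: D_def)
  have "\<forall>q\<in>{1..p}. \<exists>H. coeff_fun H = (\<lambda>x. g q (x - b))"
    using g by (intro ballI ex) (auto simp: D_def)
  then obtain H where H: "\<And>q. q \<in> {1..p} \<Longrightarrow> coeff_fun (H q) = (\<lambda>x. g q (x - b))"
    by (meson bchoice)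
  have "restr_form a G (Suc p) * F = (\<Sum>q\<in>{1..p}. restr_form a G q * H q)"
  proof (rule coeff_fun_inject, rule ext)
    fix x
    have "coeff_fun (restr_form a G (Suc p) * F) x = form_op a G (Suc p) f (x - b)"
      by (simp add: coeff_fun_restr_form F form_op_shift)
    also have "\<dots> = (\<Sum>q\<in>{1..p}. form_op a G q (coeff_fun (H q)) x)"
      unfolding eq by (intro sum.cong refl) (simp only: H form_op_shift)
    finally show "coeff_fun (restr_form a G (Suc p) * F) x = coeff_fun (\<Sum>q\<in>{1..p}. restr_form a G q * H q) x"
      by (simp add: coeff_fun_sum coeff_fun_restr_form)
  qed
  then obtain h where h: "Var t * F = (\<Sum>q\<in>{1..p}. restr_form a G q * h q)"
    using restr_forms_regular[OF gp p, of t G F H] A by auto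
  \<comment> \<open>Translating back removes the common denominator and also the factor
    \<open>Var t\<close> that \<open>restr_forms_regular\<close> introduced; the division by
    \<open>Var t\<close> is legitimate because \<open>t\<close> lies in \<open>A\<close>.\<close>
  define c where "c = - (b + unit_exp t)"
  have fh: "f x = (\<Sum>q\<in>{1..p}. form_op a G q (\<lambda>x. coeff_fun (h q) (x - c)) x)" for x
  proof -
    have "f x = coeff_fun (Var t * F) (x - c)"
      by (simp add: coeff_fun_Var_mult F c_def)
    also have "\<dots> = (\<Sum>q\<in>{1..p}. form_op a G q (coeff_fun (h q)) (x - c))"
      unfolding h by (simp add: coeff_fun_sum coeff_fun_restr_form)
    finally show ?thesis by (simp only: form_op_shift)
  qed
  have fin: "finite {x. coeff_fun (h q) (x - c) \<noteq> 0}" for q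
    using finite_vimageI[OF coeff_fun_finite, of "\<lambda>x. x - c" "h q"] by (simp add: vimage_def inj_def)
  have "neg x \<subseteq> A" if "coeff_fun (h q) (x - c) \<noteq> 0" for q x
  proof
    fix s assume "s \<in> neg x"
    then show "s \<in> A"
      using coeff_fun_nonneg[OF that, of s] A(2) by (auto simp: neg_def c_def b_def unit_exp_def split: if_splits)
  qed
  then show ?thesis
    using fh fin by (intro exI[of _ "\<lambda>q x. coeff_fun (h q) (x - c)"]) auto
qed

section \<open>A combinatorial model of localizations, and regularity on it\<close>

section \<open>Squarefree systems\<close>

lemma fscale_linear_sum:
  assumes "Vector_Spaces.linear fscale fscale \<pi>"
  shows "\<pi> (\<Sum>i\<in>I. fscale (c i) (v i)) = (\<Sum>i\<in>I. fscale (c i) (\<pi> (v i)))"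
proof -
  interpret \<pi>: Vector_Spaces.linear fscale fscale \<pi> by fact
  show ?thesis by (simp add: \<pi>.sum \<pi>.scale)
qed

lemma vector_space_fscale: "vector_space fscale"
  by unfold_locales (auto simp: fun_eq_iff algebra_simps)

text \<open>A squarefree module is presented by a system of spaces \<open>coeffs G / Rel G\<close>, one for each set \<open>G\<close> of
  variables, in such a way that all structure maps are induced by inclusions. The component of degree
  \<open>x\<close> of its localization at the variables in \<open>A\<close> is \<open>coeffs (A \<union> pos x) / Rel (A \<union> pos x)\<close> if the
  negative entries of \<open>x\<close> are at places in \<open>A\<close>, and zero otherwise.\<close>

locale squarefree_system =
  fixes gens :: "'n::{finite, linorder} set \<Rightarrow> 'g set"
    and Rel :: "'n set \<Rightarrow> ('g \<Rightarrow> 'k::field) set"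
  assumes gens_mono: "A \<subseteq> B \<Longrightarrow> gens A \<subseteq> gens B"
    and finite_gens: "finite (gens UNIV)"
    and Rel_subspace: "module.subspace fscale (Rel A)"
    and Rel_mono: "A \<subseteq> B \<Longrightarrow> Rel A \<subseteq> Rel B"
    and Rel_gens: "c \<in> Rel A \<Longrightarrow> c g \<noteq> 0 \<Longrightarrow> g \<in> gens A"
begin

sublocale fun_vs: vector_space fscale
  by (rule vector_space_fscale)

definition coeffs :: "'n set \<Rightarrow> ('g \<Rightarrow> 'k) set"
  where "coeffs A = {c. \<forall>g. c g \<noteq> 0 \<longrightarrow> g \<in> gens A}"

lemma coeffs_subspace: "fun_vs.subspace (coeffs A)"
  by (rule fun_vs.subspaceI) (auto simp: coeffs_def, metis add_cancel_left_left)

lemma coeffs_zero: "c \<in> coeffs A \<Longrightarrow> g \<notin> gens A \<Longrightarrow> c g = 0"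
  by (auto simp: coeffs_def)

lemma coeffs_mono: "A \<subseteq> B \<Longrightarrow> coeffs A \<subseteq> coeffs B"
  using gens_mono[of A B] by (auto simp: coeffs_def)

lemma Rel_coeffs: "Rel A \<subseteq> coeffs A"
  using Rel_gens by (auto simp: coeffs_def)

text \<open>The localization at the variables in \<open>A\<close> of the free module on the
  generators. Together with \<open>Loc_Rel A\<close> as the submodule of relations it models the
  localization of the presented module.\<close>

definition Loc :: "'n set \<Rightarrow> (('n \<Rightarrow> int) \<Rightarrow> 'g \<Rightarrow> 'k) set"
  where "Loc A = {u. finite {x. u x \<noteq> 0} \<and> (\<forall>x. u x \<in> coeffs (A \<union> pos x)) \<and> (\<forall>x. u x \<noteq> 0 \<longrightarrow> neg x \<subseteq> A)}"

definition Loc_Rel :: "'n set \<Rightarrow> (('n \<Rightarrow> int) \<Rightarrow> 'g \<Rightarrow> 'k) set"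
  where "Loc_Rel A = {u \<in> Loc A. \<forall>x. u x \<in> Rel (A \<union> pos x)}"

definition lform :: "('n \<times> nat \<Rightarrow> 'k) \<Rightarrow> nat \<Rightarrow> (('n \<Rightarrow> int) \<Rightarrow> 'g \<Rightarrow> 'k) \<Rightarrow> ('n \<Rightarrow> int) \<Rightarrow> 'g \<Rightarrow> 'k"
  where "lform a q u x = (\<Sum>t\<in>UNIV. fscale (a (t, q)) (u (x - unit_exp t)))"

lemma lform_add: "lform a q (u + v) = lform a q u + lform a q v"
  by (rule ext) (simp add: lform_def fun_vs.scale_right_distrib sum.distrib)

lemma lform_comm: "lform a q (lform a r u) = lform a r (lform a q u)"
proof
  fix x
  have "lform a q (lform a r u) x = (\<Sum>t\<in>UNIV. \<Sum>s\<in>UNIV. fscale (a (t, q) * a (s, r)) (u (x - unit_exp t - unit_exp s)))"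
    by (simp add: lform_def fun_vs.scale_sum_right)
  also have "\<dots> = (\<Sum>s\<in>UNIV. \<Sum>t\<in>UNIV. fscale (a (s, r) * a (t, q)) (u (x - unit_exp s - unit_exp t)))"
    by (subst sum.swap) (simp add: mult.commute diff_diff_eq add.commute)
  also have "\<dots> = lform a r (lform a q u) x"
    by (simp add: lform_def fun_vs.scale_sum_right)
  finally show "lform a q (lform a r u) x = lform a r (lform a q u) x" .
qed

sublocale lform: commuting_ops "lform a"
  by unfold_locales (rule lform_add lform_comm)+

lemma pos_diff_unit: "pos (x - unit_exp t) \<subseteq> pos x"
  by (auto simp: pos_def unit_exp_def split: if_splits)

lemma neg_diff_unit: "neg x \<subseteq> neg (x - unit_exp t)"
  by (auto simp: neg_def unit_exp_def)

lemma finite_supp_shift: "finite {x. u x \<noteq> (0::'z::zero)} \<Longrightarrow> finite {x. u (x - b) \<noteq> 0}"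
  for b :: "'n \<Rightarrow> int"
  using finite_vimageI[of "{x. u x \<noteq> 0}" "\<lambda>x. x - b"] by (simp add: vimage_def inj_def)

lemma lform_support: "lform a q u x \<noteq> 0 \<Longrightarrow> \<exists>t. u (x - unit_exp t) \<noteq> 0"
by (auto simp: lform_def)

lemma lform_finite: "finite {x. u x \<noteq> 0} \<Longrightarrow> finite {x. lform a q u x \<noteq> 0}"
proof (rule finite_subset)
  show "{x. lform a q u x \<noteq> 0} \<subseteq> (\<Union>t. {x. u (x - unit_exp t) \<noteq> 0})"
    using lform_support by auto
qed (use finite_supp_shift[of u] in auto)

lemma LocI:
  assumes "finite {x. u x \<noteq> 0}" "\<And>x. u x \<in> coeffs (A \<union> pos x)" "\<And>x. u x \<noteq> 0 \<Longrightarrow> neg x \<subseteq> A"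
  shows "u \<in> Loc A"
  using assms by (auto simp: Loc_def)

lemma LocD:
  assumes "u \<in> Loc A"
  shows "finite {x. u x \<noteq> 0}" "u x \<in> coeffs (A \<union> pos x)" "u x \<noteq> 0 \<Longrightarrow> neg x \<subseteq> A"
  using assms by (auto simp: Loc_def)

lemma Loc_0: "0 \<in> Loc A"
  by (rule LocI) (simp_all add: fun_vs.subspace_0[OF coeffs_subspace])

lemma Loc_diff:
  assumes "u \<in> Loc A" "v \<in> Loc A"
  shows "u - v \<in> Loc A"
proof (rule LocI)
  have "finite ({x. u x \<noteq> 0} \<union> {x. v x \<noteq> 0})" using assms LocD(1) by blast
  then show "finite {x. (u - v) x \<noteq> 0}" by (rule rev_finite_subset) auto
  show "(u - v) x \<in> coeffs (A \<union> pos x)" for x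
    using fun_vs.subspace_diff[OF coeffs_subspace] assms LocD(2) by simp
  show "neg x \<subseteq> A" if "(u - v) x \<noteq> 0" for x
    using that assms LocD(3) by (cases "u x = 0") auto
qed

lemma lform_Loc:
  assumes u: "u \<in> Loc A"
  shows "lform a q u \<in> Loc A"
proof (rule LocI)
  show "finite {x. lform a q u x \<noteq> 0}" by (rule lform_finite[OF LocD(1)[OF u]])
  show "lform a q u x \<in> coeffs (A \<union> pos x)" for x
    unfolding lform_def
  proof (intro fun_vs.subspace_sum[OF coeffs_subspace] fun_vs.subspace_scale[OF coeffs_subspace])
    fix t
    have "u (x - unit_exp t) \<in> coeffs (A \<union> pos (x - unit_exp t))" by (rule LocD(2)[OF u])
    also have "\<dots> \<subseteq> coeffs (A \<union> pos x)" by (intro coeffs_mono Un_mono subset_refl pos_diff_unit)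
    finally show "u (x - unit_exp t) \<in> coeffs (A \<union> pos x)" .
  qed
  show "neg x \<subseteq> A" if nz: "lform a q u x \<noteq> 0" for x
  by (metis lform_support nz order_trans neg_diff_unit LocD u)
qed

text \<open>The filtration by the size of the support \<open>A \<union> pos x\<close>: an element is
  required to be a relation wherever the support is smaller than \<open>s\<close>. It is stable
  under the forms since multiplying by a variable never shrinks the support, and it runs from
  \<open>Loc A\<close> down to \<open>Loc_Rel A\<close>.\<close>

definition Loc_filt :: "'n set \<Rightarrow> nat \<Rightarrow> (('n \<Rightarrow> int) \<Rightarrow> 'g \<Rightarrow> 'k) set"
  where "Loc_filt A s = {u \<in> Loc A. \<forall>x. card (A \<union> pos x) < s \<longrightarrow> u x \<in> Rel (A \<union> pos x)}"

lemma Loc_filtD: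
  assumes "u \<in> Loc_filt A s"
  shows "u \<in> Loc A" "card (A \<union> pos x) < s \<Longrightarrow> u x \<in> Rel (A \<union> pos x)"
  using assms by (auto simp: Loc_filt_def)

lemma Loc_filt_0: "Loc_filt A 0 = Loc A"
  by (simp add: Loc_filt_def)

lemma Loc_filt_top: "Loc_filt A (Suc (card (UNIV :: 'n set))) = Loc_Rel A"
by (auto simp: less_Suc_eq_le card_mono Loc_filt_def Loc_Rel_def)

lemma Loc_filt_mono: "Loc_filt A (Suc s) \<subseteq> Loc_filt A s"
  by (auto simp: Loc_filt_def)

lemma lform_Rel:
  assumes "\<And>t. t \<in> UNIV \<Longrightarrow> u (x - unit_exp t) \<in> Rel (A \<union> pos (x - unit_exp t))"
  shows "lform a q u x \<in> Rel (A \<union> pos x)"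
  unfolding lform_def
proof (intro fun_vs.subspace_sum[OF Rel_subspace] fun_vs.subspace_scale[OF Rel_subspace])
  fix t
  have "u (x - unit_exp t) \<in> Rel (A \<union> pos (x - unit_exp t))" by (rule assms) simp
  also have "\<dots> \<subseteq> Rel (A \<union> pos x)" by (intro Rel_mono Un_mono subset_refl pos_diff_unit)
  finally show "u (x - unit_exp t) \<in> Rel (A \<union> pos x)" .
qed

lemma stable_Loc_filt: "lform.stable a (Loc_filt A s)"
  unfolding lform.stable_def
proof (intro conjI ballI allI)
  show "0 \<in> Loc_filt A s"
    by (simp add: Loc_filt_def Loc_0 fun_vs.subspace_0[OF Rel_subspace])
  show "u - v \<in> Loc_filt A s" if "u \<in> Loc_filt A s" "v \<in> Loc_filt A s" for u v
    using that by (simp add: Loc_filt_def Loc_diff fun_vs.subspace_diff[OF Rel_subspace])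
  show "lform a q u \<in> Loc_filt A s" if u: "u \<in> Loc_filt A s" for q u
    unfolding Loc_filt_def
  proof (intro CollectI conjI allI impI)
    show "lform a q u \<in> Loc A" using Loc_filtD[OF u] lform_Loc by blast
    fix x assume x: "card (A \<union> pos x) < s"
    show "lform a q u x \<in> Rel (A \<union> pos x)"
    proof (rule lform_Rel)
      fix t
      have "card (A \<union> pos (x - unit_exp t)) \<le> card (A \<union> pos x)"
        by (intro card_mono Un_mono subset_refl pos_diff_unit) simp
      then show "u (x - unit_exp t) \<in> Rel (A \<union> pos (x - unit_exp t))"
        using x by (intro Loc_filtD(2)[OF u]) simp
    qed
  qed
qed

subsection \<open>Regularity on localizations\<close>

text \<open>The layer of the filtration at a set \<open>G\<close> of variables is a free module over the polynomials in
  \<open>G\<close> with the variables in \<open>A\<close> inverted, generated in degree \<open>ind (G - A)\<close>; \<open>layer\<close> extracts coordinates.\<close>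

definition ind :: "'n set \<Rightarrow> 'n \<Rightarrow> int"
  where "ind G = (\<lambda>t. if t \<in> G then 1 else 0)"

definition layer_exps :: "'n set \<Rightarrow> 'n set \<Rightarrow> ('n \<Rightarrow> int) set"
  where "layer_exps A G = {y. (\<forall>t. t \<notin> G \<longrightarrow> y t = 0) \<and> neg y \<subseteq> A}"

definition layer :: "'n set \<Rightarrow> 'n set \<Rightarrow> (('g \<Rightarrow> 'k) \<Rightarrow> 'g \<Rightarrow> 'k) \<Rightarrow> 'g \<Rightarrow> (('n \<Rightarrow> int) \<Rightarrow> 'g \<Rightarrow> 'k) \<Rightarrow> ('n \<Rightarrow> int) \<Rightarrow> 'k"
  where "layer A G \<pi> j u y = (if y \<in> layer_exps A G then \<pi> (u (y + ind (G - A))) j else 0)"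

lemma supp_layer_exps:
  assumes "A \<subseteq> G" "y \<in> layer_exps A G"
  shows "A \<union> pos (y + ind (G - A)) = G"
proof -
  have "t \<in> pos (y + ind (G - A)) \<longleftrightarrow> t \<in> G" if "t \<notin> A" for t
  proof -
    have "t \<notin> neg y" "t \<notin> G \<Longrightarrow> y t = 0" using assms that by (auto simp: layer_exps_def)
    then have "0 \<le> y t" "t \<notin> G \<Longrightarrow> y t = 0" by (auto simp: neg_def)
    then show ?thesis using that by (auto simp: pos_def ind_def)
  qed
  then show ?thesis using assms(1) by blast
qed

text \<open>Only the variables in \<open>G\<close> act on the layer at \<open>G\<close>. For
  \<open>t\<close> outside \<open>G\<close> the exponent that is looked up has entry -1 at a place
  outside \<open>A\<close>, where \<open>u\<close> vanishes. For \<open>t\<close> in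
  \<open>G\<close> it may lose \<open>t\<close> from its support, but then the support is smaller
  than \<open>G\<close> and the value of \<open>u\<close> is a relation, killed by
  \<open>\<pi>\<close>.\<close>

lemma layer_lform:
  assumes \<pi>: "Vector_Spaces.linear fscale fscale \<pi>" "\<And>w. w \<in> Rel G \<Longrightarrow> \<pi> w = 0"
    and AG: "A \<subseteq> G" and u: "u \<in> Loc_filt A (card G)"
  shows "layer A G \<pi> j (lform a q u) y = form_op a G q (layer A G \<pi> j u) y"
proof (cases "y \<in> layer_exps A G")
  case True
  let ?x = "y + ind (G - A)"
  have "\<pi> 0 = 0"
    using \<pi>(2) fun_vs.subspace_0[OF Rel_subspace] by blast
  have eq: "fscale (a (t, q)) (\<pi> (u (?x - unit_exp t))) j = (if t \<in> G then a (t, q) * layer A G \<pi> j u (y - unit_exp t) else 0)" for t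
  proof (cases "t \<in> G")
    case tG: True
    have eqx: "?x - unit_exp t = (y - unit_exp t) + ind (G - A)" by simp
    show ?thesis
    proof (cases "y - unit_exp t \<in> layer_exps A G")
      case False
      then have t: "t \<notin> A" "y t = 0"
        using True tG by (auto simp: layer_exps_def neg_def unit_exp_def split: if_splits) 
      have "A \<union> pos (?x - unit_exp t) \<subseteq> G - {t}"
        using supp_layer_exps[OF AG True] pos_diff_unit[of ?x t] t by (auto simp: pos_def unit_exp_def ind_def)
      then have "card (A \<union> pos (?x - unit_exp t)) \<le> card (G - {t})" by (intro card_mono) auto
      also have "\<dots> < card G" using tG by (intro card_Diff1_less) auto
      finally have "u (?x - unit_exp t) \<in> Rel (A \<union> pos (?x - unit_exp t))"
        by (rule Loc_filtD(2)[OF u])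
      moreover have "A \<union> pos (?x - unit_exp t) \<subseteq> G"
        using supp_layer_exps[OF AG True] pos_diff_unit[of ?x t] by blast
      ultimately have "\<pi> (u (?x - unit_exp t)) = 0" using \<pi>(2) Rel_mono by blast
      then show ?thesis using False by (simp add: layer_def)
    qed (simp add: layer_def tG eqx)
  next
    case False
    have "(?x - unit_exp t) t = -1" "t \<notin> A"
      using True False AG by (auto simp: layer_exps_def ind_def unit_exp_def)
    then have "t \<in> neg (?x - unit_exp t)" "t \<notin> A" unfolding neg_def mem_Collect_eq by linarith+
    then have "\<not> neg (?x - unit_exp t) \<subseteq> A" by blast
    then have "u (?x - unit_exp t) = 0" using LocD(3)[OF Loc_filtD(1)[OF u]] by blast
    then show ?thesis using False \<open>\<pi> 0 = 0\<close> by simp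
  qed
  have "layer A G \<pi> j (lform a q u) y = (\<Sum>t\<in>UNIV. fscale (a (t, q)) (\<pi> (u (?x - unit_exp t))) j)"
    using True by (simp add: layer_def lform_def fscale_linear_sum[OF \<pi>(1)] sum_fun_apply)
  also have "\<dots> = form_op a G q (layer A G \<pi> j u) y"
    unfolding eq form_op_def by (simp add: sum.If_cases)
  finally show ?thesis .
next
  case False
  have "y - unit_exp t \<notin> layer_exps A G" if "t \<in> G" for t
    using False that neg_diff_unit[of y t] by (auto simp: layer_exps_def unit_exp_def split: if_splits)
  then show ?thesis using False by (simp add: layer_def form_op_def)
qed

lemma layer_finite:
  assumes "finite {x. u x \<noteq> 0}" "\<pi> 0 = 0"
  shows "finite {y. layer A G \<pi> j u y \<noteq> 0}"
proof (rule finite_subset)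
  show "{y. layer A G \<pi> j u y \<noteq> 0} \<subseteq> {y. u (y - (- ind (G - A))) \<noteq> 0}"
    using assms(2) by (auto simp: layer_def split: if_splits)
qed (rule finite_supp_shift[OF assms(1)])

text \<open>A layer splits over the sets \<open>G\<close> of size \<open>s\<close> and over the
  coordinates \<open>j\<close> into scalar Laurent polynomials, and \<open>form_ops_regular\<close>
  divides each of these. The quotients are glued to families \<open>w\<close>; what they do not
  account for is a relation in all degrees with support of size at most \<open>s\<close>.\<close>

lemma regular_Loc_layer:
  assumes gp: "general_position m a" and A: "A \<noteq> {}"
  shows "lform.regular_mod a m (Loc_filt A s) (Loc_filt A (Suc s))"
  unfolding lform.regular_mod_def
proof (intro allI impI ballI)
  fix r u k v
  assume r: "r < m" and u: "u \<in> Loc_filt A s" and k: "k \<in> Loc_filt A (Suc s)" and v: "\<forall>q. v q \<in> Loc_filt A s"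
    and eq: "lform a (Suc r) u = k + (\<Sum>q\<in>{1..r}. lform a q (v q))"
  obtain t0 where t0: "t0 \<in> A" using A by blast
  have "\<forall>G. \<exists>\<pi>. Vector_Spaces.linear fscale fscale \<pi> \<and> (\<forall>w\<in>Rel G. \<pi> w = 0) \<and> (\<forall>c. c - \<pi> c \<in> Rel G)"
    using fun_vs.exists_projection_along[OF Rel_subspace] by blast
  then obtain \<pi> where \<pi>: "\<And>G. Vector_Spaces.linear fscale fscale (\<pi> G)" "\<And>G w. w \<in> Rel G \<Longrightarrow> \<pi> G w = 0"
    "\<And>G c. c - \<pi> G c \<in> Rel G"
    by metis
  have \<pi>0: "\<pi> G 0 = 0" for G
    by (rule \<pi>(2)) (rule fun_vs.subspace_0[OF Rel_subspace])
  have ex: "\<exists>h. (\<forall>q. finite {x. h q x \<noteq> 0}) \<and> (\<forall>q x. h q x \<noteq> 0 \<longrightarrow> neg x \<subseteq> A) \<and>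
    (\<forall>x. layer A G (\<pi> G) j u x = (\<Sum>q\<in>{1..r}. form_op a G q (h q) x))" if G: "A \<subseteq> G" "card G = s" for G j
  proof (rule form_ops_regular[OF gp r G(1) t0])
    show "finite {x. layer A G (\<pi> G) j u x \<noteq> 0}"
      using LocD(1)[OF Loc_filtD(1)[OF u]] \<pi>0 by (rule layer_finite)
    show "finite {x. layer A G (\<pi> G) j (v q) x \<noteq> 0}" for q
      using LocD(1)[OF Loc_filtD(1)[OF spec[OF v]]] \<pi>0 by (rule layer_finite)
    show "neg x \<subseteq> A" if "layer A G (\<pi> G) j w x \<noteq> 0" for w x
      using that by (auto simp: layer_def layer_exps_def split: if_splits)
    then show "neg x \<subseteq> A" if "layer A G (\<pi> G) j (v q) x \<noteq> 0" for q x
      using that .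
    fix y
    have "form_op a G (Suc r) (layer A G (\<pi> G) j u) y = layer A G (\<pi> G) j (lform a (Suc r) u) y"
      using \<pi> u G by (intro layer_lform[symmetric]) auto
    also have "\<dots> = (\<Sum>q\<in>{1..r}. layer A G (\<pi> G) j (lform a q (v q)) y)"
    proof (cases "y \<in> layer_exps A G")
      case True
      interpret \<pi>: Vector_Spaces.linear fscale fscale "\<pi> G" by (rule \<pi>(1))
      have "card (A \<union> pos (y + ind (G - A))) < Suc s"
        using supp_layer_exps[OF G(1) True] G(2) by simp
      then have "k (y + ind (G - A)) \<in> Rel G"
        using Loc_filtD(2)[OF k] supp_layer_exps[OF G(1) True] by metis
      then show ?thesis
        using True \<pi>(2) unfolding eq by (simp add: layer_def \<pi>.add \<pi>.sum sum_fun_apply)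
    qed (simp add: layer_def)
    also have "\<dots> = (\<Sum>q\<in>{1..r}. form_op a G q (layer A G (\<pi> G) j (v q)) y)"
      using \<pi> v G by (intro sum.cong refl layer_lform) auto
    finally show "form_op a G (Suc r) (layer A G (\<pi> G) j u) y =
      (\<Sum>q\<in>{1..r}. form_op a G q (layer A G (\<pi> G) j (v q)) y)" .
  qed
  have "\<exists>h. \<forall>G j. A \<subseteq> G \<longrightarrow> card G = s \<longrightarrow> (\<forall>q. finite {x. h G j q x \<noteq> 0}) \<and>
    (\<forall>q x. h G j q x \<noteq> 0 \<longrightarrow> neg x \<subseteq> A) \<and>
    (\<forall>x. layer A G (\<pi> G) j u x = (\<Sum>q\<in>{1..r}. form_op a G q (h G j q) x))"
    using ex by (intro choice allI) blast
  then obtain h where h_all: "\<forall>G j. A \<subseteq> G \<longrightarrow> card G = s \<longrightarrow> (\<forall>q. finite {x. h G j q x \<noteq> 0}) \<and>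
    (\<forall>q x. h G j q x \<noteq> 0 \<longrightarrow> neg x \<subseteq> A) \<and>
    (\<forall>x. layer A G (\<pi> G) j u x = (\<Sum>q\<in>{1..r}. form_op a G q (h G j q) x))"
    by (rule exE)
  have h: "finite {x. h G j q x \<noteq> 0}" "h G j q x \<noteq> 0 \<Longrightarrow> neg x \<subseteq> A"
    "layer A G (\<pi> G) j u x = (\<Sum>q\<in>{1..r}. form_op a G q (h G j q) x)"
    if "A \<subseteq> G" "card G = s" for G j q x
    using h_all that by blast+
  \<comment> \<open>A degree receives a value only if its support has size exactly \<open>s\<close>;
    the value is read from the layer at this support, after undoing the translation by
    \<open>ind\<close> of the support outside \<open>A\<close>.\<close>
  define w where "w q x = (\<lambda>j. if card (A \<union> pos x) = s \<and> neg x \<subseteq> A \<and> j \<in> gens (A \<union> pos x)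
    then h (A \<union> pos x) j q (x - ind ((A \<union> pos x) - A)) else 0)" for q x
  have wL: "w q \<in> Loc_filt A s" for q
    unfolding Loc_filt_def
  proof (intro CollectI conjI allI impI LocI)
    let ?S = "\<Union>G\<in>{G. A \<subseteq> G \<and> card G = s}. \<Union>j\<in>gens UNIV. {x. h G j q (x - ind (G - A)) \<noteq> 0}"
    have "finite ?S"
      using finite_gens h(1) by (intro finite_UN_I finite_supp_shift) auto
    moreover have "{x. w q x \<noteq> 0} \<subseteq> ?S"
    proof
      fix x assume "x \<in> {x. w q x \<noteq> 0}"
      then obtain j where "w q x j \<noteq> 0" by (auto simp: fun_eq_iff)
      then show "x \<in> ?S"
        using gens_mono[OF subset_UNIV] by (auto simp: w_def split: if_splits intro!: exI[of _ "A \<union> pos x"])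
    qed
    ultimately show "finite {x. w q x \<noteq> 0}" by (rule finite_subset[rotated])
    show "w q x \<in> coeffs (A \<union> pos x)" for x by (simp add: coeffs_def w_def)
    show "neg x \<subseteq> A" if "w q x \<noteq> 0" for x
      using that by (auto simp: w_def fun_eq_iff split: if_splits)
    show "w q x \<in> Rel (A \<union> pos x)" if "card (A \<union> pos x) < s" for x
    proof -
      have "w q x = 0" using that by (simp add: w_def fun_eq_iff)
      then show ?thesis by (simp add: fun_vs.subspace_0[OF Rel_subspace])
    qed
  qed
  define k' where "k' = u - (\<Sum>q\<in>{1..r}. lform a q (w q))"
  note st = lform.stableD[OF stable_Loc_filt]
  have "(\<Sum>q\<in>Q. lform a q (w q)) \<in> Loc_filt A s" if "finite Q" for Q
    using that by (induction Q rule: finite_induct) (simp_all only: sum.empty sum.insert if_True not_False_eq_True st wL)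
  then have k'L: "k' \<in> Loc_filt A s"
    unfolding k'_def by (intro st(2) u) simp
  have "k' \<in> Loc_filt A (Suc s)"
    unfolding Loc_filt_def
  proof (intro CollectI conjI allI impI)
    show "k' \<in> Loc A" using Loc_filtD(1)[OF k'L] .
    fix x assume x: "card (A \<union> pos x) < Suc s"
    let ?G = "A \<union> pos x"
    show "k' x \<in> Rel ?G"
    proof (cases "card ?G < s \<or> \<not> neg x \<subseteq> A")
      case True
      then show ?thesis
        using Loc_filtD(2)[OF k'L] LocD(3)[OF Loc_filtD(1)[OF k'L]] fun_vs.subspace_0[OF Rel_subspace]
        by metis
    next
      case False
      then have G: "A \<subseteq> ?G" "card ?G = s" and nx: "neg x \<subseteq> A" using x by auto
      define y where "y = x - ind (?G - A)"
      have y: "y \<in> layer_exps A ?G" "y + ind (?G - A) = x"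
      proof -
        have "y t = 0" if "t \<notin> ?G" for t
        proof -
          have "\<not> 0 < x t" "t \<notin> neg x" using that nx by (auto simp: pos_def)
          then show ?thesis using that by (auto simp: neg_def y_def ind_def)
        qed
        moreover have "neg y \<subseteq> A"
          using nx by (auto simp: y_def neg_def pos_def ind_def split: if_splits)
        ultimately show "y \<in> layer_exps A ?G" by (simp add: layer_exps_def)
      qed (simp add: y_def)
      \<comment> \<open>Neighbouring degrees of \<open>x\<close> may belong to another support. If
        \<open>t\<close> drops out of the support, \<open>w\<close> is zero by its definition, and
        \<open>h\<close> is zero because its argument has a negative entry outside \<open>A\<close>;
        so the layer at the support of \<open>x\<close> alone decides.\<close>
      have w_eq: "fscale (a (t, q)) (w q (x - unit_exp t)) j = (if t \<in> ?G then a (t, q) * h ?G j q (y - unit_exp t) else 0)"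
        if j: "j \<in> gens ?G" for t q j
      proof (cases "t \<in> ?G")
        case tG: True
        show ?thesis
        proof (cases "A \<union> pos (x - unit_exp t) = ?G")
          case True
          have "neg (x - unit_exp t) \<subseteq> A"
            using nx tG by (auto simp: neg_def pos_def unit_exp_def split: if_splits)
          moreover have "x - unit_exp t - ind (?G - A) = y - unit_exp t" by (simp add: y_def algebra_simps)
          ultimately show ?thesis using G j tG by (simp only: w_def True fscale_apply) simp
        next
          case False
          then have t: "t \<notin> A" "x t = 1"
            using tG by (auto simp: pos_def unit_exp_def split: if_splits)
          have "A \<union> pos (x - unit_exp t) \<subset> ?G" using False pos_diff_unit[of x t] by blast
          then have "card (A \<union> pos (x - unit_exp t)) < card ?G" by (intro psubset_card_mono) auto
          then have "w q (x - unit_exp t) = 0" using G by (simp add: w_def fun_eq_iff)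
          moreover have "t \<in> neg (y - unit_exp t)" using t tG by (simp add: neg_def y_def ind_def unit_exp_def)
          then have "h ?G j q (y - unit_exp t) = 0" using h(2)[OF G] t by blast
          ultimately show ?thesis by simp
        qed
      next
        case False
        then have "x t \<le> 0" "t \<notin> A" by (auto simp: pos_def)
        then have "t \<in> neg (x - unit_exp t)" "t \<notin> A" by (auto simp: neg_def unit_exp_def)
        then have "\<not> neg (x - unit_exp t) \<subseteq> A" by blast
        then have "w q (x - unit_exp t) = 0" by (simp add: w_def fun_eq_iff)
        then show ?thesis using False by simp
      qed
      have "(\<Sum>q\<in>{1..r}. lform a q (w q)) x = \<pi> ?G (u x)"
      proof
        fix j
        show "(\<Sum>q\<in>{1..r}. lform a q (w q)) x j = \<pi> ?G (u x) j"
        proof (cases "j \<in> gens ?G")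
          case True
          have "lform a q (w q) x j = form_op a ?G q (h ?G j q) y" for q
            unfolding lform_def sum_fun_apply w_eq[OF True] form_op_def by (simp only: sum.If_cases finite_code Collect_mem_eq Int_UNIV_left) simp
          then have "(\<Sum>q\<in>{1..r}. lform a q (w q)) x j = layer A ?G (\<pi> ?G) j u y"
            unfolding sum_fun_apply h(3)[OF G] by simp
          then show ?thesis using y by (simp add: layer_def)
        next
          case False
          \<comment> \<open>The projection may a priori create coordinates outside
            \<open>gens ?G\<close>, but it changes a vector only by a relation, and relations are
            supported on \<open>gens ?G\<close>.\<close>
          have "u x \<in> coeffs ?G" using LocD(2)[OF Loc_filtD(1)[OF u]] .
          moreover have "u x - \<pi> ?G (u x) \<in> coeffs ?G" using \<pi>(3) Rel_coeffs by blast
          ultimately have "u x j = 0" "(u x - \<pi> ?G (u x)) j = 0" using False coeffs_zero by blast+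
          then have "\<pi> ?G (u x) j = 0" by simp
          have "lform a q (w q) x \<in> coeffs ?G" for q
            using LocD(2)[OF lform_Loc[OF Loc_filtD(1)[OF wL]]] .
          then have "\<forall>q. lform a q (w q) x j = 0" using False by (auto simp: coeffs_def)
          with \<open>\<pi> ?G (u x) j = 0\<close> show ?thesis by (simp add: sum_fun_apply)
        qed
      qed
      then show ?thesis using \<pi>(3)[where G = ?G] by (simp add: k'_def)
    qed
  qed
  then show "\<exists>k'\<in>Loc_filt A (Suc s). \<exists>w. (\<forall>q. w q \<in> Loc_filt A s) \<and> u = k' + (\<Sum>q\<in>{1..r}. lform a q (w q))"
    using wL by (intro bexI[of _ k'] exI[of _ w]) (auto simp: k'_def)
qed

theorem regular_Loc:
  assumes gp: "general_position m a" and A: "A \<noteq> {}"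
  shows "lform.regular_mod a m (Loc A) (Loc_Rel A)"
proof -
  have "lform.regular_mod a m (Loc_filt A 0) (Loc_filt A (Suc s))" for s
  proof (induction s)
    case 0
    show ?case by (rule regular_Loc_layer[OF gp A])
  next
    case (Suc s)
    have "Loc_filt A (Suc s) \<subseteq> Loc_filt A 0" by (auto simp: Loc_filt_def)
    then show ?case
      by (intro lform.regular_mod_trans[OF Suc regular_Loc_layer[OF gp A] stable_Loc_filt stable_Loc_filt]
          Loc_filt_mono)
  qed
  from this[of "card (UNIV :: 'n set)"] show ?thesis
    unfolding Loc_filt_0 Loc_filt_top .
qed

end

section \<open>The Cech complex of a squarefree system\<close>

definition ech_sign :: "'n::linorder set \<Rightarrow> 'n \<Rightarrow> 'k::field"
  where "ech_sign B t = (-1) ^ card {s \<in> B. s < t}"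

lemma ech_sign_square: "ech_sign B t * ech_sign B t = 1"
  by (simp add: ech_sign_def flip: power_add mult_2)

lemma ech_sign_remove_greater: "s < t \<Longrightarrow> ech_sign (B - {t}) s = ech_sign B s"
proof -
  assume "s < t"
  then have "{r \<in> B - {t}. r < s} = {r \<in> B. r < s}" by auto
  then show ?thesis by (simp add: ech_sign_def)
qed

lemma ech_sign_remove_less:
  assumes "s < t" "s \<in> B" "finite B"
  shows "ech_sign (B - {s}) t = - ech_sign B t"
proof -
  have "{r \<in> B. r < t} = insert s {r \<in> B - {s}. r < t}" using assms by auto
  then have "card {r \<in> B. r < t} = Suc (card {r \<in> B - {s}. r < t})" using assms(3) by simp
  then show ?thesis by (simp add: ech_sign_def)
qed

text \<open>Removing the smaller element first lowers the position of the larger one by one, whereas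
  removing the larger one first does not affect the smaller one. So the two orders differ by exactly
  one sign.\<close>

lemma ech_sign_exchange:
  assumes "s \<noteq> t" "s \<in> B" "t \<in> B" "finite B"
  shows "ech_sign B s * ech_sign (B - {s}) t = - (ech_sign B t * ech_sign (B - {t}) s)"
  using assms(1)
proof (cases rule: linorder_cases[of s t])
  case less
  then show ?thesis using assms by (simp add: ech_sign_remove_less ech_sign_remove_greater)
next
  case greater
  then show ?thesis using assms by (simp add: ech_sign_remove_less ech_sign_remove_greater)
qed simp

context squarefree_system
begin

definition lscale :: "'k \<Rightarrow> ('n set \<Rightarrow> 'g \<Rightarrow> 'k) \<Rightarrow> 'n set \<Rightarrow> 'g \<Rightarrow> 'k"
  where "lscale c z = (\<lambda>A. fscale c (z A))"

lemma lscale_apply [simp]: "lscale c z A g = c * z A g"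
  by (simp add: lscale_def)

sublocale loc_vs: vector_space lscale
  by unfold_locales (auto simp: fun_eq_iff algebra_simps)

definition ldiff :: "('n set \<Rightarrow> 'g \<Rightarrow> 'k) \<Rightarrow> 'n set \<Rightarrow> 'g \<Rightarrow> 'k"
  where "ldiff z B = (\<Sum>t\<in>B. fscale (ech_sign B t) (z (B - {t})))"

lemma ldiff_apply: "ldiff z B g = (\<Sum>t\<in>B. ech_sign B t * z (B - {t}) g)"
  by (simp add: ldiff_def sum_fun_apply)

lemma ldiff_add: "ldiff (z + w) = ldiff z + ldiff w"
  by (intro ext) (simp add: ldiff_apply algebra_simps sum.distrib)

lemma ldiff_scale: "ldiff (lscale c z) = lscale c (ldiff z)"
  by (intro ext) (simp add: ldiff_apply sum_distrib_left mult_ac)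

lemma ldiff_0: "ldiff 0 = 0"
  by (intro ext) (simp add: ldiff_apply)

lemma ldiff_ldiff: "ldiff (ldiff z) = 0"
proof (intro ext)
  fix B :: "'n set" and g
  define f where "f t s = ech_sign B t * ech_sign (B - {t}) s * z (B - {t} - {s}) g" for t s
  have fin: "finite B" by simp
  have anti: "f s t = - f t s" if "s \<in> B" "t \<in> B" "s \<noteq> t" for s t
  proof -
    have *: "ech_sign B s * ech_sign (B - {s}) t = - (ech_sign B t * ech_sign (B - {t}) s :: 'k)"
      using that(3,1,2) fin by (rule ech_sign_exchange)
    have "B - {s} - {t} = B - {t} - {s}" by blast
    then show ?thesis unfolding f_def * by simp
  qed
  have "ldiff (ldiff z) B g = (\<Sum>t\<in>B. \<Sum>s\<in>B - {t}. f t s)"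
    by (simp add: ldiff_apply sum_distrib_left f_def mult.assoc)
  also have "\<dots> = (\<Sum>t\<in>B. (\<Sum>s\<in>{s\<in>B. s < t}. f t s) + (\<Sum>s\<in>{s\<in>B. t < s}. f t s))"
  proof (intro sum.cong refl)
    fix t
    have "B - {t} = {s\<in>B. s < t} \<union> {s\<in>B. t < s}" by auto
    then show "(\<Sum>s\<in>B - {t}. f t s) = (\<Sum>s\<in>{s\<in>B. s < t}. f t s) + (\<Sum>s\<in>{s\<in>B. t < s}. f t s)"
      by (metis (no_types, lifting) disjoint_iff finite finite_code mem_Collect_eq order_less_asym sum.union_disjoint)
  qed
  also have "\<dots> = (\<Sum>t\<in>B. \<Sum>s\<in>{s\<in>B. s < t}. f t s) + (\<Sum>t\<in>B. \<Sum>s\<in>{s\<in>B. t < s}. f t s)"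
    by (simp add: sum.distrib)
  also have "(\<Sum>t\<in>B. \<Sum>s\<in>{s\<in>B. t < s}. f t s) = (\<Sum>s\<in>B. \<Sum>t\<in>{t\<in>B. t < s}. f t s)"
    by (rule sum.swap_restrict) simp_all
  also have "\<dots> = - (\<Sum>t\<in>B. \<Sum>s\<in>{s\<in>B. s < t}. f t s)"
    unfolding sum_negf[symmetric] using anti by (intro sum.cong refl) auto
  finally show "ldiff (ldiff z) B g = 0 B g" by simp
qed

text \<open>The contraction of a simplex towards its vertex \<open>s\<close>. It is compatible with
  the spaces in degree \<open>x\<close> only if \<open>s\<close> lies in \<open>pos x\<close>: then
  inserting \<open>s\<close> into \<open>A\<close> does not change
  \<open>A \<union> pos x\<close>.\<close>

definition homotopy :: "'n \<Rightarrow> ('n set \<Rightarrow> 'g \<Rightarrow> 'k) \<Rightarrow> 'n set \<Rightarrow> 'g \<Rightarrow> 'k"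
  where "homotopy s z A = (if s \<in> A then 0 else fscale (ech_sign (insert s A) s) (z (insert s A)))"

lemma homotopy_identity: "ldiff (homotopy s z) + homotopy s (ldiff z) = z"
proof (intro ext)
  fix B g
  show "(ldiff (homotopy s z) + homotopy s (ldiff z)) B g = z B g"
  proof (cases "s \<in> B")
    case True
    have "ldiff (homotopy s z) B g = (\<Sum>t\<in>B. if t = s then z B g else 0)"
      unfolding ldiff_apply
    proof (intro sum.cong refl)
      fix t assume "t \<in> B"
      then show "ech_sign B t * homotopy s z (B - {t}) g = (if t = s then z B g else 0)"
        using True by (auto simp: homotopy_def insert_absorb mult.assoc[symmetric] ech_sign_square)
    qed
    then show ?thesis using True by (simp add: homotopy_def)
  next
    case False
    let ?B = "insert s B"
    have "homotopy s (ldiff z) B g = ech_sign ?B s * (ech_sign ?B s * z B g + (\<Sum>t\<in>B. ech_sign ?B t * z (?B - {t}) g))"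
      using False by (simp add: homotopy_def ldiff_apply)
    also have "\<dots> = z B g + (\<Sum>t\<in>B. ech_sign ?B s * ech_sign ?B t * z (?B - {t}) g)"
      by (simp add: distrib_left sum_distrib_left mult.assoc[symmetric] ech_sign_square)
    also have "(\<Sum>t\<in>B. ech_sign ?B s * ech_sign ?B t * z (?B - {t}) g) = - ldiff (homotopy s z) B g"
      unfolding ldiff_apply sum_negf[symmetric]
    proof (intro sum.cong refl)
      fix t assume t: "t \<in> B"
      then have ts: "t \<noteq> s" using False by blast
      have ins: "insert s (B - {t}) = ?B - {t}" using ts by auto
      have "ech_sign ?B s * ech_sign (?B - {s}) t = - (ech_sign ?B t * ech_sign (?B - {t}) s :: 'k)"
        using ts t by (intro ech_sign_exchange) auto
      then have "ech_sign ?B s * ech_sign B t = - (ech_sign ?B t * ech_sign (?B - {t}) s :: 'k)"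
        using False by simp
      \<comment> \<open>Multiplying the exchange rule by two further signs and cancelling squares
        moves the signs to the sides where the two summands carry them.\<close>
      then have "ech_sign ?B s * ech_sign (?B - {t}) s * (ech_sign ?B t * ech_sign (?B - {t}) s) =
          ech_sign ?B s * ech_sign (?B - {t}) s * - (ech_sign ?B s * ech_sign B t :: 'k)"
        by simp
      then have "ech_sign ?B s * ech_sign ?B t * (ech_sign (?B - {t}) s * ech_sign (?B - {t}) s) =
          - (ech_sign ?B s * ech_sign ?B s * (ech_sign B t * ech_sign (?B - {t}) s) :: 'k)"
        by (simp only: mult_ac mult_minus_right)
      then have "ech_sign ?B s * ech_sign ?B t = - (ech_sign B t * ech_sign (?B - {t}) s :: 'k)"
        by (simp add: ech_sign_square)
      then show "ech_sign ?B s * ech_sign ?B t * z (?B - {t}) g = - (ech_sign B t * homotopy s z (B - {t}) g)"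
        using False ts by (simp add: homotopy_def ins)
    qed
    finally show ?thesis by simp
  qed
qed

subsection \<open>The complex in a single degree\<close>

text \<open>The part of the Cech complex in a single degree \<open>x\<close>, before dividing by
  relations. The localization at \<open>A\<close> is zero in this degree unless \<open>A\<close>
  contains all places with negative entries.\<close>

definition LC :: "int \<Rightarrow> ('n \<Rightarrow> int) \<Rightarrow> ('n set \<Rightarrow> 'g \<Rightarrow> 'k) set"
  where "LC j x = {z. \<forall>A. if int (card A) = j \<and> neg x \<subseteq> A then z A \<in> coeffs (A \<union> pos x) else z A = 0}"

definition LR :: "int \<Rightarrow> ('n \<Rightarrow> int) \<Rightarrow> ('n set \<Rightarrow> 'g \<Rightarrow> 'k) set"
  where "LR j x = {z. \<forall>A. if int (card A) = j \<and> neg x \<subseteq> A then z A \<in> Rel (A \<union> pos x) else z A = 0}"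

text \<open>\<open>LZ\<close> and \<open>LB\<close> are preimages in \<open>LC\<close> of the
  cocycles and coboundaries of the complex \<open>LC\<close> modulo \<open>LR\<close>; both
  therefore contain the relations.\<close>

definition LZ :: "int \<Rightarrow> ('n \<Rightarrow> int) \<Rightarrow> ('n set \<Rightarrow> 'g \<Rightarrow> 'k) set"
  where "LZ j x = {z \<in> LC j x. ldiff z \<in> LR (j + 1) x}"

definition LB :: "int \<Rightarrow> ('n \<Rightarrow> int) \<Rightarrow> ('n set \<Rightarrow> 'g \<Rightarrow> 'k) set"
  where "LB j x = {ldiff b + r | b r. b \<in> LC (j - 1) x \<and> r \<in> LR j x}"

lemma family_subspace:
  assumes "\<And>A. fun_vs.subspace (P A)"
  shows "loc_vs.subspace {z. \<forall>A. if Q A then z A \<in> P A else z A = 0}"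
proof (rule loc_vs.subspaceI)
  show "0 \<in> {z. \<forall>A. if Q A then z A \<in> P A else z A = 0}"
    using fun_vs.subspace_0[OF assms] by simp
  show "z + w \<in> {z. \<forall>A. if Q A then z A \<in> P A else z A = 0}"
    if "z \<in> {z. \<forall>A. if Q A then z A \<in> P A else z A = 0}" "w \<in> {z. \<forall>A. if Q A then z A \<in> P A else z A = 0}" for z w
  proof (intro CollectI allI)
    fix A
    show "if Q A then (z + w) A \<in> P A else (z + w) A = 0"
      using that fun_vs.subspace_add[OF assms, of "z A" A "w A"] by (cases "Q A") (auto simp: plus_fun_apply)
  qed
  show "lscale c z \<in> {z. \<forall>A. if Q A then z A \<in> P A else z A = 0}"
    if "z \<in> {z. \<forall>A. if Q A then z A \<in> P A else z A = 0}" for c z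
  proof (intro CollectI allI)
    fix A
    show "if Q A then lscale c z A \<in> P A else lscale c z A = 0"
      using that fun_vs.subspace_scale[OF assms, of "z A" A c] by (cases "Q A") (auto simp: lscale_def)
  qed
qed

lemma LC_subspace: "loc_vs.subspace (LC j x)"
  unfolding LC_def by (rule family_subspace) (rule coeffs_subspace)

lemma LR_subspace: "loc_vs.subspace (LR j x)"
  unfolding LR_def by (rule family_subspace) (rule Rel_subspace)

lemma LR_sub_LC: "LR j x \<subseteq> LC j x"
using Rel_coeffs by (fastforce simp: LC_def LR_def split: if_splits)

lemma ldiff_family:
  assumes P: "\<And>A. fun_vs.subspace (P A)" "\<And>A B. A \<subseteq> B \<Longrightarrow> P A \<subseteq> P B"
    and z: "z \<in> {z. \<forall>A. if int (card A) = j \<and> neg x \<subseteq> A then z A \<in> P (A \<union> pos x) else z A = 0}"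
  shows "ldiff z \<in> {z. \<forall>A. if int (card A) = j + 1 \<and> neg x \<subseteq> A then z A \<in> P (A \<union> pos x) else z A = 0}"
proof (intro CollectI allI)
  fix B :: "'n set"
  have z': "z A \<in> P (A \<union> pos x)" "z A \<noteq> 0 \<Longrightarrow> int (card A) = j \<and> neg x \<subseteq> A" for A
  proof -
    have *: "if int (card A) = j \<and> neg x \<subseteq> A then z A \<in> P (A \<union> pos x) else z A = 0"
      using z by blast
    then show "z A \<in> P (A \<union> pos x)" using fun_vs.subspace_0[OF P(1)] by (auto split: if_splits)
    show "z A \<noteq> 0 \<Longrightarrow> int (card A) = j \<and> neg x \<subseteq> A" using * by (auto split: if_splits)
  qed
  have 1: "ldiff z B \<in> P (B \<union> pos x)"
    unfolding ldiff_def
  proof (intro fun_vs.subspace_sum[OF P(1)] fun_vs.subspace_scale[OF P(1)])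
    fix t
    have "z (B - {t}) \<in> P (B - {t} \<union> pos x)" by (rule z')
    also have "\<dots> \<subseteq> P (B \<union> pos x)" by (rule P(2)) blast
    finally show "z (B - {t}) \<in> P (B \<union> pos x)" .
  qed
  have 2: "ldiff z B = 0" if B: "\<not> (int (card B) = j + 1 \<and> neg x \<subseteq> B)"
    unfolding ldiff_def
  proof (intro sum.neutral ballI)
    fix t assume t: "t \<in> B"
    have "card B = Suc (card (B - {t}))" by (rule card.remove[OF _ t]) simp
    then have "\<not> (int (card (B - {t})) = j \<and> neg x \<subseteq> B - {t})" using B by auto
    then have "z (B - {t}) = 0" using z'(2) by blast
    then show "fscale (ech_sign B t) (z (B - {t})) = 0" by simp
  qed
  show "if int (card B) = j + 1 \<and> neg x \<subseteq> B then ldiff z B \<in> P (B \<union> pos x) else ldiff z B = 0"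
    using 1 2 by simp
qed

lemma ldiff_LC: "z \<in> LC j x \<Longrightarrow> ldiff z \<in> LC (j + 1) x"
  unfolding LC_def by (rule ldiff_family[OF coeffs_subspace coeffs_mono])

lemma ldiff_LR: "z \<in> LR j x \<Longrightarrow> ldiff z \<in> LR (j + 1) x"
  unfolding LR_def by (rule ldiff_family[OF Rel_subspace Rel_mono])

lemma LZ_subspace: "loc_vs.subspace (LZ j x)"
  unfolding LZ_def
  by (rule loc_vs.subspaceI) (simp_all add: ldiff_add ldiff_scale ldiff_0 loc_vs.subspace_0[OF LC_subspace] loc_vs.subspace_add[OF LC_subspace]
    loc_vs.subspace_scale[OF LC_subspace] loc_vs.subspace_0[OF LR_subspace] loc_vs.subspace_add[OF LR_subspace]
    loc_vs.subspace_scale[OF LR_subspace])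

lemma LBI: "b \<in> LC (j - 1) x \<Longrightarrow> r \<in> LR j x \<Longrightarrow> ldiff b + r \<in> LB j x"
  by (auto simp: LB_def)

lemma LBE:
  assumes "z \<in> LB j x"
  obtains b r where "b \<in> LC (j - 1) x" "r \<in> LR j x" "z = ldiff b + r"
  using assms by (auto simp: LB_def)

lemma LB_subspace: "loc_vs.subspace (LB j x)"
proof (rule loc_vs.subspaceI)
  show "0 \<in> LB j x"
    using LBI[OF loc_vs.subspace_0[OF LC_subspace] loc_vs.subspace_0[OF LR_subspace], of j x] by (simp add: ldiff_0)
  fix z w assume "z \<in> LB j x" "w \<in> LB j x"
  then obtain b r b' r' where *: "b \<in> LC (j - 1) x" "r \<in> LR j x" "z = ldiff b + r"
    "b' \<in> LC (j - 1) x" "r' \<in> LR j x" "w = ldiff b' + r'"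
    by (elim LBE)
  have "z + w = ldiff (b + b') + (r + r')"
    unfolding * ldiff_add by (simp only: add_ac)
  then show "z + w \<in> LB j x"
    using LBI[OF loc_vs.subspace_add[OF LC_subspace *(1,4)] loc_vs.subspace_add[OF LR_subspace *(2,5)]] by simp
next
  fix c z assume "z \<in> LB j x"
  then obtain b r where *: "b \<in> LC (j - 1) x" "r \<in> LR j x" "z = ldiff b + r" by (rule LBE)
  have "lscale c z = ldiff (lscale c b) + lscale c r"
    unfolding * ldiff_scale by (rule loc_vs.scale_right_distrib)
  then show "lscale c z \<in> LB j x"
    using LBI[OF loc_vs.subspace_scale[OF LC_subspace *(1)] loc_vs.subspace_scale[OF LR_subspace *(2)]] by metis
qed

lemma LB_sub_LZ: "LB j x \<subseteq> LZ j x"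
proof
  fix z assume "z \<in> LB j x"
  then obtain b r where *: "b \<in> LC (j - 1) x" "r \<in> LR j x" "z = ldiff b + r" by (rule LBE)
  have "ldiff b \<in> LC j x" using ldiff_LC[OF *(1)] by simp
  moreover have "r \<in> LC j x" using *(2) LR_sub_LC by blast
  ultimately have "z \<in> LC j x" unfolding *(3) by (rule loc_vs.subspace_add[OF LC_subspace])
  moreover have "ldiff z \<in> LR (j + 1) x"
    unfolding *(3) ldiff_add ldiff_ldiff using ldiff_LR[OF *(2)] by simp
  ultimately show "z \<in> LZ j x" by (simp add: LZ_def)
qed

lemma homotopy_family:
  assumes s: "s \<in> pos x" and P: "\<And>A. fun_vs.subspace (P A)"
    and z: "z \<in> {z. \<forall>A. if int (card A) = j + 1 \<and> neg x \<subseteq> A then z A \<in> P (A \<union> pos x) else z A = 0}"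
  shows "homotopy s z \<in> {z. \<forall>A. if int (card A) = j \<and> neg x \<subseteq> A then z A \<in> P (A \<union> pos x) else z A = 0}"
proof (intro CollectI allI)
  fix A :: "'n set"
  have sn: "s \<notin> neg x" using s by (auto simp: pos_def neg_def)
  show "if int (card A) = j \<and> neg x \<subseteq> A then homotopy s z A \<in> P (A \<union> pos x) else homotopy s z A = 0"
  proof (cases "s \<in> A")
    case True
    then show ?thesis using fun_vs.subspace_0[OF P] by (simp add: homotopy_def)
  next
    case False
    have ins: "insert s A \<union> pos x = A \<union> pos x" using s by blast
    have "neg x \<subseteq> insert s A \<longleftrightarrow> neg x \<subseteq> A" using sn by blast
    moreover have "int (card (insert s A)) = j + 1 \<longleftrightarrow> int (card A) = j" using False by simp
    moreover have "if int (card (insert s A)) = j + 1 \<and> neg x \<subseteq> insert s A then z (insert s A) \<in> P (insert s A \<union> pos x) else z (insert s A) = 0"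
      using z by blast
    ultimately have "if int (card A) = j \<and> neg x \<subseteq> A then z (insert s A) \<in> P (A \<union> pos x) else z (insert s A) = 0"
      by (simp only: ins)
    then show ?thesis
      using False fun_vs.subspace_scale[OF P] by (auto simp: homotopy_def)
  qed
qed

text \<open>At a place with positive exponent, inverting the variable changes neither coefficients
  nor relations in this degree. Inserting it into the index set is therefore a contracting homotopy
  that also respects the relations.\<close>

lemma acyclic:
  assumes "pos x \<noteq> {}"
  shows "LZ j x \<subseteq> LB j x"
proof
  fix z assume z: "z \<in> LZ j x"
  obtain s where s: "s \<in> pos x" using assms by blast
  have "homotopy s z \<in> LC (j - 1) x"
    unfolding LC_def using z by (intro homotopy_family s coeffs_subspace) (simp add: LZ_def LC_def)
  moreover have "homotopy s (ldiff z) \<in> LR j x"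
    unfolding LR_def using z by (intro homotopy_family s Rel_subspace) (simp add: LZ_def LR_def)
  ultimately show "z \<in> LB j x"
    using LBI homotopy_identity[of s z] by metis
qed

text \<open>The inclusion is multiplication by a monomial: raising the degree from \<open>y\<close>
  to \<open>x\<close> can only shrink the set of negative entries and enlarge the set of positive
  ones.\<close>

lemma LC_mono:
  assumes "neg x \<subseteq> neg y" "pos y \<subseteq> pos x"
  shows "LC j y \<subseteq> LC j x"
proof
  fix z assume z: "z \<in> LC j y"
  have "coeffs (A \<union> pos y) \<subseteq> coeffs (A \<union> pos x)" for A
    using assms(2) by (intro coeffs_mono Un_mono subset_refl)
  moreover have "z A \<in> coeffs (A \<union> pos y) \<and> (z A \<noteq> 0 \<longrightarrow> int (card A) = j \<and> neg y \<subseteq> A)" for A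
  proof -
    have "if int (card A) = j \<and> neg y \<subseteq> A then z A \<in> coeffs (A \<union> pos y) else z A = 0"
      using z by (simp add: LC_def)
    then show ?thesis using fun_vs.subspace_0[OF coeffs_subspace] by (auto split: if_splits)
  qed
  ultimately show "z \<in> LC j x" unfolding LC_def using assms(1) by fastforce
qed

lemma LR_mono:
  assumes "neg x \<subseteq> neg y" "pos y \<subseteq> pos x"
  shows "LR j y \<subseteq> LR j x"
proof
  fix z assume z: "z \<in> LR j y"
  have "Rel (A \<union> pos y) \<subseteq> Rel (A \<union> pos x)" for A
    using assms(2) by (intro Rel_mono Un_mono subset_refl)
  moreover have "z A \<in> Rel (A \<union> pos y) \<and> (z A \<noteq> 0 \<longrightarrow> int (card A) = j \<and> neg y \<subseteq> A)" for A
  proof -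
    have "if int (card A) = j \<and> neg y \<subseteq> A then z A \<in> Rel (A \<union> pos y) else z A = 0"
      using z by (simp add: LR_def)
    then show ?thesis using fun_vs.subspace_0[OF Rel_subspace] by (auto split: if_splits)
  qed
  ultimately show "z \<in> LR j x" unfolding LR_def using assms(1) by fastforce
qed

lemma LB_mono:
  assumes "neg x \<subseteq> neg y" "pos y \<subseteq> pos x"
  shows "LB j y \<subseteq> LB j x"
  using LC_mono[OF assms, of "j - 1"] LR_mono[OF assms, of j] by (auto simp: LB_def)

lemma LZ_mono:
  assumes "neg x \<subseteq> neg y" "pos y \<subseteq> pos x"
  shows "LZ j y \<subseteq> LZ j x"
  using LC_mono[OF assms, of j] LR_mono[OF assms, of "j + 1"] by (auto simp: LZ_def)

lemma LZ_cong: "neg x = neg y \<Longrightarrow> pos x = pos y \<Longrightarrow> LZ j x = LZ j y"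
  by (simp add: LZ_def LC_def LR_def)

lemma LB_cong: "neg x = neg y \<Longrightarrow> pos x = pos y \<Longrightarrow> LB j x = LB j y"
  by (simp add: LB_def LC_def LR_def)

text \<open>The degree \<open>- ind F\<close> represents all degrees with negative support
  \<open>F\<close> and no positive entry. It is also the negative of the squarefree degree that
  belongs to \<open>F\<close> in the formula to be proved.\<close>

definition hdim :: "int \<Rightarrow> 'n set \<Rightarrow> nat"
  where "hdim j F = (SOME d. subquot_dim lscale (LZ j (- ind F)) (LB j (- ind F)) d)"

text \<open>There are finitely many pairs of an index set \<open>A\<close> and a generator, and
  functions on these pairs contain the complex of every single degree. This gives finiteness of all
  the dimensions \<open>hdim\<close>.\<close>

lemma finite_support_dim:
  "\<exists>d. subquot_dim lscale {z. \<forall>A g. g \<notin> gens UNIV \<longrightarrow> z A g = 0} {0} d"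
proof -
  define I where "I = (UNIV :: 'n set set) \<times> gens UNIV"
  have "finite I" using finite_gens by (simp add: I_def)
  then obtain b where b: "bij_betw b {0..<card I} I"
    using ex_bij_betw_nat_finite by blast
  then have b: "bij_betw b {..<card I} I" by (simp add: atLeast0LessThan)
  let ?E = "\<lambda>i A g. if b i = (A, g) then 1 else 0 :: 'k"
  have sum_E: "(\<Sum>i<card I. lscale (c (b i)) (?E i)) A g = (if (A, g) \<in> I then c (A, g) else 0)" for c A g
  proof -
    have "(\<Sum>i<card I. lscale (c (b i)) (?E i)) A g = (\<Sum>i<card I. if b i = (A, g) then c (b i) else 0)"
      by (simp add: sum_fun_apply if_distrib cong: if_cong)
    also have "\<dots> = (\<Sum>p\<in>I. if p = (A, g) then c p else 0)"
      by (rule sum.reindex_bij_betw[OF b, of "\<lambda>p. if p = (A, g) then c p else 0"])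
    finally show ?thesis using \<open>finite I\<close> by simp
  qed
  have sum_E': "(\<Sum>i<card I. lscale (c i) (?E i)) A g = (if (A, g) \<in> I then c (the_inv_into {..<card I} b (A, g)) else 0)" for c A g
  proof -
    have "(\<Sum>i<card I. lscale (c i) (?E i)) = (\<Sum>i<card I. lscale (c (the_inv_into {..<card I} b (b i))) (?E i))"
      using b by (intro sum.cong refl) (simp add: the_inv_into_f_f bij_betw_def)
    then show ?thesis using sum_E[of "\<lambda>p. c (the_inv_into {..<card I} b p)"] by simp
  qed
  have "subquot_dim lscale {z. \<forall>A g. g \<notin> gens UNIV \<longrightarrow> z A g = 0} {0} (card I)"
  proof (rule loc_vs.subquot_dimI[where b = ?E])
    show "loc_vs.subspace {z. \<forall>A g. g \<notin> gens UNIV \<longrightarrow> z A g = 0}"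
      by (rule loc_vs.subspaceI) auto
    show "loc_vs.subspace {0}" by (rule loc_vs.subspace_single_0)
    show "?E i \<in> {z. \<forall>A g. g \<notin> gens UNIV \<longrightarrow> z A g = 0}" if "i < card I" for i
    proof -
      have "b i \<in> I" using bij_betwE[OF b] that by blast
      then show ?thesis by (auto simp: I_def)
    qed
    fix z assume z: "z \<in> {z :: 'n set \<Rightarrow> 'g \<Rightarrow> 'k. \<forall>A g. g \<notin> gens UNIV \<longrightarrow> z A g = 0}"
    have "z = (\<Sum>i<card I. lscale ((\<lambda>(A, g). z A g) (b i)) (?E i))"
      by (intro ext, subst sum_E) (use z in \<open>auto simp: I_def\<close>)
    then show "\<exists>c. z - (\<Sum>i<card I. lscale (c i) (?E i)) \<in> {0}"
      by (intro exI[of _ "\<lambda>i. (\<lambda>(A, g). z A g) (b i)"]) simp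
  next
    fix c i assume *: "(\<Sum>i<card I. lscale (c i) (?E i)) \<in> {0}" and i: "i < card I"
    obtain A g where Ag: "b i = (A, g)" "(A, g) \<in> I"
    proof -
      have "b i \<in> I" using bij_betwE[OF b] i by blast
      then show thesis using that by (cases "b i") auto
    qed
    have "(\<Sum>i<card I. lscale (c i) (?E i)) A g = 0" using * by simp
    then show "c i = 0"
      using b i Ag unfolding sum_E' by (metis bij_betw_def lessThan_iff the_inv_into_f_f)
  qed auto
  then show ?thesis by blast
qed

lemma hdim:
  assumes "pos x = {}"
  shows "subquot_dim lscale (LZ j x) (LB j x) (hdim j (neg x))"
proof -
  let ?F = "{z :: 'n set \<Rightarrow> 'g \<Rightarrow> 'k. \<forall>A g. g \<notin> gens UNIV \<longrightarrow> z A g = 0}"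
  have sub: "LZ j y \<subseteq> ?F" for y
  proof
    fix z assume "z \<in> LZ j y"
    then have "if int (card A) = j \<and> neg y \<subseteq> A then z A \<in> coeffs (A \<union> pos y) else z A = 0" for A
      by (simp add: LZ_def LC_def)
    then have "z A \<in> coeffs UNIV" for A
      using fun_vs.subspace_0[OF coeffs_subspace] coeffs_mono[OF subset_UNIV] by (metis subsetD)
    then show "z \<in> ?F" using coeffs_zero by blast
  qed
  have ex: "\<exists>d. subquot_dim lscale (LZ j y) (LB j y) d" for y
  proof -
    obtain d where d: "subquot_dim lscale ?F {0} d" using finite_support_dim by blast
    obtain e where e: "subquot_dim lscale (LZ j y) {0} e"
      using loc_vs.subquot_dim_split[OF d LZ_subspace[of j y] _ sub] loc_vs.subspace_0[OF LZ_subspace] by auto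
    show ?thesis
      using loc_vs.subquot_dim_split[OF e LB_subspace _ LB_sub_LZ] loc_vs.subspace_0[OF LB_subspace] by auto
  qed
  have "neg (- ind (neg x)) = neg x" "pos (- ind (neg x)) = {}"
    by (auto simp: neg_def pos_def ind_def)
  then have "LZ j x = LZ j (- ind (neg x))" "LB j x = LB j (- ind (neg x))"
    using assms by (simp_all only: LZ_cong[of x "- ind (neg x)"] LB_cong[of x "- ind (neg x)"])
  then show ?thesis
    unfolding hdim_def using ex by (metis someI_ex)
qed

end

definition tdeg :: "('n::finite \<Rightarrow> int) \<Rightarrow> int"
  where "tdeg x = (\<Sum>t\<in>UNIV. x t)"

lemma tdeg_unit: "tdeg (x - unit_exp t) = tdeg x - 1"
  by (simp add: tdeg_def unit_exp_def sum_subtractf)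

section \<open>Cech cochains in all degrees together, with differential and forms\<close>

context squarefree_system
begin

definition cscale :: "'k \<Rightarrow> ('n set \<Rightarrow> ('n \<Rightarrow> int) \<Rightarrow> 'g \<Rightarrow> 'k) \<Rightarrow> 'n set \<Rightarrow> ('n \<Rightarrow> int) \<Rightarrow> 'g \<Rightarrow> 'k"
  where "cscale c f = (\<lambda>A x. fscale c (f A x))"

lemma cscale_apply [simp]: "cscale c f A x = fscale c (f A x)"
  by (simp add: cscale_def)

sublocale cochain_vs: vector_space cscale
  by unfold_locales (auto simp: fun_eq_iff algebra_simps)

definition at_exp :: "('n \<Rightarrow> int) \<Rightarrow> ('n set \<Rightarrow> ('n \<Rightarrow> int) \<Rightarrow> 'g \<Rightarrow> 'k) \<Rightarrow> 'n set \<Rightarrow> 'g \<Rightarrow> 'k"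
  where "at_exp x c = (\<lambda>A. c A x)"

lemma at_exp_apply: "at_exp x c A = c A x"
  by (simp add: at_exp_def)

lemma at_exp_add: "at_exp x (c + d) = at_exp x c + at_exp x d"
  and at_exp_diff: "at_exp x (c - d) = at_exp x c - at_exp x d"
  and at_exp_0: "at_exp x 0 = 0"
  and at_exp_scale: "at_exp x (cscale r c) = lscale r (at_exp x c)"
  by (auto simp: at_exp_def fun_eq_iff)

lemma at_exp_eqI: "(\<And>x. at_exp x c = at_exp x d) \<Longrightarrow> c = d"
  by (auto simp: at_exp_def fun_eq_iff)

definition cdiff :: "('n set \<Rightarrow> ('n \<Rightarrow> int) \<Rightarrow> 'g \<Rightarrow> 'k) \<Rightarrow> 'n set \<Rightarrow> ('n \<Rightarrow> int) \<Rightarrow> 'g \<Rightarrow> 'k"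
  where "cdiff c = (\<lambda>B x. ldiff (at_exp x c) B)"

lemma at_exp_cdiff: "at_exp x (cdiff c) = ldiff (at_exp x c)"
  by (simp add: cdiff_def at_exp_def)

definition cform :: "('n \<times> nat \<Rightarrow> 'k) \<Rightarrow> nat \<Rightarrow> ('n set \<Rightarrow> ('n \<Rightarrow> int) \<Rightarrow> 'g \<Rightarrow> 'k) \<Rightarrow> 'n set \<Rightarrow> ('n \<Rightarrow> int) \<Rightarrow> 'g \<Rightarrow> 'k"
  where "cform a q c = (\<lambda>A. lform a q (c A))"

lemma at_exp_cform: "at_exp x (cform a q c) = (\<Sum>t\<in>UNIV. lscale (a (t, q)) (at_exp (x - unit_exp t) c))"
  by (intro ext) (simp add: at_exp_def cform_def lform_def sum_fun_apply)

lemma cdiff_cdiff: "cdiff (cdiff c) = 0"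
  by (rule at_exp_eqI) (simp add: at_exp_cdiff ldiff_ldiff at_exp_0)

lemma ldiff_sum: "ldiff (\<Sum>i\<in>I. z i) = (\<Sum>i\<in>I. ldiff (z i))"
proof (induction I rule: infinite_finite_induct)
  case (insert i I)
  then show ?case by (simp only: sum.insert if_True not_False_eq_True ldiff_add)
qed (simp_all only: sum.infinite sum.empty ldiff_0 not_False_eq_True)

lemma cdiff_cform: "cdiff (cform a q c) = cform a q (cdiff c)"
  by (rule at_exp_eqI) (simp only: at_exp_cdiff at_exp_cform ldiff_sum ldiff_scale)

lemma cdiff_add: "cdiff (c + d) = cdiff c + cdiff d"
  by (rule at_exp_eqI) (simp only: at_exp_cdiff at_exp_add ldiff_add)

lemma cdiff_scale: "cdiff (cscale r c) = cscale r (cdiff c)"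
  by (rule at_exp_eqI) (simp only: at_exp_cdiff at_exp_scale ldiff_scale)

lemma cform_add: "cform a q (c + d) = cform a q c + cform a q d"
  by (simp add: cform_def lform_add[unfolded plus_fun_def] plus_fun_def)

lemma cform_comm: "cform a q (cform a r c) = cform a r (cform a q c)"
  by (simp add: cform_def lform_comm)

lemma cform_scale: "cform a q (cscale r c) = cscale r (cform a q c)"
  by (intro ext) (simp add: cform_def lform_def sum_fun_apply sum_distrib_left mult_ac)

definition cochains :: "(('n \<Rightarrow> int) \<Rightarrow> ('n set \<Rightarrow> 'g \<Rightarrow> 'k) set) \<Rightarrow> ('n set \<Rightarrow> ('n \<Rightarrow> int) \<Rightarrow> 'g \<Rightarrow> 'k) set"
  where "cochains P = {c. finite {x. at_exp x c \<noteq> 0} \<and> (\<forall>x. at_exp x c \<in> P x)}"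

definition graded_part :: "('n set \<Rightarrow> ('n \<Rightarrow> int) \<Rightarrow> 'g \<Rightarrow> 'k) set \<Rightarrow> int \<Rightarrow> ('n set \<Rightarrow> ('n \<Rightarrow> int) \<Rightarrow> 'g \<Rightarrow> 'k) set"
  where "graded_part C e = {c \<in> C. \<forall>x. at_exp x c \<noteq> 0 \<longrightarrow> tdeg x = e}"

lemma cochainsD:
  assumes "c \<in> cochains P"
  shows "finite {x. at_exp x c \<noteq> 0}" "at_exp x c \<in> P x"
  using assms by (auto simp: cochains_def)

lemma graded_cochainsI:
  "finite {x. at_exp x c \<noteq> 0} \<Longrightarrow> (\<And>x. at_exp x c \<in> P x) \<Longrightarrow> (\<And>x. at_exp x c \<noteq> 0 \<Longrightarrow> tdeg x = e) \<Longrightarrow>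
    c \<in> graded_part (cochains P) e"
  by (auto simp: cochains_def graded_part_def)

lemma graded_cochainsD:
  assumes "c \<in> graded_part (cochains P) e"
  shows "finite {x. at_exp x c \<noteq> 0}" "at_exp x c \<in> P x" "at_exp x c \<noteq> 0 \<Longrightarrow> tdeg x = e"
  using assms by (auto simp: cochains_def graded_part_def)

lemma graded_cochains_mono:
  assumes "\<And>x. tdeg x = e \<Longrightarrow> P x \<subseteq> Q x" "\<And>x. loc_vs.subspace (Q x)"
  shows "graded_part (cochains P) e \<subseteq> graded_part (cochains Q) e"
proof
  fix c assume c: "c \<in> graded_part (cochains P) e"
  show "c \<in> graded_part (cochains Q) e"
  proof (rule graded_cochainsI)
    show "at_exp x c \<in> Q x" for x
      using graded_cochainsD(2,3)[OF c, of x] assms loc_vs.subspace_0[OF assms(2), of x]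
      by (cases "at_exp x c = 0") auto
  qed (use graded_cochainsD[OF c] in auto)
qed

lemma cochains_subspace:
  assumes "\<And>x. loc_vs.subspace (P x)"
  shows "cochain_vs.subspace (cochains P)"
proof (rule cochain_vs.subspaceI)
  show "0 \<in> cochains P" by (simp add: cochains_def at_exp_0 loc_vs.subspace_0[OF assms])
  fix c d assume c: "c \<in> cochains P" and d: "d \<in> cochains P"
  have "finite ({x. at_exp x c \<noteq> 0} \<union> {x. at_exp x d \<noteq> 0})" using cochainsD(1) c d by blast
  then have "finite {x. at_exp x (c + d) \<noteq> 0}" by (rule rev_finite_subset) (auto simp: at_exp_add)
  then show "c + d \<in> cochains P"
    using c d by (simp add: cochains_def at_exp_add loc_vs.subspace_add[OF assms])
next
  fix r c assume c: "c \<in> cochains P"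
  have "finite {x. at_exp x (cscale r c) \<noteq> 0}"
    using cochainsD(1)[OF c] by (rule rev_finite_subset) (auto simp: at_exp_scale)
  then show "cscale r c \<in> cochains P"
    using c by (simp add: cochains_def at_exp_scale loc_vs.subspace_scale[OF assms])
qed

lemma graded_part_subspace:
  assumes "cochain_vs.subspace C"
  shows "cochain_vs.subspace (graded_part C e)"
  unfolding graded_part_def
proof (rule cochain_vs.subspaceI)
  show "0 \<in> {c \<in> C. \<forall>x. at_exp x c \<noteq> 0 \<longrightarrow> tdeg x = e}"
    using cochain_vs.subspace_0[OF assms] by (simp add: at_exp_0)
  fix c d assume "c \<in> {c \<in> C. \<forall>x. at_exp x c \<noteq> 0 \<longrightarrow> tdeg x = e}" "d \<in> {c \<in> C. \<forall>x. at_exp x c \<noteq> 0 \<longrightarrow> tdeg x = e}"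
  then show "c + d \<in> {c \<in> C. \<forall>x. at_exp x c \<noteq> 0 \<longrightarrow> tdeg x = e}"
    using cochain_vs.subspace_add[OF assms] by (auto simp: at_exp_add) (metis add_0)
next
  fix r c assume "c \<in> {c \<in> C. \<forall>x. at_exp x c \<noteq> 0 \<longrightarrow> tdeg x = e}"
  then show "cscale r c \<in> {c \<in> C. \<forall>x. at_exp x c \<noteq> 0 \<longrightarrow> tdeg x = e}"
    using cochain_vs.subspace_scale[OF assms] by (auto simp: at_exp_scale)
qed

lemmas graded_cochains_subspace = graded_part_subspace[OF cochains_subspace]

lemma cdiff_cochains:
  assumes "\<And>x z. z \<in> P x \<Longrightarrow> ldiff z \<in> Q x" "c \<in> cochains P"
  shows "cdiff c \<in> cochains Q"
proof -
  have "finite {x. at_exp x (cdiff c) \<noteq> 0}"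
    using cochainsD(1)[OF assms(2)] by (rule rev_finite_subset) (auto simp: at_exp_cdiff ldiff_0)
  then show ?thesis
    using assms cochainsD(2)[OF assms(2)] by (simp add: cochains_def at_exp_cdiff)
qed

lemma graded_cdiff:
  "c \<in> graded_part C e \<Longrightarrow> cdiff c \<in> D \<Longrightarrow> cdiff c \<in> graded_part D e"
  by (auto simp: graded_part_def at_exp_cdiff) (metis ldiff_0)

lemma at_exp_cform_support:
  assumes "at_exp x (cform a q c) \<noteq> 0"
  shows "\<exists>t. at_exp (x - unit_exp t) c \<noteq> 0"
using assms by (fastforce simp: at_exp_cform)

lemma cform_cochains:
  assumes P: "\<And>x. loc_vs.subspace (P x)" "\<And>x t. P (x - unit_exp t) \<subseteq> P x" and c: "c \<in> cochains P"
  shows "cform a q c \<in> cochains P"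
  unfolding cochains_def
proof (intro CollectI conjI allI)
  have "finite (\<Union>t. {x. at_exp (x - unit_exp t) c \<noteq> 0})"
    using finite_supp_shift[of "\<lambda>x. at_exp x c", OF cochainsD(1)[OF c]] by auto
  then show "finite {x. at_exp x (cform a q c) \<noteq> 0}"
    by (rule rev_finite_subset) (use at_exp_cform_support in auto)
  show "at_exp x (cform a q c) \<in> P x" for x
    unfolding at_exp_cform using cochainsD(2)[OF c] P(2)
    by (intro loc_vs.subspace_sum[OF P(1)] loc_vs.subspace_scale[OF P(1)]) blast
qed

lemma graded_cform: "c \<in> graded_part C e \<Longrightarrow> cform a q c \<in> D \<Longrightarrow> cform a q c \<in> graded_part D (e + 1)"
  unfolding graded_part_def
  by (auto dest!: at_exp_cform_support simp: tdeg_unit)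

abbreviation Cech :: "int \<Rightarrow> ('n set \<Rightarrow> ('n \<Rightarrow> int) \<Rightarrow> 'g \<Rightarrow> 'k) set"
  where "Cech j \<equiv> cochains (LC j)"

abbreviation Cech_Rel :: "int \<Rightarrow> ('n set \<Rightarrow> ('n \<Rightarrow> int) \<Rightarrow> 'g \<Rightarrow> 'k) set"
  where "Cech_Rel j \<equiv> cochains (LR j)"

lemma cochain_component:
  assumes P: "\<And>A. fun_vs.subspace (P A)"
    and c: "c \<in> cochains (\<lambda>x. {z. \<forall>A. if int (card A) = j \<and> neg x \<subseteq> A then z A \<in> P (A \<union> pos x) else z A = 0})"
  shows "finite {x. c A x \<noteq> 0}" "c A x \<in> P (A \<union> pos x)" "c A x \<noteq> 0 \<Longrightarrow> neg x \<subseteq> A \<and> int (card A) = j"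
proof -
  show "finite {x. c A x \<noteq> 0}"
    using cochainsD(1)[OF c] by (rule rev_finite_subset) (auto simp: at_exp_def fun_eq_iff)
  have *: "if int (card A) = j \<and> neg x \<subseteq> A then c A x \<in> P (A \<union> pos x) else c A x = 0"
    using cochainsD(2)[OF c, of x] unfolding at_exp_def by blast
  then show "c A x \<in> P (A \<union> pos x)" "c A x \<noteq> 0 \<Longrightarrow> neg x \<subseteq> A \<and> int (card A) = j"
    using fun_vs.subspace_0[OF P] by (auto split: if_splits)
qed

lemma Cech_component:
  assumes "c \<in> Cech j"
  shows "c A \<in> Loc A" "int (card A) \<noteq> j \<Longrightarrow> c A = 0"
proof -
  note * = cochain_component[OF coeffs_subspace assms[unfolded LC_def]]
  show "c A \<in> Loc A" by (rule LocI) (use * in blast)+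
  show "c A = 0" if "int (card A) \<noteq> j"
  proof
    fix x show "c A x = 0 x" using *(3)[of A x] that by auto
  qed
qed

lemma Cech_Rel_component:
  assumes "c \<in> Cech_Rel j"
  shows "c A \<in> Loc_Rel A"
proof -
  have "c \<in> Cech j" using assms LR_sub_LC by (auto simp: cochains_def)
  then show ?thesis
    using cochain_component(2)[OF Rel_subspace assms[unfolded LR_def]] Cech_component by (auto simp: Loc_Rel_def)
qed

lemma CechI:
  assumes "\<And>A. int (card A) = j \<Longrightarrow> c A \<in> Loc A" "\<And>A. int (card A) \<noteq> j \<Longrightarrow> c A = 0"
  shows "c \<in> Cech j"
  unfolding cochains_def LC_def
proof (intro CollectI conjI allI)
  have "finite {x. c A x \<noteq> 0}" for A
    using LocD(1)[OF assms(1)] assms(2)[of A] by (cases "int (card A) = j") auto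
  then have "finite (\<Union>A. {x. c A x \<noteq> 0})" by auto
  then show "finite {x. at_exp x c \<noteq> 0}"
    by (rule rev_finite_subset) (auto simp: at_exp_def fun_eq_iff)
  fix x A
  show "if int (card A) = j \<and> neg x \<subseteq> A then at_exp x c A \<in> coeffs (A \<union> pos x) else at_exp x c A = 0"
  proof (cases "int (card A) = j")
    case True
    then show ?thesis using LocD(2)[OF assms(1)[OF True], of x] LocD(3)[OF assms(1)[OF True], of x] by (auto simp: at_exp_def)
  next
    case False
    then show ?thesis using assms(2) by (simp add: at_exp_def)
  qed
qed

lemma Cech_RelI:
  assumes "\<And>A. int (card A) = j \<Longrightarrow> c A \<in> Loc_Rel A" "\<And>A. int (card A) \<noteq> j \<Longrightarrow> c A = 0"
  shows "c \<in> Cech_Rel j"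
proof -
  have c: "c \<in> Cech j" using assms by (intro CechI) (auto simp: Loc_Rel_def)
  have "at_exp x c \<in> LR j x" for x
    unfolding LR_def
  proof (intro CollectI allI)
    fix A
    show "if int (card A) = j \<and> neg x \<subseteq> A then at_exp x c A \<in> Rel (A \<union> pos x) else at_exp x c A = 0"
    proof (cases "int (card A) = j")
      case True
      then show ?thesis
        using assms(1)[OF True] LocD(3)[of "c A" A x] by (auto simp: at_exp_def Loc_Rel_def)
    next
      case False
      then show ?thesis using assms(2) by (simp add: at_exp_def)
    qed
  qed
  then show ?thesis using cochainsD(1)[OF c] by (simp add: cochains_def)
qed

lemma LC_shift: "LC j (x - unit_exp t) \<subseteq> LC j x"
  by (rule LC_mono[OF neg_diff_unit pos_diff_unit])

lemma LR_shift: "LR j (x - unit_exp t) \<subseteq> LR j x"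
  by (rule LR_mono[OF neg_diff_unit pos_diff_unit])

lemma LZ_shift: "LZ j (x - unit_exp t) \<subseteq> LZ j x"
  by (rule LZ_mono[OF neg_diff_unit pos_diff_unit])

lemma LB_shift: "LB j (x - unit_exp t) \<subseteq> LB j x"
  by (rule LB_mono[OF neg_diff_unit pos_diff_unit])

text \<open>The homogeneous component of total degree \<open>e\<close>. Regularity on localizations
  is proved without a grading, and truncation makes the elements that it supplies
  homogeneous.\<close>

definition truncate :: "int \<Rightarrow> (('n \<Rightarrow> int) \<Rightarrow> 'g \<Rightarrow> 'k) \<Rightarrow> ('n \<Rightarrow> int) \<Rightarrow> 'g \<Rightarrow> 'k"
  where "truncate e u = (\<lambda>x. if tdeg x = e then u x else 0)"

lemma truncate_Loc: "u \<in> Loc A \<Longrightarrow> truncate e u \<in> Loc A"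
proof (rule LocI)
  assume u: "u \<in> Loc A"
  show "finite {x. truncate e u x \<noteq> 0}"
    using LocD(1)[OF u] by (rule rev_finite_subset) (auto simp: truncate_def)
  show "truncate e u x \<in> coeffs (A \<union> pos x)" for x
    using LocD(2)[OF u] fun_vs.subspace_0[OF coeffs_subspace] by (simp add: truncate_def)
  show "neg x \<subseteq> A" if "truncate e u x \<noteq> 0" for x
    using LocD(3)[OF u] that by (auto simp: truncate_def split: if_splits)
qed

lemma truncate_Loc_Rel: "u \<in> Loc_Rel A \<Longrightarrow> truncate e u \<in> Loc_Rel A"
  using truncate_Loc[of u A e] fun_vs.subspace_0[OF Rel_subspace] by (auto simp: Loc_Rel_def truncate_def)

lemma truncate_add: "truncate e (u + v) = truncate e u + truncate e v"
  by (auto simp: truncate_def fun_eq_iff)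

lemma truncate_sum: "truncate e (\<Sum>i\<in>I. u i) = (\<Sum>i\<in>I. truncate e (u i))"
  by (auto simp: truncate_def fun_eq_iff sum_fun_apply)

lemma truncate_lform: "truncate e (lform a q u) = lform a q (truncate (e - 1) u)"
  by (intro ext) (auto simp: truncate_def lform_def tdeg_unit sum_fun_apply)

end

section \<open>Forms in general position acting on the Cech complex\<close>

locale squarefree_system_forms = squarefree_system +
  fixes a :: "'a \<times> nat \<Rightarrow> 'c" and m :: nat
  assumes gp: "general_position m a"
begin

sublocale cs: cochain_system cscale "cform a" cdiff "\<lambda>j. graded_part (Cech j)" "\<lambda>j. graded_part (Cech_Rel j)" m
proof (unfold_locales, goal_cases)
  case (10 x j e)
  then show ?case by (intro graded_cdiff) (auto intro: cdiff_cochains ldiff_LC simp: graded_part_def)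
next
  case (11 x j e)
  then show ?case by (intro graded_cdiff) (auto intro: cdiff_cochains ldiff_LR simp: graded_part_def)
next
  case (12 x j e q)
  then show ?case
    by (intro graded_cform) (auto intro: cform_cochains[OF LC_subspace LC_shift] simp: graded_part_def)
next
  case (13 x j e q)
  then show ?case
    by (intro graded_cform) (auto intro: cform_cochains[OF LR_subspace LR_shift] simp: graded_part_def)
next
  case (9 j e)
  then show ?case by (intro graded_cochains_mono LR_sub_LC LC_subspace)
qed (rule cform_add cform_comm cform_scale cdiff_add cdiff_scale cdiff_cform graded_cochains_subspace
  LC_subspace LR_subspace cdiff_cdiff)+

end

lemma finite_nonpos_exps: "finite {x :: 'n::finite \<Rightarrow> int. pos x = {} \<and> tdeg x = e}"
proof (rule finite_subset)
  show "{x :: 'n \<Rightarrow> int. pos x = {} \<and> tdeg x = e} \<subseteq> (\<Pi>\<^sub>E t\<in>UNIV. {e..0})"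
  proof
    fix x :: "'n \<Rightarrow> int" assume "x \<in> {x. pos x = {} \<and> tdeg x = e}"
    then have x: "\<And>t. x t \<le> 0" "tdeg x = e" by (auto simp: pos_def not_less)
    have "e \<le> x t" for t
    proof -
      have "e = x t + (\<Sum>s\<in>UNIV - {t}. x s)"
        using x(2) by (simp add: tdeg_def sum.remove[of UNIV t])
      also have "\<dots> \<le> x t" using x(1) by (simp add: sum_nonpos)
      finally show ?thesis .
    qed
    then show "x \<in> (\<Pi>\<^sub>E t\<in>UNIV. {e..0})" using x by auto
  qed
qed (auto intro: finite_PiE)

lemma restr_form_single:
  "restr_form a G q * Poly_Mapping.single k 1 =
    (\<Sum>t\<in>G. Const (a (t, q)) * Poly_Mapping.single (Poly_Mapping.single t 1 + k) 1)"
proof -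
  have "restr_form a G q * Poly_Mapping.single k 1 =
      (\<Sum>t\<in>UNIV. Const (if t \<in> G then a (t, q) else 0) * (Var t * Poly_Mapping.single k 1))"
    by (simp add: restr_form_def lin_def sum_distrib_right mult.assoc)
  also have "\<dots> = (\<Sum>t\<in>UNIV. if t \<in> G then Const (a (t, q)) * Poly_Mapping.single (Poly_Mapping.single t 1 + k) 1 else 0)"
    by (intro sum.cong) (auto simp: Var_def mult_single)
  finally show ?thesis by (simp add: sum.If_cases)
qed

context squarefree_system_forms
begin

text \<open>No variable is inverted at the empty index set, so exponents there have no negative
  entries and total degree at least zero.\<close>

lemma cochain_degree_0:
  assumes "c \<in> graded_part (Cech j) e" "e < 0"
  shows "c {} = 0"
proof
  fix x
  show "c {} x = 0 x"
  proof (rule ccontr)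
    assume "c {} x \<noteq> 0 x"
    then have nz: "c {} x \<noteq> 0" by simp
    have "c \<in> Cech j" using assms(1) by (simp add: graded_part_def)
    then have "neg x \<subseteq> {}" by (rule LocD(3)[OF Cech_component(1)[of c j "{}"], OF _ nz])
    then have "\<And>t. 0 \<le> x t" by (auto simp: neg_def not_less)
    then have "0 \<le> tdeg x" by (simp add: tdeg_def sum_nonneg)
    moreover have "at_exp x c \<noteq> 0" using nz by (auto simp: at_exp_def fun_eq_iff)
    then have "tdeg x = e" using graded_cochainsD(3)[OF assms(1)] by blast
    ultimately show False using assms(2) by simp
  qed
qed

lemma graded_Cech_truncate:
  assumes "c \<in> graded_part (Cech j) e"
  shows "truncate e (c A) = c A"
proof
  fix x
  have "c A x = 0" if "tdeg x \<noteq> e"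
    using graded_cochainsD(3)[OF assms, of x] that by (metis at_exp_apply zero_fun_apply)
  then show "truncate e (c A) x = c A x" by (simp add: truncate_def)
qed

lemma graded_CechI:
  assumes "\<And>A. int (card A) = j \<Longrightarrow> c A = truncate e (u A) \<and> u A \<in> Loc A" "\<And>A. int (card A) \<noteq> j \<Longrightarrow> c A = 0"
  shows "c \<in> graded_part (Cech j) e"
proof -
  have "tdeg x = e" if "at_exp x c \<noteq> 0" for x
  proof (rule ccontr)
    assume ne: "tdeg x \<noteq> e"
    have "at_exp x c A = 0" for A
      using ne assms[of A] by (cases "int (card A) = j") (auto simp: at_exp_def truncate_def)
    then show False using that by (auto simp: fun_eq_iff)
  qed
  moreover have "c \<in> Cech j"
    using assms truncate_Loc by (intro CechI) auto
  ultimately show ?thesis by (simp add: graded_part_def)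
qed

text \<open>The division is carried out on each localization separately and without regard to
  degrees. Truncation to degree \<open>e - 1\<close>, and to one degree less for the coefficients of
  the forms, then makes the result homogeneous.\<close>

lemma regular_Cech:
  assumes e: "e < 0" and r: "r < m" and c: "c \<in> graded_part (Cech j) (e - 1)"
    and mem: "cform a (Suc r) c \<in> cs.forms_part r j e"
  shows "c \<in> cs.forms_part r j (e - 1)"
proof -
  obtain k v where k: "k \<in> graded_part (Cech_Rel j) e" and v: "\<And>q. v q \<in> graded_part (Cech j) (e - 1)"
    and eq: "cform a (Suc r) c = k + (\<Sum>q\<in>{1..r}. cform a q (v q))"
    using mem by (auto simp: cs.forms_part_def)
  have ex: "\<exists>k' w. k' \<in> Loc_Rel A \<and> (\<forall>q. w q \<in> Loc A) \<and> c A = k' + (\<Sum>q\<in>{1..r}. lform a q (w q))" for A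
  proof (cases "A = {}")
    case True
    have "c A = 0" unfolding True using cochain_degree_0[OF c] e by simp
    moreover have "0 \<in> Loc_Rel A" using Loc_0 fun_vs.subspace_0[OF Rel_subspace] by (auto simp: Loc_Rel_def)
    moreover have "(\<Sum>q\<in>{1..r}. lform a q 0) = (0 :: ('a \<Rightarrow> int) \<Rightarrow> 'b \<Rightarrow> 'c)" by (simp only: lform.\<theta>_0 sum.neutral_const)
    ultimately show ?thesis using Loc_0[of A] by (intro exI[of _ 0] exI[of _ "\<lambda>_. 0"]) simp
  next
    case False
    have "lform a (Suc r) (c A) = k A + (\<Sum>q\<in>{1..r}. lform a q (v q A))"
      using fun_cong[OF eq, of A] by (simp add: cform_def sum_fun_apply)
    moreover have "c \<in> Cech j" "k \<in> Cech_Rel j" "\<And>q. v q \<in> Cech j"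
      using c k v by (simp_all add: graded_part_def)
    then have "c A \<in> Loc A" "k A \<in> Loc_Rel A" "\<And>q. v q A \<in> Loc A"
      using Cech_component(1) Cech_Rel_component by blast+
    ultimately show ?thesis
      using lform.regular_modD[OF regular_Loc[OF gp False] r, of "c A" "k A" "\<lambda>q. v q A" thesis for thesis] by blast
  qed
  obtain k' w where k': "\<And>A. k' A \<in> Loc_Rel A" and w: "\<And>A q. w A q \<in> Loc A"
    and cA: "\<And>A. c A = k' A + (\<Sum>q\<in>{1..r}. lform a q (w A q))"
  proof -
    have "\<exists>k'. \<forall>A. \<exists>w. k' A \<in> Loc_Rel A \<and> (\<forall>q. w q \<in> Loc A) \<and> c A = k' A + (\<Sum>q\<in>{1..r}. lform a q (w q))"
      by (rule choice) (rule allI, rule ex)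
    then obtain k' where "\<forall>A. \<exists>w. k' A \<in> Loc_Rel A \<and> (\<forall>q. w q \<in> Loc A) \<and> c A = k' A + (\<Sum>q\<in>{1..r}. lform a q (w q))"
      by (rule exE)
    then have "\<exists>w. \<forall>A. k' A \<in> Loc_Rel A \<and> (\<forall>q. w A q \<in> Loc A) \<and> c A = k' A + (\<Sum>q\<in>{1..r}. lform a q (w A q))"
      by (rule choice)
    then show thesis using that by blast
  qed
  define K where "K A = (if int (card A) = j then truncate (e - 1) (k' A) else 0)" for A
  define w' where "w' q A = (if int (card A) = j then truncate (e - 1 - 1) (w A q) else 0)" for q A
  have w': "w' q \<in> graded_part (Cech j) (e - 1 - 1)" for q
    using w by (intro graded_CechI[where u = "\<lambda>A. w A q"]) (auto simp: w'_def)
  have K: "K \<in> graded_part (Cech_Rel j) (e - 1)"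
  proof -
    have "K \<in> graded_part (Cech j) (e - 1)"
      using k' by (intro graded_CechI[where u = k']) (auto simp: K_def Loc_Rel_def)
    moreover have "K \<in> Cech_Rel j"
      using k' truncate_Loc_Rel by (intro Cech_RelI) (auto simp: K_def)
    ultimately show ?thesis by (simp add: graded_part_def)
  qed
  have "c = K + (\<Sum>q\<in>{1..r}. cform a q (w' q))"
  proof
    fix A
    show "c A = (K + (\<Sum>q\<in>{1..r}. cform a q (w' q))) A"
    proof (cases "int (card A) = j")
      case True
      have "c A = truncate (e - 1) (c A)" using graded_Cech_truncate[OF c] by simp
      also have "\<dots> = truncate (e - 1) (k' A) + (\<Sum>q\<in>{1..r}. truncate (e - 1) (lform a q (w A q)))"
        by (subst cA) (simp only: truncate_add truncate_sum)
      also have "\<dots> = K A + (\<Sum>q\<in>{1..r}. lform a q (w' q A))"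
        by (simp only: truncate_lform K_def w'_def if_P[OF True])
      finally show ?thesis by (simp add: sum_fun_apply cform_def)
    next
      case False
      then have "c A = 0" using c Cech_component(2) by (auto simp: graded_part_def)
      moreover have "lform a q 0 = 0" for q by (rule lform.\<theta>_0)
      ultimately show ?thesis using False by (simp add: K_def w'_def sum_fun_apply cform_def)
    qed
  qed
  then show ?thesis
    unfolding cs.forms_part_def using K w' by blast
qed

sublocale rs: regular_cochain_system cscale "cform a" cdiff "\<lambda>j. graded_part (Cech j)" "\<lambda>j. graded_part (Cech_Rel j)" m
  by unfold_locales (rule regular_Cech)

lemma cocycles_eq: "cs.cocycles_mod 0 j e = graded_part (cochains (LZ j)) e"
proof (intro equalityI subsetI)
  fix c assume "c \<in> cs.cocycles_mod 0 j e"
  then have "c \<in> graded_part (Cech j) e" "cdiff c \<in> graded_part (Cech_Rel (j + 1)) e"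
    by (simp_all add: cs.cocycles_mod_def cs.forms_part_0)
  then show "c \<in> graded_part (cochains (LZ j)) e"
    by (auto simp: graded_part_def cochains_def LZ_def at_exp_cdiff)
next
  fix c assume c: "c \<in> graded_part (cochains (LZ j)) e"
  then have "c \<in> graded_part (Cech j) e"
    by (auto simp: graded_part_def cochains_def LZ_def)
  moreover have "cdiff c \<in> graded_part (Cech_Rel (j + 1)) e"
    using c by (intro graded_cdiff[OF c] cdiff_cochains[where P = "LZ j"]) (auto simp: graded_part_def LZ_def)
  ultimately show "c \<in> cs.cocycles_mod 0 j e"
    by (simp add: cs.cocycles_mod_def cs.forms_part_0)
qed

text \<open>Degreewise coboundaries form a coboundary once the bounding elements are chosen in each
  degree; the choice has to be zero wherever \<open>c\<close> is zero, so that the chosen cochain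
  has finite support.\<close>

lemma coboundaries_eq: "cs.coboundaries_mod 0 j e = graded_part (cochains (LB j)) e"
proof (intro equalityI subsetI)
  fix c assume "c \<in> cs.coboundaries_mod 0 j e"
  then obtain b t where b: "b \<in> graded_part (Cech (j - 1)) e" and t: "t \<in> graded_part (Cech_Rel j) e" and c: "c = cdiff b + t"
    by (auto simp: cs.coboundaries_mod_def cs.forms_part_0)
  have "ldiff z \<in> LB j x" if "z \<in> LC (j - 1) x" for z x
    using LBI[OF that loc_vs.subspace_0[OF LR_subspace]] by simp
  then have "cdiff b \<in> graded_part (cochains (LB j)) e"
    using b by (intro graded_cdiff[OF b] cdiff_cochains[where P = "LC (j - 1)"]) (auto simp: graded_part_def)
  moreover have "LR j x \<subseteq> LB j x" for x
    using LBI[OF loc_vs.subspace_0[OF LC_subspace], of _ j x] by (auto simp: ldiff_0)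
  then have "t \<in> graded_part (cochains (LB j)) e"
    using t by (auto simp: graded_part_def cochains_def)
  ultimately show "c \<in> graded_part (cochains (LB j)) e"
    unfolding c by (rule cochain_vs.subspace_add[OF graded_cochains_subspace[OF LB_subspace]])
next
  fix c assume c: "c \<in> graded_part (cochains (LB j)) e"
  have "\<forall>x. \<exists>b. b \<in> LC (j - 1) x \<and> at_exp x c - ldiff b \<in> LR j x \<and> (at_exp x c = 0 \<longrightarrow> b = 0)"
  proof
    fix x
    show "\<exists>b. b \<in> LC (j - 1) x \<and> at_exp x c - ldiff b \<in> LR j x \<and> (at_exp x c = 0 \<longrightarrow> b = 0)"
    proof (cases "at_exp x c = 0")
      case True
      then show ?thesis
        using loc_vs.subspace_0[OF LC_subspace] loc_vs.subspace_0[OF LR_subspace] by (intro exI[of _ 0]) (simp add: ldiff_0)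
    next
      case False
      have "at_exp x c \<in> LB j x" using graded_cochainsD(2)[OF c] .
      then obtain b r where "b \<in> LC (j - 1) x" "r \<in> LR j x" "at_exp x c = ldiff b + r" by (rule LBE)
      then show ?thesis using False by (intro exI[of _ b]) simp
    qed
  qed
  then obtain b where b: "\<And>x. b x \<in> LC (j - 1) x" "\<And>x. at_exp x c - ldiff (b x) \<in> LR j x" "\<And>x. at_exp x c = 0 \<Longrightarrow> b x = 0"
    by metis
  define b' where "b' = (\<lambda>A x. b x A)"
  have at_b': "at_exp x b' = b x" for x by (simp add: at_exp_def b'_def)
  have b': "b' \<in> graded_part (Cech (j - 1)) e"
  proof (rule graded_cochainsI)
    show "finite {x. at_exp x b' \<noteq> 0}"
      using graded_cochainsD(1)[OF c] by (rule rev_finite_subset) (use at_b' b(3) in auto)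
    show "tdeg x = e" if "at_exp x b' \<noteq> 0" for x
      using graded_cochainsD(3)[OF c, of x] that at_b' b(3) by auto
  qed (simp add: at_b' b)
  have "c - cdiff b' \<in> graded_part (Cech_Rel j) e"
  proof (rule graded_cochainsI)
    have zero: "at_exp x (c - cdiff b') = 0" if "at_exp x c = 0" for x
      using that b(3)[OF that] by (simp add: at_exp_diff at_exp_cdiff at_b' ldiff_0)
    show "finite {x. at_exp x (c - cdiff b') \<noteq> 0}"
      using graded_cochainsD(1)[OF c] by (rule rev_finite_subset) (use zero in auto)
    show "tdeg x = e" if "at_exp x (c - cdiff b') \<noteq> 0" for x
      using graded_cochainsD(3)[OF c, of x] that zero by auto
    show "at_exp x (c - cdiff b') \<in> LR j x" for x
      using b(2) by (simp add: at_exp_diff at_exp_cdiff at_b')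
  qed
  then have "cdiff b' + (c - cdiff b') \<in> cs.coboundaries_mod 0 j e"
    using b' by (intro cs.coboundaries_modI) (simp_all add: cs.forms_part_0)
  then show "c \<in> cs.coboundaries_mod 0 j e" by simp
qed

subsection \<open>Coregularity on the cohomology in low degrees\<close>

text \<open>In degrees with nonpositive entries the cohomology depends only on the set of negative entries.
  The cohomology is filtered by the size of that set; each layer is dual to polynomial rings.\<close>

definition filt_at :: "int \<Rightarrow> nat \<Rightarrow> ('a \<Rightarrow> int) \<Rightarrow> ('a set \<Rightarrow> 'b \<Rightarrow> 'c) set"
  where "filt_at j s x = (if pos x = {} \<and> s < card (neg x) then LB j x else LZ j x)"

definition filt :: "int \<Rightarrow> nat \<Rightarrow> int \<Rightarrow> ('a set \<Rightarrow> ('a \<Rightarrow> int) \<Rightarrow> 'b \<Rightarrow> 'c) set"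
  where "filt j s e = graded_part (cochains (filt_at j s)) e"

lemma filt_at_subspace: "loc_vs.subspace (filt_at j s x)"
  by (simp add: filt_at_def LB_subspace LZ_subspace)

lemma filt_at_sub: "LB j x \<subseteq> filt_at j s x" "filt_at j s x \<subseteq> LZ j x"
  using LB_sub_LZ by (auto simp: filt_at_def)

lemma filt_at_mono: "filt_at j s x \<subseteq> filt_at j (Suc s) x"
  using LB_sub_LZ by (auto simp: filt_at_def)

lemma filt_at_shift: "filt_at j s (x - unit_exp t) \<subseteq> filt_at j s x"
proof (cases "pos x = {} \<and> s < card (neg x)")
  case True
  have "card (neg x) \<le> card (neg (x - unit_exp t))" by (intro card_mono neg_diff_unit) simp
  then have "pos (x - unit_exp t) = {} \<and> s < card (neg (x - unit_exp t))"
    using True pos_diff_unit[of x t] by auto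
  then show ?thesis using True LB_shift by (simp add: filt_at_def)
next
  case False
  then have "filt_at j s x = LZ j x" by (simp only: filt_at_def if_False)
  then show ?thesis using LZ_shift[of j x t] filt_at_sub(2)[of j s "x - unit_exp t"] by blast
qed

lemma filt_stable: "cs.graded_stable (filt j s)"
  unfolding cs.graded_stable_def filt_def
proof (intro allI conjI ballI)
  fix e
  note sub = graded_cochains_subspace[OF filt_at_subspace]
  show "0 \<in> graded_part (cochains (filt_at j s)) e" by (rule cochain_vs.subspace_0[OF sub])
  show "x - y \<in> graded_part (cochains (filt_at j s)) e"
    if "x \<in> graded_part (cochains (filt_at j s)) e" "y \<in> graded_part (cochains (filt_at j s)) e" for x y
    using that by (rule cochain_vs.subspace_diff[OF sub])
  show "cform a q x \<in> graded_part (cochains (filt_at j s)) (e + 1)"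
    if x: "x \<in> graded_part (cochains (filt_at j s)) e" for q x
    using x by (intro graded_cform[OF x] cform_cochains filt_at_subspace filt_at_shift) (simp add: graded_part_def)
qed

lemma filt_mono: "filt j s e \<subseteq> filt j (Suc s) e"
  unfolding filt_def by (intro graded_cochains_mono filt_at_mono filt_at_subspace)

lemma filt_top: "filt j (card (UNIV :: 'a set)) e = cs.cocycles_mod 0 j e"
proof -
  have "\<not> card (UNIV :: 'a set) < card (neg x)" for x :: "'a \<Rightarrow> int" by (simp add: card_mono not_less)
  then have "filt_at j (card (UNIV :: 'a set)) = LZ j" by (intro ext) (simp add: filt_at_def)
  then show ?thesis by (simp add: filt_def cocycles_eq)
qed

text \<open>A vector of negative total degree has a negative entry. Without positive entries its
  negative support is thus nonempty and \<open>filt_at j 0\<close> is already \<open>LB\<close>;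
  with a positive entry \<open>LZ\<close> and \<open>LB\<close> agree by
  \<open>acyclic\<close>.\<close>

lemma filt_bottom:
  assumes "e < 0"
  shows "filt j 0 e = cs.coboundaries_mod 0 j e"
proof
  show "cs.coboundaries_mod 0 j e \<subseteq> filt j 0 e"
    unfolding filt_def coboundaries_eq by (intro graded_cochains_mono filt_at_sub filt_at_subspace)
  have "filt_at j 0 x \<subseteq> LB j x" if x: "tdeg x = e" for x
  proof (cases "pos x = {}")
    case True
    have "neg x \<noteq> {}"
    proof
      assume "neg x = {}"
      then have "\<And>t. 0 \<le> x t" by (auto simp: neg_def not_less)
      then have "0 \<le> tdeg x" by (simp add: tdeg_def sum_nonneg)
      then show False using x assms by simp
    qed
    then have "0 < card (neg x)" by (simp add: card_gt_0_iff)
    then show ?thesis using True by (simp add: filt_at_def)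
  next
    case False
    then show ?thesis using acyclic by (simp add: filt_at_def)
  qed
  then show "filt j 0 e \<subseteq> cs.coboundaries_mod 0 j e"
    unfolding filt_def coboundaries_eq by (intro graded_cochains_mono LB_subspace)
qed

text \<open>The linear map with prescribed values on monomials. Linear maps from the polynomial ring
  to families of coefficients describe the layers of the cohomology as graded duals.\<close>

definition mono_ext :: "(('a \<Rightarrow>\<^sub>0 nat) \<Rightarrow> 'a set \<Rightarrow> 'b \<Rightarrow> 'c) \<Rightarrow> ('a, 'c) mpoly \<Rightarrow> 'a set \<Rightarrow> 'b \<Rightarrow> 'c"
  where "mono_ext \<nu> f = (\<Sum>k\<in>Poly_Mapping.keys f. lscale (Poly_Mapping.lookup f k) (\<nu> k))"

lemma mono_ext_superset:
  "finite K \<Longrightarrow> Poly_Mapping.keys f \<subseteq> K \<Longrightarrow> mono_ext \<nu> f = (\<Sum>k\<in>K. lscale (Poly_Mapping.lookup f k) (\<nu> k))"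
  unfolding mono_ext_def by (intro sum.mono_neutral_left) (auto simp: in_keys_iff)

lemma mono_ext_linear: "Vector_Spaces.linear pscale lscale (mono_ext \<nu>)"
  unfolding Vector_Spaces.linear_iff
proof (intro conjI allI vector_space_pscale loc_vs.vector_space_axioms)
  fix f g :: "('a, 'c) mpoly"
  have "Poly_Mapping.keys (f + g) \<subseteq> Poly_Mapping.keys f \<union> Poly_Mapping.keys g" by (rule keys_add)
  then show "mono_ext \<nu> (f + g) = mono_ext \<nu> f + mono_ext \<nu> g"
    by (simp only: mono_ext_superset[of "Poly_Mapping.keys f \<union> Poly_Mapping.keys g"] finite_Un finite_keys Un_upper1 Un_upper2
      lookup_add loc_vs.scale_left_distrib sum.distrib simp_thms)
  fix c
  have "Poly_Mapping.keys (Const c * f) \<subseteq> Poly_Mapping.keys f" by (auto simp: in_keys_iff lookup_Const_mult)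
  then show "mono_ext \<nu> (Const c * f) = lscale c (mono_ext \<nu> f)"
    by (simp only: mono_ext_superset[of "Poly_Mapping.keys f"] finite_keys order_refl lookup_Const_mult
      loc_vs.scale_sum_right loc_vs.scale_scale)
qed

lemma mono_ext_single: "mono_ext \<nu> (Poly_Mapping.single k 1) = \<nu> k"
  by (simp add: mono_ext_def)

lemma linear_mpoly_zero:
  assumes W: "Vector_Spaces.linear pscale lscale W" and 0: "\<And>k. W (Poly_Mapping.single k 1) = 0"
  shows "W f = 0"
proof -
  interpret W: Vector_Spaces.linear pscale lscale W by fact
  have "f = (\<Sum>k\<in>Poly_Mapping.keys f. Const (Poly_Mapping.lookup f k) * Poly_Mapping.single k 1)"
    unfolding single_eq_Const_mult[symmetric] by (rule poly_mapping_sum_single[symmetric])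
  then have "W f = (\<Sum>k\<in>Poly_Mapping.keys f. lscale (Poly_Mapping.lookup f k) (W (Poly_Mapping.single k 1)))"
    by (metis (no_types, lifting) W.sum W.scale sum.cong)
  then show ?thesis by (simp only: 0 loc_vs.scale_zero_right sum.neutral_const)
qed

text \<open>This parametrizes the exponents with negative support \<open>G\<close> and no positive
  entry by the monomials in the variables of \<open>G\<close>. A larger monomial gives a lower
  exponent, which is the reversal of degrees in the duality.\<close>

definition expo :: "'a set \<Rightarrow> ('a \<Rightarrow>\<^sub>0 nat) \<Rightarrow> 'a \<Rightarrow> int"
  where "expo G k = (\<lambda>t. - ind G t - int (Poly_Mapping.lookup k t))"

lemma expo_single: "expo G (Poly_Mapping.single t 1 + k) = expo G k - unit_exp t"
  by (auto simp: expo_def fun_eq_iff lookup_add lookup_single unit_exp_def when_def)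

lemma expo_signs:
  assumes "Poly_Mapping.keys k \<subseteq> G"
  shows "pos (expo G k) = {}" "neg (expo G k) = G"
  using assms by (auto simp: expo_def pos_def neg_def ind_def in_keys_iff subset_iff)

lemma expo_to_exp:
  assumes "pos x = {}"
  shows "expo (neg x) (to_exp (- ind (neg x) - x)) = x" "Poly_Mapping.keys (to_exp (- ind (neg x) - x)) \<subseteq> neg x"
proof -
  have *: "x t \<le> 0" for t using assms by (auto simp: pos_def not_less)
  show "expo (neg x) (to_exp (- ind (neg x) - x)) = x"
  proof
    fix t show "expo (neg x) (to_exp (- ind (neg x) - x)) t = x t"
      using *[of t] by (auto simp: expo_def ind_def neg_def)
  qed
  show "Poly_Mapping.keys (to_exp (- ind (neg x) - x)) \<subseteq> neg x"
  proof
    fix t assume "t \<in> Poly_Mapping.keys (to_exp (- ind (neg x) - x))"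
    then have "x t \<noteq> 0" using *[of t] by (auto simp: in_keys_iff ind_def neg_def split: if_splits)
    then show "t \<in> neg x" using *[of t] by (simp add: neg_def)
  qed
qed

text \<open>The layer of \<open>u\<close> at \<open>G\<close> is encoded by the functional
  \<open>U\<close> that sends a monomial \<open>k\<close> to the class of \<open>u\<close> in degree
  \<open>expo G k\<close>. Multiplying the argument by a form corresponds to applying the form to
  \<open>u\<close>. So \<open>ann\<close> says that the first \<open>r\<close> forms annihilate
  \<open>U\<close>, and to divide \<open>u\<close> by the next form is to divide \<open>U\<close> by
  it. If \<open>G\<close> has at most \<open>r\<close> elements, its variables are combinations of
  the first \<open>r\<close> forms; then \<open>U\<close> vanishes on all nonconstant monomials, and
  \<open>e\<close> is too low for the constant one to matter.\<close>

lemma layer_dual: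
  assumes r: "r < m" and G: "card G = Suc s" and e: "e < - int (Suc s)"
    and u: "u \<in> filt j (Suc s) e" and ann: "\<And>q. q \<in> {0<..r} \<Longrightarrow> cform a q u \<in> filt j s (e + 1)"
  shows "\<exists>W. Vector_Spaces.linear pscale lscale W \<and> (\<forall>f. W f \<in> LZ j (- ind G)) \<and>
    (\<forall>q\<in>{0<..r}. \<forall>f. W (restr_form a G q * f) = 0) \<and>
    (\<forall>k. Poly_Mapping.keys k \<subseteq> G \<longrightarrow>
      at_exp (expo G k) u - W (restr_form a G (Suc r) * Poly_Mapping.single k 1) \<in> LB j (- ind G))"
proof -
  have G0: "pos (- ind G) = {}" "neg (- ind G) = G" by (auto simp: pos_def neg_def ind_def)
  obtain \<pi> where \<pi>: "Vector_Spaces.linear lscale lscale \<pi>" "\<And>z. z \<in> LB j (- ind G) \<Longrightarrow> \<pi> z = 0"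
    "\<And>z. z - \<pi> z \<in> LB j (- ind G)"
    using loc_vs.exists_projection_along[OF LB_subspace] by metis
  obtain \<rho> where \<rho>: "Vector_Spaces.linear lscale lscale \<rho>" "\<And>z. z \<in> LZ j (- ind G) \<Longrightarrow> \<rho> z = 0"
    "\<And>z. z - \<rho> z \<in> LZ j (- ind G)"
    using loc_vs.exists_projection_along[OF LZ_subspace] by metis
  interpret \<pi>: Vector_Spaces.linear lscale lscale \<pi> by (rule \<pi>(1))
  \<comment> \<open>Representatives modulo coboundaries are chosen linearly by \<open>\<pi>\<close>,
    so that annihilation modulo \<open>LB\<close> becomes annihilation on the nose.\<close>
  define \<nu> where "\<nu> k = (if Poly_Mapping.keys k \<subseteq> G then \<pi> (at_exp (expo G k) u) else 0)" for k
  define U where "U = mono_ext \<nu>"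
  have U: "Vector_Spaces.linear pscale lscale U" unfolding U_def by (rule mono_ext_linear)
  interpret U: Vector_Spaces.linear pscale lscale U by (rule U)
  have U_single: "U (Poly_Mapping.single k 1) = \<nu> k" for k by (simp add: U_def mono_ext_single)
  have uLZ: "at_exp x u \<in> LZ j x" for x
    using graded_cochainsD(2)[OF u[unfolded filt_def]] filt_at_sub(2) by blast
  have U_form: "U (restr_form a G q * Poly_Mapping.single k 1) =
      (if Poly_Mapping.keys k \<subseteq> G then \<pi> (at_exp (expo G k) (cform a q u)) else 0)" for q k
  proof -
    have keys: "Poly_Mapping.keys (Poly_Mapping.single t 1 + k) = insert t (Poly_Mapping.keys k)" for t
      by (auto simp: in_keys_iff lookup_add lookup_single when_def split: if_splits)
    have lhs: "U (restr_form a G q * Poly_Mapping.single k 1) = (\<Sum>t\<in>G. lscale (a (t, q)) (\<nu> (Poly_Mapping.single t 1 + k)))"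
      unfolding restr_form_single by (simp only: U.sum U.scale U_single)
    show ?thesis
    proof (cases "Poly_Mapping.keys k \<subseteq> G")
      case True
      \<comment> \<open>A variable outside \<open>G\<close> would enlarge the negative support
        beyond size \<open>Suc s\<close>, and there the filtration requires \<open>u\<close> to be a
        coboundary.\<close>
      have out: "\<pi> (at_exp (expo G k - unit_exp t) u) = 0" if "t \<notin> G" for t
      proof -
        let ?y = "expo G k - unit_exp t"
        have "pos ?y = {}" using expo_signs(1)[OF True] pos_diff_unit[of "expo G k" t] by blast
        moreover have "insert t G \<subseteq> neg ?y"
        proof -
          have "G \<subseteq> neg ?y" using expo_signs(2)[OF True] neg_diff_unit[of "expo G k" t] by blast
          moreover have "expo G k t \<le> 0" using expo_signs(1)[OF True] by (auto simp: pos_def not_less)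
          then have "t \<in> neg ?y" by (simp add: neg_def unit_exp_def)
          ultimately show ?thesis by blast
        qed
        then have "card (insert t G) \<le> card (neg ?y)" by (intro card_mono) auto
        then have "Suc s < card (neg ?y)" using that G by (simp)
        ultimately have "at_exp ?y u \<in> LB j ?y"
          using graded_cochainsD(2)[OF u[unfolded filt_def], of ?y] by (simp add: filt_at_def)
        also have "LB j ?y \<subseteq> LB j (- ind G)"
          using \<open>insert t G \<subseteq> neg ?y\<close> \<open>pos ?y = {}\<close> G0 by (intro LB_mono) auto
        finally show ?thesis by (rule \<pi>(2))
      qed
      have "(\<Sum>t\<in>G. lscale (a (t, q)) (\<nu> (Poly_Mapping.single t 1 + k))) =
          (\<Sum>t\<in>G. lscale (a (t, q)) (\<pi> (at_exp (expo G k - unit_exp t) u)))"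
        using True by (intro sum.cong refl) (simp only: \<nu>_def keys expo_single insert_subset simp_thms if_True)
      also have "\<dots> = (\<Sum>t\<in>UNIV. lscale (a (t, q)) (\<pi> (at_exp (expo G k - unit_exp t) u)))"
      proof (rule sum.mono_neutral_left)
        show "\<forall>t\<in>UNIV - G. lscale (a (t, q)) (\<pi> (at_exp (expo G k - unit_exp t) u)) = 0"
        proof
          fix t assume "t \<in> UNIV - G"
          then have "\<pi> (at_exp (expo G k - unit_exp t) u) = 0" by (intro out) simp
          then show "lscale (a (t, q)) (\<pi> (at_exp (expo G k - unit_exp t) u)) = 0" by (simp only: loc_vs.scale_zero_right)
        qed
      qed simp_all
      finally show ?thesis
        unfolding lhs at_exp_cform using True by (simp only: \<pi>.sum \<pi>.scale if_True)
    next
      case False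
      have "\<nu> (Poly_Mapping.single t 1 + k) = 0" for t
        using False unfolding \<nu>_def keys by simp
      then have "(\<Sum>t\<in>G. lscale (a (t, q)) (\<nu> (Poly_Mapping.single t 1 + k))) = 0"
        by (simp only: loc_vs.scale_zero_right sum.neutral_const)
      then show ?thesis using False lhs by simp
    qed
  qed
  have lin_form: "Vector_Spaces.linear pscale lscale (\<lambda>f. W (restr_form a G q * f))"
    if W: "Vector_Spaces.linear pscale lscale W" for W q
  using W vector_space_pscale by (auto simp: Vector_Spaces.linear_iff distrib_left mult.left_commute)
  have U_ann: "U (restr_form a G q * f) = 0" if q: "q \<in> {0<..r}" for q f
  proof (rule linear_mpoly_zero[OF lin_form[OF U]])
    fix k
    show "U (restr_form a G q * Poly_Mapping.single k 1) = 0"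
    proof (cases "Poly_Mapping.keys k \<subseteq> G")
      case True
      let ?y = "expo G k"
      have "at_exp ?y (cform a q u) \<in> filt_at j s ?y"
        using graded_cochainsD(2)[OF ann[OF q, unfolded filt_def]] .
      then have "at_exp ?y (cform a q u) \<in> LB j ?y"
        using expo_signs[OF True] G by (simp add: filt_at_def)
      also have "LB j ?y = LB j (- ind G)"
        using expo_signs[OF True] G0 by (intro LB_cong) simp_all
      finally show ?thesis using \<pi>(2) by (simp add: U_form)
    qed (simp add: U_form)
  qed
  have ran: "{1..r} = {0<..r}" by auto
  have "\<exists>W. Vector_Spaces.linear pscale lscale W \<and> (\<forall>f. W (restr_form a G (Suc r) * f) = U f) \<and>
    (\<forall>q\<in>{1..r}. \<forall>f. W (restr_form a G q * f) = 0)"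
  proof (cases "r < card G")
    case True
    show ?thesis
      by (rule restr_forms_coregular[OF gp r True U]) (simp only: U_ann ran)
  next
    case False
    have "U f = 0" for f
    proof (rule linear_mpoly_zero[OF U])
      fix k
      show "U (Poly_Mapping.single k 1) = 0"
      proof (rule ccontr)
        assume "U (Poly_Mapping.single k 1) \<noteq> 0"
        then have nz: "\<nu> k \<noteq> 0" by (simp add: U_single)
        then have kG: "Poly_Mapping.keys k \<subseteq> G" and nz': "at_exp (expo G k) u \<noteq> 0"
          by (auto simp: \<nu>_def \<pi>.zero split: if_splits)
        have "tdeg (expo G k) = e"
          using graded_cochainsD(3)[OF u[unfolded filt_def] nz'] .
        moreover have "tdeg (expo G k) = - int (card G) - (\<Sum>t\<in>UNIV. int (Poly_Mapping.lookup k t))"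
          by (simp add: tdeg_def expo_def ind_def sum_subtractf sum_negf sum.If_cases)
        \<comment> \<open>Since \<open>e\<close> is below \<open>- card G\<close>, the monomial
          \<open>k\<close> is not constant, and some variable \<open>t\<close> of \<open>G\<close>
          divides it.\<close>
        ultimately have "(\<Sum>t\<in>UNIV. int (Poly_Mapping.lookup k t)) > 0" using e G by simp
        then obtain t where t: "Poly_Mapping.lookup k t \<noteq> 0"
          by (metis less_irrefl of_nat_0 sum.neutral)
        then have tG: "t \<in> G" using kG by (auto simp: in_keys_iff)
        obtain c where c: "Var t = (\<Sum>q\<in>{1..r}. restr_form a G q * Const (c q))"
          using Var_in_restr_forms[OF gp r _ tG] False by (meson not_less)
        define k' where "k' = k - Poly_Mapping.single t 1"
        have "k = Poly_Mapping.single t 1 + k'"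
          using t by (intro poly_mapping_eqI) (auto simp: k'_def lookup_add lookup_minus lookup_single when_def)
        then have "Poly_Mapping.single k 1 = Var t * Poly_Mapping.single k' (1 :: 'c)"
          by (simp add: Var_def mult_single)
        also have "\<dots> = (\<Sum>q\<in>{1..r}. restr_form a G q * (Const (c q) * Poly_Mapping.single k' 1))"
          unfolding c by (simp add: sum_distrib_right mult.assoc)
        finally have "U (Poly_Mapping.single k 1) = 0"
          unfolding ran by (simp only: U.sum U_ann sum.neutral_const)
            (metis (no_types, lifting) U_ann sum.neutral)
        then show False using nz by (simp add: U_single)
      qed
    qed
    moreover have "Vector_Spaces.linear pscale lscale (\<lambda>_. 0)"
      using vector_space_pscale loc_vs.vector_space_axioms by (simp add: Vector_Spaces.linear_iff)
    ultimately show ?thesis by (intro exI[of _ "\<lambda>_. 0"]) simp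
  qed
  then obtain W where W: "Vector_Spaces.linear pscale lscale W" "\<And>f. W (restr_form a G (Suc r) * f) = U f"
    "\<And>q f. q \<in> {1..r} \<Longrightarrow> W (restr_form a G q * f) = 0" by metis
  interpret W: Vector_Spaces.linear pscale lscale W by (rule W(1))
  interpret \<rho>: Vector_Spaces.linear lscale lscale \<rho> by (rule \<rho>(1))
  \<comment> \<open>The values of \<open>W\<close> are arbitrary families. Subtracting their
    projection along \<open>LZ\<close> makes them cocycles; the required equations survive, since
    the values on multiples of the forms in question are zero or cocycles already.\<close>
  have lin: "Vector_Spaces.linear pscale lscale (\<lambda>f. W f - \<rho> (W f))"
    unfolding Vector_Spaces.linear_iff
    using vector_space_pscale loc_vs.vector_space_axioms
    by (simp add: W.add W.scale \<rho>.add \<rho>.scale loc_vs.scale_right_diff_distrib add_diff_add)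
  show ?thesis
  proof (intro exI[of _ "\<lambda>f. W f - \<rho> (W f)"] conjI allI ballI impI lin)
    show "W f - \<rho> (W f) \<in> LZ j (- ind G)" for f by (rule \<rho>(3))
    show "W (restr_form a G q * f) - \<rho> (W (restr_form a G q * f)) = 0" if "q \<in> {0<..r}" for q f
      using that W(3) unfolding ran by (simp only: \<rho>.zero diff_self)
    fix k :: "'a \<Rightarrow>\<^sub>0 nat" assume k: "Poly_Mapping.keys k \<subseteq> G"
    have cong: "LZ j (expo G k) = LZ j (- ind G)"
      using expo_signs[OF k] G0 by (intro LZ_cong) simp_all
    have "W (restr_form a G (Suc r) * Poly_Mapping.single k 1) = \<pi> (at_exp (expo G k) u)"
      using k by (simp add: W(2) U_single \<nu>_def)
    moreover have "at_exp (expo G k) u - \<pi> (at_exp (expo G k) u) \<in> LZ j (- ind G)"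
      using \<pi>(3) LB_sub_LZ by blast
    from loc_vs.subspace_diff[OF LZ_subspace uLZ[of "expo G k", unfolded cong] this]
    have "\<rho> (\<pi> (at_exp (expo G k) u)) = 0" by (intro \<rho>(2)) simp
    ultimately show "at_exp (expo G k) u - (W (restr_form a G (Suc r) * Poly_Mapping.single k 1) -
        \<rho> (W (restr_form a G (Suc r) * Poly_Mapping.single k 1))) \<in> LB j (- ind G)"
      using \<pi>(3) by simp
  qed
qed

end

context squarefree_system_forms
begin

text \<open>The functionals obtained for the various sets \<open>G\<close> of size
  \<open>Suc s\<close> live in disjoint sets of degrees. Reading each of them back through
  \<open>expo\<close> assembles them to one cochain, one degree lower, that the next form sends to
  \<open>u\<close> up to the next step of the filtration.\<close>

lemma coregular_layer: "cs.coregular_mod 0 m (filt j (Suc s)) (filt j s)"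
proof (rule cs.coregular_modI)
  fix r :: nat assume r: "0 \<le> r" "r < m"
  show "\<exists>e0. \<forall>e<e0. \<forall>u\<in>filt j (Suc s) e. (\<forall>q\<in>{0<..r}. cform a q u \<in> filt j s (e + 1)) \<longrightarrow>
    (\<exists>w\<in>filt j (Suc s) (e - 1). (\<forall>q\<in>{0<..r}. cform a q w \<in> filt j s e) \<and> u - cform a (Suc r) w \<in> filt j s e)"
  proof (intro exI[of _ "- int (Suc s)"] allI impI ballI)
    fix e u
    assume e: "e < - int (Suc s)" and u: "u \<in> filt j (Suc s) e"
      and ann: "\<forall>q\<in>{0<..r}. cform a q u \<in> filt j s (e + 1)"
    have "\<forall>G\<in>{G :: 'a set. card G = Suc s}. \<exists>W. Vector_Spaces.linear pscale lscale W \<and> (\<forall>f. W f \<in> LZ j (- ind G)) \<and>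
      (\<forall>q\<in>{0<..r}. \<forall>f. W (restr_form a G q * f) = 0) \<and>
      (\<forall>k. Poly_Mapping.keys k \<subseteq> G \<longrightarrow>
        at_exp (expo G k) u - W (restr_form a G (Suc r) * Poly_Mapping.single k 1) \<in> LB j (- ind G))"
      using layer_dual[OF r(2) _ e u] ann by blast
    from bchoice[OF this] obtain W where W_all: "\<forall>G\<in>{G :: 'a set. card G = Suc s}. Vector_Spaces.linear pscale lscale (W G) \<and>
      (\<forall>f. W G f \<in> LZ j (- ind G)) \<and> (\<forall>q\<in>{0<..r}. \<forall>f. W G (restr_form a G q * f) = 0) \<and>
      (\<forall>k. Poly_Mapping.keys k \<subseteq> G \<longrightarrow>
        at_exp (expo G k) u - W G (restr_form a G (Suc r) * Poly_Mapping.single k 1) \<in> LB j (- ind G))"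
      by (rule exE)
    have W: "Vector_Spaces.linear pscale lscale (W G)" "W G f \<in> LZ j (- ind G)"
      "q \<in> {0<..r} \<Longrightarrow> W G (restr_form a G q * f) = 0"
      "Poly_Mapping.keys k \<subseteq> G \<Longrightarrow> at_exp (expo G k) u - W G (restr_form a G (Suc r) * Poly_Mapping.single k 1) \<in> LB j (- ind G)"
      if "card G = Suc s" for G f q k
      using W_all that by blast+
    \<comment> \<open>The monomial is the inverse image of \<open>x\<close> under
      \<open>expo\<close>. Requiring total degree \<open>e - 1\<close> makes the cochain homogeneous
      and, by \<open>finite_nonpos_exps\<close>, of finite support.\<close>
    define w where "w = (\<lambda>A x. if pos x = {} \<and> card (neg x) = Suc s \<and> tdeg x = e - 1
      then W (neg x) (Poly_Mapping.single (to_exp (- ind (neg x) - x)) 1) A else 0)"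
    have at_w: "at_exp x w = (if pos x = {} \<and> card (neg x) = Suc s \<and> tdeg x = e - 1
      then W (neg x) (Poly_Mapping.single (to_exp (- ind (neg x) - x)) 1) else 0)" for x
      by (auto simp: w_def at_exp_def fun_eq_iff)
    have signs: "pos (- ind G) = {}" "neg (- ind G) = G" for G :: "'a set"
      by (auto simp: pos_def neg_def ind_def)
    \<comment> \<open>Subtracting a unit vector keeps or enlarges the negative support. Above size
      \<open>Suc s\<close> nothing of \<open>w\<close> is therefore visible, and at size
      \<open>Suc s\<close> only the variables inside the support contribute, which yields the
      restricted form.\<close>
    have at_form_w: "at_exp y (cform a q w) = (if tdeg y = e \<and> card (neg y) = Suc s
        then W (neg y) (restr_form a (neg y) q * Poly_Mapping.single (to_exp (- ind (neg y) - y)) 1) else 0)"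
      if y: "pos y = {}" and s: "s < card (neg y)" for y q
    proof (cases "tdeg y = e \<and> card (neg y) = Suc s")
      case False
      have "at_exp (y - unit_exp t) w = 0" for t
      proof -
        have "tdeg (y - unit_exp t) \<noteq> e - 1 \<or> card (neg (y - unit_exp t)) \<noteq> Suc s"
        proof (cases "tdeg y = e")
          case True
          then have "Suc s < card (neg y)" using False s by auto
          also have "card (neg y) \<le> card (neg (y - unit_exp t))" by (intro card_mono neg_diff_unit) simp
          finally show ?thesis by simp
        qed (simp add: tdeg_unit)
        then show ?thesis by (auto simp: at_w)
      qed
      then have "at_exp y (cform a q w) = 0" by (simp only: at_exp_cform loc_vs.scale_zero_right sum.neutral_const)
      then show ?thesis by (simp only: if_not_P[OF False])
    next
      case True
      let ?G = "neg y" and ?k = "to_exp (- ind (neg y) - y)"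
      interpret W: Vector_Spaces.linear pscale lscale "W ?G" using W(1) True by blast
      have le: "y t \<le> 0" for t using y by (auto simp: pos_def not_less)
      have pos: "pos (y - unit_exp t) = {}" for t using y pos_diff_unit[of y t] by blast
      have in_G: "at_exp (y - unit_exp t) w = W ?G (Poly_Mapping.single (Poly_Mapping.single t 1 + ?k) 1)" if t: "t \<in> ?G" for t
      proof -
        have n: "neg (y - unit_exp t) = ?G"
          using t le by (auto simp: neg_def unit_exp_def split: if_splits)
        have "to_exp (- ind ?G - (y - unit_exp t)) = Poly_Mapping.single t 1 + ?k"
          using t by (intro poly_mapping_eqI) (auto simp: lookup_add lookup_single when_def unit_exp_def ind_def neg_def nat_add_distrib)
        then show ?thesis using True n pos by (simp add: at_w tdeg_unit)
      qed
      have out: "at_exp (y - unit_exp t) w = 0" if t: "t \<notin> ?G" for t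
      proof -
        have "insert t ?G \<subseteq> neg (y - unit_exp t)"
          using neg_diff_unit[of y t] le[of t] by (auto simp: neg_def unit_exp_def)
        then have "card (insert t ?G) \<le> card (neg (y - unit_exp t))" by (intro card_mono) auto
        then have "card (neg (y - unit_exp t)) \<noteq> Suc s" using t True by simp
        then show ?thesis by (simp add: at_w)
      qed
      have "at_exp y (cform a q w) = (\<Sum>t\<in>?G. lscale (a (t, q)) (at_exp (y - unit_exp t) w))"
        unfolding at_exp_cform
      proof (rule sum.mono_neutral_right)
        show "\<forall>t\<in>UNIV - ?G. lscale (a (t, q)) (at_exp (y - unit_exp t) w) = 0"
        proof
          fix t assume "t \<in> UNIV - ?G"
          then have "at_exp (y - unit_exp t) w = 0" by (intro out) simp
          then show "lscale (a (t, q)) (at_exp (y - unit_exp t) w) = 0" by (simp only: loc_vs.scale_zero_right)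
        qed
      qed simp_all
      also have "\<dots> = (\<Sum>t\<in>?G. lscale (a (t, q)) (W ?G (Poly_Mapping.single (Poly_Mapping.single t 1 + ?k) 1)))"
        by (intro sum.cong refl) (simp only: in_G)
      also have "\<dots> = W ?G (restr_form a ?G q * Poly_Mapping.single ?k 1)"
        unfolding restr_form_single by (simp only: W.sum W.scale)
      finally show ?thesis using True by simp
    qed
    have w: "w \<in> filt j (Suc s) (e - 1)"
      unfolding filt_def
    proof (rule graded_cochainsI)
      show "finite {x. at_exp x w \<noteq> 0}"
        by (rule finite_subset[OF _ finite_nonpos_exps[of "e - 1"]]) (auto simp: at_w)
      show "tdeg x = e - 1" if "at_exp x w \<noteq> 0" for x
        using that by (auto simp: at_w split: if_splits)
      show "at_exp x w \<in> filt_at j (Suc s) x" for x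
      proof (cases "pos x = {} \<and> card (neg x) = Suc s \<and> tdeg x = e - 1")
        case True
        then have "at_exp x w = W (neg x) (Poly_Mapping.single (to_exp (- ind (neg x) - x)) 1)" by (simp add: at_w)
        also have "\<dots> \<in> LZ j (- ind (neg x))" using W(2) True by blast
        also have "LZ j (- ind (neg x)) = LZ j x" using True signs by (intro LZ_cong) simp_all
        finally show ?thesis using True by (simp add: filt_at_def)
      next
        case False
        then have "at_exp x w = 0" by (auto simp: at_w)
        then show ?thesis by (simp add: loc_vs.subspace_0[OF filt_at_subspace])
      qed
    qed
    show "\<exists>w\<in>filt j (Suc s) (e - 1). (\<forall>q\<in>{0<..r}. cform a q w \<in> filt j s e) \<and> u - cform a (Suc r) w \<in> filt j s e"
    proof (intro bexI[of _ w] conjI ballI w)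
      fix q assume q: "q \<in> {0<..r}"
      have form: "cform a q w \<in> filt j (Suc s) e"
        by (rule cs.graded_stableD(6)[OF filt_stable w])
      show "cform a q w \<in> filt j s e"
        unfolding filt_def
      proof (rule graded_cochainsI)
        fix y
        show "at_exp y (cform a q w) \<in> filt_at j s y"
        proof (cases "pos y = {} \<and> s < card (neg y)")
          case True
          then have "at_exp y (cform a q w) = 0" using at_form_w[of y q] W(3)[OF _ q] by simp
          then show ?thesis by (simp add: loc_vs.subspace_0[OF filt_at_subspace])
        next
          case False
          then show ?thesis
            using graded_cochainsD(2)[OF form[unfolded filt_def], of y] filt_at_sub(2) by (auto simp: filt_at_def split: if_splits)
        qed
      qed (use graded_cochainsD[OF form[unfolded filt_def]] in auto)
    next
      have form: "u - cform a (Suc r) w \<in> filt j (Suc s) e"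
        by (rule cs.graded_stableD(2)[OF filt_stable u cs.graded_stableD(6)[OF filt_stable w]])
      show "u - cform a (Suc r) w \<in> filt j s e"
        unfolding filt_def
      proof (rule graded_cochainsI)
        fix y
        show "at_exp y (u - cform a (Suc r) w) \<in> filt_at j s y"
        proof (cases "pos y = {} \<and> card (neg y) = Suc s \<and> tdeg y = e")
          case True
          then have y: "pos y = {}" by blast
          have "at_exp y (u - cform a (Suc r) w) = at_exp (expo (neg y) (to_exp (- ind (neg y) - y))) u -
              W (neg y) (restr_form a (neg y) (Suc r) * Poly_Mapping.single (to_exp (- ind (neg y) - y)) 1)"
            using True at_form_w[of y "Suc r"] by (simp add: at_exp_diff expo_to_exp(1)[OF y])
          also have "\<dots> \<in> LB j (- ind (neg y))"
            using True by (intro W(4) expo_to_exp(2)) auto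
          also have "LB j (- ind (neg y)) = LB j y" using y signs by (intro LB_cong) simp_all
          finally have "at_exp y (u - cform a (Suc r) w) \<in> LB j y" .
          then show ?thesis using filt_at_sub(1) by blast
        next
          case False
          have *: "at_exp y (u - cform a (Suc r) w) \<in> filt_at j (Suc s) y"
            using graded_cochainsD(2)[OF form[unfolded filt_def]] .
          have "at_exp y (u - cform a (Suc r) w) = 0" if "tdeg y \<noteq> e"
            using graded_cochainsD(3)[OF form[unfolded filt_def], of y] that by blast
          then show ?thesis
            using * False loc_vs.subspace_0[OF filt_at_subspace, of j s y] by (cases "tdeg y = e") (auto simp: filt_at_def split: if_splits)
        qed
      qed (use graded_cochainsD[OF form[unfolded filt_def]] in auto)
    qed
  qed
qed

theorem coregular_cohomology: "cs.coregular_mod 0 m (cs.cocycles_mod 0 j) (cs.coboundaries_mod 0 j)"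
proof -
  have sub0: "filt j 0 e \<subseteq> filt j s e" for s e
    by (induction s) (use filt_mono in blast)+
  have "cs.coregular_mod 0 m (filt j s) (filt j 0)" for s
  proof (induction s)
    case 0
    have zero: "cform a q 0 = 0" for q by (rule cs.\<theta>_0)
    show ?case
      by (rule cs.coregular_modI, intro exI[of _ 0] allI impI ballI bexI[of _ 0])
        (simp_all add: zero cs.graded_stableD(1)[OF filt_stable])
  next
    case (Suc s)
    show ?case
      by (rule cs.coregular_mod_trans[OF coregular_layer Suc filt_stable filt_stable filt_stable filt_mono sub0])
  qed
  from this[of "card (UNIV :: 'a set)"]
  have *: "cs.coregular_mod 0 m (cs.cocycles_mod 0 j) (filt j 0)"
    by (simp add: filt_top[abs_def, symmetric] fun_eq_iff cs.coregular_mod_def)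
  show ?thesis
  proof (rule cs.coregular_modI)
    fix r assume r: "0 \<le> r" "r < m"
    obtain e0 where e0: "\<And>e u. e < e0 \<Longrightarrow> u \<in> cs.cocycles_mod 0 j e \<Longrightarrow>
        (\<And>q. q \<in> {0<..r} \<Longrightarrow> cform a q u \<in> filt j 0 (e + 1)) \<Longrightarrow>
      \<exists>w\<in>cs.cocycles_mod 0 j (e - 1). (\<forall>q\<in>{0<..r}. cform a q w \<in> filt j 0 e) \<and> u - cform a (Suc r) w \<in> filt j 0 e"
      by (rule cs.coregular_modD[OF * r]) blast
    show "\<exists>e0. \<forall>e<e0. \<forall>u\<in>cs.cocycles_mod 0 j e. (\<forall>q\<in>{0<..r}. cform a q u \<in> cs.coboundaries_mod 0 j (e + 1)) \<longrightarrow>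
      (\<exists>w\<in>cs.cocycles_mod 0 j (e - 1). (\<forall>q\<in>{0<..r}. cform a q w \<in> cs.coboundaries_mod 0 j e) \<and>
        u - cform a (Suc r) w \<in> cs.coboundaries_mod 0 j e)"
    \<comment> \<open>The bound -1 keeps both \<open>e\<close> and \<open>e + 1\<close> negative,
      where \<open>filt j 0\<close> consists of the coboundaries.\<close>
    proof (intro exI[of _ "min e0 (-1)"] allI impI ballI)
      fix e u assume "e < min e0 (-1)" and u: "u \<in> cs.cocycles_mod 0 j e"
        and ann: "\<forall>q\<in>{0<..r}. cform a q u \<in> cs.coboundaries_mod 0 j (e + 1)"
      then have e: "e < e0" "e < 0" "e + 1 < 0" by auto
      show "\<exists>w\<in>cs.cocycles_mod 0 j (e - 1). (\<forall>q\<in>{0<..r}. cform a q w \<in> cs.coboundaries_mod 0 j e) \<and>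
        u - cform a (Suc r) w \<in> cs.coboundaries_mod 0 j e"
        using e0[OF e(1) u] ann unfolding filt_bottom[OF e(2)] filt_bottom[OF e(3)] by blast
    qed
  qed
qed

subsection \<open>Dimensions of the cohomology\<close>

definition point_cochain :: "('a \<Rightarrow> int) \<Rightarrow> ('a set \<Rightarrow> 'b \<Rightarrow> 'c) \<Rightarrow> 'a set \<Rightarrow> ('a \<Rightarrow> int) \<Rightarrow> 'b \<Rightarrow> 'c"
  where "point_cochain x z = (\<lambda>A y. if y = x then z A else 0)"

lemma at_point_cochain: "at_exp y (point_cochain x z) = (if y = x then z else 0)"
  by (auto simp: at_exp_def point_cochain_def fun_eq_iff)

lemma dim_layers:
  assumes "finite D" "\<And>x. x \<in> D \<Longrightarrow> pos x = {} \<and> tdeg x = e"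
  shows "subquot_dim cscale (graded_part (cochains (\<lambda>x. if x \<in> D then LZ j x else LB j x)) e)
    (graded_part (cochains (LB j)) e) (\<Sum>x\<in>D. hdim j (neg x))"
  using assms
proof (induction D rule: finite_induct)
  case empty
  then show ?case
    using cochain_vs.subquot_dim_self[OF graded_cochains_subspace[OF LB_subspace, of "\<lambda>_. j" "\<lambda>x. x" e]]
    by (simp only: empty_iff if_False sum.empty)
next
  case (insert x D)
  have sub: "loc_vs.subspace (if y \<in> E then LZ j y else LB j y)" for y E
    by (simp add: LZ_subspace LB_subspace)
  let ?V = "\<lambda>E. graded_part (cochains (\<lambda>x. if x \<in> E then LZ j x else LB j x)) e"
  have x: "pos x = {}" "tdeg x = e" using insert.prems by auto
  have "subquot_dim cscale (?V (insert x D)) (?V D) (hdim j (neg x))"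
  proof (rule subquot_dim_transport[OF loc_vs.vector_space_axioms cochain_vs.vector_space_axioms hdim[OF x(1)],
        where r = "\<lambda>z c. at_exp x c = z"])
    show "?V D \<subseteq> ?V (insert x D)"
      using LB_sub_LZ by (intro graded_cochains_mono sub) auto
    show "\<exists>c\<in>?V (insert x D). at_exp x c = z" if z: "z \<in> LZ j x" for z
    proof (intro bexI[of _ "point_cochain x z"] graded_cochainsI)
      show "finite {y. at_exp y (point_cochain x z) \<noteq> 0}"
        by (rule finite_subset[of _ "{x}"]) (auto simp: at_point_cochain)
      show "at_exp y (point_cochain x z) \<in> (if y \<in> insert x D then LZ j y else LB j y)" for y
        using z loc_vs.subspace_0[OF sub, of y "insert x D"] by (cases "y = x") (simp_all only: at_point_cochain insertI1 if_True if_False simp_thms)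
      show "tdeg y = e" if "at_exp y (point_cochain x z) \<noteq> 0" for y
        using that x by (auto simp: at_point_cochain split: if_splits)
    qed (simp add: at_point_cochain)
    show "\<exists>z\<in>LZ j x. at_exp x c = z" if "c \<in> ?V (insert x D)" for c
      using graded_cochainsD(2)[OF that, of x] by simp
    show "z \<in> LB j x \<longleftrightarrow> c \<in> ?V D" if zc: "at_exp x c = z" "c \<in> ?V (insert x D)" for z c
    proof
      assume z: "z \<in> LB j x"
      show "c \<in> ?V D"
      proof (rule graded_cochainsI)
        show "at_exp y c \<in> (if y \<in> D then LZ j y else LB j y)" for y
          using graded_cochainsD(2)[OF zc(2), of y] z zc(1) insert.hyps by (cases "y = x") auto
      qed (use graded_cochainsD[OF zc(2)] in auto)
    next
      assume "c \<in> ?V D"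
      then show "z \<in> LB j x" using graded_cochainsD(2)[of c _ e x] zc insert.hyps by fastforce
    qed
    show "cochain_vs.subspace (?V (insert x D))" "cochain_vs.subspace (?V D)"
      by (rule graded_cochains_subspace, rule sub)+
  qed (simp_all only: at_exp_add at_exp_scale)
  moreover have "subquot_dim cscale (?V D) (graded_part (cochains (LB j)) e) (\<Sum>x\<in>D. hdim j (neg x))"
    using insert.prems by (intro insert.IH) auto
  ultimately have "subquot_dim cscale (?V (insert x D)) (graded_part (cochains (LB j)) e)
      (hdim j (neg x) + (\<Sum>x\<in>D. hdim j (neg x)))"
    by (rule cochain_vs.subquot_dim_trans)
  then show ?case
    using insert.hyps by (simp only: sum.insert if_True not_False_eq_True simp_thms)
qed

lemma dim_cohomology:
  assumes e: "e < 0"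
  shows "subquot_dim cscale (cs.cocycles_mod 0 j e) (cs.coboundaries_mod 0 j e)
    (\<Sum>x\<in>{x. pos x = {} \<and> tdeg x = e}. hdim j (neg x))"
proof -
  let ?D = "{x :: 'a \<Rightarrow> int. pos x = {} \<and> tdeg x = e}"
  \<comment> \<open>In total degree \<open>e\<close> an exponent outside \<open>?D\<close> has a
    positive entry, so by \<open>acyclic\<close> every cocycle there is a coboundary.\<close>
  have "graded_part (cochains (\<lambda>x. if x \<in> ?D then LZ j x else LB j x)) e = graded_part (cochains (LZ j)) e"
  proof (intro equalityI graded_cochains_mono)
    show "loc_vs.subspace (if x \<in> ?D then LZ j x else LB j x)" for x
      by (simp add: LZ_subspace LB_subspace)
    show "LZ j x \<subseteq> (if x \<in> ?D then LZ j x else LB j x)" if "tdeg x = e" for x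
      using that acyclic[of x j] by auto
    show "(if x \<in> ?D then LZ j x else LB j x) \<subseteq> LZ j x" for x
      using LB_sub_LZ by auto
  qed (rule LZ_subspace)
  then show ?thesis
    using dim_layers[OF finite_nonpos_exps[of e], of e j] unfolding cocycles_eq coboundaries_eq by simp
qed

end

section \<open>Exponent vectors with given negative support and total degree\<close>

subsection \<open>Counting exponent vectors\<close>

lemma exps_remove_bij:
  assumes "t \<notin> F"
  shows "bij_betw (\<lambda>x. x + unit_exp t) {x. pos x = {} \<and> neg x = insert t F \<and> tdeg x = - int (Suc i) \<and> x t = -1}
    {x :: 'n::finite \<Rightarrow> int. pos x = {} \<and> neg x = F \<and> tdeg x = - int i}"
proof (rule bij_betwI[where g = "\<lambda>x. x - unit_exp t"])
  have deg: "tdeg (x + unit_exp t) = tdeg x + 1" for x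
    using tdeg_unit[of "x + unit_exp t" t] by simp
  show "(\<lambda>x. x + unit_exp t) \<in> {x. pos x = {} \<and> neg x = insert t F \<and> tdeg x = - int (Suc i) \<and> x t = -1} \<rightarrow>
    {x. pos x = {} \<and> neg x = F \<and> tdeg x = - int i}"
  proof (rule Pi_I)
    fix x assume "x \<in> {x. pos x = {} \<and> neg x = insert t F \<and> tdeg x = - int (Suc i) \<and> x t = -1}"
    then have x: "pos x = {}" "neg x = insert t F" "tdeg x = - int (Suc i)" "x t = -1" by auto
    have "s \<in> neg (x + unit_exp t) \<longleftrightarrow> s \<in> F" for s
      using x(2,4) assms by (cases "s = t") (auto simp: neg_def unit_exp_def set_eq_iff)
    moreover have "s \<notin> pos (x + unit_exp t)" for s
      using x(1,4) by (cases "s = t") (auto simp: pos_def unit_exp_def)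
    ultimately show "x + unit_exp t \<in> {x. pos x = {} \<and> neg x = F \<and> tdeg x = - int i}"
      using x(3) by (auto simp: deg)
  qed
  show "(\<lambda>x. x - unit_exp t) \<in> {x. pos x = {} \<and> neg x = F \<and> tdeg x = - int i} \<rightarrow>
    {x. pos x = {} \<and> neg x = insert t F \<and> tdeg x = - int (Suc i) \<and> x t = -1}"
  proof (rule Pi_I)
    fix x assume "x \<in> {x :: 'n \<Rightarrow> int. pos x = {} \<and> neg x = F \<and> tdeg x = - int i}"
    then have x: "pos x = {}" "neg x = F" "tdeg x = - int i" by auto
    have "\<not> 0 < x t" "\<not> x t < 0" using x(1,2) assms by (auto simp: pos_def neg_def)
    then have xt: "x t = 0" by simp
    have "s \<in> neg (x - unit_exp t) \<longleftrightarrow> s \<in> insert t F" for s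
      using x(2) xt by (cases "s = t") (auto simp: neg_def unit_exp_def)
    moreover have "s \<notin> pos (x - unit_exp t)" for s
      using x(1) xt by (cases "s = t") (auto simp: pos_def unit_exp_def)
    ultimately show "x - unit_exp t \<in> {x. pos x = {} \<and> neg x = insert t F \<and> tdeg x = - int (Suc i) \<and> x t = -1}"
    proof -
      assume n: "\<And>s. s \<in> neg (x - unit_exp t) \<longleftrightarrow> s \<in> insert t F" and p: "\<And>s. s \<notin> pos (x - unit_exp t)"
      have "neg (x - unit_exp t) = insert t F" "pos (x - unit_exp t) = {}" using n p by blast+
      moreover have "tdeg (x - unit_exp t) = - int (Suc i)" using x(3) tdeg_unit[of x t] by linarith
      moreover have "(x - unit_exp t) t = x t - 1" by (simp add: unit_exp_apply)
      ultimately show ?thesis using xt by (simp only: mem_Collect_eq) simp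
    qed
  qed
qed auto

lemma exps_decrease_bij:
  assumes "t \<in> F"
  shows "bij_betw (\<lambda>x. x + unit_exp t) {x. pos x = {} \<and> neg x = F \<and> tdeg x = - int (Suc i) \<and> x t \<noteq> -1}
    {x :: 'n::finite \<Rightarrow> int. pos x = {} \<and> neg x = F \<and> tdeg x = - int i}"
proof (rule bij_betwI[where g = "\<lambda>x. x - unit_exp t"])
  have deg: "tdeg (x + unit_exp t) = tdeg x + 1" for x
    using tdeg_unit[of "x + unit_exp t" t] by simp
  show "(\<lambda>x. x + unit_exp t) \<in> {x. pos x = {} \<and> neg x = F \<and> tdeg x = - int (Suc i) \<and> x t \<noteq> -1} \<rightarrow>
    {x. pos x = {} \<and> neg x = F \<and> tdeg x = - int i}"
  proof (rule Pi_I)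
    fix x assume "x \<in> {x. pos x = {} \<and> neg x = F \<and> tdeg x = - int (Suc i) \<and> x t \<noteq> -1}"
    then have x: "pos x = {}" "neg x = F" "tdeg x = - int (Suc i)" "x t \<noteq> -1" by auto
    have "x t < 0" using x(2) assms by (auto simp: neg_def)
    then have xt: "x t < -1" using x(4) by simp
    have "s \<in> neg (x + unit_exp t) \<longleftrightarrow> s \<in> F" for s
      using x(2) xt assms by (cases "s = t") (auto simp: neg_def unit_exp_def)
    moreover have "s \<notin> pos (x + unit_exp t)" for s
      using x(1) xt by (cases "s = t") (auto simp: pos_def unit_exp_def)
    ultimately show "x + unit_exp t \<in> {x. pos x = {} \<and> neg x = F \<and> tdeg x = - int i}"
      using x(3) by (auto simp: deg)
  qed
  show "(\<lambda>x. x - unit_exp t) \<in> {x. pos x = {} \<and> neg x = F \<and> tdeg x = - int i} \<rightarrow>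
    {x. pos x = {} \<and> neg x = F \<and> tdeg x = - int (Suc i) \<and> x t \<noteq> -1}"
  proof (rule Pi_I)
    fix x assume "x \<in> {x :: 'n \<Rightarrow> int. pos x = {} \<and> neg x = F \<and> tdeg x = - int i}"
    then have x: "pos x = {}" "neg x = F" "tdeg x = - int i" by auto
    have xt: "x t < 0" using x(2) assms by (auto simp: neg_def)
    have "s \<in> neg (x - unit_exp t) \<longleftrightarrow> s \<in> F" for s
      using x(2) xt assms by (cases "s = t") (auto simp: neg_def unit_exp_def)
    moreover have "s \<notin> pos (x - unit_exp t)" for s
      using x(1) xt by (cases "s = t") (auto simp: pos_def unit_exp_def)
    ultimately show "x - unit_exp t \<in> {x. pos x = {} \<and> neg x = F \<and> tdeg x = - int (Suc i) \<and> x t \<noteq> -1}"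
    proof -
      assume n: "\<And>s. s \<in> neg (x - unit_exp t) \<longleftrightarrow> s \<in> F" and p: "\<And>s. s \<notin> pos (x - unit_exp t)"
      have "neg (x - unit_exp t) = F" "pos (x - unit_exp t) = {}" using n p by blast+
      moreover have "tdeg (x - unit_exp t) = - int (Suc i)" using x(3) tdeg_unit[of x t] by linarith
      moreover have "(x - unit_exp t) t = x t - 1" by (simp add: unit_exp_apply)
      ultimately show ?thesis using xt by (simp only: mem_Collect_eq) simp
    qed
  qed
qed auto

definition num_exps :: "'n::finite set \<Rightarrow> nat \<Rightarrow> nat"
  where "num_exps F i = card {x. pos x = {} \<and> neg x = F \<and> tdeg x = - int i}"

text \<open>Distinguish by the entry at \<open>t\<close>. If it is -1, raising it by one removes
  \<open>t\<close> from the negative support; if it is lower, raising it leaves the support as it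
  is. This recursion is Pascal's rule.\<close>

lemma num_exps_rec:
  assumes "t \<notin> F"
  shows "num_exps (insert t F) (Suc i) = num_exps F i + num_exps (insert t F) i"
proof -
  let ?P = "\<lambda>x :: 'a \<Rightarrow> int. pos x = {} \<and> neg x = insert t F \<and> tdeg x = - int (Suc i)"
  have fin: "finite {x. ?P x \<and> Q x}" for Q
    by (rule finite_subset[OF _ finite_nonpos_exps[of "- int (Suc i)"]]) auto
  have "{x. ?P x} = {x. ?P x \<and> x t = -1} \<union> {x. ?P x \<and> x t \<noteq> -1}" by auto
  then have "card {x. ?P x} = card {x. ?P x \<and> x t = -1} + card {x. ?P x \<and> x t \<noteq> -1}"
    using card_Un_disjoint[OF fin[of "\<lambda>x. x t = -1"] fin[of "\<lambda>x. x t \<noteq> -1"]] by auto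
  also have "card {x. ?P x \<and> x t = -1} = num_exps F i"
    unfolding num_exps_def using bij_betw_same_card[OF exps_remove_bij[OF assms]] by simp
  also have "card {x. ?P x \<and> x t \<noteq> -1} = num_exps (insert t F) i"
    unfolding num_exps_def using bij_betw_same_card[OF exps_decrease_bij[of t "insert t F"]] by simp
  finally show ?thesis by (simp add: num_exps_def)
qed

lemma num_exps_empty: "num_exps ({} :: 'n::finite set) i = (if i = 0 then 1 else 0)"
proof -
  have "{x :: 'n \<Rightarrow> int. pos x = {} \<and> neg x = {} \<and> tdeg x = - int i} = (if i = 0 then {0} else {})"
  proof -
    have "x = 0" if "pos x = {}" "neg x = {}" for x :: "'n \<Rightarrow> int"
    proof
      fix t
      have "\<not> 0 < x t" "\<not> x t < 0" using that by (auto simp: pos_def neg_def)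
      then show "x t = 0 t" by simp
    qed
    then have "{x :: 'n \<Rightarrow> int. pos x = {} \<and> neg x = {} \<and> tdeg x = - int i} = {x. x = 0 \<and> tdeg x = - int i}"
      by (auto simp: pos_def neg_def)
    then show ?thesis by (auto simp: tdeg_def)
  qed
  then show ?thesis by (simp add: num_exps_def)
qed

lemma num_exps_0:
  assumes "F \<noteq> {}"
  shows "num_exps (F :: 'n::finite set) 0 = 0"
proof -
  have "False" if x: "pos x = {}" "neg x = F" "tdeg x = 0" for x :: "'n \<Rightarrow> int"
  proof -
    obtain t where "x t < 0" using x(2) assms by (auto simp: neg_def)
    moreover have "\<And>s. x s \<le> 0" using x(1) by (auto simp: pos_def not_less)
    ultimately have "tdeg x < 0"
      unfolding tdeg_def by (metis (mono_tags, lifting) UNIV_I finite sum_strict_mono_ex1 sum.neutral_const)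
    then show False using x(3) by simp
  qed
  then have "{x :: 'n \<Rightarrow> int. pos x = {} \<and> neg x = F \<and> tdeg x = - int 0} = {}" by auto
  then show ?thesis by (simp only: num_exps_def card.empty)
qed

lemma num_exps_eq_binomial:
  fixes F :: "'n::finite set"
  shows "F \<noteq> {} \<Longrightarrow> num_exps F (Suc i) = i choose (card F - 1)"
proof (induction i arbitrary: F)
  case 0
  then obtain t F' where F: "F = insert t F'" "t \<notin> F'" by (meson Set.set_insert ex_in_conv)
  show ?case
    using num_exps_rec[OF F(2), of 0] num_exps_0[OF 0] num_exps_0[of F'] num_exps_empty[where 'n = 'n, of 0] F
    by (cases "F' = {}") (auto simp: card_gt_0_iff binomial_eq_0)
next
  case (Suc i)
  then obtain t F' where F: "F = insert t F'" "t \<notin> F'" by (meson Set.set_insert ex_in_conv)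
  show ?case
  proof (cases "F' = {}")
    case True
    then show ?thesis using num_exps_rec[OF F(2), of "Suc i"] Suc.IH[of F] F by (simp add: num_exps_empty)
  next
    case False
    then obtain k where k: "card F' = Suc k" by (metis card_eq_0_iff finite not0_implies_Suc)
    then have "card F = Suc (Suc k)" using F by simp
    then show ?thesis
      using num_exps_rec[OF F(2), of "Suc i"] Suc.IH[of F] Suc.IH[of F'] F False k by simp
  qed
qed

text \<open>Pascal's rule under the convention for negative lower index, with
  \<open>1 \<le> i\<close> keeping the upper index \<open>i - 1\<close> nonnegative. The inequality
  allows the truncated subtraction of natural numbers to be pulled inside a sum.\<close>

lemma binom_diff:
  assumes "1 \<le> i"
  shows "binom i b - binom (i - 1) b = binom (i - 1) (b - 1)" "binom (i - 1) b \<le> binom i b"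
proof -
  obtain n where n: "i = int (Suc n)"
    using assms by (intro that[of "nat (i - 1)"]) simp
  have "binom i b - binom (i - 1) b = binom (i - 1) (b - 1) \<and> binom (i - 1) b \<le> binom i b"
  proof (cases "b \<le> 0")
    case True
    then show ?thesis by (cases "b = 0") (simp_all add: binom_def)
  next
    case False
    then obtain k where "b = int (Suc k)" by (intro that[of "nat (b - 1)"]) simp
    then show ?thesis by (simp add: binom_def n nat_add_distrib)
  qed
  then show "binom i b - binom (i - 1) b = binom (i - 1) (b - 1)" "binom (i - 1) b \<le> binom i b" by auto
qed

section \<open>The dimension formula for the model\<close>

context squarefree_system_forms
begin

definition predicted_dim :: "nat \<Rightarrow> int \<Rightarrow> int \<Rightarrow> nat"
  where "predicted_dim r j i = (\<Sum>F\<in>UNIV. binom (i - 1) (int (card F) - int r - 1) * hdim (j + int r) F)"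

lemma sum_exps_eq:
  assumes "1 \<le> i"
  shows "(\<Sum>x\<in>{x. pos x = {} \<and> tdeg x = - i}. hdim j (neg x)) = predicted_dim 0 j i"
proof -
  obtain n where n: "i = int (Suc n)"
    using assms by (intro that[of "nat (i - 1)"]) simp
  have "(\<Sum>x\<in>{x. pos x = {} \<and> tdeg x = - i}. hdim j (neg x)) =
      (\<Sum>F\<in>UNIV. \<Sum>x\<in>{x \<in> {x. pos x = {} \<and> tdeg x = - i}. neg x = F}. hdim j (neg x))"
    by (rule sum.group[symmetric]) (auto intro: finite_nonpos_exps)
  also have "\<dots> = (\<Sum>F\<in>UNIV. num_exps F (Suc n) * hdim j F)"
  proof (intro sum.cong refl)
    fix F :: "'a set"
    have "{x \<in> {x. pos x = {} \<and> tdeg x = - i}. neg x = F} = {x. pos x = {} \<and> neg x = F \<and> tdeg x = - int (Suc n)}"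
      using n by auto
    then show "(\<Sum>x\<in>{x \<in> {x. pos x = {} \<and> tdeg x = - i}. neg x = F}. hdim j (neg x)) = num_exps F (Suc n) * hdim j F"
      by (simp add: num_exps_def)
  qed
  also have "\<dots> = predicted_dim 0 j i"
    unfolding predicted_dim_def
  proof (intro sum.cong refl)
    fix F :: "'a set"
    have "num_exps F (Suc n) = binom (i - 1) (int (card F) - 1)"
    proof (cases "F = {}")
      \<comment> \<open>Empty support forces total degree zero, which \<open>1 \<le> i\<close>
        excludes; on the other side the lower index is -1, so both numbers are zero.\<close>
      case True
      then show ?thesis by (simp add: num_exps_empty binom_def)
    next
      case False
      then have "0 < card F" by (simp add: card_gt_0_iff)
      then show ?thesis using False num_exps_eq_binomial[OF False, of n] n by (auto simp: binom_def nat_diff_distrib)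
    qed
    then show "num_exps F (Suc n) * hdim j F = binom (i - 1) (int (card F) - int 0 - 1) * hdim (j + int 0) F"
      by simp
  qed
  finally show ?thesis .
qed

lemma predicted_dim_step:
  assumes "1 \<le> i"
  shows "predicted_dim r (j + 1) (i + 1) - predicted_dim r (j + 1) i = predicted_dim (Suc r) j i"
proof -
  let ?b = "\<lambda>F :: 'a set. int (card F) - int r - 1" and ?h = "\<lambda>F. hdim (j + 1 + int r) F"
  have "predicted_dim r (j + 1) (i + 1) - predicted_dim r (j + 1) i =
      (\<Sum>F\<in>UNIV. binom i (?b F) * ?h F - binom (i - 1) (?b F) * ?h F)"
    unfolding predicted_dim_def
    by (subst sum_subtractf_nat) (use binom_diff(2)[OF assms] in auto)
  also have "\<dots> = predicted_dim (Suc r) j i"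
    unfolding predicted_dim_def
  proof (intro sum.cong refl)
    fix F :: "'a set"
    have "?b F - 1 = int (card F) - int (Suc r) - 1" "j + 1 + int r = j + int (Suc r)" by simp_all
    then show "binom i (?b F) * ?h F - binom (i - 1) (?b F) * ?h F =
        binom (i - 1) (int (card F) - int (Suc r) - 1) * hdim (j + int (Suc r)) F"
      using binom_diff(1)[OF assms, of "?b F"] by (metis diff_mult_distrib)
  qed
  finally show ?thesis .
qed

theorem dim_cohomology_mod_forms:
  "\<exists>i0. \<forall>i>i0. subquot_dim cscale (cs.cocycles_mod m j (- i)) (cs.coboundaries_mod m j (- i)) (predicted_dim m j i)"
proof -
  let ?D = "\<lambda>j e. predicted_dim 0 j (- e)"
  have dim: "\<exists>e0. \<forall>e<e0. subquot_dim cscale (cs.cocycles_mod 0 j e) (cs.coboundaries_mod 0 j e) (?D j e)" for j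
  proof (intro exI[of _ 0] allI impI)
    fix e :: int assume "e < 0"
    then show "subquot_dim cscale (cs.cocycles_mod 0 j e) (cs.coboundaries_mod 0 j e) (?D j e)"
      using dim_cohomology[of e j] sum_exps_eq[of "- e" j] by simp
  qed
  have it: "rs.iterated_dim ?D r j e = predicted_dim r j (- e)" if "e < 0" for r j e
    using that
  proof (induction r arbitrary: j e)
    case (Suc r)
    then show ?case using predicted_dim_step[of "- e" r j] by (simp add: algebra_simps)
  qed simp
  obtain e0 where e0: "\<forall>e<e0. subquot_dim cscale (cs.cocycles_mod m j e) (cs.coboundaries_mod m j e) (rs.iterated_dim ?D m j e)"
    using rs.dim_mod_forms[OF coregular_cohomology dim, of m] by blast
  show ?thesis
  proof (intro exI[of _ "max 0 (- e0)"] allI impI)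
    fix i :: int assume "max 0 (- e0) < i"
    then have "- i < e0" "- i < 0" by auto
    then show "subquot_dim cscale (cs.cocycles_mod m j (- i)) (cs.coboundaries_mod m j (- i)) (predicted_dim m j i)"
      using e0 it[of "- i" m j] by auto
  qed
qed

end

section \<open>Transfer from function spaces to algebraic records\<close>

section \<open>Abelian groups as images\<close>

lemma type_algebra_simps [simp]:
  "carrier ring_of_type_algebra = UNIV" "\<zero>\<^bsub>ring_of_type_algebra\<^esub> = 0" "\<one>\<^bsub>ring_of_type_algebra\<^esub> = 1"
  "x \<oplus>\<^bsub>ring_of_type_algebra\<^esub> y = x + y" "x \<otimes>\<^bsub>ring_of_type_algebra\<^esub> y = x * y"
  by (simp_all add: ring_of_type_algebra_def)

text \<open>A record is presented as the image of an additive subgroup \<open>C\<close> of a type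
  with genuine addition. The group laws need not be known for \<open>L\<close>: they are inherited
  from \<open>C\<close>, and sums, cosets and scalar multiples can be computed on
  representatives.\<close>

locale group_image =
  fixes C :: "'c::ab_group_add set" and h :: "'c \<Rightarrow> 'q" and L :: "('q, 'x) ring_scheme"
  assumes C_0: "0 \<in> C" and C_diff: "x \<in> C \<Longrightarrow> y \<in> C \<Longrightarrow> x - y \<in> C"
    and h_add: "x \<in> C \<Longrightarrow> y \<in> C \<Longrightarrow> h (x + y) = h x \<oplus>\<^bsub>L\<^esub> h y"
    and carrier_eq: "carrier L = h ` C" and zero_eq: "\<zero>\<^bsub>L\<^esub> = h 0"
begin

lemma C_minus: "x \<in> C \<Longrightarrow> - x \<in> C"
  using C_diff[OF C_0, of x] by simp

lemma C_add: "x \<in> C \<Longrightarrow> y \<in> C \<Longrightarrow> x + y \<in> C"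
  using C_diff[of x "- y"] C_minus by simp

lemma C_sum: "(\<And>i. i \<in> I \<Longrightarrow> f i \<in> C) \<Longrightarrow> (\<Sum>i\<in>I. f i) \<in> C"
  by (induction I rule: infinite_finite_induct) (simp_all add: C_0 C_add)

lemma h_closed: "x \<in> C \<Longrightarrow> h x \<in> carrier L"
  by (simp add: carrier_eq)

lemma abelian_group: "abelian_group L"
proof (rule abelian_groupI)
  show "\<exists>y\<in>carrier L. y \<oplus>\<^bsub>L\<^esub> x = \<zero>\<^bsub>L\<^esub>" if x: "x \<in> carrier L" for x
  using x h_add C_minus by (fastforce simp: carrier_eq zero_eq)
qed (auto simp: carrier_eq zero_eq C_0 C_add add_ac simp flip: h_add)

lemma h_sum:
  assumes "finite I" "\<And>i. i \<in> I \<Longrightarrow> f i \<in> C"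
  shows "(\<Oplus>\<^bsub>L\<^esub> i\<in>I. h (f i)) = h (\<Sum>i\<in>I. f i)"
proof -
  interpret L: abelian_group L by (rule abelian_group)
  show ?thesis
    using assms
  proof (induction I rule: finite_induct)
    case (insert i I)
    then show ?case
      by (subst L.finsum_insert) (auto simp: h_closed h_add C_sum)
  qed (simp add: zero_eq)
qed

lemma h_diff_eq:
  assumes "x \<in> C" "y \<in> C"
  shows "h x = h y \<longleftrightarrow> h (x - y) = \<zero>\<^bsub>L\<^esub>"
proof -
  interpret L: abelian_group L by (rule abelian_group)
  have "h x = h (x - y) \<oplus>\<^bsub>L\<^esub> h y"
    using h_add[OF C_diff[OF assms] assms(2)] by simp
  then show ?thesis
    using h_closed[OF C_diff[OF assms]] h_closed[OF assms(2)] by (metis L.l_zero L.add.r_cancel L.zero_closed)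
qed

definition coset :: "'c set \<Rightarrow> 'c \<Rightarrow> 'q set"
  where "coset B z = (\<lambda>b. h (z + b)) ` B"

context
  fixes B
  assumes B0: "0 \<in> B" and B_diff: "\<And>x y. x \<in> B \<Longrightarrow> y \<in> B \<Longrightarrow> x - y \<in> B" and BC: "B \<subseteq> C"
begin

lemma B_minus: "x \<in> B \<Longrightarrow> - x \<in> B"
  using B_diff[OF B0, of x] by simp

lemma B_add: "x \<in> B \<Longrightarrow> y \<in> B \<Longrightarrow> x + y \<in> B"
  using B_diff[of x "- y"] B_minus by simp

lemma r_coset_eq: "z \<in> C \<Longrightarrow> h ` B +>\<^bsub>L\<^esub> h z = coset B z"
  using BC by (auto simp: a_r_coset_def' coset_def add.commute[of z] subset_iff h_add image_iff)

lemma set_add_coset: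
  assumes "z \<in> C" "w \<in> C"
  shows "set_add L (coset B z) (coset B w) = coset B (z + w)"
proof
  show "set_add L (coset B z) (coset B w) \<subseteq> coset B (z + w)"
  proof
    fix x assume "x \<in> set_add L (coset B z) (coset B w)"
    then obtain b b' where b: "b \<in> B" "b' \<in> B" "x = h (z + b) \<oplus>\<^bsub>L\<^esub> h (w + b')"
      by (auto simp: set_add_def' coset_def)
    then have "x = h ((z + b) + (w + b'))"
      using assms BC by (subst h_add) (auto intro: C_add)
    also have "(z + b) + (w + b') = (z + w) + (b + b')" by (simp add: algebra_simps)
    finally show "x \<in> coset B (z + w)" using b B_add by (auto simp: coset_def)
  qed
  show "coset B (z + w) \<subseteq> set_add L (coset B z) (coset B w)"
  proof
    fix x assume "x \<in> coset B (z + w)"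
    then obtain b where b: "b \<in> B" "x = h (z + w + b)" by (auto simp: coset_def)
    have "x = h ((z + b) + (w + 0))" using b by (simp add: algebra_simps)
    also have "\<dots> = h (z + b) \<oplus>\<^bsub>L\<^esub> h (w + 0)"
      using assms BC b by (intro h_add) (auto intro: C_add)
    finally have "x = h (z + b) \<oplus>\<^bsub>L\<^esub> h (w + 0)" .
    moreover have "h (z + b) \<in> coset B z" "h (w + 0) \<in> coset B w"
      unfolding coset_def using B0 b(1) by blast+
    ultimately show "x \<in> set_add L (coset B z) (coset B w)"
      unfolding set_add_def' by blast
  qed
qed

lemma coset_eq_iff:
  assumes "z \<in> C"
  shows "coset B z = h ` B \<longleftrightarrow> (\<exists>b\<in>B. h z = h b)"
proof
  assume "coset B z = h ` B"
  moreover have "h z \<in> coset B z" using B0 by (force simp: coset_def)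
  ultimately show "\<exists>b\<in>B. h z = h b" by auto
next
  assume "\<exists>b\<in>B. h z = h b"
  then obtain b where b: "b \<in> B" "h z = h b" by blast
  then have "h (z + c) = h (b + c)" if "c \<in> B" for c
    using assms BC that by (simp add: h_add subset_iff)
  then have "coset B z = coset B b" by (simp add: coset_def)
  also have "\<dots> = h ` B"
  proof
    show "coset B b \<subseteq> h ` B" using b B_add by (auto simp: coset_def)
    show "h ` B \<subseteq> coset B b"
    proof
      fix x assume "x \<in> h ` B"
      then obtain c where "c \<in> B" "x = h c" by blast
      then have "x = h (b + (c - b))" "c - b \<in> B" using B_diff b by auto
      then show "x \<in> coset B b" unfolding coset_def by (rule image_eqI)
    qed
  qed
  finally show "coset B z = h ` B" .
qed

text \<open>\<open>s\<close> lifts the scalar multiplication \<open>g\<close> to representatives.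
  Adding the subgroup completes the image of a coset to a full coset; multiplication by zero, for
  instance, sends a coset to a single element.\<close>

lemma smult_coset:
  assumes "z \<in> C" and s: "\<And>x. x \<in> C \<Longrightarrow> g (h x) = h (s x)" "\<And>x y. s (x + y) = s x + s y"
    and sB: "\<And>x. x \<in> B \<Longrightarrow> s x \<in> B" and sC: "\<And>x. x \<in> C \<Longrightarrow> s x \<in> C"
  shows "set_add L (h ` B) (g ` coset B z) = coset B (s z)"
proof
  have gh: "g (h (z + b)) = h (s z + s b)" if "b \<in> B" for b
    using assms(1) BC that by (subst s(1)) (auto intro: C_add simp: s(2))
  show "set_add L (h ` B) (g ` coset B z) \<subseteq> coset B (s z)"
  proof
    fix x assume "x \<in> set_add L (h ` B) (g ` coset B z)"
    then obtain b b' where b: "b \<in> B" "b' \<in> B" "x = h b \<oplus>\<^bsub>L\<^esub> h (s z + s b')"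
      by (auto simp: set_add_def' coset_def gh)
    then have "x = h (b + (s z + s b'))"
      using assms(1) BC by (subst h_add) (auto intro: C_add sC)
    also have "b + (s z + s b') = s z + (b + s b')" by (simp add: algebra_simps)
    finally show "x \<in> coset B (s z)" using b B_add sB by (auto simp: coset_def)
  qed
  have s0: "s 0 = 0" using s(2)[of 0 0] by simp
  show "coset B (s z) \<subseteq> set_add L (h ` B) (g ` coset B z)"
  proof
    fix x assume "x \<in> coset B (s z)"
    then obtain b where b: "b \<in> B" "x = h (s z + b)" by (auto simp: coset_def)
    then have "x = h (b + (s z + s 0))" by (simp add: s0 add.commute)
    also have "\<dots> = h b \<oplus>\<^bsub>L\<^esub> h (s z + s 0)"
      using b BC assms(1) by (intro h_add) (auto intro: C_add sC C_0)
    also have "h (s z + s 0) = g (h (z + 0))" using gh[OF B0] by simp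
    finally have "x = h b \<oplus>\<^bsub>L\<^esub> g (h (z + 0))" .
    moreover have "h (z + 0) \<in> coset B z" unfolding coset_def using B0 by (rule imageI)
    ultimately show "x \<in> set_add L (h ` B) (g ` coset B z)"
      using b(1) unfolding set_add_def' by blast
  qed
qed

end

end

section \<open>Dimensions of images\<close>

text \<open>The passage to the dimension used in the statement. Both the vector space laws on
  \<open>W\<close> and a basis are transported along \<open>h\<close>, and \<open>ker\<close> makes
  the images of the \<open>b j\<close> independent and distinct; distinctness matters since a basis
  is a set.\<close>

lemma kdim_eq:
  fixes s :: "'k::field \<Rightarrow> 'c::ab_group_add \<Rightarrow> 'c" and L :: "(('n, 'k) mpoly, 'q) module"
  assumes vs: "vector_space s" and dim: "subquot_dim s V B d" and W: "h ` V = W"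
    and add: "\<And>x y. x \<in> V \<Longrightarrow> y \<in> V \<Longrightarrow> h (x + y) = h x \<oplus>\<^bsub>L\<^esub> h y"
    and smult: "\<And>c x. x \<in> V \<Longrightarrow> Const c \<odot>\<^bsub>L\<^esub> h x = h (s c x)"
    and zero: "h 0 = \<zero>\<^bsub>L\<^esub>" and ker: "\<And>x. x \<in> V \<Longrightarrow> h x = \<zero>\<^bsub>L\<^esub> \<longleftrightarrow> x \<in> B"
  shows "kdim L W = enat d"
proof -
  interpret vs: vector_space s by fact
  obtain b where b: "vs.subspace V" "vs.subspace B" "B \<subseteq> V" "\<And>j. j < d \<Longrightarrow> b j \<in> V"
    "\<And>v. v \<in> V \<Longrightarrow> \<exists>c. v - (\<Sum>j<d. s (c j) (b j)) \<in> B"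
    "\<And>c j. (\<Sum>j<d. s (c j) (b j)) \<in> B \<Longrightarrow> j < d \<Longrightarrow> c j = 0"
    using dim by (rule vs.subquot_dimE) blast
  define U where "U = as_vectorspace L W"
  have U: "carrier U = W" "\<zero>\<^bsub>U\<^esub> = \<zero>\<^bsub>L\<^esub>" "\<And>x y. x \<oplus>\<^bsub>U\<^esub> y = x \<oplus>\<^bsub>L\<^esub> y" "\<And>c x. c \<odot>\<^bsub>U\<^esub> x = Const c \<odot>\<^bsub>L\<^esub> x"
    by (simp_all add: U_def as_vectorspace_def)
  interpret G: group_image V h U
    by unfold_locales (auto simp: U W zero add vs.subspace_0[OF b(1)] vs.subspace_diff[OF b(1)])
  have cr: "cring (scalars :: 'k ring)" by (rule cring_from_type_algebra)
  interpret L: abelian_group U by (rule G.abelian_group)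
  have mod: "Module.module (scalars :: 'k ring) U"
  proof (rule moduleI[OF cr G.abelian_group])
    fix c e :: 'k and x y assume "x \<in> carrier U" and "y \<in> carrier U"
    then obtain x' y' where x: "x = h x'" "x' \<in> V" "y = h y'" "y' \<in> V" by (auto simp: U W[symmetric])
    note sc = vs.subspace_scale[OF b(1)] vs.subspace_add[OF b(1)]
    show "c \<odot>\<^bsub>U\<^esub> x \<in> carrier U" using x sc by (auto simp: U smult W[symmetric])
    show "(c \<oplus>\<^bsub>scalars\<^esub> e) \<odot>\<^bsub>U\<^esub> x = c \<odot>\<^bsub>U\<^esub> x \<oplus>\<^bsub>U\<^esub> e \<odot>\<^bsub>U\<^esub> x"
      using x sc by (simp add: U smult vs.scale_left_distrib add)
    show "c \<odot>\<^bsub>U\<^esub> (x \<oplus>\<^bsub>U\<^esub> y) = c \<odot>\<^bsub>U\<^esub> x \<oplus>\<^bsub>U\<^esub> c \<odot>\<^bsub>U\<^esub> y"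
      using x sc by (simp add: U smult vs.scale_right_distrib flip: add)
    show "(c \<otimes>\<^bsub>scalars\<^esub> e) \<odot>\<^bsub>U\<^esub> x = c \<odot>\<^bsub>U\<^esub> (e \<odot>\<^bsub>U\<^esub> x)"
      using x sc by (simp add: U smult)
    show "\<one>\<^bsub>scalars\<^esub> \<odot>\<^bsub>U\<^esub> x = x"
      using x smult[of x' 1] by (simp add: U)
  qed
  interpret S: vectorspace "scalars :: 'k ring" U
    by (intro vectorspace.intro mod field_from_type_algebra)
  define A where "A = (\<lambda>j. h (b j)) ` {..<d}"
  have sumV: "(\<Sum>j<d. s (c j) (b j)) \<in> V" for c
    using b by (intro vs.subspace_sum vs.subspace_scale) auto
  have inj: "inj_on (\<lambda>j. h (b j)) {..<d}"
  proof (rule inj_onI, rule ccontr)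
    fix x y assume *: "x \<in> {..<d}" "y \<in> {..<d}" "h (b x) = h (b y)" "x \<noteq> y"
    have "(\<Sum>i<d. s (if i = x then 1 else if i = y then -1 else 0) (b i)) =
      (\<Sum>i<d. (if i = x then b x else 0) + (if i = y then - b y else 0))"
      using *(4) by (intro sum.cong) auto
    also have "\<dots> = b x - b y" using *(1,2) by (simp add: sum.distrib)
    finally have eq: "(\<Sum>i<d. s (if i = x then 1 else if i = y then -1 else 0) (b i)) = b x - b y" .
    have "h (b x - b y) = \<zero>\<^bsub>L\<^esub>"
      using G.h_diff_eq[of "b x" "b y"] b(4) * by (simp add: U)
    then have "b x - b y \<in> B" using ker[of "b x - b y"] b(1,4) * by (simp add: vs.subspace_diff)
    then show False
      using b(6)[of "\<lambda>i. if i = x then 1 else if i = y then -1 else 0" x] * eq by simp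
  qed
  have A: "finite A" "card A = d" "A \<subseteq> carrier U"
    using inj b(4) by (auto simp: A_def card_image U W[symmetric])
  have lincomb: "S.lincomb c A = h (\<Sum>j<d. s (c (h (b j))) (b j))" for c
  proof -
    have "S.lincomb c A = (\<Oplus>\<^bsub>U\<^esub> j\<in>{..<d}. c (h (b j)) \<odot>\<^bsub>U\<^esub> h (b j))"
      unfolding S.lincomb_def A_def
      using b(4) vs.subspace_scale[OF b(1)] inj
      by (intro L.finsum_reindex) (auto simp: U smult W[symmetric])
    also have "\<dots> = (\<Oplus>\<^bsub>U\<^esub> j\<in>{..<d}. h (s (c (h (b j))) (b j)))"
      using b(4) vs.subspace_scale[OF b(1)] by (intro L.finsum_cong') (auto simp: U smult W[symmetric])
    also have "\<dots> = h (\<Sum>j<d. s (c (h (b j))) (b j))"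
      using b(4) vs.subspace_scale[OF b(1)] by (intro G.h_sum) auto
    finally show ?thesis .
  qed
  have indpt: "S.lin_indpt A"
  proof (rule S.finite_lin_indpt2[OF A(1,3)], rule ballI)
    fix c v assume "S.lincomb c A = \<zero>\<^bsub>U\<^esub>" "v \<in> A"
    then have "(\<Sum>j<d. s (c (h (b j))) (b j)) \<in> B"
      using ker[OF sumV] by (simp add: lincomb U)
    moreover obtain j where "j < d" "v = h (b j)"
      using \<open>v \<in> A\<close> by (auto simp: A_def)
    ultimately show "c v = \<zero>\<^bsub>scalars\<^esub>" using b(6)[of "\<lambda>j. c (h (b j))"] by simp
  qed
  have gen: "S.gen_set A"
  proof
    show "S.span A \<subseteq> carrier U" by (rule S.span_is_subset2[OF A(3)])
    show "carrier U \<subseteq> S.span A"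
    proof
      fix x assume "x \<in> carrier U"
      then obtain v where v: "v \<in> V" "x = h v" by (auto simp: U W[symmetric])
      obtain c where c: "v - (\<Sum>j<d. s (c j) (b j)) \<in> B" using b(5) v by blast
      then have "h v = h (\<Sum>j<d. s (c j) (b j))"
        using G.h_diff_eq[OF v(1) sumV] ker[of "v - (\<Sum>j<d. s (c j) (b j))"] b(3) by (auto simp: U)
      also have "\<dots> = S.lincomb (\<lambda>x. c (the_inv_into {..<d} (\<lambda>j. h (b j)) x)) A"
        unfolding lincomb using the_inv_into_f_f[OF inj] by (intro arg_cong[of _ _ h] sum.cong refl) simp
      finally show "x \<in> S.span A"
        unfolding S.span_def v(2) using A(1) by auto
    qed
  qed
  have "S.basis A" using indpt gen A by (simp add: S.basis_def)
  then have "S.fin_dim" "S.dim = d"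
    using S.dim_basis[OF A(1)] A gen by (auto simp: S.fin_dim_def)
  then show ?thesis by (simp add: kdim_def U_def)
qed

section \<open>Localizations of modules\<close>

locale frac_module = Module.module R N for R :: "'s::comm_ring_1 ring" and N :: "('s, 'q) module" +
  fixes f :: 's
  assumes R: "R = ring_of_type_algebra"
begin

lemma smult_closed': "x \<in> carrier N \<Longrightarrow> a \<odot>\<^bsub>N\<^esub> x \<in> carrier N"
  using smult_closed[of a x] by (simp add: R)

lemma smult_smult: "x \<in> carrier N \<Longrightarrow> a \<odot>\<^bsub>N\<^esub> (b \<odot>\<^bsub>N\<^esub> x) = (a * b) \<odot>\<^bsub>N\<^esub> x"
  using smult_assoc1[of a b x] by (simp add: R)

lemma smult_add: "x \<in> carrier N \<Longrightarrow> y \<in> carrier N \<Longrightarrow> a \<odot>\<^bsub>N\<^esub> (x \<oplus>\<^bsub>N\<^esub> y) = a \<odot>\<^bsub>N\<^esub> x \<oplus>\<^bsub>N\<^esub> a \<odot>\<^bsub>N\<^esub> y"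
  using smult_r_distr[of a x y] by (simp add: R)

lemma smult_1: "x \<in> carrier N \<Longrightarrow> 1 \<odot>\<^bsub>N\<^esub> x = x"
  using smult_one[of x] by (simp add: R)

lemma frac_rel_iff:
  "((u, k), (v, l)) \<in> frac_rel N f \<longleftrightarrow> u \<in> carrier N \<and> v \<in> carrier N \<and>
    (\<exists>q. f ^ (q + l) \<odot>\<^bsub>N\<^esub> u = f ^ (q + k) \<odot>\<^bsub>N\<^esub> v)"
  by (auto simp: frac_rel_def smult_smult power_add)

lemma frac_rel_trans:
  assumes "((u, k), (v, l)) \<in> frac_rel N f" "((v, l), (w, m)) \<in> frac_rel N f"
  shows "((u, k), (w, m)) \<in> frac_rel N f"
proof -
  obtain q r where c: "u \<in> carrier N" "v \<in> carrier N" "w \<in> carrier N"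
    and q: "f ^ (q + l) \<odot>\<^bsub>N\<^esub> u = f ^ (q + k) \<odot>\<^bsub>N\<^esub> v" and r: "f ^ (r + m) \<odot>\<^bsub>N\<^esub> v = f ^ (r + l) \<odot>\<^bsub>N\<^esub> w"
    using assms by (auto simp: frac_rel_iff)
  have "f ^ ((q + r + l) + m) \<odot>\<^bsub>N\<^esub> u = f ^ (r + m) \<odot>\<^bsub>N\<^esub> (f ^ (q + l) \<odot>\<^bsub>N\<^esub> u)"
    using c by (simp add: smult_smult power_add mult_ac)
  also have "\<dots> = f ^ (q + k) \<odot>\<^bsub>N\<^esub> (f ^ (r + m) \<odot>\<^bsub>N\<^esub> v)"
    unfolding q using c by (simp add: smult_smult mult.commute)
  also have "\<dots> = f ^ ((q + r + l) + k) \<odot>\<^bsub>N\<^esub> w"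
    unfolding r using c by (simp add: smult_smult power_add mult_ac)
  finally show ?thesis using c by (auto simp: frac_rel_iff)
qed

lemma frac_rel_sym: "((u, k), (v, l)) \<in> frac_rel N f \<Longrightarrow> ((v, l), (u, k)) \<in> frac_rel N f"
  unfolding frac_rel_iff by (elim conjE exE, intro conjI exI) (assumption, assumption, erule sym)

lemma frac_rel_refl: "u \<in> carrier N \<Longrightarrow> ((u, k), (u, k)) \<in> frac_rel N f"
  by (simp add: frac_rel_iff)

lemma mem_frac: "(v, l) \<in> frac N f u k \<longleftrightarrow> ((u, k), (v, l)) \<in> frac_rel N f"
  by (simp add: frac_def)

lemma frac_eq_rel: "((u, k), (v, l)) \<in> frac_rel N f \<Longrightarrow> frac N f u k = frac N f v l"
proof -
  assume *: "((u, k), (v, l)) \<in> frac_rel N f"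
  have mem: "(w, m) \<in> frac N f u k \<longleftrightarrow> (w, m) \<in> frac N f v l" for w m
    unfolding mem_frac
    by (rule iffI) (erule frac_rel_trans[OF frac_rel_sym[OF *]], erule frac_rel_trans[OF *])
  show ?thesis
  using Set.set_eqI mem by auto
qed

lemma frac_eq_iff:
  assumes "u \<in> carrier N" "v \<in> carrier N"
  shows "frac N f u k = frac N f v l \<longleftrightarrow> (\<exists>q. f ^ (q + l) \<odot>\<^bsub>N\<^esub> u = f ^ (q + k) \<odot>\<^bsub>N\<^esub> v)"
by (metis frac_eq_rel mem_frac frac_rel_refl assms frac_rel_iff)

lemma frac_expand: "u \<in> carrier N \<Longrightarrow> frac N f (f ^ n \<odot>\<^bsub>N\<^esub> u) (n + k) = frac N f u k"
  by (simp add: frac_eq_iff smult_closed' smult_smult add_ac flip: power_add)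

text \<open>Operations on fractions are unions over representatives; the union collapses to a single
  class as soon as all representatives give the same one.\<close>

lemma UN_frac:
  assumes "u \<in> carrier N" "\<And>v l. ((u, k), (v, l)) \<in> frac_rel N f \<Longrightarrow> F v l = F u k"
  shows "(\<Union>(v, l)\<in>frac N f u k. F v l) = F u k"
proof -
  have "(u, k) \<in> frac N f u k" using mem_frac frac_rel_refl[OF assms(1)] by blast
  then have ne: "frac N f u k \<noteq> {}" by blast
  have "(case p of (v, l) \<Rightarrow> F v l) = F u k" if "p \<in> frac N f u k" for p
    using that assms(2)[of "fst p" "snd p"] mem_frac[of "fst p" "snd p" u k] by (simp add: case_prod_beta)
  then show ?thesis by (intro SUP_eq_const ne)
qed

lemma carrier_localization: "carrier (localization N f) = {frac N f u k | u k. u \<in> carrier N}"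
  by (auto simp: localization_def quotient_def frac_def)

lemma zero_localization: "\<zero>\<^bsub>localization N f\<^esub> = frac N f \<zero>\<^bsub>N\<^esub> 0"
  by (simp add: localization_def)

lemma smult_localization:
  assumes "u \<in> carrier N"
  shows "a \<odot>\<^bsub>localization N f\<^esub> frac N f u k = frac N f (a \<odot>\<^bsub>N\<^esub> u) k"
proof -
  have "(\<Union>(v, l)\<in>frac N f u k. frac N f (a \<odot>\<^bsub>N\<^esub> v) l) = frac N f (a \<odot>\<^bsub>N\<^esub> u) k"
  proof (rule UN_frac[OF assms])
    fix v l assume "((u, k), (v, l)) \<in> frac_rel N f"
    then obtain q where v: "v \<in> carrier N" and q: "f ^ (q + l) \<odot>\<^bsub>N\<^esub> u = f ^ (q + k) \<odot>\<^bsub>N\<^esub> v"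
      by (auto simp: frac_rel_iff)
    have "f ^ (q + k) \<odot>\<^bsub>N\<^esub> (a \<odot>\<^bsub>N\<^esub> v) = f ^ (q + l) \<odot>\<^bsub>N\<^esub> (a \<odot>\<^bsub>N\<^esub> u)"
      using arg_cong[OF q, of "\<lambda>x. a \<odot>\<^bsub>N\<^esub> x"] assms v by (simp add: smult_smult mult_ac)
    then show "frac N f (a \<odot>\<^bsub>N\<^esub> v) l = frac N f (a \<odot>\<^bsub>N\<^esub> u) k"
      using assms v by (auto simp: frac_eq_iff smult_closed')
  qed
  then show ?thesis by (simp add: localization_def)
qed

lemma add_localization:
  assumes u: "u \<in> carrier N" and v: "v \<in> carrier N"
  shows "frac N f u k \<oplus>\<^bsub>localization N f\<^esub> frac N f v l = frac N f (f ^ l \<odot>\<^bsub>N\<^esub> u \<oplus>\<^bsub>N\<^esub> f ^ k \<odot>\<^bsub>N\<^esub> v) (k + l)"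
proof -
  let ?F = "\<lambda>u k v l. frac N f (f ^ l \<odot>\<^bsub>N\<^esub> u \<oplus>\<^bsub>N\<^esub> f ^ k \<odot>\<^bsub>N\<^esub> v) (k + l)"
  have F: "?F u' k' v' l' = ?F u k v l"
    if *: "((u, k), (u', k')) \<in> frac_rel N f" "((v, l), (v', l')) \<in> frac_rel N f" for u' k' v' l'
  proof -
    obtain q r where c: "u' \<in> carrier N" "v' \<in> carrier N"
      and q: "f ^ (q + k') \<odot>\<^bsub>N\<^esub> u = f ^ (q + k) \<odot>\<^bsub>N\<^esub> u'" and r: "f ^ (r + l') \<odot>\<^bsub>N\<^esub> v = f ^ (r + l) \<odot>\<^bsub>N\<^esub> v'"
      using * by (auto simp: frac_rel_iff)
    have "f ^ ((q + r) + (k + l)) \<odot>\<^bsub>N\<^esub> (f ^ l' \<odot>\<^bsub>N\<^esub> u' \<oplus>\<^bsub>N\<^esub> f ^ k' \<odot>\<^bsub>N\<^esub> v') =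
        f ^ (r + l + l') \<odot>\<^bsub>N\<^esub> (f ^ (q + k) \<odot>\<^bsub>N\<^esub> u') \<oplus>\<^bsub>N\<^esub> f ^ (q + k + k') \<odot>\<^bsub>N\<^esub> (f ^ (r + l) \<odot>\<^bsub>N\<^esub> v')"
      using c by (simp add: smult_smult smult_add smult_closed' add_ac flip: power_add)
    also have "\<dots> = f ^ (r + l + l') \<odot>\<^bsub>N\<^esub> (f ^ (q + k') \<odot>\<^bsub>N\<^esub> u) \<oplus>\<^bsub>N\<^esub> f ^ (q + k + k') \<odot>\<^bsub>N\<^esub> (f ^ (r + l') \<odot>\<^bsub>N\<^esub> v)"
      by (simp only: q r)
    also have "\<dots> = f ^ ((q + r) + (k' + l')) \<odot>\<^bsub>N\<^esub> (f ^ l \<odot>\<^bsub>N\<^esub> u \<oplus>\<^bsub>N\<^esub> f ^ k \<odot>\<^bsub>N\<^esub> v)"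
      using u v by (simp add: smult_smult smult_add smult_closed' add_ac flip: power_add)
    finally show ?thesis
      using c u v by (subst frac_eq_iff) (auto simp: smult_closed')
  qed
  have "(\<Union>(v', l')\<in>frac N f v l. ?F u' k' v' l') = ?F u k v l" if *: "((u, k), (u', k')) \<in> frac_rel N f" for u' k'
  proof -
    have "(\<Union>(v', l')\<in>frac N f v l. ?F u' k' v' l') = ?F u' k' v l"
      using F[OF *] F[OF * frac_rel_refl[OF v]] by (intro UN_frac[OF v]) simp
    also have "\<dots> = ?F u k v l" by (rule F[OF * frac_rel_refl[OF v]])
    finally show ?thesis .
  qed
  then have "(\<Union>(u', k')\<in>frac N f u k. \<Union>(v', l')\<in>frac N f v l. ?F u' k' v' l') = (\<Union>(v', l')\<in>frac N f v l. ?F u k v' l')"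
    using frac_rel_refl[OF u] by (intro UN_frac[OF u]) simp
  also have "\<dots> = ?F u k v l"
    using F[OF frac_rel_refl[OF u]] by (intro UN_frac[OF v])
  finally show ?thesis by (simp add: localization_def)
qed

lemma loc_map_frac:
  assumes u: "u \<in> carrier N"
  shows "loc_map N f g (frac N f u k) = frac N (f * g) (g ^ k \<odot>\<^bsub>N\<^esub> u) k"
proof -
  interpret fg: frac_module R N "f * g" by unfold_locales (rule R)
  show ?thesis
    unfolding loc_map_def
  proof (rule UN_frac[OF u])
    fix v l assume "((u, k), (v, l)) \<in> frac_rel N f"
    then obtain q where v: "v \<in> carrier N" and q: "f ^ (q + l) \<odot>\<^bsub>N\<^esub> u = f ^ (q + k) \<odot>\<^bsub>N\<^esub> v"
      by (auto simp: frac_rel_iff)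
    have "(f * g) ^ (q + k) \<odot>\<^bsub>N\<^esub> (g ^ l \<odot>\<^bsub>N\<^esub> v) = g ^ (q + k + l) \<odot>\<^bsub>N\<^esub> (f ^ (q + k) \<odot>\<^bsub>N\<^esub> v)"
      using v by (simp add: smult_smult power_mult_distrib power_add mult_ac)
    also have "\<dots> = (f * g) ^ (q + l) \<odot>\<^bsub>N\<^esub> (g ^ k \<odot>\<^bsub>N\<^esub> u)"
      unfolding q[symmetric] using u by (simp add: smult_smult power_mult_distrib power_add mult_ac)
    finally show "frac N (f * g) (g ^ l \<odot>\<^bsub>N\<^esub> v) l = frac N (f * g) (g ^ k \<odot>\<^bsub>N\<^esub> u) k"
      using u v by (auto simp: fg.frac_eq_iff smult_closed')
  qed
qed

end

section \<open>The Cech complex of a presented module\<close>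

text \<open>Multiplication by the Laurent monomial of exponent \<open>b\<close>.\<close>

definition shift :: "('n \<Rightarrow> int) \<Rightarrow> (('n \<Rightarrow> int) \<Rightarrow> 'z) \<Rightarrow> ('n \<Rightarrow> int) \<Rightarrow> 'z"
  where "shift b u = (\<lambda>x. u (x - b))"

lemma shift_shift: "shift b (shift c u) = shift (b + c) u"
  by (simp add: shift_def diff_diff_eq)

lemma shift_0 [simp]: "shift 0 u = u"
  by (simp add: shift_def)

lemma shift_add: "shift b (u + v) = shift b u + shift b v"
  by (simp add: shift_def plus_fun_def)

lemma shift_sum: "shift b (\<Sum>i\<in>I. u i) = (\<Sum>i\<in>I. shift b (u i))"
  by (auto simp: shift_def fun_eq_iff sum_fun_apply)

text \<open>The exponent vector of \<open>var_prod A ^ k\<close>; for \<open>k = 1\<close> it is the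
  squarefree degree that corresponds to \<open>A\<close>.\<close>

definition nind :: "nat \<Rightarrow> 'n set \<Rightarrow> 'n \<Rightarrow> int"
  where "nind k A = (\<lambda>t. if t \<in> A then int k else 0)"

lemma nind_add: "nind k A + nind l A = nind (k + l) A"
  by (auto simp: nind_def fun_eq_iff)

lemma nind_insert: "t \<notin> A \<Longrightarrow> nind k {t} + nind k A = nind k (insert t A)"
  by (auto simp: nind_def fun_eq_iff)

lemma nind_0 [simp]: "nind 0 A = 0" "nind k {} = 0"
  by (auto simp: nind_def fun_eq_iff)

lemma nind_single: "nind (Suc 0) {t} = unit_exp t"
  by (auto simp: nind_def unit_exp_def fun_eq_iff)

lemma neg_one_power_Const: "(- 1) ^ k = Const ((- 1) ^ k)"
  by (induction k) (simp_all add: Const_mult Const_uminus)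

context squarefree_system
begin

lemma pos_shift_sub:
  assumes "\<And>t. 0 \<le> b t"
  shows "pos (x - b) \<subseteq> pos x" "neg x \<subseteq> neg (x - b)"
proof -
  have "x t - b t \<le> x t" for t using assms[of t] by simp
  then show "pos (x - b) \<subseteq> pos x" "neg x \<subseteq> neg (x - b)"
    by (auto simp: pos_def neg_def) (meson less_le_trans le_less_trans)+
qed

lemma shift_Loc:
  assumes "\<And>t. 0 \<le> b t" "u \<in> Loc A"
  shows "shift b u \<in> Loc A"
proof (rule LocI)
  show "finite {x. shift b u x \<noteq> 0}"
    using finite_supp_shift[OF LocD(1)[OF assms(2)], of b] by (simp add: shift_def)
  show "shift b u x \<in> coeffs (A \<union> pos x)" for x
    using LocD(2)[OF assms(2), of "x - b"] coeffs_mono[OF Un_mono[OF subset_refl[of A] pos_shift_sub(1)[of b x, OF assms(1)]]]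
    by (auto simp: shift_def)
  show "neg x \<subseteq> A" if "shift b u x \<noteq> 0" for x
    using that LocD(3)[OF assms(2), of "x - b"] pos_shift_sub(2)[of b x, OF assms(1)] by (auto simp: shift_def)
qed

lemma lform_shift: "lform a q (shift b u) = shift b (lform a q u)"
  by (auto simp: lform_def shift_def fun_eq_iff sum_fun_apply algebra_simps)

definition uscale :: "'k \<Rightarrow> (('n \<Rightarrow> int) \<Rightarrow> 'g \<Rightarrow> 'k) \<Rightarrow> ('n \<Rightarrow> int) \<Rightarrow> 'g \<Rightarrow> 'k"
  where "uscale r u = (\<lambda>x. fscale r (u x))"

lemma uscale_Loc: "u \<in> Loc A \<Longrightarrow> uscale r u \<in> Loc A"
proof (rule LocI)
  assume u: "u \<in> Loc A"
  show "finite {x. uscale r u x \<noteq> 0}"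
    using LocD(1)[OF u] by (rule rev_finite_subset) (auto simp: uscale_def fun_vs.scale_zero_right)
  show "uscale r u x \<in> coeffs (A \<union> pos x)" for x
    using fun_vs.subspace_scale[OF coeffs_subspace LocD(2)[OF u]] by (simp add: uscale_def)
  show "neg x \<subseteq> A" if "uscale r u x \<noteq> 0" for x
    using LocD(3)[OF u, of x] that fun_vs.scale_zero_right[of r] by (auto simp: uscale_def simp del: fun_vs.scale_zero_right)
qed

text \<open>The denominator \<open>var_prod A ^ k\<close> is good for \<open>c\<close> if clearing it makes all exponents at \<open>A\<close> strictly
  positive, and not just nonnegative: then \<open>pos (x + nind k A) = A \<union> pos x\<close>, so that coefficients and
  relations are the same before and after.\<close>

definition good :: "'n set \<Rightarrow> nat \<Rightarrow> (('n \<Rightarrow> int) \<Rightarrow> 'g \<Rightarrow> 'k) \<Rightarrow> bool"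
  where "good A k c \<longleftrightarrow> (\<forall>x. c x \<noteq> 0 \<longrightarrow> (\<forall>t\<in>A. 0 < x t + int k))"

lemma good_mono: "good A k c \<Longrightarrow> k \<le> l \<Longrightarrow> good A l c"
  by (fastforce simp: good_def)

lemma good_0: "good A k 0"
  by (simp add: good_def)

lemma good_ex:
  assumes "c \<in> Loc A"
  shows "\<exists>k. good A k c"
proof -
  let ?N = "\<Sum>x\<in>{x. c x \<noteq> 0}. \<Sum>t\<in>UNIV. nat \<bar>x t\<bar>"
  have "0 < x t + int (Suc ?N)" if "c x \<noteq> 0" for x t
  proof -
    have "nat \<bar>x t\<bar> \<le> (\<Sum>t\<in>UNIV. nat \<bar>x t\<bar>)" by (rule member_le_sum) auto
    also have "\<dots> \<le> ?N" using LocD(1)[OF assms] that by (intro member_le_sum) auto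
    finally show ?thesis by linarith
  qed
  then show ?thesis unfolding good_def by blast
qed

lemma good_supports:
  assumes "c x \<noteq> 0" "good A k c"
  shows "pos (x + nind k A) = A \<union> pos x" "neg (x + nind k A) = neg x - A"
proof -
  have "t \<in> A \<Longrightarrow> 0 < x t + int k" for t using assms by (simp add: good_def)
  then show "pos (x + nind k A) = A \<union> pos x" "neg (x + nind k A) = neg x - A"
    by (auto simp: pos_def neg_def nind_def not_less split: if_splits) (meson less_asym not_less order_less_imp_le)+
qed

lemma good_shift_Loc:
  assumes c: "c \<in> Loc A" and k: "good A k c"
  shows "shift (nind k A) c \<in> Loc {}"
proof (rule LocI)
  show "finite {x. shift (nind k A) c x \<noteq> 0}"
    using finite_supp_shift[OF LocD(1)[OF c]] by (simp add: shift_def)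
  fix y
  have y: "pos y = A \<union> pos (y - nind k A)" "neg y = neg (y - nind k A) - A" if "shift (nind k A) c y \<noteq> 0"
    using good_supports[OF that[unfolded shift_def] k] by simp_all
  show "shift (nind k A) c y \<in> coeffs ({} \<union> pos y)"
  using y LocD c by (fastforce simp: shift_def fun_vs.subspace_0 coeffs_subspace)
  show "neg y \<subseteq> {}" if "shift (nind k A) c y \<noteq> 0"
    using y(2)[OF that] LocD(3)[OF c that[unfolded shift_def]] by blast
qed

lemma good_shift_Loc_Rel:
  assumes c: "c \<in> Loc_Rel A" and k: "good A k c"
  shows "shift (nind k A) c \<in> Loc_Rel {}"
proof -
  have "shift (nind k A) c y \<in> Rel ({} \<union> pos y)" for y
  proof (cases "shift (nind k A) c y = 0")
    case False
    then have "pos y = A \<union> pos (y - nind k A)"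
      using good_supports(1)[OF False[unfolded shift_def] k] by simp
    then show ?thesis using c by (simp add: Loc_Rel_def shift_def)
  qed (simp add: fun_vs.subspace_0[OF Rel_subspace])
  then show ?thesis using c good_shift_Loc[OF _ k] by (simp add: Loc_Rel_def)
qed

lemma unshift_Loc:
  assumes u: "u \<in> Loc {}"
  shows "shift (- nind k A) u \<in> Loc A"
proof (rule LocI)
  show "finite {x. shift (- nind k A) u x \<noteq> 0}"
    using finite_supp_shift[OF LocD(1)[OF u], of "- nind k A"] by (simp add: shift_def)
  fix x
  have sup: "pos (x + nind k A) \<subseteq> A \<union> pos x" by (auto simp: pos_def nind_def split: if_splits)
  show "shift (- nind k A) u x \<in> coeffs (A \<union> pos x)"
    using LocD(2)[OF u, of "x + nind k A"] coeffs_mono[OF sup] by (auto simp: shift_def)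
  show "neg x \<subseteq> A" if "shift (- nind k A) u x \<noteq> 0"
  proof -
    have "neg (x + nind k A) \<subseteq> {}" using LocD(3)[OF u, of "x + nind k A"] that by (simp add: shift_def)
    then show ?thesis by (auto simp: neg_def nind_def split: if_splits)
  qed
qed

lemma unshift_Loc_Rel:
  assumes u: "u \<in> Loc_Rel {}"
  shows "shift (- nind k A) u \<in> Loc_Rel A"
proof -
  have "shift (- nind k A) u x \<in> Rel (A \<union> pos x)" for x
  proof -
    have sup: "pos (x + nind k A) \<subseteq> A \<union> pos x" by (auto simp: pos_def nind_def split: if_splits)
    have "u (x + nind k A) \<in> Rel (pos (x + nind k A))" using u by (simp add: Loc_Rel_def)
    then show ?thesis using Rel_mono[OF sup] by (auto simp: shift_def)
  qed
  then show ?thesis using u unshift_Loc by (simp add: Loc_Rel_def)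
qed

text \<open>The exponent \<open>Suc k\<close> instead of \<open>k\<close>: clearing the denominator
  makes the entries at \<open>A\<close> nonnegative, and one further factor makes them
  positive.\<close>

lemma good_unshift:
  assumes u: "u \<in> Loc {}"
  shows "good A (Suc k) (shift (- nind k A) u)"
  unfolding good_def
proof (intro allI impI ballI)
  fix x t assume "shift (- nind k A) u x \<noteq> 0" and t: "t \<in> A"
  then have "neg (x + nind k A) \<subseteq> {}" using LocD(3)[OF u, of "x + nind k A"] by (simp add: shift_def)
  then have "\<not> (x + nind k A) t < 0" by (auto simp: neg_def)
  then show "0 < x t + int (Suc k)" using t by (simp add: nind_def)
qed

end

text \<open>Elements of \<open>N\<close> are represented by families of coefficients of the generators. The two instances are
  \<open>M\<close> itself, with \<open>m = 0\<close>, and its quotient by the multiples of the forms.\<close>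

locale presented_module = squarefree_system_forms gens Rel a m
  for gens :: "'n::{finite, linorder} set \<Rightarrow> 'g set" and Rel :: "'n set \<Rightarrow> ('g \<Rightarrow> 'k::field) set"
    and a :: "'n \<times> nat \<Rightarrow> 'k" and m :: nat +
  fixes N :: "(('n, 'k) mpoly, 'q) module" and \<pi> :: "(('n \<Rightarrow> int) \<Rightarrow> 'g \<Rightarrow> 'k) \<Rightarrow> 'q"
  assumes mod: "Module.module poly_ring N"
    and carrier_N: "carrier N = \<pi> ` Loc {}" and \<pi>_0: "\<zero>\<^bsub>N\<^esub> = \<pi> 0"
    and \<pi>_add: "u \<in> Loc {} \<Longrightarrow> v \<in> Loc {} \<Longrightarrow> \<pi> (u + v) = \<pi> u \<oplus>\<^bsub>N\<^esub> \<pi> v"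
    and \<pi>_Var: "u \<in> Loc {} \<Longrightarrow> Var t \<odot>\<^bsub>N\<^esub> \<pi> u = \<pi> (shift (unit_exp t) u)"
    and \<pi>_Const: "u \<in> Loc {} \<Longrightarrow> Const r \<odot>\<^bsub>N\<^esub> \<pi> u = \<pi> (uscale r u)"
    and \<pi>_ker: "u \<in> Loc {} \<Longrightarrow> \<pi> u = \<zero>\<^bsub>N\<^esub> \<longleftrightarrow>
      (\<exists>k\<in>Loc_Rel {}. \<exists>v. (\<forall>q. v q \<in> Loc {}) \<and> u = k + (\<Sum>q\<in>{1..m}. lform a q (v q)))"
begin

definition forms :: "'n set \<Rightarrow> (('n \<Rightarrow> int) \<Rightarrow> 'g \<Rightarrow> 'k) set"
  where "forms A = {k + (\<Sum>q\<in>{1..m}. lform a q (v q)) | k v. k \<in> Loc_Rel A \<and> (\<forall>q. v q \<in> Loc A)}"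

lemma \<pi>_ker': "u \<in> Loc {} \<Longrightarrow> \<pi> u = \<zero>\<^bsub>N\<^esub> \<longleftrightarrow> u \<in> forms {}"
  using \<pi>_ker by (auto simp: forms_def)

lemma frac_module: "frac_module poly_ring N"
  by (intro frac_module.intro mod) (simp add: frac_module_axioms_def)

lemma \<pi>_closed: "u \<in> Loc {} \<Longrightarrow> \<pi> u \<in> carrier N"
  by (simp add: carrier_N)

lemma Var_power_\<pi>: "u \<in> Loc {} \<Longrightarrow> Var t ^ k \<odot>\<^bsub>N\<^esub> \<pi> u = \<pi> (shift (nind k {t}) u)"
proof (induction k)
  case 0
  then show ?case by (simp only: power_0 frac_module.smult_1[OF frac_module] \<pi>_closed nind_0 shift_0)
next
  case (Suc k)
  have "Var t ^ Suc k \<odot>\<^bsub>N\<^esub> \<pi> u = Var t \<odot>\<^bsub>N\<^esub> (Var t ^ k \<odot>\<^bsub>N\<^esub> \<pi> u)"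
    using frac_module.smult_smult[OF frac_module \<pi>_closed[OF Suc.prems]] by simp
  also have "\<dots> = \<pi> (shift (unit_exp t) (shift (nind k {t}) u))"
    unfolding Suc.IH[OF Suc.prems] by (intro \<pi>_Var shift_Loc Suc.prems) (simp add: nind_def)
  also have "\<dots> = \<pi> (shift (nind (Suc k) {t}) u)"
    by (simp add: shift_shift nind_add flip: nind_single)
  finally show ?case .
qed

lemma var_prod_power_\<pi>:
  assumes u: "u \<in> Loc {}"
  shows "var_prod A ^ k \<odot>\<^bsub>N\<^esub> \<pi> u = \<pi> (shift (nind k A) u)"
  using finite[of A]
proof (induction A rule: finite_induct)
  case empty
  then show ?case
    by (simp only: var_prod_def prod.empty power_one frac_module.smult_1[OF frac_module] \<pi>_closed[OF u] nind_0 shift_0)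
next
  case (insert t A)
  have "var_prod (insert t A) ^ k \<odot>\<^bsub>N\<^esub> \<pi> u = Var t ^ k \<odot>\<^bsub>N\<^esub> (var_prod A ^ k \<odot>\<^bsub>N\<^esub> \<pi> u)"
    using insert.hyps frac_module.smult_smult[OF frac_module \<pi>_closed[OF u]]
    by (simp add: var_prod_def power_mult_distrib)
  also have "\<dots> = \<pi> (shift (nind k {t}) (shift (nind k A) u))"
    unfolding insert.IH by (intro Var_power_\<pi> shift_Loc u) (simp add: nind_def)
  also have "\<dots> = \<pi> (shift (nind k (insert t A)) u)"
    by (simp add: shift_shift nind_insert insert.hyps)
  finally show ?case .
qed

lemma formsI: "k \<in> Loc_Rel A \<Longrightarrow> (\<And>q. v q \<in> Loc A) \<Longrightarrow> k + (\<Sum>q\<in>{1..m}. lform a q (v q)) \<in> forms A"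
  unfolding forms_def by blast

text \<open>The fraction represented by \<open>c\<close>: a good denominator is cleared, the
  numerator is read in \<open>N\<close>, and the denominator is put back. By
  \<open>loc_elem_eq\<close> any good denominator gives the same fraction.\<close>

definition loc_elem :: "'n set \<Rightarrow> (('n \<Rightarrow> int) \<Rightarrow> 'g \<Rightarrow> 'k) \<Rightarrow> ('q \<times> nat) set"
  where "loc_elem A c = (let k = (SOME k. good A k c) in frac N (var_prod A) (\<pi> (shift (nind k A) c)) k)"

lemma loc_elem_eq:
  assumes c: "c \<in> Loc A" and k: "good A k c"
  shows "loc_elem A c = frac N (var_prod A) (\<pi> (shift (nind k A) c)) k"
proof -
  have expand: "frac N (var_prod A) (\<pi> (shift (nind k A) c)) k = frac N (var_prod A) (\<pi> (shift (nind (n + k) A) c)) (n + k)"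
    if "good A k c" for k n
  proof -
    have L: "shift (nind k A) c \<in> Loc {}" by (rule good_shift_Loc[OF c that])
    have "\<pi> (shift (nind (n + k) A) c) = var_prod A ^ n \<odot>\<^bsub>N\<^esub> \<pi> (shift (nind k A) c)"
      by (simp add: var_prod_power_\<pi>[OF L] shift_shift nind_add)
    then show ?thesis using frac_module.frac_expand[OF frac_module \<pi>_closed[OF L]] by simp
  qed
  define l where "l = (SOME k. good A k c)"
  have l: "good A l c" unfolding l_def using k by (rule someI)
  have "loc_elem A c = frac N (var_prod A) (\<pi> (shift (nind l A) c)) l" by (simp add: loc_elem_def l_def Let_def)
  also have "\<dots> = frac N (var_prod A) (\<pi> (shift (nind k A) c)) k"
    using expand[OF l, of k] expand[OF k, of l] by (simp add: add.commute)
  finally show ?thesis .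
qed

text \<open>Every fraction arises from a family in \<open>Loc A\<close>. Its own denominator
  \<open>k\<close> may be one short of being good, so the fraction is expanded by one factor
  \<open>var_prod A\<close>.\<close>

lemma loc_elem_unshift:
  assumes u: "u \<in> Loc {}"
  shows "loc_elem A (shift (- nind k A) u) = frac N (var_prod A) (\<pi> u) k"
proof -
  have "nind (Suc k) A + - nind k A = nind 1 A" by (auto simp: nind_def fun_eq_iff)
  then have "loc_elem A (shift (- nind k A) u) = frac N (var_prod A) (var_prod A ^ 1 \<odot>\<^bsub>N\<^esub> \<pi> u) (1 + k)"
    unfolding loc_elem_eq[OF unshift_Loc[OF u] good_unshift[OF u]] by (simp only: shift_shift var_prod_power_\<pi>[OF u] plus_1_eq_Suc)
  also have "\<dots> = frac N (var_prod A) (\<pi> u) k"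
    by (rule frac_module.frac_expand[OF frac_module \<pi>_closed[OF u]])
  finally show ?thesis .
qed

lemma common_good:
  assumes "finite I" "\<And>i. i \<in> I \<Longrightarrow> f i \<in> Loc A"
  shows "\<exists>k. \<forall>i\<in>I. good A k (f i)"
  using assms
proof (induction I rule: finite_induct)
  case (insert i I)
  obtain k where k: "\<forall>i\<in>I. good A k (f i)" using insert by auto
  obtain l where l: "good A l (f i)" using good_ex[of "f i" A] insert by auto
  show ?case
    using k l good_mono[of A _ _ "max k l"] by (intro exI[of _ "max k l"]) auto
qed simp

sublocale loc: group_image "Loc A" "loc_elem A" "localization N (var_prod A)" for A
proof
  interpret F: frac_module poly_ring N "var_prod A" by (rule frac_module)
  show "0 \<in> Loc A" by (rule Loc_0)
  show "x - y \<in> Loc A" if "x \<in> Loc A" "y \<in> Loc A" for x y using that by (rule Loc_diff)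
  then have sum: "x + y \<in> Loc A" if "x \<in> Loc A" "y \<in> Loc A" for x y
    using that Loc_0[of A] by (metis diff_0 diff_minus_eq_add)
  show "loc_elem A (x + y) = loc_elem A x \<oplus>\<^bsub>localization N (var_prod A)\<^esub> loc_elem A y"
    if x: "x \<in> Loc A" and y: "y \<in> Loc A" for x y
  proof -
    have "\<exists>k. \<forall>i\<in>{x, y, x + y}. good A k i"
      using x y sum by (intro common_good) auto
    then obtain k where k: "good A k x" "good A k y" "good A k (x + y)" by auto
    let ?x = "shift (nind k A) x" and ?y = "shift (nind k A) y"
    have L: "?x \<in> Loc {}" "?y \<in> Loc {}" using good_shift_Loc x y k by auto
    have "loc_elem A x \<oplus>\<^bsub>localization N (var_prod A)\<^esub> loc_elem A y =
        frac N (var_prod A) (var_prod A ^ k \<odot>\<^bsub>N\<^esub> \<pi> ?x \<oplus>\<^bsub>N\<^esub> var_prod A ^ k \<odot>\<^bsub>N\<^esub> \<pi> ?y) (k + k)"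
      unfolding loc_elem_eq[OF x k(1)] loc_elem_eq[OF y k(2)] by (intro F.add_localization \<pi>_closed L)
    also have "\<dots> = frac N (var_prod A) (var_prod A ^ k \<odot>\<^bsub>N\<^esub> \<pi> (?x + ?y)) (k + k)"
      using L by (simp add: F.smult_add \<pi>_closed \<pi>_add)
    also have "\<dots> = frac N (var_prod A) (\<pi> (shift (nind k A) (x + y))) k"
      unfolding shift_add using good_shift_Loc[OF sum[OF x y] k(3)] by (intro F.frac_expand \<pi>_closed) (simp add: shift_add)
    also have "\<dots> = loc_elem A (x + y)" by (rule loc_elem_eq[OF sum[OF x y] k(3), symmetric])
    finally show ?thesis by simp
  qed
  show "carrier (localization N (var_prod A)) = loc_elem A ` Loc A"
  using good_ex loc_elem_eq F.carrier_localization \<pi>_closed good_shift_Loc loc_elem_unshift unshift_Loc by (fastforce simp: F.carrier_localization carrier_N)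
  show "\<zero>\<^bsub>localization N (var_prod A)\<^esub> = loc_elem A 0"
    using loc_elem_eq[OF Loc_0 good_0, of A 0] by (simp add: F.zero_localization \<pi>_0)
qed

text \<open>A fraction is zero if and only if some power of the denominator kills its numerator in
  \<open>N\<close>. An expression for the killed numerator through relations and forms is translated
  back to \<open>A\<close>. Conversely, an expression over \<open>A\<close> is cleared by a
  denominator that is good for \<open>c\<close>, for the relation and for all coefficients of the
  forms simultaneously.\<close>

lemma loc_elem_zero_iff:
  assumes c: "c \<in> Loc A"
  shows "loc_elem A c = \<zero>\<^bsub>localization N (var_prod A)\<^esub> \<longleftrightarrow> c \<in> forms A"
proof -
  interpret F: frac_module poly_ring N "var_prod A" by (rule frac_module)
  have iff: "loc_elem A c = \<zero>\<^bsub>localization N (var_prod A)\<^esub> \<longleftrightarrow> (\<exists>q. shift (nind (q + k) A) c \<in> forms {})"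
    if k: "good A k c" for k
  proof -
    have L: "shift (nind k A) c \<in> Loc {}" by (rule good_shift_Loc[OF c k])
    have zc: "\<zero>\<^bsub>N\<^esub> \<in> carrier N" using \<pi>_closed[OF Loc_0] by (simp add: \<pi>_0)
    have z: "p \<odot>\<^bsub>N\<^esub> \<zero>\<^bsub>N\<^esub> = \<zero>\<^bsub>N\<^esub>" for p using F.smult_r_null[of p] by simp
    have "loc_elem A c = \<zero>\<^bsub>localization N (var_prod A)\<^esub> \<longleftrightarrow>
        (\<exists>q. var_prod A ^ (q + 0) \<odot>\<^bsub>N\<^esub> \<pi> (shift (nind k A) c) = var_prod A ^ (q + k) \<odot>\<^bsub>N\<^esub> \<zero>\<^bsub>N\<^esub>)"
      unfolding F.zero_localization loc_elem_eq[OF c k] by (rule F.frac_eq_iff[OF \<pi>_closed[OF L] zc])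
    also have "\<dots> \<longleftrightarrow> (\<exists>q. \<pi> (shift (nind (q + k) A) c) = \<zero>\<^bsub>N\<^esub>)"
      by (simp add: z var_prod_power_\<pi>[OF L] shift_shift nind_add)
    also have "\<dots> \<longleftrightarrow> (\<exists>q. shift (nind (q + k) A) c \<in> forms {})"
      using good_shift_Loc[OF c good_mono[OF k]] by (simp add: \<pi>_ker')
    finally show ?thesis .
  qed
  show ?thesis
  proof
    assume *: "loc_elem A c = \<zero>\<^bsub>localization N (var_prod A)\<^esub>"
    obtain k where k: "good A k c" using good_ex[OF c] by blast
    obtain q where "shift (nind (q + k) A) c \<in> forms {}" using * iff[OF k] by blast
    then obtain \<kappa> v where \<kappa>: "\<kappa> \<in> Loc_Rel {}" and v: "\<And>q. v q \<in> Loc {}"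
      and eq: "shift (nind (q + k) A) c = \<kappa> + (\<Sum>q\<in>{1..m}. lform a q (v q))"
      by (auto simp: forms_def)
    let ?s = "shift (- nind (q + k) A)"
    have "c = ?s (shift (nind (q + k) A) c)" by (simp add: shift_shift)
    also have "\<dots> = ?s \<kappa> + (\<Sum>q\<in>{1..m}. lform a q (?s (v q)))"
      unfolding eq shift_add shift_sum lform_shift ..
    also have "\<dots> \<in> forms A" by (intro formsI unshift_Loc_Rel unshift_Loc \<kappa> v)
    finally show "c \<in> forms A" .
  next
    assume "c \<in> forms A"
    then obtain \<kappa> v where \<kappa>: "\<kappa> \<in> Loc_Rel A" and v: "\<And>q. v q \<in> Loc A"
      and eq: "c = \<kappa> + (\<Sum>q\<in>{1..m}. lform a q (v q))"
      by (auto simp: forms_def)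
    have "\<exists>k. \<forall>i\<in>insert c (insert \<kappa> (v ` {1..m})). good A k i"
      using c \<kappa> v by (intro common_good) (auto simp: Loc_Rel_def)
    then obtain k where k: "good A k c" "good A k \<kappa>" "\<And>q. q \<in> {1..m} \<Longrightarrow> good A k (v q)" by auto
    \<comment> \<open>The value 0 outside the range: \<open>formsI\<close> asks for membership at
      every index, whereas \<open>k\<close> is good only for the finitely many coefficients that
      occur.\<close>
    let ?v = "\<lambda>q. shift (nind k A) (if q \<in> {1..m} then v q else 0)"
    have "?v q \<in> Loc {}" for q
      using good_shift_Loc[OF v k(3)] good_shift_Loc[OF Loc_0 good_0, of k A] by (cases "q \<in> {1..m}") auto
    then have "shift (nind k A) \<kappa> + (\<Sum>q\<in>{1..m}. lform a q (?v q)) \<in> forms {}"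
      by (intro formsI good_shift_Loc_Rel[OF \<kappa> k(2)])
    also have "shift (nind k A) \<kappa> + (\<Sum>q\<in>{1..m}. lform a q (?v q)) = shift (nind (0 + k) A) c"
      unfolding eq shift_add shift_sum lform_shift by simp
    finally have "shift (nind (0 + k) A) c \<in> forms {}" .
    then show "loc_elem A c = \<zero>\<^bsub>localization N (var_prod A)\<^esub>" using iff[OF k(1)] by blast
  qed
qed

lemma loc_elem_Const:
  assumes c: "c \<in> Loc A"
  shows "Const r \<odot>\<^bsub>localization N (var_prod A)\<^esub> loc_elem A c = loc_elem A (uscale r c)"
proof -
  interpret F: frac_module poly_ring N "var_prod A" by (rule frac_module)
  have "\<exists>k. \<forall>i\<in>{c, uscale r c}. good A k i"
    using c uscale_Loc by (intro common_good) auto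
  then obtain k where k: "good A k c" "good A k (uscale r c)" by auto
  have "Const r \<odot>\<^bsub>localization N (var_prod A)\<^esub> loc_elem A c = frac N (var_prod A) (Const r \<odot>\<^bsub>N\<^esub> \<pi> (shift (nind k A) c)) k"
    unfolding loc_elem_eq[OF c k(1)] by (intro F.smult_localization \<pi>_closed good_shift_Loc c k)
  also have "Const r \<odot>\<^bsub>N\<^esub> \<pi> (shift (nind k A) c) = \<pi> (shift (nind k A) (uscale r c))"
    using \<pi>_Const[OF good_shift_Loc[OF c k(1)]] by (simp add: uscale_def shift_def)
  finally show ?thesis using loc_elem_eq[OF uscale_Loc[OF c] k(2)] by simp
qed

lemma Loc_mono:
  assumes "A \<subseteq> B" "c \<in> Loc A"
  shows "c \<in> Loc B"
proof (rule LocI)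
  show "finite {x. c x \<noteq> 0}" by (rule LocD(1)[OF assms(2)])
  show "c x \<in> coeffs (B \<union> pos x)" for x
    using LocD(2)[OF assms(2), of x] coeffs_mono[OF Un_mono[OF assms(1) subset_refl[of "pos x"]]] by blast
  show "neg x \<subseteq> B" if "c x \<noteq> 0" for x
    using LocD(3)[OF assms(2) that] assms(1) by blast
qed

text \<open>On representatives the canonical map between localizations is the inclusion of
  \<open>Loc A\<close> in \<open>Loc (insert t A)\<close>; a denominator good for both sets makes
  this visible. For this reason the Cech differential turns into the alternating sum
  \<open>cdiff\<close>.\<close>

lemma loc_map_loc_elem:
  assumes c: "c \<in> Loc A" and t: "t \<notin> A"
  shows "loc_map N (var_prod A) (Var t) (loc_elem A c) = loc_elem (insert t A) c"
proof -
  interpret F: frac_module poly_ring N "var_prod A" by (rule frac_module)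
  have c': "c \<in> Loc (insert t A)" by (rule Loc_mono[OF _ c]) blast
  obtain k1 k2 where "good A k1 c" "good (insert t A) k2 c" using good_ex c c' by blast
  then have k: "good A (max k1 k2) c" "good (insert t A) (max k1 k2) c" using good_mono by auto
  let ?k = "max k1 k2"
  have L: "shift (nind ?k A) c \<in> Loc {}" by (rule good_shift_Loc[OF c k(1)])
  have "loc_map N (var_prod A) (Var t) (loc_elem A c) =
      frac N (var_prod A * Var t) (Var t ^ ?k \<odot>\<^bsub>N\<^esub> \<pi> (shift (nind ?k A) c)) ?k"
    unfolding loc_elem_eq[OF c k(1)] by (rule F.loc_map_frac[OF \<pi>_closed[OF L]])
  also have "var_prod A * Var t = var_prod (insert t A)"
    using t by (simp add: var_prod_def mult.commute)
  also have "Var t ^ ?k \<odot>\<^bsub>N\<^esub> \<pi> (shift (nind ?k A) c) = \<pi> (shift (nind ?k (insert t A)) c)"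
    unfolding Var_power_\<pi>[OF L] shift_shift nind_insert[OF t] ..
  finally show ?thesis using loc_elem_eq[OF c' k(2)] by simp
qed

subsection \<open>Cochains and cohomology\<close>

definition cochain_elem :: "int \<Rightarrow> ('n set \<Rightarrow> ('n \<Rightarrow> int) \<Rightarrow> 'g \<Rightarrow> 'k) \<Rightarrow> 'n set \<Rightarrow> ('q \<times> nat) set"
  where "cochain_elem j c = (\<lambda>A\<in>{A. int (card A) = j}. loc_elem A (c A))"

definition cforms :: "int \<Rightarrow> ('n set \<Rightarrow> ('n \<Rightarrow> int) \<Rightarrow> 'g \<Rightarrow> 'k) set"
  where "cforms j = {k + (\<Sum>q\<in>{1..m}. cform a q (v q)) | k v. k \<in> Cech_Rel j \<and> (\<forall>q. v q \<in> Cech j)}"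

lemma cformsI: "k \<in> Cech_Rel j \<Longrightarrow> (\<And>q. v q \<in> Cech j) \<Longrightarrow> k + (\<Sum>q\<in>{1..m}. cform a q (v q)) \<in> cforms j"
  unfolding cforms_def by blast

lemma Cech_subspace: "cochain_vs.subspace (Cech j)"
  by (rule cochains_subspace[OF LC_subspace])

sublocale cech: group_image "Cech j" "cochain_elem j" "cech N j" for j
proof
  show "0 \<in> Cech j" by (rule cochain_vs.subspace_0[OF Cech_subspace])
  show "x - y \<in> Cech j" if "x \<in> Cech j" "y \<in> Cech j" for x y
    using that by (rule cochain_vs.subspace_diff[OF Cech_subspace])
  show "cochain_elem j (x + y) = cochain_elem j x \<oplus>\<^bsub>cech N j\<^esub> cochain_elem j y"
    if "x \<in> Cech j" "y \<in> Cech j" for x y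
    using Cech_component(1)[OF that(1)] Cech_component(1)[OF that(2)]
    by (auto simp: cochain_elem_def cech_def prod_module_def fun_eq_iff loc.h_add[unfolded plus_fun_def] plus_fun_def)
  show "\<zero>\<^bsub>cech N j\<^esub> = cochain_elem j 0"
    by (auto simp: cochain_elem_def cech_def prod_module_def fun_eq_iff loc.zero_eq zero_fun_def)
  show "carrier (cech N j) = cochain_elem j ` Cech j"
  proof
    show "cochain_elem j ` Cech j \<subseteq> carrier (cech N j)"
      using Cech_component(1) by (auto simp: cochain_elem_def cech_def prod_module_def loc.h_closed)
    show "carrier (cech N j) \<subseteq> cochain_elem j ` Cech j"
    proof
      fix y assume "y \<in> carrier (cech N j)"
      then have y: "y \<in> (\<Pi>\<^sub>E A\<in>{A. int (card A) = j}. loc_elem A ` Loc A)"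
        by (simp add: cech_def prod_module_def loc.carrier_eq cong: PiE_cong)
      then have "\<forall>A\<in>{A. int (card A) = j}. \<exists>c. c \<in> Loc A \<and> y A = loc_elem A c"
        by (auto simp: PiE_def Pi_def)
      from bchoice[OF this] obtain c where "\<forall>A\<in>{A. int (card A) = j}. c A \<in> Loc A \<and> y A = loc_elem A (c A)"
        by (rule exE)
      then have c: "c A \<in> Loc A" "y A = loc_elem A (c A)" if "int (card A) = j" for A using that by auto
      let ?c = "\<lambda>A. if int (card A) = j then c A else 0"
      have "?c \<in> Cech j" using c by (intro CechI) auto
      moreover have "y = cochain_elem j ?c"
      proof
        fix A show "y A = cochain_elem j ?c A"
          using c[of A] PiE_arb[OF y, of A] by (cases "int (card A) = j") (auto simp: cochain_elem_def)
      qed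
      ultimately show "y \<in> cochain_elem j ` Cech j" by blast
    qed
  qed
qed

lemma cochain_elem_zero_iff:
  assumes c: "c \<in> Cech j"
  shows "cochain_elem j c = \<zero>\<^bsub>cech N j\<^esub> \<longleftrightarrow> c \<in> cforms j"
proof -
  have "cochain_elem j c = \<zero>\<^bsub>cech N j\<^esub> \<longleftrightarrow> (\<forall>A. int (card A) = j \<longrightarrow> c A \<in> forms A)"
    using loc_elem_zero_iff[OF Cech_component(1)[OF c]]
    by (auto simp: cochain_elem_def cech_def prod_module_def fun_eq_iff restrict_def)
  also have "\<dots> \<longleftrightarrow> c \<in> cforms j"
  proof
    assume *: "\<forall>A. int (card A) = j \<longrightarrow> c A \<in> forms A"
    have "\<forall>A\<in>{A. int (card A) = j}. \<exists>p. fst p \<in> Loc_Rel A \<and> (\<forall>q. snd p q \<in> Loc A) \<and>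
        c A = fst p + (\<Sum>q\<in>{1..m}. lform a q (snd p q))"
    proof
      fix A :: "'n set" assume "A \<in> {A. int (card A) = j}"
      then obtain k v where "k \<in> Loc_Rel A" "\<forall>q. v q \<in> Loc A" "c A = k + (\<Sum>q\<in>{1..m}. lform a q (v q))"
        using * by (auto simp: forms_def)
      then show "\<exists>p. fst p \<in> Loc_Rel A \<and> (\<forall>q. snd p q \<in> Loc A) \<and>
          c A = fst p + (\<Sum>q\<in>{1..m}. lform a q (snd p q))"
        by (intro exI[of _ "(k, v)"]) simp
    qed
    from bchoice[OF this] obtain p where p: "\<forall>A\<in>{A. int (card A) = j}. fst (p A) \<in> Loc_Rel A \<and>
        (\<forall>q. snd (p A) q \<in> Loc A) \<and> c A = fst (p A) + (\<Sum>q\<in>{1..m}. lform a q (snd (p A) q))"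
      by (rule exE)
    let ?k = "\<lambda>A. if int (card A) = j then fst (p A) else 0"
    let ?v = "\<lambda>q A. if int (card A) = j then snd (p A) q else 0"
    have "?k \<in> Cech_Rel j" using p by (intro Cech_RelI) auto
    moreover have "?v q \<in> Cech j" for q using p by (intro CechI) auto
    moreover have "c = ?k + (\<Sum>q\<in>{1..m}. cform a q (?v q))"
    proof
      fix A
      show "c A = (?k + (\<Sum>q\<in>{1..m}. cform a q (?v q))) A"
      proof (cases "int (card A) = j")
        case True
        then have "c A = fst (p A) + (\<Sum>q\<in>{1..m}. lform a q (snd (p A) q))" using p by blast
        then show ?thesis using True by (simp add: sum_fun_apply cform_def)
      next
        case False
        have "lform a q 0 = 0" for q by (rule lform.\<theta>_0)
        then show ?thesis using False Cech_component(2)[OF c] by (simp add: sum_fun_apply cform_def)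
      qed
    qed
    ultimately show "c \<in> cforms j" by (simp only: cformsI)
  next
    assume "c \<in> cforms j"
    then obtain k v where k: "k \<in> Cech_Rel j" and v: "\<And>q. v q \<in> Cech j" and eq: "c = k + (\<Sum>q\<in>{1..m}. cform a q (v q))"
      by (auto simp: cforms_def)
    show "\<forall>A. int (card A) = j \<longrightarrow> c A \<in> forms A"
    proof (intro allI impI)
      fix A
      have "c A = k A + (\<Sum>q\<in>{1..m}. lform a q (v q A))" by (simp add: eq sum_fun_apply cform_def)
      then show "c A \<in> forms A"
        using formsI[OF Cech_Rel_component(1)[OF k] Cech_component(1)[OF v]] by simp
    qed
  qed
  finally show ?thesis .
qed

lemma cdiff_Cech: "c \<in> Cech j \<Longrightarrow> cdiff c \<in> Cech (j + 1)"
  by (rule cdiff_cochains) (rule ldiff_LC)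

lemma cech_diff_cochain_elem:
  assumes c: "c \<in> Cech j"
  shows "cech_diff N j (cochain_elem j c) = cochain_elem (j + 1) (cdiff c)"
proof
  fix B
  show "cech_diff N j (cochain_elem j c) B = cochain_elem (j + 1) (cdiff c) B"
  proof (cases "int (card B) = j + 1")
    case False
    then show ?thesis by (simp add: cech_diff_def cochain_elem_def)
  next
    case True
    let ?L = "localization N (var_prod B)" and ?s = "\<lambda>t. ech_sign B t :: 'k"
    interpret L: abelian_group ?L by (rule loc.abelian_group)
    have cL: "c (B - {t}) \<in> Loc B" for t
      by (rule Loc_mono[OF _ Cech_component(1)[OF c]]) blast
    have summand: "(-1) ^ card {s \<in> B. s < t} \<odot>\<^bsub>?L\<^esub>
        loc_map N (var_prod (B - {t})) (Var t) (cochain_elem j c (B - {t})) = loc_elem B (uscale (?s t) (c (B - {t})))"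
      if t: "t \<in> B" for t
    proof -
      have card: "int (card (B - {t})) = j" using True card.remove[OF _ t] by simp
      then have "cochain_elem j c (B - {t}) = loc_elem (B - {t}) (c (B - {t}))" by (simp add: cochain_elem_def)
      moreover have "loc_map N (var_prod (B - {t})) (Var t) (loc_elem (B - {t}) (c (B - {t}))) = loc_elem B (c (B - {t}))"
        using loc_map_loc_elem[OF Cech_component(1)[OF c, of "B - {t}"], of t] t by (simp add: insert_absorb)
      ultimately show ?thesis
        using loc_elem_Const[OF cL, of "?s t" t] by (simp add: neg_one_power_Const ech_sign_def)
    qed
    have "cech_diff N j (cochain_elem j c) B = (\<Oplus>\<^bsub>?L\<^esub> t\<in>B. (-1) ^ card {s \<in> B. s < t} \<odot>\<^bsub>?L\<^esub>
        loc_map N (var_prod (B - {t})) (Var t) (cochain_elem j c (B - {t})))"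
      using True by (simp add: cech_diff_def)
    also have "\<dots> = (\<Oplus>\<^bsub>?L\<^esub> t\<in>B. loc_elem B (uscale (?s t) (c (B - {t}))))"
      by (intro L.finsum_cong' refl) (auto simp: summand loc.h_closed uscale_Loc cL)
    also have "\<dots> = loc_elem B (\<Sum>t\<in>B. uscale (?s t) (c (B - {t})))"
      by (intro loc.h_sum uscale_Loc cL) simp
    also have "(\<Sum>t\<in>B. uscale (?s t) (c (B - {t}))) = cdiff c B"
      by (auto simp: cdiff_def ldiff_def at_exp_def uscale_def fun_eq_iff sum_fun_apply)
    finally have "cech_diff N j (cochain_elem j c) B = loc_elem B (cdiff c B)" .
    moreover have "cochain_elem (j + 1) (cdiff c) B = loc_elem B (cdiff c B)" using True by (simp add: cochain_elem_def)
    ultimately show ?thesis by simp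
  qed
qed

text \<open>\<open>Zm\<close> and \<open>Bm\<close> are the preimages of the cocycles and of the coboundaries of \<open>N\<close>.\<close>

definition Zm :: "int \<Rightarrow> ('n set \<Rightarrow> ('n \<Rightarrow> int) \<Rightarrow> 'g \<Rightarrow> 'k) set"
  where "Zm j = {c \<in> Cech j. cdiff c \<in> cforms (j + 1)}"

definition Bm :: "int \<Rightarrow> ('n set \<Rightarrow> ('n \<Rightarrow> int) \<Rightarrow> 'g \<Rightarrow> 'k) set"
  where "Bm j = {cdiff b + t | b t. b \<in> Cech (j - 1) \<and> t \<in> cforms j}"

lemma cforms_sub: "cforms j \<subseteq> Cech j"
proof
  fix c assume "c \<in> cforms j"
  then obtain k v where "k \<in> Cech_Rel j" "\<And>q. v q \<in> Cech j" and eq: "c = k + (\<Sum>q\<in>{1..m}. cform a q (v q))"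
    by (auto simp: cforms_def)
  moreover have "Cech_Rel j \<subseteq> Cech j" using LR_sub_LC by (auto simp: cochains_def)
  ultimately show "c \<in> Cech j"
    by (auto intro!: cochain_vs.subspace_add[OF Cech_subspace] cochain_vs.subspace_sum[OF Cech_subspace]
        cform_cochains[OF LC_subspace LC_shift])
qed

lemma cforms_iff: "c \<in> cforms j \<longleftrightarrow> c \<in> Cech j \<and> cochain_elem j c = \<zero>\<^bsub>cech N j\<^esub>"
  using cochain_elem_zero_iff cforms_sub by blast

lemma cforms_diff: "c \<in> cforms j \<Longrightarrow> d \<in> cforms j \<Longrightarrow> c - d \<in> cforms j"
by (metis cech.h_diff_eq cech.C_diff cforms_iff)

lemma cforms_0: "0 \<in> cforms j"
  by (simp add: cforms_iff cech.C_0 cech.zero_eq)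

lemma cdiff_cforms: "c \<in> cforms j \<Longrightarrow> cdiff c \<in> cforms (j + 1)"
proof -
  assume "c \<in> cforms j"
  then obtain k v where k: "k \<in> Cech_Rel j" and v: "\<And>q. v q \<in> Cech j" and eq: "c = k + (\<Sum>q\<in>{1..m}. cform a q (v q))"
    by (auto simp: cforms_def)
  have "cdiff c = cdiff k + (\<Sum>q\<in>{1..m}. cform a q (cdiff (v q)))"
    unfolding eq by (simp only: cs.d_add cs.d_sum cdiff_cform)
  moreover have "cdiff k \<in> Cech_Rel (j + 1)" using k by (rule cdiff_cochains[rotated]) (rule ldiff_LR)
  ultimately show ?thesis using cformsI[OF _ cdiff_Cech[OF v]] by simp
qed

lemma Zm_diff: "x \<in> Zm j \<Longrightarrow> y \<in> Zm j \<Longrightarrow> x - y \<in> Zm j"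
  by (simp only: Zm_def mem_Collect_eq cech.C_diff cs.d_diff cforms_diff simp_thms)

lemma Bm_sub: "Bm j \<subseteq> Zm j"
proof
  fix x assume "x \<in> Bm j"
  then obtain b t where x: "x = cdiff b + t" "b \<in> Cech (j - 1)" "t \<in> cforms j" by (auto simp: Bm_def)
  have "cdiff b \<in> Cech j" using cdiff_Cech[OF x(2)] by simp
  then have "x \<in> Cech j" unfolding x(1) using x(3) cforms_sub by (intro cech.C_add) auto
  moreover have "cdiff x \<in> cforms (j + 1)"
    unfolding x(1) cdiff_add cdiff_cdiff using cdiff_cforms[OF x(3)] by simp
  ultimately show "x \<in> Zm j" by (simp add: Zm_def)
qed

lemma Bm_0: "0 \<in> Bm j"
  unfolding Bm_def using cforms_0 cech.C_0 cs.d_0 by (intro CollectI exI[of _ 0]) simp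

lemma Bm_diff: "x \<in> Bm j \<Longrightarrow> y \<in> Bm j \<Longrightarrow> x - y \<in> Bm j"
proof -
  assume "x \<in> Bm j" "y \<in> Bm j"
  then obtain b t b' t' where x: "x = cdiff b + t" "b \<in> Cech (j - 1)" "t \<in> cforms j"
    and y: "y = cdiff b' + t'" "b' \<in> Cech (j - 1)" "t' \<in> cforms j" by (auto simp: Bm_def)
  have "x - y = cdiff (b - b') + (t - t')" unfolding x y cs.d_diff by (simp only: add_diff_add)
  then show ?thesis unfolding Bm_def using cech.C_diff[OF x(2) y(2)] cforms_diff[OF x(3) y(3)] by blast
qed

lemma cocycles_image: "cocycles N j = cochain_elem j ` Zm j"
using cochain_elem_zero_iff cdiff_Cech by (auto simp: cech_diff_cochain_elem Zm_def cocycles_def cech.carrier_eq)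

lemma coboundaries_image: "coboundaries N j = cochain_elem j ` Bm j"
proof -
  have "coboundaries N j = (\<lambda>b. cochain_elem j (cdiff b)) ` Cech (j - 1)"
    unfolding coboundaries_def cech.carrier_eq image_image
    by (intro image_cong refl) (use cech_diff_cochain_elem[of _ "j - 1"] in simp)
  also have "\<dots> = cochain_elem j ` Bm j"
  proof
    show "(\<lambda>b. cochain_elem j (cdiff b)) ` Cech (j - 1) \<subseteq> cochain_elem j ` Bm j"
    proof
      fix y assume "y \<in> (\<lambda>b. cochain_elem j (cdiff b)) ` Cech (j - 1)"
      then obtain b where b: "b \<in> Cech (j - 1)" "y = cochain_elem j (cdiff b)" by blast
      have "cdiff b + 0 \<in> Bm j" unfolding Bm_def using b(1) cforms_0 by blast
      then show "y \<in> cochain_elem j ` Bm j" using b(2) by simp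
    qed
    show "cochain_elem j ` Bm j \<subseteq> (\<lambda>b. cochain_elem j (cdiff b)) ` Cech (j - 1)"
    proof
      fix y assume "y \<in> cochain_elem j ` Bm j"
      then obtain b t where b: "b \<in> Cech (j - 1)" "t \<in> cforms j" "y = cochain_elem j (cdiff b + t)"
        by (auto simp: Bm_def)
      have "cdiff b \<in> Cech j" using cdiff_Cech[OF b(1)] by simp
      moreover have "t \<in> Cech j" using b(2) cforms_sub by blast
      moreover have "cochain_elem j t = cochain_elem j 0" using b(2) by (simp add: cforms_iff cech.zero_eq)
      ultimately have "y = cochain_elem j (cdiff b + 0)"
        unfolding b(3) by (simp only: cech.h_add cech.C_0)
      then show "y \<in> (\<lambda>b. cochain_elem j (cdiff b)) ` Cech (j - 1)" using b(1) by simp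
    qed
  qed
  finally show ?thesis .
qed

lemma Zm_Cech: "Zm j \<subseteq> Cech j"
  by (auto simp: Zm_def)

sublocale coh: group_image "Zm j" "cochain_elem j" "(cech N j)\<lparr>carrier := cocycles N j\<rparr>" for j
proof
  show "0 \<in> Zm j" using Bm_0 Bm_sub by blast
  show "cochain_elem j (x + y) = cochain_elem j x \<oplus>\<^bsub>(cech N j)\<lparr>carrier := cocycles N j\<rparr>\<^esub> cochain_elem j y"
    if "x \<in> Zm j" "y \<in> Zm j" for x y
    using cech.h_add[of x j y] that Zm_Cech by auto
qed (simp_all add: Zm_diff cocycles_image cech.zero_eq)

lemma cochain_elem_Const:
  assumes c: "c \<in> Cech j"
  shows "Const r \<odot>\<^bsub>cech N j\<^esub> cochain_elem j c = cochain_elem j (cscale r c)"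
  using loc_elem_Const[OF Cech_component(1)[OF c]]
  by (auto simp: cochain_elem_def cech_def prod_module_def fun_eq_iff cscale_def uscale_def)

definition coh_class :: "int \<Rightarrow> ('n set \<Rightarrow> ('n \<Rightarrow> int) \<Rightarrow> 'g \<Rightarrow> 'k) \<Rightarrow> ('n set \<Rightarrow> ('q \<times> nat) set) set"
  where "coh_class j z = group_image.coset (cochain_elem j) (Bm j) z"

lemma cforms_cscale: "c \<in> cforms j \<Longrightarrow> cscale r c \<in> cforms j"
proof -
  assume "c \<in> cforms j"
  then obtain k v where k: "k \<in> Cech_Rel j" and v: "\<And>q. v q \<in> Cech j" and eq: "c = k + (\<Sum>q\<in>{1..m}. cform a q (v q))"
    by (auto simp: cforms_def)
  have "cscale r c = cscale r k + (\<Sum>q\<in>{1..m}. cform a q (cscale r (v q)))"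
    unfolding eq by (simp only: cochain_vs.scale_right_distrib cochain_vs.scale_sum_right cform_scale)
  then show ?thesis
    using cformsI[OF cochain_vs.subspace_scale[OF cochains_subspace[OF LR_subspace] k] cochain_vs.subspace_scale[OF Cech_subspace v]]
    by simp
qed

lemma Zm_cscale: "c \<in> Zm j \<Longrightarrow> cscale r c \<in> Zm j"
  by (simp only: Zm_def mem_Collect_eq cochain_vs.subspace_scale[OF Cech_subspace] cdiff_scale cforms_cscale simp_thms)

lemma Bm_cscale: "c \<in> Bm j \<Longrightarrow> cscale r c \<in> Bm j"
proof -
  assume "c \<in> Bm j"
  then obtain b t where c: "c = cdiff b + t" "b \<in> Cech (j - 1)" "t \<in> cforms j" by (auto simp: Bm_def)
  have "cscale r c = cdiff (cscale r b) + cscale r t"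
    unfolding c(1) cdiff_scale by (rule cochain_vs.scale_right_distrib)
  then show ?thesis
    unfolding Bm_def using cochain_vs.subspace_scale[OF Cech_subspace c(2)] cforms_cscale[OF c(3)] by blast
qed

text \<open>\<open>wt\<close> extends the degree \<open>dg\<close> of monomials to integer exponent
  vectors, so that the fine grading (\<open>wt\<close> the identity) and the total degree
  (\<open>wt = tdeg\<close>) are covered by one argument. Homogeneous classes are images of
  homogeneous families in \<open>Zm\<close>, and the families with trivial class are those in
  \<open>Bm\<close>.\<close>

theorem local_cohomology_dim_eq:
  fixes dg :: "('n \<Rightarrow>\<^sub>0 nat) \<Rightarrow> 'e::ab_group_add" and wt :: "('n \<Rightarrow> int) \<Rightarrow> 'e"
  assumes gr: "\<And>e. gr e = \<pi> ` {u \<in> Loc {}. \<forall>x. u x \<noteq> 0 \<longrightarrow> wt x = e}"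
    and wt: "\<And>x p. wt (x + (\<lambda>t. int (Poly_Mapping.lookup p t))) = wt x + dg p"
    and dim: "subquot_dim cscale {z \<in> Zm j. \<forall>x. at_exp x z \<noteq> 0 \<longrightarrow> wt x = e}
      {z \<in> Bm j. \<forall>x. at_exp x z \<noteq> 0 \<longrightarrow> wt x = e} d"
  shows "local_cohomology_dim dg N gr j e = enat d"
proof -
  let ?V = "{z \<in> Zm j. \<forall>x. at_exp x z \<noteq> 0 \<longrightarrow> wt x = e}"
  let ?P = "(cech N j)\<lparr>carrier := cocycles N j\<rparr>"
  have nind_wt: "wt (x + nind k A) = wt x + dg (\<Sum>t\<in>A. Poly_Mapping.single t k)" for x k A
  proof -
    have "(\<lambda>t. int (Poly_Mapping.lookup (\<Sum>s\<in>A. Poly_Mapping.single s k) t)) = nind k A"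
      by (auto simp: lookup_sum lookup_single when_def nind_def fun_eq_iff)
    then show ?thesis using wt[of x "\<Sum>t\<in>A. Poly_Mapping.single t k"] by simp
  qed
  \<comment> \<open>Clearing the denominator \<open>var_prod A ^ k\<close> raises every weight by
    its degree, which is exactly the shift built into \<open>loc_grading\<close>.\<close>
  have loc_gr: "loc_grading dg N gr A e = loc_elem A ` {c \<in> Loc A. \<forall>x. c x \<noteq> 0 \<longrightarrow> wt x = e}" for A
  proof
    show "loc_grading dg N gr A e \<subseteq> loc_elem A ` {c \<in> Loc A. \<forall>x. c x \<noteq> 0 \<longrightarrow> wt x = e}"
    proof
      fix y assume "y \<in> loc_grading dg N gr A e"
      then obtain u k where u: "u \<in> Loc {}" "y = frac N (var_prod A) (\<pi> u) k"
        "\<And>x. u x \<noteq> 0 \<Longrightarrow> wt x = e + dg (\<Sum>t\<in>A. Poly_Mapping.single t k)"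
        by (auto simp: loc_grading_def gr)
      let ?c = "shift (- nind k A) u"
      have c: "?c \<in> Loc A" by (rule unshift_Loc[OF u(1)])
      have y: "y = loc_elem A ?c" unfolding u(2) by (rule loc_elem_unshift[OF u(1), symmetric])
      have "wt x = e" if "?c x \<noteq> 0" for x
      proof -
        have "u (x + nind k A) \<noteq> 0" using that by (simp add: shift_def)
        then have "wt (x + nind k A) = e + dg (\<Sum>t\<in>A. Poly_Mapping.single t k)" by (rule u(3))
        then show ?thesis unfolding nind_wt by simp
      qed
      then show "y \<in> loc_elem A ` {c \<in> Loc A. \<forall>x. c x \<noteq> 0 \<longrightarrow> wt x = e}" using y c by blast
    qed
    show "loc_elem A ` {c \<in> Loc A. \<forall>x. c x \<noteq> 0 \<longrightarrow> wt x = e} \<subseteq> loc_grading dg N gr A e"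
    proof
      fix y assume "y \<in> loc_elem A ` {c \<in> Loc A. \<forall>x. c x \<noteq> 0 \<longrightarrow> wt x = e}"
      then obtain c where c: "c \<in> Loc A" "y = loc_elem A c" "\<And>x. c x \<noteq> 0 \<Longrightarrow> wt x = e" by blast
      obtain k where k: "good A k c" using good_ex[OF c(1)] by blast
      have "wt x = e + dg (\<Sum>t\<in>A. Poly_Mapping.single t k)" if "shift (nind k A) c x \<noteq> 0" for x
        using c(3)[of "x - nind k A"] nind_wt[of "x - nind k A" k A] that by (simp add: shift_def)
      then have "\<pi> (shift (nind k A) c) \<in> gr (e + dg (\<Sum>t\<in>A. Poly_Mapping.single t k))"
        unfolding gr using good_shift_Loc[OF c(1) k] by blast
      then show "y \<in> loc_grading dg N gr A e"
        unfolding loc_grading_def c(2) loc_elem_eq[OF c(1) k] by blast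
    qed
  qed
  have piece: "cocycles N j \<inter> (\<Pi>\<^sub>E A\<in>{A. int (card A) = j}. loc_grading dg N gr A e) = cochain_elem j ` ?V"
  proof
    show "cochain_elem j ` ?V \<subseteq> cocycles N j \<inter> (\<Pi>\<^sub>E A\<in>{A. int (card A) = j}. loc_grading dg N gr A e)"
    proof
      fix y assume "y \<in> cochain_elem j ` ?V"
      then obtain z where z: "z \<in> Zm j" "\<And>x. at_exp x z \<noteq> 0 \<Longrightarrow> wt x = e" "y = cochain_elem j z" by blast
      have "loc_elem A (z A) \<in> loc_grading dg N gr A e" for A
      proof -
        have "wt x = e" if "z A x \<noteq> 0" for x
          using z(2)[of x] that by (metis at_exp_apply zero_fun_apply)
        then show ?thesis unfolding loc_gr using Cech_component(1)[of z j A] z(1) Zm_Cech by blast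
      qed
      then show "y \<in> cocycles N j \<inter> (\<Pi>\<^sub>E A\<in>{A. int (card A) = j}. loc_grading dg N gr A e)"
        using z by (auto simp: cocycles_image cochain_elem_def)
    qed
    show "cocycles N j \<inter> (\<Pi>\<^sub>E A\<in>{A. int (card A) = j}. loc_grading dg N gr A e) \<subseteq> cochain_elem j ` ?V"
    proof
      fix y assume y: "y \<in> cocycles N j \<inter> (\<Pi>\<^sub>E A\<in>{A. int (card A) = j}. loc_grading dg N gr A e)"
      then have "\<forall>A\<in>{A. int (card A) = j}. \<exists>c. c \<in> Loc A \<and> (\<forall>x. c x \<noteq> 0 \<longrightarrow> wt x = e) \<and> y A = loc_elem A c"
        unfolding loc_gr by (auto simp: PiE_def Pi_def)
      from bchoice[OF this] obtain c where
        c: "\<forall>A\<in>{A. int (card A) = j}. c A \<in> Loc A \<and> (\<forall>x. c A x \<noteq> 0 \<longrightarrow> wt x = e) \<and> y A = loc_elem A (c A)"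
        by (rule exE)
      let ?c = "\<lambda>A. if int (card A) = j then c A else 0"
      have cC: "?c \<in> Cech j" using c by (intro CechI) auto
      have y_eq: "y = cochain_elem j ?c"
      proof
        fix A show "y A = cochain_elem j ?c A"
          using c PiE_arb[of y "{A. int (card A) = j}" "\<lambda>A. loc_grading dg N gr A e" A] y
          by (cases "int (card A) = j") (auto simp: cochain_elem_def)
      qed
      have "cech_diff N j (cochain_elem j ?c) = \<zero>\<^bsub>cech N (j + 1)\<^esub>"
        using y unfolding y_eq by (simp add: cocycles_def)
      then have "?c \<in> Zm j"
        unfolding cech_diff_cochain_elem[OF cC] using cochain_elem_zero_iff[OF cdiff_Cech[OF cC]] cC by (simp add: Zm_def)
      moreover have "wt x = e" if "at_exp x ?c \<noteq> 0" for x
      proof (rule ccontr)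
        assume "wt x \<noteq> e"
        then have "?c A x = 0" for A using c by auto
        then have "at_exp x ?c = 0" by (auto simp: at_exp_def fun_eq_iff)
        then show False using that by simp
      qed
      ultimately show "y \<in> cochain_elem j ` ?V" using y_eq by blast
    qed
  qed
  have sub: "?V \<subseteq> Zm j" by blast
  note B = Bm_0[of j] Bm_diff[of _ j] Bm_sub[of j]
  have W: "local_cohomology_grading dg N gr j e = coh_class j ` ?V"
    unfolding local_cohomology_grading_def quot_grading_def piece coboundaries_image image_image coh_class_def
    using coh.r_coset_eq[OF B] sub by (intro image_cong refl) blast
  have "kdim (local_cohomology N j) (local_cohomology_grading dg N gr j e) = enat d"
    unfolding W
  proof (rule kdim_eq[OF cochain_vs.vector_space_axioms dim refl])
    fix x y assume x: "x \<in> ?V" and y: "y \<in> ?V"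
    show "coh_class j (x + y) = coh_class j x \<oplus>\<^bsub>local_cohomology N j\<^esub> coh_class j y"
      using coh.set_add_coset[of "Bm j" j x y] B x y by (simp add: local_cohomology_def quot_module_def coh_class_def)
  next
    fix c x assume x: "x \<in> ?V"
    show "Const c \<odot>\<^bsub>local_cohomology N j\<^esub> coh_class j x = coh_class j (cscale c x)"
    proof -
      have "set_add ?P (cochain_elem j ` Bm j) ((\<lambda>y. Const c \<odot>\<^bsub>?P\<^esub> y) ` group_image.coset (cochain_elem j) (Bm j) x) = group_image.coset (cochain_elem j) (Bm j) (cscale c x)"
      proof (rule coh.smult_coset)
        show "Const c \<odot>\<^bsub>?P\<^esub> cochain_elem j z = cochain_elem j (cscale c z)" if "z \<in> Zm j" for z
          using cochain_elem_Const[of z j c] that Zm_Cech by auto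
        show "cscale c (u + v) = cscale c u + cscale c v" for u v :: "'n set \<Rightarrow> ('n \<Rightarrow> int) \<Rightarrow> 'g \<Rightarrow> 'k"
          by (rule cochain_vs.scale_right_distrib)
      qed (use B x in \<open>simp_all only: mem_Collect_eq Bm_cscale Zm_cscale\<close>)
      then show ?thesis by (simp add: local_cohomology_def quot_module_def coh_class_def coboundaries_image)
    qed
  next
    show "coh_class j 0 = \<zero>\<^bsub>local_cohomology N j\<^esub>"
      by (simp add: local_cohomology_def quot_module_def coh_class_def coboundaries_image coh.coset_def)
  next
    fix x assume x: "x \<in> ?V"
    have "coh_class j x = \<zero>\<^bsub>local_cohomology N j\<^esub> \<longleftrightarrow> (\<exists>b\<in>Bm j. cochain_elem j x = cochain_elem j b)"
      using coh.coset_eq_iff[of "Bm j" j x] B x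
      by (simp add: local_cohomology_def quot_module_def coh_class_def coboundaries_image)
    \<comment> \<open>Families representing the same cochain of \<open>N\<close> differ by an
      element of \<open>cforms j\<close>, and \<open>Bm j\<close> contains these.\<close>
    also have "\<dots> \<longleftrightarrow> x \<in> Bm j"
    proof
      assume "\<exists>b\<in>Bm j. cochain_elem j x = cochain_elem j b"
      then obtain b where b: "b \<in> Bm j" "cochain_elem j x = cochain_elem j b" by blast
      have C: "x \<in> Cech j" "b \<in> Cech j" using x b Bm_sub Zm_Cech by blast+
      then have "x - b \<in> cforms j"
        using b(2) cech.h_diff_eq[OF C] cech.C_diff[OF C] by (simp add: cforms_iff)
      then have "cdiff 0 + (x - b) \<in> Bm j" unfolding Bm_def using cech.C_0 by blast
      then have xb: "x - b \<in> Bm j" by (simp only: cs.d_0 add_0)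
      have "0 - b \<in> Bm j" by (rule Bm_diff[OF Bm_0 b(1)])
      from Bm_diff[OF xb this] show "x \<in> Bm j" by simp
    qed blast
    finally show "coh_class j x = \<zero>\<^bsub>local_cohomology N j\<^esub> \<longleftrightarrow> x \<in> {z \<in> Bm j. \<forall>x. at_exp x z \<noteq> 0 \<longrightarrow> wt x = e}"
      using x by blast
  qed
  then show ?thesis by (simp add: local_cohomology_dim_def)
qed

end

section \<open>Homogeneous cocycles for the total degree and for the fine degree\<close>

context presented_module
begin

definition truncate_cochain :: "int \<Rightarrow> ('n set \<Rightarrow> ('n \<Rightarrow> int) \<Rightarrow> 'g \<Rightarrow> 'k) \<Rightarrow> 'n set \<Rightarrow> ('n \<Rightarrow> int) \<Rightarrow> 'g \<Rightarrow> 'k"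
  where "truncate_cochain e c = (\<lambda>A. truncate e (c A))"

lemma at_exp_truncate: "at_exp x (truncate_cochain e c) = (if tdeg x = e then at_exp x c else 0)"
  by (auto simp: at_exp_def truncate_cochain_def truncate_def fun_eq_iff)

lemma truncate_cochains:
  assumes "c \<in> cochains P" "\<And>x. loc_vs.subspace (P x)"
  shows "truncate_cochain e c \<in> graded_part (cochains P) e"
proof (rule graded_cochainsI)
  show "finite {x. at_exp x (truncate_cochain e c) \<noteq> 0}"
    using cochainsD(1)[OF assms(1)] by (rule rev_finite_subset) (auto simp: at_exp_truncate split: if_splits)
  show "at_exp x (truncate_cochain e c) \<in> P x" for x
    using cochainsD(2)[OF assms(1)] loc_vs.subspace_0[OF assms(2)] by (simp add: at_exp_truncate)
qed (auto simp: at_exp_truncate split: if_splits)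

lemma truncate_cochain_id: "(\<And>x. at_exp x c \<noteq> 0 \<Longrightarrow> tdeg x = e) \<Longrightarrow> truncate_cochain e c = c"
  by (rule at_exp_eqI) (metis at_exp_truncate)

lemma truncate_cochain_add: "truncate_cochain e (c + d) = truncate_cochain e c + truncate_cochain e d"
  by (rule at_exp_eqI) (simp add: at_exp_truncate at_exp_add)

lemma truncate_cochain_cdiff: "truncate_cochain e (cdiff c) = cdiff (truncate_cochain e c)"
  by (rule at_exp_eqI) (simp add: at_exp_truncate at_exp_cdiff ldiff_0)

lemma truncate_cochain_sum: "truncate_cochain e (\<Sum>i\<in>I. c i) = (\<Sum>i\<in>I. truncate_cochain e (c i))"
  by (auto simp: truncate_cochain_def truncate_sum fun_eq_iff sum_fun_apply)

lemma truncate_cochain_cform: "truncate_cochain e (cform a q c) = cform a q (truncate_cochain (e - 1) c)"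
  by (simp add: truncate_cochain_def cform_def truncate_lform)

lemma truncate_cforms:
  assumes "c \<in> cforms j"
  shows "truncate_cochain e c \<in> cs.forms_part m j e"
proof -
  obtain k v where k: "k \<in> Cech_Rel j" and v: "\<And>q. v q \<in> Cech j" and eq: "c = k + (\<Sum>q\<in>{1..m}. cform a q (v q))"
    using assms by (auto simp: cforms_def)
  have "truncate_cochain e c = truncate_cochain e k + (\<Sum>q\<in>{1..m}. cform a q (truncate_cochain (e - 1) (v q)))"
    unfolding eq by (simp only: truncate_cochain_add truncate_cochain_sum truncate_cochain_cform)
  then show ?thesis
    unfolding cs.forms_part_def using truncate_cochains[OF k LR_subspace] truncate_cochains[OF v LC_subspace]
    by (intro CollectI exI[of _ "truncate_cochain e k"] exI[of _ "\<lambda>q. truncate_cochain (e - 1) (v q)"]) simp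
qed

lemma forms_part_cforms: "cs.forms_part m j e \<subseteq> cforms j"
using cformsI by (auto simp: cs.forms_part_def graded_part_def)

text \<open>\<open>Zm\<close> allows arbitrary coefficients of the forms in its cocycle condition.
  Truncating this condition replaces them by homogeneous ones of the degree that
  \<open>cs.forms_part\<close> demands, while a homogeneous cochain equals its own
  truncation.\<close>

lemma homogeneous_cocycles: "{z \<in> Zm j. \<forall>x. at_exp x z \<noteq> 0 \<longrightarrow> tdeg x = e} = cs.cocycles_mod m j e"
proof
  show "{z \<in> Zm j. \<forall>x. at_exp x z \<noteq> 0 \<longrightarrow> tdeg x = e} \<subseteq> cs.cocycles_mod m j e"
  proof
    fix z assume z: "z \<in> {z \<in> Zm j. \<forall>x. at_exp x z \<noteq> 0 \<longrightarrow> tdeg x = e}"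
    then have "truncate_cochain e (cdiff z) \<in> cs.forms_part m (j + 1) e"
      by (intro truncate_cforms) (simp add: Zm_def)
    moreover have "truncate_cochain e z = z" using z by (intro truncate_cochain_id) blast
    ultimately show "z \<in> cs.cocycles_mod m j e"
      using z by (simp add: cs.cocycles_mod_def graded_part_def Zm_def truncate_cochain_cdiff)
  qed
  show "cs.cocycles_mod m j e \<subseteq> {z \<in> Zm j. \<forall>x. at_exp x z \<noteq> 0 \<longrightarrow> tdeg x = e}"
    using forms_part_cforms by (auto simp: cs.cocycles_mod_def Zm_def graded_part_def)
qed

lemma homogeneous_coboundaries: "{z \<in> Bm j. \<forall>x. at_exp x z \<noteq> 0 \<longrightarrow> tdeg x = e} = cs.coboundaries_mod m j e"
proof
  show "{z \<in> Bm j. \<forall>x. at_exp x z \<noteq> 0 \<longrightarrow> tdeg x = e} \<subseteq> cs.coboundaries_mod m j e"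
  proof
    fix z assume z: "z \<in> {z \<in> Bm j. \<forall>x. at_exp x z \<noteq> 0 \<longrightarrow> tdeg x = e}"
    then obtain b t where b: "b \<in> Cech (j - 1)" "t \<in> cforms j" "z = cdiff b + t" by (auto simp: Bm_def)
    have "z = truncate_cochain e z" using z by (intro truncate_cochain_id[symmetric]) blast
    also have "\<dots> = cdiff (truncate_cochain e b) + truncate_cochain e t"
      unfolding b(3) truncate_cochain_add truncate_cochain_cdiff ..
    finally show "z \<in> cs.coboundaries_mod m j e"
      unfolding cs.coboundaries_mod_def
      using truncate_cochains[OF b(1) LC_subspace] truncate_cforms[OF b(2)] by blast
  qed
  show "cs.coboundaries_mod m j e \<subseteq> {z \<in> Bm j. \<forall>x. at_exp x z \<noteq> 0 \<longrightarrow> tdeg x = e}"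
  proof
    fix z assume z: "z \<in> cs.coboundaries_mod m j e"
    then obtain b t where b: "b \<in> graded_part (Cech (j - 1)) e" "t \<in> cs.forms_part m j e" "z = cdiff b + t"
      by (auto simp: cs.coboundaries_mod_def)
    have "b \<in> Cech (j - 1)" using b(1) by (simp add: graded_part_def)
    then have "z \<in> Bm j" unfolding Bm_def using b(2,3) forms_part_cforms by blast
    moreover have "z \<in> cs.cocycles_mod m j e"
      using z cs.coboundaries_sub_cocycles by blast
    ultimately show "z \<in> {z \<in> Bm j. \<forall>x. at_exp x z \<noteq> 0 \<longrightarrow> tdeg x = e}"
      unfolding homogeneous_cocycles[symmetric] by blast
  qed
qed

lemma point_cochains:
  "z \<in> P x \<Longrightarrow> (\<And>y. loc_vs.subspace (P y)) \<Longrightarrow> point_cochain x z \<in> cochains P"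
  by (auto simp: cochains_def at_point_cochain intro: loc_vs.subspace_0)

lemma point_cochain_cdiff: "cdiff (point_cochain x z) = point_cochain x (ldiff z)"
  by (rule at_exp_eqI) (simp add: at_point_cochain at_exp_cdiff ldiff_0)

lemma point_cochain_add: "point_cochain x (z + w) = point_cochain x z + point_cochain x w"
  by (rule at_exp_eqI) (simp add: at_point_cochain at_exp_add)

text \<open>With no forms divided out, the fine grading is available, and the piece of degree
  \<open>x\<close> is the complex of the single degree \<open>x\<close>, embedded by
  \<open>point_cochain x\<close>. This computes the cohomology of \<open>M\<close> itself, which
  enters the right-hand side of the formula.\<close>

lemma dim_fine_piece:
  assumes "m = 0" "pos x = {}"
  shows "subquot_dim cscale {z \<in> Zm j. \<forall>y. at_exp y z \<noteq> 0 \<longrightarrow> y = x} {z \<in> Bm j. \<forall>y. at_exp y z \<noteq> 0 \<longrightarrow> y = x}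
    (hdim j (neg x))" (is "subquot_dim _ ?V ?W _")
proof (rule subquot_dim_transport[where r = "\<lambda>z c. c = point_cochain x z",
      OF loc_vs.vector_space_axioms cochain_vs.vector_space_axioms hdim[OF assms(2)]])
  have forms0: "cforms i = Cech_Rel i" for i
  proof -
    have "{1..m} = {}" using assms(1) by simp
    then have "cforms i = {k | k v. k \<in> Cech_Rel i \<and> (\<forall>q::nat. v q \<in> Cech i)}" by (simp only: cforms_def sum.empty add_0_right)
    also have "\<dots> = Cech_Rel i" using cech.C_0[of i] by (auto intro!: exI[of _ "\<lambda>_. 0"])
    finally show ?thesis .
  qed
  have scl: "point_cochain x (lscale r z) = cscale r (point_cochain x z)" for r z
    by (rule at_exp_eqI) (simp add: at_point_cochain at_exp_scale)
  have ptV: "point_cochain x z \<in> ?V \<longleftrightarrow> z \<in> LZ j x" for z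
  proof
    assume "point_cochain x z \<in> ?V"
    then have "point_cochain x z \<in> Cech j" "point_cochain x (ldiff z) \<in> Cech_Rel (j + 1)"
      by (auto simp: Zm_def forms0 point_cochain_cdiff)
    then show "z \<in> LZ j x"
      using cochainsD(2)[of "point_cochain x z" "LC j" x] cochainsD(2)[of "point_cochain x (ldiff z)" "LR (j + 1)" x]
      by (simp add: LZ_def at_point_cochain)
  next
    assume "z \<in> LZ j x"
    then show "point_cochain x z \<in> ?V"
      using point_cochains[of z "LC j" x] point_cochains[of "ldiff z" "LR (j + 1)" x] LC_subspace LR_subspace
      by (auto simp: Zm_def forms0 point_cochain_cdiff LZ_def at_point_cochain split: if_splits)
  qed
  have ptW: "point_cochain x z \<in> ?W \<longleftrightarrow> z \<in> LB j x" for z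
  proof
    assume "point_cochain x z \<in> ?W"
    then obtain b t where b: "b \<in> Cech (j - 1)" "t \<in> Cech_Rel j" "point_cochain x z = cdiff b + t"
      by (auto simp: Bm_def forms0)
    have "z = ldiff (at_exp x b) + at_exp x t"
      using arg_cong[OF b(3), of "at_exp x"] by (simp only: at_point_cochain at_exp_add at_exp_cdiff if_True refl)
    then show "z \<in> LB j x" unfolding LB_def using cochainsD(2)[OF b(1)] cochainsD(2)[OF b(2)] by blast
  next
    assume "z \<in> LB j x"
    then obtain b r where b: "z = ldiff b + r" "b \<in> LC (j - 1) x" "r \<in> LR j x" by (auto simp: LB_def)
    have "point_cochain x z = cdiff (point_cochain x b) + point_cochain x r"
      unfolding b(1) point_cochain_add point_cochain_cdiff ..
    then have "point_cochain x z \<in> Bm j"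
      unfolding Bm_def forms0 using point_cochains[of b "LC (j - 1)" x, OF b(2) LC_subspace] point_cochains[of r "LR j" x, OF b(3) LR_subspace] by blast
    then show "point_cochain x z \<in> ?W" by (auto simp: at_point_cochain)
  qed
  have pt: "c = point_cochain x (at_exp x c)" if "\<forall>y. at_exp y c \<noteq> 0 \<longrightarrow> y = x" for c
    by (rule at_exp_eqI) (use that in \<open>auto simp: at_point_cochain\<close>)
  have V: "?V = point_cochain x ` LZ j x"
  proof (intro subset_antisym subsetI)
    fix c assume c: "c \<in> ?V"
    then have eq: "c = point_cochain x (at_exp x c)" by (intro pt) blast
    have "at_exp x c \<in> LZ j x" using c unfolding ptV[symmetric] eq[symmetric] .
    with eq show "c \<in> point_cochain x ` LZ j x" by (rule image_eqI)
  next
    fix c assume "c \<in> point_cochain x ` LZ j x"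
    then obtain z where "z \<in> LZ j x" "c = point_cochain x z" by (rule imageE)
    then show "c \<in> ?V" using ptV[of z] by (simp only:)
  qed
  have supp: "cochain_vs.subspace {c \<in> S. \<forall>y. at_exp y c \<noteq> 0 \<longrightarrow> y = x}" if S: "cochain_vs.subspace S" for S
  proof (rule cochain_vs.subspaceI)
    show "0 \<in> {c \<in> S. \<forall>y. at_exp y c \<noteq> 0 \<longrightarrow> y = x}"
      using cochain_vs.subspace_0[OF S] by (simp add: at_exp_0)
    show "c + d \<in> {c \<in> S. \<forall>y. at_exp y c \<noteq> 0 \<longrightarrow> y = x}"
      if "c \<in> {c \<in> S. \<forall>y. at_exp y c \<noteq> 0 \<longrightarrow> y = x}" "d \<in> {c \<in> S. \<forall>y. at_exp y c \<noteq> 0 \<longrightarrow> y = x}" for c d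
      using cochain_vs.subspace_add[OF S] that by (auto simp: at_exp_add) (metis add_0)
    show "cscale r c \<in> {c \<in> S. \<forall>y. at_exp y c \<noteq> 0 \<longrightarrow> y = x}"
      if "c \<in> {c \<in> S. \<forall>y. at_exp y c \<noteq> 0 \<longrightarrow> y = x}" for r c
      using cochain_vs.subspace_scale[OF S] that by (auto simp: at_exp_scale)
  qed
  have "cochain_vs.subspace (Zm j)"
  using cochain_vs.subspaceI coh.C_add coh.C_0 Zm_cscale by auto
  then show "cochain_vs.subspace ?V" by (rule supp)
  have Bm_add: "c + d \<in> Bm j" if "c \<in> Bm j" "d \<in> Bm j" for c d
    using Bm_diff[OF that(1) Bm_diff[OF Bm_0 that(2)]] by simp
  have "cochain_vs.subspace (Bm j)"
    by (rule cochain_vs.subspaceI) (simp_all only: Bm_0 Bm_cscale Bm_add)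
  then show "cochain_vs.subspace ?W" by (rule supp)
  show "?W \<subseteq> ?V" using Bm_sub by blast
  show "\<exists>c\<in>?V. c = point_cochain x z" if "z \<in> LZ j x" for z using that unfolding ptV[symmetric] by (rule bexI[rotated]) simp
  show "\<exists>z\<in>LZ j x. c = point_cochain x z" if "c \<in> ?V" for c using that unfolding V by (rule imageE) (rule bexI)
  show "z \<in> LB j x \<longleftrightarrow> c \<in> ?W" if "c = point_cochain x z" for z c unfolding that ptW ..
  show "u' + v' = point_cochain x (u + v)" if "u' = point_cochain x u" "v' = point_cochain x v" for u v u' v'
    unfolding that point_cochain_add ..
  show "cscale r c = point_cochain x (lscale r z)" if "c = point_cochain x z" for r z c
    unfolding that scl ..
qed

end

section \<open>An open set of coefficient matrices\<close>

section \<open>Generic linear forms are in general position\<close>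

definition vars_in :: "'v set \<Rightarrow> ('v, 'k::comm_ring_1) mpoly \<Rightarrow> bool"
  where "vars_in I f \<longleftrightarrow> (\<forall>p\<in>Poly_Mapping.keys f. Poly_Mapping.keys p \<subseteq> I)"

lemma vars_in_Const: "vars_in I (Const c)"
  by (simp add: vars_in_def Const_def)

lemma vars_in_Var: "v \<in> I \<Longrightarrow> vars_in I (Var v)"
  by (simp add: vars_in_def Var_def)

lemma vars_in_add: "vars_in I f \<Longrightarrow> vars_in I g \<Longrightarrow> vars_in I (f + g)"
  using Poly_Mapping.keys_add[of f g] by (auto simp: vars_in_def)

lemma vars_in_mult: "vars_in I f \<Longrightarrow> vars_in I g \<Longrightarrow> vars_in I (f * g)"
  unfolding vars_in_def
proof
  fix p assume f: "\<forall>p\<in>Poly_Mapping.keys f. Poly_Mapping.keys p \<subseteq> I" "\<forall>p\<in>Poly_Mapping.keys g. Poly_Mapping.keys p \<subseteq> I"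
    and "p \<in> Poly_Mapping.keys (f * g)"
  then obtain q r where "q \<in> Poly_Mapping.keys f" "r \<in> Poly_Mapping.keys g" "p = q + r"
    using keys_mult[of f g] by blast
  then show "Poly_Mapping.keys p \<subseteq> I" using f Poly_Mapping.keys_add[of q r] by blast
qed

lemma vars_in_sum: "(\<And>i. i \<in> J \<Longrightarrow> vars_in I (f i)) \<Longrightarrow> vars_in I (\<Sum>i\<in>J. f i)"
  using vars_in_Const[of I 0] by (induction J rule: infinite_finite_induct) (auto intro: vars_in_add)

lemma vars_in_prod: "(\<And>i. i \<in> J \<Longrightarrow> vars_in I (f i)) \<Longrightarrow> vars_in I (\<Prod>i\<in>J. f i)"
  using vars_in_Const[of I 1] by (induction J rule: infinite_finite_induct) (auto intro: vars_in_mult)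

definition enum :: "'n set \<Rightarrow> nat \<Rightarrow> 'n"
  where "enum G = (SOME h. bij_betw h {0..<card G} G)"

lemma bij_enum: "bij_betw (enum (G :: 'n::finite set)) {0..<card G} G"
  unfolding enum_def using ex_bij_betw_nat_finite[OF finite, of G] by (rule someI_ex)

lemma enum_in: "i < card (G :: 'n::finite set) \<Longrightarrow> enum G i \<in> G"
  using bij_enum[of G] by (auto simp: bij_betw_def)

lemma enum_ex:
  assumes "t \<in> (G :: 'n::finite set)"
  obtains i where "i < card G" "enum G i = t"
proof -
  have "t \<in> enum G ` {0..<card G}" using bij_enum[of G] assms by (simp add: bij_betw_def)
  then show ?thesis using that by auto
qed

lemma enum_eq_iff: "i < card (G :: 'n::finite set) \<Longrightarrow> j < card G \<Longrightarrow> enum G i = enum G j \<longleftrightarrow> i = j"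
  using bij_enum[of G] by (auto simp: bij_betw_def inj_on_def)

text \<open>The first \<open>card G\<close> forms restricted to \<open>G\<close>. Forms are numbered
  from 1 and columns from 0, hence \<open>Suc j\<close>.\<close>

definition minor_mat :: "('n \<times> nat \<Rightarrow> 'k) \<Rightarrow> 'n set \<Rightarrow> 'k mat"
  where "minor_mat a G = mat (card G) (card G) (\<lambda>(i, j). a (enum G i, Suc j))"

lemma minor_mat_carrier: "minor_mat a G \<in> carrier_mat (card G) (card G)"
  by (simp add: minor_mat_def)

text \<open>The Leibniz expansion of the determinant of \<open>minor_mat\<close>, with the
  coefficients of the forms as indeterminates.\<close>

definition minor_poly :: "'n set \<Rightarrow> ('n \<times> nat, 'k::field) mpoly"
  where "minor_poly G = (\<Sum>p | p permutes {0..<card G}. Const (signof p) * (\<Prod>i<card G. Var (enum G i, Suc (p i))))"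

lemma eval_minor_poly: "poly_eval (minor_poly G) a = det (minor_mat a G)"
proof -
  have "poly_eval (minor_poly G) a = (\<Sum>p | p permutes {0..<card G}. signof p * (\<Prod>i<card G. a (enum G i, Suc (p i))))"
    by (simp add: poly_eval_eq minor_poly_def eval_hom.poly_subst_sum eval_hom.poly_subst_mult eval_hom.poly_subst_prod)
  also have "\<dots> = det (minor_mat a G)"
    unfolding det_def'[OF minor_mat_carrier]
    by (intro sum.cong refl arg_cong2[of _ _ _ _ "(*)"] prod.cong)
       (auto simp: minor_mat_def permutes_in_image[of _ "{0..<card G}", simplified] lessThan_atLeast0)
  finally show ?thesis .
qed

lemma vars_minor_poly:
  assumes "card G \<le> m"
  shows "vars_in (UNIV \<times> {1..m}) (minor_poly G)"
  unfolding minor_poly_def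
proof (intro vars_in_sum vars_in_mult vars_in_Const vars_in_prod vars_in_Var)
  fix p i assume "p \<in> {p. p permutes {0..<card G}}" "i \<in> {..<card G}"
  then have "p i < card G" using permutes_in_image[of p "{0..<card G}" i] by simp
  then show "(enum G i, Suc (p i)) \<in> UNIV \<times> {1..m}" using assms by simp
qed

lemma minor_mat_mult_vec:
  assumes "i < card G"
  shows "(minor_mat a G *\<^sub>v vec (card G) w) $ i = (\<Sum>j<card G. a (enum G i, Suc j) * w j)"
  using assms by (simp add: minor_mat_def scalar_prod_def lessThan_atLeast0)

text \<open>Finitely many minors control both halves of general position. A dependence of the first
  \<open>p + 1\<close> forms on \<open>G\<close> would restrict to any subset \<open>H\<close> with
  \<open>p + 1\<close> elements and give a kernel vector of its matrix. If \<open>G\<close> has at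
  most \<open>p\<close> elements, the inverse of its matrix expresses each variable through the
  forms.\<close>

lemma general_position_if_minors:
  fixes a :: "'n::finite \<times> nat \<Rightarrow> 'k::field"
  assumes det: "\<And>G. G \<noteq> {} \<Longrightarrow> card G \<le> m \<Longrightarrow> det (minor_mat a G) \<noteq> 0"
  shows "general_position m a"
  unfolding general_position_def
proof (intro allI impI conjI ballI)
  fix G :: "'n set" and p :: nat and \<nu> :: "nat \<Rightarrow> 'k" assume p: "p < m" "p < card G"
  obtain H where H: "H \<subseteq> G" "card H = Suc p" using obtain_subset_with_card_n[of "Suc p" G] p(2) by auto
  show "\<exists>t\<in>G. a (t, Suc p) + (\<Sum>q\<in>{1..p}. \<nu> q * a (t, q)) \<noteq> 0"
  proof (rule ccontr)
    assume "\<not> ?thesis"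
    then have zero: "a (t, Suc p) + (\<Sum>q\<in>{1..p}. \<nu> q * a (t, q)) = 0" if "t \<in> H" for t using H(1) that by blast
    let ?w = "\<lambda>j. if j = p then 1 else \<nu> (Suc j)"
    have "minor_mat a H *\<^sub>v vec (card H) ?w = 0\<^sub>v (card H)"
    proof (rule eq_vecI)
      fix i assume "i < dim_vec (0\<^sub>v (card H) :: 'k vec)"
      then have i: "i < card H" by simp
      then have "enum H i \<in> H" by (rule enum_in)
      have "(minor_mat a H *\<^sub>v vec (card H) ?w) $ i = (\<Sum>j<Suc p. a (enum H i, Suc j) * ?w j)"
        unfolding minor_mat_mult_vec[OF i] unfolding H(2) ..
      also have "\<dots> = a (enum H i, Suc p) + (\<Sum>j<p. \<nu> (Suc j) * a (enum H i, Suc j))"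
        by (simp add: mult.commute)
      also have "(\<Sum>j<p. \<nu> (Suc j) * a (enum H i, Suc j)) = (\<Sum>q\<in>{1..p}. \<nu> q * a (enum H i, q))"
        by (rule sum.reindex_bij_witness[of _ "\<lambda>q. q - 1" Suc]) auto
      finally show "(minor_mat a H *\<^sub>v vec (card H) ?w) $ i = 0\<^sub>v (card H) $ i"
        using zero[OF \<open>enum H i \<in> H\<close>] i by simp
    qed (simp add: minor_mat_def)
    moreover have "vec (card H) ?w \<noteq> 0\<^sub>v (card H)"
    proof
      assume "vec (card H) ?w = 0\<^sub>v (card H)"
      then have "vec (card H) ?w $ p = 0\<^sub>v (card H) $ p" by simp
      then show False using H(2) by simp
    qed
    ultimately have "det (minor_mat a H) = 0"
      unfolding det_0_iff_vec_prod_zero_field[OF minor_mat_carrier] by (intro exI[of _ "vec (card H) ?w"]) simp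
    moreover have "det (minor_mat a H) \<noteq> 0" using H p by (intro det) auto
    ultimately show False by contradiction
  qed
next
  fix G :: "'n set" and p t assume p: "p < m" "card G \<le> p" and t: "t \<in> G"
  have "det (minor_mat a G) \<noteq> 0" using p t by (intro det) auto
  from det_non_zero_imp_unit[OF minor_mat_carrier this, of "()"]
  obtain B where B: "B \<in> carrier_mat (card G) (card G)" "minor_mat a G * B = 1\<^sub>m (card G)"
    by (auto simp: Units_def ring_mat_def)
  obtain k where k: "k < card G" "enum G k = t" using t by (rule enum_ex)
  \<comment> \<open>The coefficients are column \<open>k\<close> of the inverse matrix, with
    \<open>k\<close> the number of \<open>t\<close> in the enumeration; forms beyond
    \<open>card G\<close> receive coefficient zero.\<close>
  let ?c = "\<lambda>q. if q \<le> card G then B $$ (q - 1, k) else 0"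
  have "(\<Sum>q\<in>{1..p}. ?c q * a (s, q)) = (if s = t then 1 else 0)" if "s \<in> G" for s
  proof -
    obtain i where i: "i < card G" "enum G i = s" using \<open>s \<in> G\<close> by (rule enum_ex)
    have "(\<Sum>q\<in>{1..p}. ?c q * a (s, q)) = (\<Sum>q\<in>{1..card G}. ?c q * a (s, q))"
      using p(2) by (intro sum.mono_neutral_right) auto
    also have "\<dots> = (\<Sum>j<card G. a (s, Suc j) * B $$ (j, k))"
      by (rule sum.reindex_bij_witness[of _ Suc "\<lambda>q. q - 1"]) auto
    also have "\<dots> = (minor_mat a G * B) $$ (i, k)"
      using i k B(1) by (simp add: minor_mat_def scalar_prod_def lessThan_atLeast0)
    also have "\<dots> = (if i = k then 1 else 0)" unfolding B(2) using i k by simp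
    also have "i = k \<longleftrightarrow> s = t" using enum_eq_iff[OF i(1) k(1)] i(2) k(2) by simp
    finally show ?thesis .
  qed
  then show "\<exists>c. \<forall>s\<in>G. (\<Sum>q\<in>{1..p}. c q * a (s, q)) = (if s = t then 1 else 0)" by (intro exI[of _ ?c] ballI)
qed

text \<open>A kernel vector of the Vandermonde matrix is the coefficient vector of a nonzero
  polynomial of degree below \<open>card G\<close> that vanishes at the \<open>card G\<close>
  distinct points \<open>\<alpha> t\<close>.\<close>

lemma vandermonde_minor:
  fixes \<alpha> :: "'n::finite \<Rightarrow> 'k::field"
  assumes "inj \<alpha>" "\<And>t q. q < card G \<Longrightarrow> a (t, Suc q) = \<alpha> t ^ q"
  shows "det (minor_mat a G) \<noteq> 0"
proof
  assume "det (minor_mat a G) = 0"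
  then obtain v where v: "v \<in> carrier_vec (card G)" "v \<noteq> 0\<^sub>v (card G)" "minor_mat a G *\<^sub>v v = 0\<^sub>v (card G)"
    unfolding det_0_iff_vec_prod_zero_field[OF minor_mat_carrier] by blast
  define f where "f = (\<Sum>j<card G. Polynomial.monom (v $ j) j)"
  have coeff: "poly.coeff f j = (if j < card G then v $ j else 0)" for j
    by (simp add: f_def coeff_sum sum.delta)
  have "f \<noteq> 0"
  proof
    assume "f = 0"
    then have "v $ j = 0" if "j < card G" for j using coeff[of j] that by simp
    then have "v = 0\<^sub>v (card G)" using v(1) by (intro eq_vecI) auto
    then show False using v(2) by contradiction
  qed
  have "poly f (\<alpha> t) = 0" if t: "t \<in> G" for t
  proof -
    obtain i where i: "i < card G" "enum G i = t" using t by (rule enum_ex)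
    have "v = vec (card G) (\<lambda>j. v $ j)" using v(1) by auto
    then have "0 = (\<Sum>j<card G. a (enum G i, Suc j) * v $ j)"
      using minor_mat_mult_vec[OF i(1), of a "\<lambda>j. v $ j"] v(3) i(1) by simp
    also have "\<dots> = poly f (\<alpha> t)"
      unfolding f_def poly_sum i(2) by (intro sum.cong refl) (simp add: assms(2) poly_monom mult.commute)
    finally show ?thesis by simp
  qed
  then have "\<alpha> ` G \<subseteq> {x. poly f x = 0}" by blast
  then have "card (\<alpha> ` G) \<le> card {x. poly f x = 0}" using poly_roots_finite[OF \<open>f \<noteq> 0\<close>] by (rule card_mono[rotated])
  also have "\<dots> \<le> degree f" by (rule card_poly_roots_bound[OF \<open>f \<noteq> 0\<close>])
  finally have "card G \<le> degree f" using card_image[OF inj_on_subset[OF assms(1) subset_UNIV]] by metis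
  moreover have "poly.coeff f (degree f) \<noteq> 0" using \<open>f \<noteq> 0\<close> by simp
  ultimately show False using coeff[of "degree f"] by simp
qed

text \<open>The open set is the complement of the zeros of a single polynomial, the product of all
  minors. It contains the Vandermonde matrix of an injective \<open>\<alpha>\<close>, and such an
  \<open>\<alpha>\<close> exists because the field is infinite.\<close>

theorem generic_general_position:
  assumes "infinite (UNIV :: 'k::field set)"
  shows "\<exists>U :: ('n::finite \<times> nat \<Rightarrow> 'k) set. zariski_open (UNIV \<times> {1..m}) U \<and> U \<noteq> {} \<and>
    (\<forall>a\<in>U. general_position m a)"
proof -
  let ?Gs = "{G :: 'n set. G \<noteq> {} \<and> card G \<le> m}"
  define F :: "('n \<times> nat, 'k) mpoly" where "F = (\<Prod>G\<in>?Gs. minor_poly G)"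
  have eval: "poly_eval F a \<noteq> 0 \<longleftrightarrow> (\<forall>G\<in>?Gs. det (minor_mat a G) \<noteq> 0)" for a
  proof -
    have "poly_eval F a = (\<Prod>G\<in>?Gs. det (minor_mat a G))"
      by (simp add: F_def poly_eval_eq eval_hom.poly_subst_prod flip: eval_minor_poly)
    then show ?thesis by auto
  qed
  let ?U = "{a \<in> UNIV \<times> {1..m} \<rightarrow>\<^sub>E UNIV. poly_eval F a \<noteq> 0}"
  have "vars_in (UNIV \<times> {1..m}) F" unfolding F_def by (intro vars_in_prod vars_minor_poly) simp
  then have "zariski_open (UNIV \<times> {1..m}) ?U"
    unfolding zariski_open_def by (intro exI[of _ "{F}"]) (auto simp: vars_in_def)
  moreover have "?U \<noteq> {}"
  proof -
    obtain \<alpha> :: "'n \<Rightarrow> 'k" where \<alpha>: "inj \<alpha>"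
    proof -
      obtain B :: "'k set" where B: "finite B" "card B = card (UNIV :: 'n set)"
        using infinite_arbitrarily_large[OF assms] by blast
      then obtain h where "bij_betw h (UNIV :: 'n set) B" using finite_same_card_bij[OF finite B(1)] by (metis B(2))
      then show ?thesis using that[of h] by (auto simp: bij_betw_def)
    qed
    let ?a = "restrict (\<lambda>(t, q). \<alpha> t ^ (q - 1)) (UNIV \<times> {1..m})"
    have "det (minor_mat ?a G) \<noteq> 0" if "G \<in> ?Gs" for G
      using that by (intro vandermonde_minor[OF \<alpha>]) auto
    then have "?a \<in> ?U" using eval by auto
    then show ?thesis by blast
  qed
  moreover have "general_position m a" if "a \<in> ?U" for a
    using that eval by (intro general_position_if_minors) auto
  ultimately show ?thesis by blast
qed

section \<open>From generators and relations to a squarefree system\<close>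

section \<open>The system of a squarefree module\<close>

lemma fine_deg_to_exp: "(\<And>t. 0 \<le> x t) \<Longrightarrow> fine_deg (to_exp x) = x"
  by (simp add: fine_deg_def)

lemma coeff_fun_single: "coeff_fun (Poly_Mapping.single k d) x = (if x = fine_deg k then d else 0)"
proof (cases "\<forall>t. 0 \<le> x t")
  case True
  then have "k = to_exp x \<longleftrightarrow> x = fine_deg k"
    using fine_deg_to_exp[of x] to_exp_int[of k] by (auto simp: fine_deg_def)
  then show ?thesis using True by (simp add: coeff_fun_def lookup_single when_def)
next
  case False
  then have "x \<noteq> fine_deg k" by (auto simp: fine_deg_def)
  then show ?thesis using False by (simp only: coeff_fun_def if_False)
qed

lemma coeff_fun_single_mult: "coeff_fun (Poly_Mapping.single q c * f) x = c * coeff_fun f (x - fine_deg q)"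
proof -
  have fd: "fine_deg (q + k) = fine_deg q + fine_deg k" for k
    by (simp add: fine_deg_def lookup_add plus_fun_def)
  have eq: "x = fine_deg q + fine_deg k \<longleftrightarrow> x - fine_deg q = fine_deg k" for k
    by (auto simp: algebra_simps)
  have "coeff_fun (Poly_Mapping.single q c * f) x =
      coeff_fun (Poly_Mapping.single q c * (\<Sum>k\<in>Poly_Mapping.keys f. Poly_Mapping.single k (Poly_Mapping.lookup f k))) x"
    by (simp only: poly_mapping_sum_single)
  also have "\<dots> = (\<Sum>k\<in>Poly_Mapping.keys f. if x - fine_deg q = fine_deg k then c * Poly_Mapping.lookup f k else 0)"
    by (simp add: sum_distrib_left mult_single coeff_fun_sum coeff_fun_single fd eq)
  also have "\<dots> = c * coeff_fun (\<Sum>k\<in>Poly_Mapping.keys f. Poly_Mapping.single k (Poly_Mapping.lookup f k)) (x - fine_deg q)"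
    by (simp add: sum_distrib_left coeff_fun_sum coeff_fun_single if_distrib cong: if_cong)
  finally show ?thesis by (simp only: poly_mapping_sum_single)
qed

definition point :: "('n \<Rightarrow> int) \<Rightarrow> ('g \<Rightarrow> 'k::zero) \<Rightarrow> ('n \<Rightarrow> int) \<Rightarrow> 'g \<Rightarrow> 'k"
  where "point x c = (\<lambda>y. if y = x then c else (\<lambda>_. 0))"

lemma shift_point: "shift b (point x c) = point (x + b) c"
  by (auto simp: shift_def point_def fun_eq_iff algebra_simps)

locale squarefree_presentation =
  fixes M :: "(('n::{finite, linorder}, 'k::field) mpoly, 'm) module" and gr :: "('n \<Rightarrow> int) \<Rightarrow> 'm set"
    and G :: "'m set" and \<delta> :: "'m \<Rightarrow> 'n \<Rightarrow> int"
  assumes graded: "graded_module fine_deg M gr" and finite_G: "finite G" and G_carrier: "G \<subseteq> carrier M"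
    and \<delta>_squarefree: "g \<in> G \<Longrightarrow> \<delta> g \<in> squarefree_degrees" and G_gr: "g \<in> G \<Longrightarrow> g \<in> gr (\<delta> g)"
    and span_G: "LinearCombinations.module.span poly_ring M G = carrier M"
    and rels: "s \<in> relations M G \<Longrightarrow> \<exists>R c. finite R \<and>
      R \<subseteq> {r \<in> relations M G. \<exists>d\<in>squarefree_degrees. homogeneous_relation \<delta> G d r} \<and>
      (\<forall>g\<in>G. s g = (\<Sum>r\<in>R. c r * r g))"
begin

text \<open>The denominator \<open>1\<close> is arbitrary: only the lemmas on modules over the polynomial ring are wanted.\<close>

sublocale fm: frac_module poly_ring M 1
  using graded by (intro frac_module.intro) (auto simp: graded_module_def frac_module_axioms_def)

lemma \<delta>_01: "g \<in> G \<Longrightarrow> \<delta> g t = 0 \<or> \<delta> g t = 1"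
  using \<delta>_squarefree[of g] by (auto simp: squarefree_degrees_def)

lemma G_carrier': "g \<in> G \<Longrightarrow> g \<in> carrier M"
  using G_carrier by blast

definition eval_gens :: "('m \<Rightarrow> ('n, 'k) mpoly) \<Rightarrow> 'm"
  where "eval_gens s = (\<Oplus>\<^bsub>M\<^esub> g\<in>G. s g \<odot>\<^bsub>M\<^esub> g)"

lemma eval_gens_closed: "eval_gens s \<in> carrier M"
  unfolding eval_gens_def by (intro fm.finsum_closed) (auto simp: fm.smult_closed' G_carrier')

lemma eval_gens_cong: "(\<And>g. g \<in> G \<Longrightarrow> s g = r g) \<Longrightarrow> eval_gens s = eval_gens r"
  unfolding eval_gens_def by (intro fm.finsum_cong') (auto simp: fm.smult_closed' G_carrier')

lemma eval_gens_add: "eval_gens (\<lambda>g. s g + r g) = eval_gens s \<oplus>\<^bsub>M\<^esub> eval_gens r"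
proof -
  have "eval_gens (\<lambda>g. s g + r g) = (\<Oplus>\<^bsub>M\<^esub> g\<in>G. s g \<odot>\<^bsub>M\<^esub> g \<oplus>\<^bsub>M\<^esub> r g \<odot>\<^bsub>M\<^esub> g)"
    unfolding eval_gens_def using fm.smult_l_distr
    by (intro fm.finsum_cong') (auto simp: fm.smult_closed' G_carrier')
  then show ?thesis
    unfolding eval_gens_def by (simp add: fm.finsum_addf fm.smult_closed' G_carrier' Pi_I)
qed

lemma eval_gens_smult: "p \<odot>\<^bsub>M\<^esub> eval_gens s = eval_gens (\<lambda>g. p * s g)"
proof -
  have "p \<odot>\<^bsub>M\<^esub> eval_gens s = (\<Oplus>\<^bsub>M\<^esub> g\<in>G. p \<odot>\<^bsub>M\<^esub> (s g \<odot>\<^bsub>M\<^esub> g))"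
    unfolding eval_gens_def by (rule fm.finsum_smult_ldistr[OF finite_G]) (auto simp: fm.smult_closed' G_carrier')
  then show ?thesis
    unfolding eval_gens_def by (simp add: fm.smult_smult G_carrier' cong: fm.finsum_cong)
qed

lemma eval_gens_0: "eval_gens (\<lambda>g. 0) = \<zero>\<^bsub>M\<^esub>"
  using eval_gens_smult[of 0 "\<lambda>_. 0"] fm.smult_l_null[OF eval_gens_closed] by simp

lemma carrier_eval_gens: "v \<in> carrier M \<Longrightarrow> \<exists>s. v = eval_gens s"
using span_G by (auto simp: fm.finite_span finite_G G_carrier fm.lincomb_def eval_gens_def)

definition nonneg_supp :: "(('n \<Rightarrow> int) \<Rightarrow> 'm \<Rightarrow> 'k) \<Rightarrow> bool"
  where "nonneg_supp u \<longleftrightarrow> finite {x. u x \<noteq> 0} \<and> (\<forall>x g. u x g \<noteq> 0 \<longrightarrow> g \<in> G \<and> \<delta> g \<le> x)"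

text \<open>A family \<open>u\<close> stands for the sum over \<open>y\<close> and \<open>g\<close> of \<open>u y g\<close> times the monomial of degree \<open>y - \<delta> g\<close>
  times \<open>g\<close>; this is the polynomial coefficient of \<open>g\<close>.\<close>

definition gen_coeffs :: "(('n \<Rightarrow> int) \<Rightarrow> 'm \<Rightarrow> 'k) \<Rightarrow> 'm \<Rightarrow> ('n, 'k) mpoly"
  where "gen_coeffs u g = (SOME p. coeff_fun p = (\<lambda>y. u (y + \<delta> g) g))"

lemma coeff_gen_coeffs:
  assumes "nonneg_supp u"
  shows "coeff_fun (gen_coeffs u g) y = u (y + \<delta> g) g"
proof -
  have "{y. u (y + \<delta> g) g \<noteq> 0} \<subseteq> (\<lambda>x. x - \<delta> g) ` {x. u x \<noteq> 0}"
  proof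
    fix y assume "y \<in> {y. u (y + \<delta> g) g \<noteq> 0}"
    then show "y \<in> (\<lambda>x. x - \<delta> g) ` {x. u x \<noteq> 0}" by (intro image_eqI[of _ _ "y + \<delta> g"]) auto
  qed
  then have fin: "finite {y. u (y + \<delta> g) g \<noteq> 0}"
    by (rule finite_subset) (use assms in \<open>simp add: nonneg_supp_def\<close>)
  have "0 \<le> y t" if "u (y + \<delta> g) g \<noteq> 0" for y t
  proof -
    have "\<delta> g \<le> y + \<delta> g" using assms that unfolding nonneg_supp_def by blast
    from le_funD[OF this, of t] show ?thesis by simp
  qed
  then obtain p where "coeff_fun p = (\<lambda>y. u (y + \<delta> g) g)" using fin coeff_fun_surj by metis
  then have "coeff_fun (gen_coeffs u g) = (\<lambda>y. u (y + \<delta> g) g)" unfolding gen_coeffs_def by (rule someI)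
  then show ?thesis by simp
qed

lemma gen_coeffs_eqI: "nonneg_supp u \<Longrightarrow> (\<And>y. coeff_fun p y = u (y + \<delta> g) g) \<Longrightarrow> gen_coeffs u g = p"
  by (rule coeff_fun_inject) (simp add: fun_eq_iff coeff_gen_coeffs)

definition to_module :: "(('n \<Rightarrow> int) \<Rightarrow> 'm \<Rightarrow> 'k) \<Rightarrow> 'm"
  where "to_module u = eval_gens (gen_coeffs u)"

lemma nonneg_supp_0: "nonneg_supp 0"
  by (simp add: nonneg_supp_def)

lemma nonneg_supp_add: "nonneg_supp u \<Longrightarrow> nonneg_supp v \<Longrightarrow> nonneg_supp (u + v)"
  unfolding nonneg_supp_def
proof (intro conjI allI impI)
  assume u: "finite {x. u x \<noteq> 0} \<and> (\<forall>x g. u x g \<noteq> 0 \<longrightarrow> g \<in> G \<and> \<delta> g \<le> x)"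
    and v: "finite {x. v x \<noteq> 0} \<and> (\<forall>x g. v x g \<noteq> 0 \<longrightarrow> g \<in> G \<and> \<delta> g \<le> x)"
  have "finite ({x. u x \<noteq> 0} \<union> {x. v x \<noteq> 0})" using u v by blast
  then show "finite {x. (u + v) x \<noteq> 0}" by (rule rev_finite_subset) auto
  fix x g assume "(u + v) x g \<noteq> 0"
  then have "u x g \<noteq> 0 \<or> v x g \<noteq> 0" by auto
  then show "g \<in> G" "\<delta> g \<le> x" using u v by blast+
qed

lemma nonneg_supp_scale: "nonneg_supp u \<Longrightarrow> nonneg_supp (\<lambda>x. fscale r (u x))"
  by (auto simp: nonneg_supp_def elim!: rev_finite_subset)

lemma nonneg_supp_shift:
  assumes u: "nonneg_supp u" and b: "0 \<le> b"
  shows "nonneg_supp (shift b u)"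
  unfolding nonneg_supp_def
proof (intro conjI allI impI)
  show "finite {x. shift b u x \<noteq> 0}"
    using finite_vimageI[of "{x. u x \<noteq> 0}" "\<lambda>x. x - b"] u by (simp add: nonneg_supp_def shift_def vimage_def inj_def)
  fix x g assume "shift b u x g \<noteq> 0"
  then have *: "g \<in> G" "\<delta> g \<le> x - b" using u by (auto simp: nonneg_supp_def shift_def)
  then show "g \<in> G" by blast
  have "\<delta> g t \<le> x t" for t using le_funD[OF *(2), of t] le_funD[OF b, of t] by simp
  then show "\<delta> g \<le> x" by (rule le_funI)
qed

lemma nonneg_supp_point: "nonneg_supp (point x c) \<longleftrightarrow> (\<forall>g. c g \<noteq> 0 \<longrightarrow> g \<in> G \<and> \<delta> g \<le> x)"
  by (auto simp: nonneg_supp_def point_def zero_fun_def)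

lemma to_module_closed: "to_module u \<in> carrier M"
  by (simp add: to_module_def eval_gens_closed)

lemma to_module_add: "nonneg_supp u \<Longrightarrow> nonneg_supp v \<Longrightarrow> to_module (u + v) = to_module u \<oplus>\<^bsub>M\<^esub> to_module v"
  unfolding to_module_def eval_gens_add[symmetric]
  by (intro eval_gens_cong gen_coeffs_eqI nonneg_supp_add) (simp_all add: coeff_fun_add coeff_gen_coeffs)

lemma to_module_0: "to_module 0 = \<zero>\<^bsub>M\<^esub>"
  unfolding to_module_def eval_gens_0[symmetric]
  by (intro eval_gens_cong gen_coeffs_eqI nonneg_supp_0) simp

lemma to_module_scale: "nonneg_supp u \<Longrightarrow> Const r \<odot>\<^bsub>M\<^esub> to_module u = to_module (\<lambda>x. fscale r (u x))"
  unfolding to_module_def eval_gens_smult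
  by (rule sym) (intro eval_gens_cong gen_coeffs_eqI nonneg_supp_scale; simp add: coeff_fun_Const_mult coeff_gen_coeffs)

lemma to_module_shift:
  assumes u: "nonneg_supp u" and b: "0 \<le> b"
  shows "Poly_Mapping.single (to_exp b) 1 \<odot>\<^bsub>M\<^esub> to_module u = to_module (shift b u)"
proof -
  have "fine_deg (to_exp b) = b" using b by (intro fine_deg_to_exp) (simp add: le_fun_def)
  then show ?thesis
    unfolding to_module_def eval_gens_smult
    by (intro eval_gens_cong sym[OF gen_coeffs_eqI] nonneg_supp_shift u b)
       (simp add: coeff_fun_single_mult coeff_gen_coeffs[OF u] shift_def diff_add_eq)
qed

lemma to_module_surj:
  assumes "v \<in> carrier M"
  shows "\<exists>u. nonneg_supp u \<and> v = to_module u"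
proof -
  obtain s where s: "v = eval_gens s" using carrier_eval_gens[OF assms] by blast
  let ?u = "\<lambda>x g. if g \<in> G then coeff_fun (s g) (x - \<delta> g) else 0"
  have "{x. ?u x \<noteq> 0} \<subseteq> (\<Union>g\<in>G. (\<lambda>y. y + \<delta> g) ` {y. coeff_fun (s g) y \<noteq> 0})"
  proof
    fix x assume "x \<in> {x. ?u x \<noteq> 0}"
    then obtain g where "g \<in> G" "coeff_fun (s g) (x - \<delta> g) \<noteq> 0" by (auto simp: fun_eq_iff split: if_splits)
    then show "x \<in> (\<Union>g\<in>G. (\<lambda>y. y + \<delta> g) ` {y. coeff_fun (s g) y \<noteq> 0})"
      by (intro UN_I[of g] image_eqI[of _ _ "x - \<delta> g"]) auto
  qed
  then have "finite {x. ?u x \<noteq> 0}"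
    by (rule finite_subset) (intro finite_UN_I finite_imageI finite_G coeff_fun_finite)
  moreover have "\<delta> g \<le> x" if "coeff_fun (s g) (x - \<delta> g) \<noteq> 0" for x g
    using coeff_fun_nonneg[OF that] by (auto simp: le_fun_def)
  ultimately have u: "nonneg_supp ?u" by (auto simp: nonneg_supp_def split: if_splits)
  moreover have "v = to_module ?u"
    unfolding s to_module_def by (intro eval_gens_cong sym[OF gen_coeffs_eqI] u) simp
  ultimately show ?thesis by blast
qed

lemma to_module_zero_iff:
  assumes "nonneg_supp u"
  shows "to_module u = \<zero>\<^bsub>M\<^esub> \<longleftrightarrow> restrict (gen_coeffs u) G \<in> relations M G"
proof -
  have "(\<Oplus>\<^bsub>M\<^esub> g\<in>G. restrict (gen_coeffs u) G g \<odot>\<^bsub>M\<^esub> g) = to_module u"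
    unfolding to_module_def eval_gens_def[symmetric] by (rule eval_gens_cong) simp
  then show ?thesis by (simp add: relations_def)
qed

definition sq_gens :: "'n set \<Rightarrow> 'm set"
  where "sq_gens F = {g \<in> G. \<forall>t. \<delta> g t = 1 \<longrightarrow> t \<in> F}"

text \<open>This is where squarefree generators matter: the entries of \<open>\<delta> g\<close> are
  0 or 1, so comparing them with a nonnegative vector \<open>x\<close> only tests which entries of
  \<open>x\<close> are positive.\<close>

lemma le_iff_sq_gens:
  assumes "\<And>t. 0 \<le> x t"
  shows "g \<in> sq_gens (pos x) \<longleftrightarrow> g \<in> G \<and> \<delta> g \<le> x"
proof (cases "g \<in> G")
  case True
  have "(\<delta> g t = 1 \<longrightarrow> t \<in> pos x) \<longleftrightarrow> \<delta> g t \<le> x t" for t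
    using \<delta>_01[OF True, of t] assms[of t] by (auto simp: pos_def)
  then show ?thesis using True by (simp add: sq_gens_def le_fun_def)
qed (simp add: sq_gens_def)

text \<open>Relations are recorded in the squarefree degree of \<open>F\<close> only;
  \<open>to_module_kernel\<close> shows that they determine the relations in all degrees with
  positive support \<open>F\<close>.\<close>

definition sq_Rel :: "'n set \<Rightarrow> ('m \<Rightarrow> 'k) set"
  where "sq_Rel F = {c. (\<forall>g. c g \<noteq> 0 \<longrightarrow> g \<in> sq_gens F) \<and> to_module (point (nind 1 F) c) = \<zero>\<^bsub>M\<^esub>}"

lemma pos_nind: "pos (nind 1 F) = F"
  by (auto simp: pos_def nind_def)

lemma sq_gens_point: "(\<forall>g. c g \<noteq> 0 \<longrightarrow> g \<in> sq_gens F) \<longleftrightarrow> nonneg_supp (point (nind 1 F) c)"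
  using le_iff_sq_gens[of "nind 1 F"] unfolding nonneg_supp_point pos_nind by (simp add: nind_def)

lemma point_add: "point x (c + d :: 'm \<Rightarrow> 'k) = point x c + point x d"
  by (auto simp: point_def fun_eq_iff)

lemma sq_Rel_iff: "c \<in> sq_Rel F \<longleftrightarrow> nonneg_supp (point (nind 1 F) c) \<and> to_module (point (nind 1 F) c) = \<zero>\<^bsub>M\<^esub>"
  by (simp add: sq_Rel_def sq_gens_point)

lemma sq_Rel_shift:
  assumes "c \<in> sq_Rel F" "nind 1 F \<le> x"
  shows "to_module (point x c) = \<zero>\<^bsub>M\<^esub>"
proof -
  have "to_module (shift (x - nind 1 F) (point (nind 1 F) c)) = \<zero>\<^bsub>M\<^esub>"
    using assms fm.smult_r_null by (subst to_module_shift[symmetric]) (auto simp: sq_Rel_iff le_fun_def)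
  then show ?thesis by (simp add: shift_point)
qed

sublocale sq: squarefree_system sq_gens sq_Rel
proof
  show mono: "A \<subseteq> B \<Longrightarrow> sq_gens A \<subseteq> sq_gens B" for A B by (auto simp: sq_gens_def)
  show "finite (sq_gens UNIV)" using finite_G by (simp add: sq_gens_def)
  show "g \<in> sq_gens A" if "c \<in> sq_Rel A" "c g \<noteq> 0" for c A g using that by (simp add: sq_Rel_def)
  show "sq_Rel A \<subseteq> sq_Rel B" if "A \<subseteq> B" for A B
  proof
    fix c assume c: "c \<in> sq_Rel A"
    have "nind 1 A \<le> nind 1 B" using that by (auto simp: nind_def le_fun_def)
    then show "c \<in> sq_Rel B" using c sq_Rel_shift[OF c] mono[OF that] by (auto simp: sq_Rel_def)
  qed
  interpret fun_vs: vector_space fscale by (rule vector_space_fscale)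
  show "fun_vs.subspace (sq_Rel A)" for A
  proof (rule fun_vs.subspaceI)
    have "point x (0 :: 'm \<Rightarrow> 'k) = 0" for x :: "'n \<Rightarrow> int" by (auto simp: point_def fun_eq_iff)
    then show "0 \<in> sq_Rel A" by (simp only: sq_Rel_iff nonneg_supp_0 to_module_0 simp_thms)
    show "c + d \<in> sq_Rel A" if "c \<in> sq_Rel A" "d \<in> sq_Rel A" for c d
      using that by (simp add: sq_Rel_iff point_add nonneg_supp_add to_module_add)
    show "fscale r c \<in> sq_Rel A" if "c \<in> sq_Rel A" for r c
    proof -
      have eq: "point (nind 1 A) (fscale r c) = (\<lambda>y. fscale r (point (nind 1 A) c y))"
        by (auto simp: point_def fun_eq_iff)
      show ?thesis
        using that fm.smult_r_null[of "Const r"] to_module_scale[of "point (nind 1 A) c" r] nonneg_supp_scale[of "point (nind 1 A) c" r]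
        unfolding sq_Rel_iff eq by simp
    qed
  qed
qed

lemma Loc_eq: "sq.Loc {} = {u. nonneg_supp u}"
proof -
  have "(\<forall>g. u x g \<noteq> 0 \<longrightarrow> g \<in> G \<and> \<delta> g \<le> x) \<longleftrightarrow> u x \<in> sq.coeffs (pos x) \<and> (u x \<noteq> 0 \<longrightarrow> neg x = {})" for u x
  proof (cases "neg x = {}")
    case True
    then have "0 \<le> x t" for t by (simp add: neg_def) (meson not_le)
    then show ?thesis using True le_iff_sq_gens[of x] by (auto simp: sq.coeffs_def)
  next
    case False
    then obtain t where t: "x t < 0" by (auto simp: neg_def)
    have "\<not> \<delta> g \<le> x" if "g \<in> G" for g
      using \<delta>_01[OF that, of t] t by (auto simp: le_fun_def intro!: exI[of _ t])
    then show ?thesis using False by (auto simp: fun_eq_iff sq.coeffs_def)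
  qed
  then show ?thesis unfolding sq.Loc_def nonneg_supp_def by auto
qed

lemma sum_points:
  assumes "finite {x. u x \<noteq> (0 :: 'm \<Rightarrow> 'k)}"
  shows "u = (\<Sum>x\<in>{x. u x \<noteq> 0}. point x (u x))"
proof
  fix y
  have "(\<Sum>x\<in>{x. u x \<noteq> 0}. point x (u x)) y = (\<Sum>x\<in>{x. u x \<noteq> 0}. if x = y then u x else 0)"
    by (rule trans[OF sum_fun_apply]) (intro sum.cong; auto simp: point_def)
  then show "u y = (\<Sum>x\<in>{x. u x \<noteq> 0}. point x (u x)) y" using assms by simp
qed

sublocale img: group_image "sq.Loc {}" to_module M
proof
  show "0 \<in> sq.Loc {}" by (rule sq.Loc_0)
  show "u - v \<in> sq.Loc {}" if "u \<in> sq.Loc {}" "v \<in> sq.Loc {}" for u v using that by (rule sq.Loc_diff)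
  show "carrier M = to_module ` sq.Loc {}" using to_module_surj to_module_closed by (auto simp: Loc_eq)
qed (simp_all add: Loc_eq to_module_add to_module_0)

lemma nonneg_supp_points: "nonneg_supp u \<Longrightarrow> nonneg_supp (point x (u x))"
  unfolding nonneg_supp_point by (simp add: nonneg_supp_def)

lemma to_module_points:
  assumes u: "nonneg_supp u"
  shows "to_module u = (\<Oplus>\<^bsub>M\<^esub> x\<in>{x. u x \<noteq> 0}. to_module (point x (u x)))"
proof -
  have fin: "finite {x. u x \<noteq> 0}" using u by (simp add: nonneg_supp_def)
  have "(\<Oplus>\<^bsub>M\<^esub> x\<in>{x. u x \<noteq> 0}. to_module (point x (u x))) = to_module (\<Sum>x\<in>{x. u x \<noteq> 0}. point x (u x))"
    using nonneg_supp_points[OF u] by (intro img.h_sum fin) (simp add: Loc_eq)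
  then show ?thesis by (simp only: sum_points[OF fin, symmetric])
qed

text \<open>Homogeneity leaves at most one monomial in each coefficient \<open>r g\<close>, the one
  of degree \<open>d - \<delta> g\<close>. The relation is therefore a vector of scalars
  \<open>\<rho>\<close> placed in degree \<open>d\<close>, and multiplying it by a polynomial
  translates that polynomial by \<open>d\<close> and scales it by \<open>\<rho>\<close>.\<close>

lemma relation_coeffs:
  assumes r: "r \<in> relations M G" and d: "d \<in> squarefree_degrees" and hom: "homogeneous_relation \<delta> G d r"
  obtains \<rho> where "\<rho> \<in> sq_Rel (pos d)" "\<And>p x g. g \<in> G \<Longrightarrow> coeff_fun (p * r g) (x - \<delta> g) = coeff_fun p (x - d) * \<rho> g"
    "\<And>g. g \<notin> G \<Longrightarrow> \<rho> g = 0"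
proof
  define \<rho> where "\<rho> = (\<lambda>g. if g \<in> G then coeff_fun (r g) (d - \<delta> g) else 0)"
  have d_eq: "d = nind 1 (pos d)"
    using d by (auto simp: squarefree_degrees_def nind_def pos_def fun_eq_iff) (metis less_irrefl zero_less_one)
  have hom': "y + \<delta> g = d" if "g \<in> G" "coeff_fun (r g) y \<noteq> 0" for g y
  proof -
    have "to_exp y \<in> Poly_Mapping.keys (r g)" using that(2) by (auto simp: coeff_fun_def in_keys_iff split: if_splits)
    then have "fine_deg (to_exp y) + \<delta> g = d" using hom that(1) by (auto simp: homogeneous_relation_def)
    then show ?thesis using coeff_fun_nonneg[OF that(2)] by (simp add: fine_deg_to_exp)
  qed
  have le: "\<delta> g \<le> d" if "\<rho> g \<noteq> 0" for g
    using that coeff_fun_nonneg[of "r g" "d - \<delta> g"] by (auto simp: \<rho>_def le_fun_def split: if_splits)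
  show "\<rho> g = 0" if "g \<notin> G" for g using that by (simp add: \<rho>_def)
  have supp: "nonneg_supp (point d \<rho>)"
    using le by (auto simp: nonneg_supp_point) (auto simp: \<rho>_def split: if_splits)
  have "gen_coeffs (point d \<rho>) g = r g" if "g \<in> G" for g
  proof (rule gen_coeffs_eqI[OF supp])
    fix y show "coeff_fun (r g) y = point d \<rho> (y + \<delta> g) g"
      using hom'[OF that, of y] that by (auto simp: point_def \<rho>_def algebra_simps)
  qed
  then have "to_module (point d \<rho>) = eval_gens r" unfolding to_module_def by (rule eval_gens_cong)
  also have "\<dots> = \<zero>\<^bsub>M\<^esub>" using r by (simp add: relations_def eval_gens_def)
  finally show "\<rho> \<in> sq_Rel (pos d)" using supp by (simp only: sq_Rel_iff d_eq[symmetric] simp_thms)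
  fix p x g assume g: "g \<in> G"
  show "coeff_fun (p * r g) (x - \<delta> g) = coeff_fun p (x - d) * \<rho> g"
  proof (cases "\<rho> g = 0")
    case True
    then have "coeff_fun (r g) (d - \<delta> g) = 0" using g by (simp add: \<rho>_def)
    then have "coeff_fun (r g) y = 0" for y using hom'[OF g, of y] by (metis add_diff_cancel_right')
    then have "r g = 0" by (intro coeff_fun_inject) (simp add: fun_eq_iff)
    then show ?thesis using True by simp
  next
    case False
    have fd: "fine_deg (to_exp (d - \<delta> g)) = d - \<delta> g" using le[OF False] by (intro fine_deg_to_exp) (simp add: le_fun_def)
    have "r g = Poly_Mapping.single (to_exp (d - \<delta> g)) (\<rho> g)"
    proof (rule coeff_fun_inject, rule ext)
      fix y show "coeff_fun (r g) y = coeff_fun (Poly_Mapping.single (to_exp (d - \<delta> g)) (\<rho> g)) y"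
        using hom'[OF g, of y] g by (auto simp: coeff_fun_single fd \<rho>_def algebra_simps)
    qed
    then show ?thesis by (simp add: mult.commute[of p] coeff_fun_single_mult fd)
  qed
qed

text \<open>From left to right squarefree relations enter. In degree \<open>x\<close> a relation of
  degree \<open>d\<close> contributes only if \<open>d \<le> x\<close>; hence \<open>pos d\<close>
  is contained in \<open>pos x\<close>, and its scalar vector lies in \<open>sq_Rel (pos x)\<close>.
  Conversely, a relation in the squarefree degree of \<open>pos x\<close> is multiplied by a
  monomial up to degree \<open>x\<close>.\<close>

lemma to_module_kernel:
  assumes u: "nonneg_supp u"
  shows "to_module u = \<zero>\<^bsub>M\<^esub> \<longleftrightarrow> (\<forall>x. u x \<in> sq_Rel (pos x))"
proof
  assume *: "\<forall>x. u x \<in> sq_Rel (pos x)"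
  have "to_module (point x (u x)) = \<zero>\<^bsub>M\<^esub>" if nz: "u x \<noteq> 0" for x
  proof -
    obtain g where "u x g \<noteq> 0" using nz by (auto simp: fun_eq_iff)
    then have "g \<in> G" "\<delta> g \<le> x" using u by (auto simp: nonneg_supp_def)
    then have "0 \<le> x t" for t using \<delta>_01[of g t] le_funD[of "\<delta> g" x t] by auto
    then have "nind 1 (pos x) \<le> x" by (auto simp: nind_def pos_def le_fun_def)
    then show ?thesis using * by (intro sq_Rel_shift) auto
  qed
  then show "to_module u = \<zero>\<^bsub>M\<^esub>" unfolding to_module_points[OF u] by (intro fm.add.finprod_one_eqI) auto
next
  assume "to_module u = \<zero>\<^bsub>M\<^esub>"
  then have "restrict (gen_coeffs u) G \<in> relations M G" by (simp add: to_module_zero_iff[OF u])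
  from rels[OF this] obtain R c where R: "finite R"
      "R \<subseteq> {r \<in> relations M G. \<exists>d\<in>squarefree_degrees. homogeneous_relation \<delta> G d r}"
    and c: "\<And>g. g \<in> G \<Longrightarrow> gen_coeffs u g = (\<Sum>r\<in>R. c r * r g)"
    by auto
  have "\<forall>r\<in>R. \<exists>p. snd p \<in> sq_Rel (pos (fst p)) \<and> (\<forall>g. g \<notin> G \<longrightarrow> snd p g = 0) \<and>
      (\<forall>f x g. g \<in> G \<longrightarrow> coeff_fun (f * r g) (x - \<delta> g) = coeff_fun f (x - fst p) * snd p g)"
  proof
    fix r assume "r \<in> R"
    then obtain d where "r \<in> relations M G" "d \<in> squarefree_degrees" "homogeneous_relation \<delta> G d r" using R(2) by blast
    then obtain \<rho> where "\<rho> \<in> sq_Rel (pos d)" "\<And>g. g \<notin> G \<Longrightarrow> \<rho> g = 0"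
      "\<And>p x g. g \<in> G \<Longrightarrow> coeff_fun (p * r g) (x - \<delta> g) = coeff_fun p (x - d) * \<rho> g"
      by (rule relation_coeffs) blast
    then show "\<exists>p. snd p \<in> sq_Rel (pos (fst p)) \<and> (\<forall>g. g \<notin> G \<longrightarrow> snd p g = 0) \<and>
        (\<forall>f x g. g \<in> G \<longrightarrow> coeff_fun (f * r g) (x - \<delta> g) = coeff_fun f (x - fst p) * snd p g)"
      by (intro exI[of _ "(d, \<rho>)"]) simp
  qed
  from bchoice[OF this] obtain p where p: "\<forall>r\<in>R. snd (p r) \<in> sq_Rel (pos (fst (p r))) \<and> (\<forall>g. g \<notin> G \<longrightarrow> snd (p r) g = 0) \<and>
      (\<forall>f x g. g \<in> G \<longrightarrow> coeff_fun (f * r g) (x - \<delta> g) = coeff_fun f (x - fst (p r)) * snd (p r) g)"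
    by (rule exE)
  show "\<forall>x. u x \<in> sq_Rel (pos x)"
  proof
    fix x
    let ?s = "\<lambda>r. fscale (coeff_fun (c r) (x - fst (p r))) (snd (p r))"
    have "u x g = (\<Sum>r\<in>R. ?s r g)" for g
    proof (cases "g \<in> G")
      case True
      have "u x g = coeff_fun (gen_coeffs u g) (x - \<delta> g)" by (simp add: coeff_gen_coeffs[OF u])
      also have "\<dots> = (\<Sum>r\<in>R. ?s r g)" unfolding c[OF True] coeff_fun_sum using p True by (intro sum.cong) auto
      finally show ?thesis .
    next
      case False
      then show ?thesis using p u by (auto simp: nonneg_supp_def intro!: sum.neutral[symmetric])
    qed
    then have "u x = (\<Sum>r\<in>R. ?s r)" by (auto simp: fun_eq_iff sum_fun_apply)
    also have "\<dots> \<in> sq_Rel (pos x)"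
    proof (rule fun_vs.subspace_sum[OF sq.Rel_subspace])
      fix r assume r: "r \<in> R"
      show "?s r \<in> sq_Rel (pos x)"
      proof (cases "coeff_fun (c r) (x - fst (p r)) = 0")
        case True
        then have "?s r = 0" by (auto simp: fun_eq_iff)
        then show ?thesis by (simp only: fun_vs.subspace_0[OF sq.Rel_subspace])
      next
        case False
        have "fst (p r) t \<le> x t" for t using coeff_fun_nonneg[OF False, of t] by simp
        then have "pos (fst (p r)) \<subseteq> pos x" by (auto simp: pos_def intro: less_le_trans)
        then have "snd (p r) \<in> sq_Rel (pos x)" using p r sq.Rel_mono by blast
        then show ?thesis by (rule fun_vs.subspace_scale[OF sq.Rel_subspace])
      qed
    qed
    finally show "u x \<in> sq_Rel (pos x)" .
  qed
qed

end

section \<open>Gradings and multiples of the forms in terms of the presentation\<close>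

context squarefree_presentation
begin

lemma gr_subgroup: "additive_subgroup (gr x) M"
  and gr_unique: "v \<in> carrier M \<Longrightarrow> \<exists>!f. (\<forall>x. f x \<in> gr x) \<and> finite {x. f x \<noteq> \<zero>\<^bsub>M\<^esub>} \<and>
    v = (\<Oplus>\<^bsub>M\<^esub> x\<in>{x. f x \<noteq> \<zero>\<^bsub>M\<^esub>}. f x)"
  and gr_smult: "v \<in> gr x \<Longrightarrow> Poly_Mapping.single p c \<odot>\<^bsub>M\<^esub> v \<in> gr (fine_deg p + x)"
  using graded by (auto simp: graded_module_def)

lemma gr_finsum: "finite I \<Longrightarrow> (\<And>i. i \<in> I \<Longrightarrow> f i \<in> gr x) \<Longrightarrow> (\<Oplus>\<^bsub>M\<^esub> i\<in>I. f i) \<in> gr x"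
proof (induction I rule: finite_induct)
  case empty
  then show ?case by (simp add: additive_subgroup.zero_closed[OF gr_subgroup])
next
  case (insert i I)
  have "f \<in> insert i I \<rightarrow> carrier M" using insert.prems additive_subgroup.a_subset[OF gr_subgroup] by blast
  then show ?case
    using insert additive_subgroup.a_closed[OF gr_subgroup] by (simp add: Pi_iff)
qed

lemma point_0: "point x (0 :: 'm \<Rightarrow> 'k) = 0"
  by (auto simp: point_def fun_eq_iff)

lemma point_gr:
  assumes "nonneg_supp (point x c)"
  shows "to_module (point x c) \<in> gr x"
  unfolding to_module_def eval_gens_def
proof (rule gr_finsum[OF finite_G])
  fix g assume g: "g \<in> G"
  show "gen_coeffs (point x c) g \<odot>\<^bsub>M\<^esub> g \<in> gr x"
  proof (cases "c g = 0")
    case True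
    have "gen_coeffs (point x c) g = 0" by (rule gen_coeffs_eqI[OF assms]) (simp add: point_def True)
    then show ?thesis
      using fm.smult_l_null[OF G_carrier'[OF g]] by (simp add: additive_subgroup.zero_closed[OF gr_subgroup])
  next
    case False
    then have "\<delta> g \<le> x" using assms by (simp add: nonneg_supp_point)
    then have fd: "fine_deg (to_exp (x - \<delta> g)) = x - \<delta> g" by (intro fine_deg_to_exp) (simp add: le_fun_def)
    have "gen_coeffs (point x c) g = Poly_Mapping.single (to_exp (x - \<delta> g)) (c g)"
      by (rule gen_coeffs_eqI[OF assms]) (auto simp: coeff_fun_single fd point_def algebra_simps)
    then show ?thesis using gr_smult[OF G_gr[OF g], of "to_exp (x - \<delta> g)" "c g"] by (simp add: fd)
  qed
qed

text \<open>An element of \<open>gr e\<close> has two homogeneous decompositions, the one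
  concentrated in degree \<open>e\<close> and the one read off from \<open>u\<close>. Uniqueness
  equates them, so only the part of \<open>u\<close> at \<open>e\<close> is left.\<close>

lemma gr_component:
  assumes v: "v \<in> gr e" and u: "nonneg_supp u" and eq: "v = to_module u"
  shows "v = to_module (point e (u e))"
proof -
  let ?P = "\<lambda>f. (\<forall>x. f x \<in> gr x) \<and> finite {x. f x \<noteq> \<zero>\<^bsub>M\<^esub>} \<and> v = (\<Oplus>\<^bsub>M\<^esub> x\<in>{x. f x \<noteq> \<zero>\<^bsub>M\<^esub>}. f x)"
  let ?f = "\<lambda>x. if x = e then v else \<zero>\<^bsub>M\<^esub>" and ?h = "\<lambda>x. to_module (point x (u x))"
  have vM: "v \<in> carrier M" using eq to_module_closed by simp
  have "?P ?f"
  proof (cases "v = \<zero>\<^bsub>M\<^esub>")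
    case True
    then show ?thesis by (simp add: additive_subgroup.zero_closed[OF gr_subgroup])
  next
    case False
    then have "{x. ?f x \<noteq> \<zero>\<^bsub>M\<^esub>} = {e}" by auto
    then show ?thesis using v vM by (simp add: additive_subgroup.zero_closed[OF gr_subgroup])
  qed
  note Pf = this
  have Ph: "?P ?h"
  proof (intro conjI allI)
    show "?h x \<in> gr x" for x by (rule point_gr[OF nonneg_supp_points[OF u]])
    have sub: "{x. ?h x \<noteq> \<zero>\<^bsub>M\<^esub>} \<subseteq> {x. u x \<noteq> 0}"
    proof
      fix x assume "x \<in> {x. ?h x \<noteq> \<zero>\<^bsub>M\<^esub>}"
      moreover have "?h x = \<zero>\<^bsub>M\<^esub>" if "u x = 0" unfolding that point_0 by (rule to_module_0)
      ultimately show "x \<in> {x. u x \<noteq> 0}" by blast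
    qed
    have fin: "finite {x. u x \<noteq> 0}" using u by (simp add: nonneg_supp_def)
    show "finite {x. ?h x \<noteq> \<zero>\<^bsub>M\<^esub>}" by (rule finite_subset[OF sub fin])
    have v_eq: "v = (\<Oplus>\<^bsub>M\<^esub> x\<in>{x. u x \<noteq> 0}. ?h x)" unfolding eq by (rule to_module_points[OF u])
    have "(\<Oplus>\<^bsub>M\<^esub> x\<in>{x. ?h x \<noteq> \<zero>\<^bsub>M\<^esub>}. ?h x) = (\<Oplus>\<^bsub>M\<^esub> x\<in>{x. u x \<noteq> 0}. ?h x)"
      by (rule fm.add.finprod_mono_neutral_cong_left[OF fin sub]) (auto simp: to_module_closed)
    from trans[OF v_eq this[symmetric]] show "v = (\<Oplus>\<^bsub>M\<^esub> x\<in>{x. ?h x \<noteq> \<zero>\<^bsub>M\<^esub>}. ?h x)" .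
  qed
  obtain f0 where f0: "\<forall>f. ?P f \<longrightarrow> f = f0" by (rule ex1E[OF gr_unique[OF vM]])
  have "?f = f0" using spec[OF f0, of ?f] Pf by (rule mp)
  moreover have "?h = f0" using spec[OF f0, of ?h] Ph by (rule mp)
  ultimately have "?f = ?h" by (rule trans[OF _ sym])
  from fun_cong[OF this, of e] show ?thesis by simp
qed

lemma gr_eq: "gr e = to_module ` {u \<in> sq.Loc {}. \<forall>x. u x \<noteq> 0 \<longrightarrow> x = e}"
proof
  show "gr e \<subseteq> to_module ` {u \<in> sq.Loc {}. \<forall>x. u x \<noteq> 0 \<longrightarrow> x = e}"
  proof
    fix v assume v: "v \<in> gr e"
    then have "v \<in> carrier M" using additive_subgroup.a_subset[OF gr_subgroup] by blast
    then obtain u where u: "nonneg_supp u" "v = to_module u" using to_module_surj by blast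
    have "point e (u e) \<in> {u \<in> sq.Loc {}. \<forall>x. u x \<noteq> 0 \<longrightarrow> x = e}"
      using nonneg_supp_points[OF u(1)] by (simp add: Loc_eq) (simp add: point_def zero_fun_def)
    with gr_component[OF v u] show "v \<in> to_module ` {u \<in> sq.Loc {}. \<forall>x. u x \<noteq> 0 \<longrightarrow> x = e}" by (rule image_eqI)
  qed
  show "to_module ` {u \<in> sq.Loc {}. \<forall>x. u x \<noteq> 0 \<longrightarrow> x = e} \<subseteq> gr e"
  proof
    fix v assume "v \<in> to_module ` {u \<in> sq.Loc {}. \<forall>x. u x \<noteq> 0 \<longrightarrow> x = e}"
    then obtain u where u: "nonneg_supp u" "\<forall>x. u x \<noteq> 0 \<longrightarrow> x = e" "v = to_module u" by (auto simp: Loc_eq)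
    have "u = point e (u e)"
    proof
      fix x show "u x = point e (u e) x" using u(2) by (cases "x = e") (auto simp: point_def zero_fun_def)
    qed
    then show "v \<in> gr e" using point_gr[OF nonneg_supp_points[OF u(1), of e]] u(3) by simp
  qed
qed

lemma coarsen_eq: "coarsen M gr i = to_module ` {u \<in> sq.Loc {}. \<forall>x. u x \<noteq> 0 \<longrightarrow> tdeg x = i}"
proof
  show "coarsen M gr i \<subseteq> to_module ` {u \<in> sq.Loc {}. \<forall>x. u x \<noteq> 0 \<longrightarrow> tdeg x = i}"
  proof
    fix v assume "v \<in> coarsen M gr i"
    then obtain D f where D: "finite D" "v = (\<Oplus>\<^bsub>M\<^esub> x\<in>D. f x)" "\<And>x. x \<in> D \<Longrightarrow> tdeg x = i" "\<And>x. x \<in> D \<Longrightarrow> f x \<in> gr x"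
      by (auto simp: coarsen_def tdeg_def)
    have "\<forall>x\<in>D. \<exists>u. u \<in> sq.Loc {} \<and> (\<forall>y. u y \<noteq> 0 \<longrightarrow> y = x) \<and> f x = to_module u"
      using D(4) unfolding gr_eq by auto
    from bchoice[OF this] obtain w where
      w: "\<forall>x\<in>D. w x \<in> sq.Loc {} \<and> (\<forall>y. w x y \<noteq> 0 \<longrightarrow> y = x) \<and> f x = to_module (w x)" by (rule exE)
    have "v = (\<Oplus>\<^bsub>M\<^esub> x\<in>D. to_module (w x))"
      unfolding D(2) using w by (intro fm.finsum_cong') (auto simp: to_module_closed)
    also have "\<dots> = to_module (\<Sum>x\<in>D. w x)" using w by (intro img.h_sum D(1)) blast
    finally have v: "v = to_module (\<Sum>x\<in>D. w x)" .
    have "tdeg y = i" if nz: "(\<Sum>x\<in>D. w x) y \<noteq> 0" for y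
    proof (rule ccontr)
      assume "tdeg y \<noteq> i"
      then have "w x y = 0" if "x \<in> D" for x using w D(3) that by metis
      then have "(\<Sum>x\<in>D. w x y) = 0" by (intro sum.neutral) blast
      moreover have "(\<Sum>x\<in>D. w x) y = (\<Sum>x\<in>D. w x y)" by (rule sum_fun_apply)
      ultimately show False using nz by simp
    qed
    moreover have "(\<Sum>x\<in>D. w x) \<in> sq.Loc {}" using w by (intro img.C_sum) blast
    ultimately show "v \<in> to_module ` {u \<in> sq.Loc {}. \<forall>x. u x \<noteq> 0 \<longrightarrow> tdeg x = i}" using v by blast
  qed
  show "to_module ` {u \<in> sq.Loc {}. \<forall>x. u x \<noteq> 0 \<longrightarrow> tdeg x = i} \<subseteq> coarsen M gr i"
  proof
    fix v assume "v \<in> to_module ` {u \<in> sq.Loc {}. \<forall>x. u x \<noteq> 0 \<longrightarrow> tdeg x = i}"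
    then obtain u where u: "nonneg_supp u" "\<forall>x. u x \<noteq> 0 \<longrightarrow> tdeg x = i" "v = to_module u" by (auto simp: Loc_eq)
    have "finite {x. u x \<noteq> 0}" using u by (simp add: nonneg_supp_def)
    then show "v \<in> coarsen M gr i"
      unfolding coarsen_def u(3) to_module_points[OF u(1)] using u(2) point_gr[OF nonneg_supp_points[OF u(1)]]
      by (intro CollectI exI[of _ "{x. u x \<noteq> 0}"] exI[of _ "\<lambda>x. to_module (point x (u x))"]) (simp add: tdeg_def)
  qed
qed

lemma to_module_Var: "nonneg_supp u \<Longrightarrow> Var t \<odot>\<^bsub>M\<^esub> to_module u = to_module (shift (unit_exp t) u)"
proof -
  assume u: "nonneg_supp u"
  have "to_exp (unit_exp t) = Poly_Mapping.single t 1"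
    by (rule poly_mapping_eqI) (simp add: lookup_single unit_exp_def when_def)
  then show ?thesis
    using to_module_shift[OF u, of "unit_exp t"] by (simp add: Var_def le_fun_def unit_exp_def)
qed

lemma to_module_linear_form:
  assumes u: "nonneg_supp u"
  shows "linear_form a q \<odot>\<^bsub>M\<^esub> to_module u = to_module (sq.lform a q u)"
proof -
  have "nonneg_supp (sq.lform a q u)" using sq.lform_Loc[of u "{}"] u by (simp add: Loc_eq)
  then show ?thesis
    unfolding to_module_def eval_gens_smult
    by (intro eval_gens_cong sym[OF gen_coeffs_eqI])
       (simp_all add: linear_form_def sum_distrib_right mult.assoc coeff_fun_sum coeff_fun_Const_mult coeff_fun_Var_mult
        coeff_gen_coeffs[OF u] sq.lform_def sum_fun_apply diff_add_eq)
qed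

lemma to_module_kernel': "u \<in> sq.Loc {} \<Longrightarrow> to_module u = \<zero>\<^bsub>M\<^esub> \<longleftrightarrow> u \<in> sq.Loc_Rel {}"
  using to_module_kernel by (simp add: Loc_eq sq.Loc_Rel_def)

lemma presented_self: "presented_module sq_gens sq_Rel a 0 M to_module"
proof (intro presented_module.intro squarefree_system_forms.intro squarefree_system_forms_axioms.intro
    presented_module_axioms.intro sq.squarefree_system_axioms)
  show "general_position 0 a" by (simp add: general_position_def)
  show "Module.module poly_ring M" by (rule fm.module_axioms)
  show "carrier M = to_module ` sq.Loc {}" by (rule img.carrier_eq)
  show "\<zero>\<^bsub>M\<^esub> = to_module 0" by (rule to_module_0[symmetric])
  show "to_module (u + v) = to_module u \<oplus>\<^bsub>M\<^esub> to_module v" if "u \<in> sq.Loc {}" "v \<in> sq.Loc {}" for u v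
    using that by (rule img.h_add)
  show "Var t \<odot>\<^bsub>M\<^esub> to_module u = to_module (shift (unit_exp t) u)" if "u \<in> sq.Loc {}" for u t
    using that by (simp only: Loc_eq mem_Collect_eq to_module_Var)
  show "Const r \<odot>\<^bsub>M\<^esub> to_module u = to_module (sq.uscale r u)" if "u \<in> sq.Loc {}" for u r
    using that by (simp only: Loc_eq mem_Collect_eq to_module_scale sq.uscale_def)
  show "to_module u = \<zero>\<^bsub>M\<^esub> \<longleftrightarrow> (\<exists>k\<in>sq.Loc_Rel {}. \<exists>v. (\<forall>q. v q \<in> sq.Loc {}) \<and> u = k + (\<Sum>q\<in>{1..0}. sq.lform a q (v q)))"
    if "u \<in> sq.Loc {}" for u
    unfolding to_module_kernel'[OF that] using sq.Loc_0[of "{}"] by (auto intro!: exI[of _ "\<lambda>_. 0"])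
qed

lemma forms_submodule_iff:
  "x \<in> forms_submodule m (linear_form a) M \<longleftrightarrow> (\<exists>v. (\<forall>q. v q \<in> sq.Loc {}) \<and> x = to_module (\<Sum>q\<in>{1..m}. sq.lform a q (v q)))"
proof -
  have eq: "(\<Oplus>\<^bsub>M\<^esub> q\<in>{1..m}. linear_form a q \<odot>\<^bsub>M\<^esub> to_module (v q)) = to_module (\<Sum>q\<in>{1..m}. sq.lform a q (v q))"
    if "\<And>q. q \<in> {1..m} \<Longrightarrow> v q \<in> sq.Loc {}" for v
  proof -
    have "(\<Oplus>\<^bsub>M\<^esub> q\<in>{1..m}. linear_form a q \<odot>\<^bsub>M\<^esub> to_module (v q)) = (\<Oplus>\<^bsub>M\<^esub> q\<in>{1..m}. to_module (sq.lform a q (v q)))"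
      using that by (intro fm.finsum_cong') (auto simp: to_module_linear_form Loc_eq to_module_closed)
    also have "\<dots> = to_module (\<Sum>q\<in>{1..m}. sq.lform a q (v q))"
      using that by (intro img.h_sum sq.lform_Loc) auto
    finally show ?thesis .
  qed
  show ?thesis
  proof
    assume "x \<in> forms_submodule m (linear_form a) M"
    then obtain w where w: "w \<in> {1..m} \<rightarrow> carrier M" "x = (\<Oplus>\<^bsub>M\<^esub> q\<in>{1..m}. linear_form a q \<odot>\<^bsub>M\<^esub> w q)"
      by (auto simp: forms_submodule_def)
    have "\<forall>q\<in>{1..m}. \<exists>u. u \<in> sq.Loc {} \<and> w q = to_module u" using w(1) img.carrier_eq by (auto simp: Pi_iff)
    from bchoice[OF this] obtain v where v: "\<forall>q\<in>{1..m}. v q \<in> sq.Loc {} \<and> w q = to_module (v q)" by (rule exE)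
    \<comment> \<open>Outside the range the coefficient is set to 0, since membership in
      \<open>sq.Loc {}\<close> is required for every index.\<close>
    let ?v = "\<lambda>q. if q \<in> {1..m} then v q else 0"
    have "x = (\<Oplus>\<^bsub>M\<^esub> q\<in>{1..m}. linear_form a q \<odot>\<^bsub>M\<^esub> to_module (?v q))"
      unfolding w(2) using v by (intro fm.finsum_cong') (auto simp: fm.smult_closed' to_module_closed)
    also have "\<dots> = to_module (\<Sum>q\<in>{1..m}. sq.lform a q (?v q))" using v by (intro eq) auto
    finally show "\<exists>v. (\<forall>q. v q \<in> sq.Loc {}) \<and> x = to_module (\<Sum>q\<in>{1..m}. sq.lform a q (v q))"
      using v sq.Loc_0 by (intro exI[of _ ?v]) auto
  next
    assume "\<exists>v. (\<forall>q. v q \<in> sq.Loc {}) \<and> x = to_module (\<Sum>q\<in>{1..m}. sq.lform a q (v q))"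
    then obtain v where v: "\<And>q. v q \<in> sq.Loc {}" "x = to_module (\<Sum>q\<in>{1..m}. sq.lform a q (v q))" by blast
    show "x \<in> forms_submodule m (linear_form a) M"
      unfolding forms_submodule_def v(2) eq[OF v(1), symmetric]
      by (intro CollectI exI[of _ "\<lambda>q. to_module (v q)"]) (simp add: to_module_closed)
  qed
qed

end

section \<open>Quotient modules\<close>

context frac_module
begin

lemma quot_simps:
  "carrier (quot_module N H) = a_rcosets\<^bsub>N\<^esub> H" "\<zero>\<^bsub>quot_module N H\<^esub> = H"
  "A \<oplus>\<^bsub>quot_module N H\<^esub> B = A <+>\<^bsub>N\<^esub> B"
  "s \<odot>\<^bsub>quot_module N H\<^esub> A = H <+>\<^bsub>N\<^esub> (\<lambda>x. s \<odot>\<^bsub>N\<^esub> x) ` A"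
  by (simp_all add: quot_module_def)

context
  fixes H :: "'q set"
  assumes H: "additive_subgroup H N" and smult_H: "\<And>s x. x \<in> H \<Longrightarrow> s \<odot>\<^bsub>N\<^esub> x \<in> H"
begin

interpretation H: abelian_subgroup H N
  by (rule abelian_subgroupI3[OF H M.abelian_group_axioms])

lemma quot_smult:
  assumes x: "x \<in> carrier N"
  shows "s \<odot>\<^bsub>quot_module N H\<^esub> (H +>\<^bsub>N\<^esub> x) = H +>\<^bsub>N\<^esub> (s \<odot>\<^bsub>N\<^esub> x)"
  unfolding quot_simps
proof
  have sx: "s \<odot>\<^bsub>N\<^esub> x \<in> carrier N" by (rule smult_closed'[OF x])
  show "H <+>\<^bsub>N\<^esub> (\<lambda>x. s \<odot>\<^bsub>N\<^esub> x) ` (H +>\<^bsub>N\<^esub> x) \<subseteq> H +>\<^bsub>N\<^esub> (s \<odot>\<^bsub>N\<^esub> x)"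
  proof
    fix y assume "y \<in> H <+>\<^bsub>N\<^esub> (\<lambda>x. s \<odot>\<^bsub>N\<^esub> x) ` (H +>\<^bsub>N\<^esub> x)"
    then obtain h k where hk: "h \<in> H" "k \<in> H" "y = h \<oplus>\<^bsub>N\<^esub> s \<odot>\<^bsub>N\<^esub> (k \<oplus>\<^bsub>N\<^esub> x)"
      by (auto simp: set_add_def' a_r_coset_def')
    have "y = (h \<oplus>\<^bsub>N\<^esub> s \<odot>\<^bsub>N\<^esub> k) \<oplus>\<^bsub>N\<^esub> s \<odot>\<^bsub>N\<^esub> x"
      unfolding hk(3) using hk x sx H.a_Hcarr by (simp add: smult_add smult_closed' M.a_assoc)
    moreover have "h \<oplus>\<^bsub>N\<^esub> s \<odot>\<^bsub>N\<^esub> k \<in> H" using hk smult_H by (simp add: H.a_closed)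
    ultimately show "y \<in> H +>\<^bsub>N\<^esub> (s \<odot>\<^bsub>N\<^esub> x)" by (auto simp: a_r_coset_def')
  qed
  show "H +>\<^bsub>N\<^esub> (s \<odot>\<^bsub>N\<^esub> x) \<subseteq> H <+>\<^bsub>N\<^esub> (\<lambda>x. s \<odot>\<^bsub>N\<^esub> x) ` (H +>\<^bsub>N\<^esub> x)"
  proof
    fix y assume "y \<in> H +>\<^bsub>N\<^esub> (s \<odot>\<^bsub>N\<^esub> x)"
    then obtain h where "h \<in> H" "y = h \<oplus>\<^bsub>N\<^esub> s \<odot>\<^bsub>N\<^esub> x" by (auto simp: a_r_coset_def')
    moreover have "x \<in> H +>\<^bsub>N\<^esub> x" using x H.a_rcos_self by blast
    ultimately show "y \<in> H <+>\<^bsub>N\<^esub> (\<lambda>x. s \<odot>\<^bsub>N\<^esub> x) ` (H +>\<^bsub>N\<^esub> x)" by (auto simp: set_add_def')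
  qed
qed

lemma quot_module_module: "Module.module R (quot_module N H)"
proof (rule moduleI)
  show "cring R" by (rule R.is_cring)
  have coset: "\<exists>x\<in>carrier N. A = H +>\<^bsub>N\<^esub> x" if "A \<in> carrier (quot_module N H)" for A
    using that by (auto simp: quot_simps A_RCOSETS_def')
  have coset': "H +>\<^bsub>N\<^esub> x \<in> carrier (quot_module N H)" if "x \<in> carrier N" for x
    using that by (auto simp: quot_simps A_RCOSETS_def')
  have add: "(H +>\<^bsub>N\<^esub> z) \<oplus>\<^bsub>quot_module N H\<^esub> (H +>\<^bsub>N\<^esub> w) = H +>\<^bsub>N\<^esub> (z \<oplus>\<^bsub>N\<^esub> w)"
    if "z \<in> carrier N" "w \<in> carrier N" for z w
    using H.a_rcos_sum[OF that] by (simp add: quot_simps)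
  have zero: "\<zero>\<^bsub>quot_module N H\<^esub> = H +>\<^bsub>N\<^esub> \<zero>\<^bsub>N\<^esub>"
    using H.a_subset by (simp add: quot_simps)
  show "abelian_group (quot_module N H)"
  proof (rule abelian_groupI)
    fix A B assume "A \<in> carrier (quot_module N H)" "B \<in> carrier (quot_module N H)"
    then obtain x y where x: "x \<in> carrier N" "A = H +>\<^bsub>N\<^esub> x" and y: "y \<in> carrier N" "B = H +>\<^bsub>N\<^esub> y"
      using coset by blast
    show "A \<oplus>\<^bsub>quot_module N H\<^esub> B \<in> carrier (quot_module N H)" using x y by (simp add: add coset')
    show "A \<oplus>\<^bsub>quot_module N H\<^esub> B = B \<oplus>\<^bsub>quot_module N H\<^esub> A" using x y by (simp add: add M.a_comm)
    show "\<zero>\<^bsub>quot_module N H\<^esub> \<oplus>\<^bsub>quot_module N H\<^esub> A = A" using x by (simp add: add zero)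
    show "\<exists>B\<in>carrier (quot_module N H). B \<oplus>\<^bsub>quot_module N H\<^esub> A = \<zero>\<^bsub>quot_module N H\<^esub>"
      using x by (intro bexI[of _ "H +>\<^bsub>N\<^esub> (\<ominus>\<^bsub>N\<^esub> x)"]) (simp_all add: add zero coset' M.l_neg)
    fix C assume "C \<in> carrier (quot_module N H)"
    then obtain z where z: "z \<in> carrier N" "C = H +>\<^bsub>N\<^esub> z" using coset by blast
    show "A \<oplus>\<^bsub>quot_module N H\<^esub> B \<oplus>\<^bsub>quot_module N H\<^esub> C = A \<oplus>\<^bsub>quot_module N H\<^esub> (B \<oplus>\<^bsub>quot_module N H\<^esub> C)"
      using x y z by (simp add: add M.a_assoc)
  qed (simp add: zero coset')
  fix s r A B assume "A \<in> carrier (quot_module N H)" "B \<in> carrier (quot_module N H)"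
  then obtain x y where x: "x \<in> carrier N" "A = H +>\<^bsub>N\<^esub> x" and y: "y \<in> carrier N" "B = H +>\<^bsub>N\<^esub> y"
    using coset by blast
  note simps = x y add quot_smult smult_closed' smult_add smult_smult M.a_closed R
  show "s \<odot>\<^bsub>quot_module N H\<^esub> A \<in> carrier (quot_module N H)"
    using x smult_closed'[OF x(1)] by (auto simp: quot_smult quot_simps(1) A_RCOSETS_def')
  show "(s \<oplus>\<^bsub>R\<^esub> r) \<odot>\<^bsub>quot_module N H\<^esub> A = s \<odot>\<^bsub>quot_module N H\<^esub> A \<oplus>\<^bsub>quot_module N H\<^esub> r \<odot>\<^bsub>quot_module N H\<^esub> A"
    using smult_l_distr[of s r x] by (simp add: simps)
  show "s \<odot>\<^bsub>quot_module N H\<^esub> (A \<oplus>\<^bsub>quot_module N H\<^esub> B) = s \<odot>\<^bsub>quot_module N H\<^esub> A \<oplus>\<^bsub>quot_module N H\<^esub> s \<odot>\<^bsub>quot_module N H\<^esub> B"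
    by (simp add: simps)
  show "(s \<otimes>\<^bsub>R\<^esub> r) \<odot>\<^bsub>quot_module N H\<^esub> A = s \<odot>\<^bsub>quot_module N H\<^esub> (r \<odot>\<^bsub>quot_module N H\<^esub> A)"
    by (simp add: simps)
  show "\<one>\<^bsub>R\<^esub> \<odot>\<^bsub>quot_module N H\<^esub> A = A"
    using smult_1[OF x(1)] by (simp add: simps)
qed

end

end

section \<open>The quotient by the forms as a presented module, and both sides of the
  formula\<close>

context squarefree_presentation
begin

abbreviation \<Theta>M :: "('n \<times> nat \<Rightarrow> 'k) \<Rightarrow> nat \<Rightarrow> 'm set"
  where "\<Theta>M a m \<equiv> forms_submodule m (linear_form a) M"

lemma \<Theta>M_smult: "x \<in> \<Theta>M a m \<Longrightarrow> s \<odot>\<^bsub>M\<^esub> x \<in> \<Theta>M a m"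
proof -
  assume "x \<in> \<Theta>M a m"
  then obtain w where w: "w \<in> {1..m} \<rightarrow> carrier M" "x = (\<Oplus>\<^bsub>M\<^esub> q\<in>{1..m}. linear_form a q \<odot>\<^bsub>M\<^esub> w q)"
    by (auto simp: forms_submodule_def)
  have "s \<odot>\<^bsub>M\<^esub> x = (\<Oplus>\<^bsub>M\<^esub> q\<in>{1..m}. s \<odot>\<^bsub>M\<^esub> (linear_form a q \<odot>\<^bsub>M\<^esub> w q))"
    unfolding w(2) using w(1) by (intro fm.finsum_smult_ldistr) (auto simp: fm.smult_closed')
  also have "\<dots> = (\<Oplus>\<^bsub>M\<^esub> q\<in>{1..m}. linear_form a q \<odot>\<^bsub>M\<^esub> (s \<odot>\<^bsub>M\<^esub> w q))"
    using w(1) by (intro fm.finsum_cong') (auto simp: fm.smult_closed' fm.smult_smult Pi_iff mult.commute)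
  finally show ?thesis
    unfolding forms_submodule_def using w(1)
    by (intro CollectI exI[of _ "\<lambda>q. s \<odot>\<^bsub>M\<^esub> w q"]) (auto simp: fm.smult_closed')
qed

lemma \<Theta>M_subgroup: "additive_subgroup (\<Theta>M a m) M"
proof (rule additive_subgroup.intro)
  have sub: "\<Theta>M a m \<subseteq> carrier M" using to_module_closed by (auto simp: forms_submodule_iff)
  have z: "\<zero>\<^bsub>M\<^esub> \<in> \<Theta>M a m"
    unfolding forms_submodule_iff using sq.Loc_0 sq.lform.\<theta>_0 to_module_0
    by (intro exI[of _ "\<lambda>_. 0"]) simp
  show "subgroup (\<Theta>M a m) (add_monoid M)"
  proof (rule fm.add.subgroupI)
    show "\<Theta>M a m \<noteq> {}" using z by blast
    \<comment> \<open>Negation is multiplication by the scalar -1, so closure under scalars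
      suffices.\<close>
    show "\<ominus>\<^bsub>M\<^esub> x \<in> \<Theta>M a m" if x: "x \<in> \<Theta>M a m" for x
    proof -
      have xM: "x \<in> carrier M" using x sub by blast
      have "(- 1) \<odot>\<^bsub>M\<^esub> x \<oplus>\<^bsub>M\<^esub> x = (- 1 + 1) \<odot>\<^bsub>M\<^esub> x"
        using fm.smult_l_distr[of "- 1" 1 x] fm.smult_1 xM by simp
      also have "\<dots> = \<zero>\<^bsub>M\<^esub>" using fm.smult_l_null[OF xM] by simp
      finally have "\<ominus>\<^bsub>M\<^esub> x = (- 1) \<odot>\<^bsub>M\<^esub> x"
        by (rule fm.minus_equality) (simp_all add: xM fm.smult_closed')
      then show ?thesis using \<Theta>M_smult[OF x] by simp
    qed
    show "x \<oplus>\<^bsub>M\<^esub> y \<in> \<Theta>M a m" if xy: "x \<in> \<Theta>M a m" "y \<in> \<Theta>M a m" for x y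
    proof -
      obtain v w where v: "\<forall>q. v q \<in> sq.Loc {}" "x = to_module (\<Sum>q\<in>{1..m}. sq.lform a q (v q))"
        and w: "\<forall>q. w q \<in> sq.Loc {}" "y = to_module (\<Sum>q\<in>{1..m}. sq.lform a q (w q))"
        using xy unfolding forms_submodule_iff by auto
      have "x \<oplus>\<^bsub>M\<^esub> y = to_module ((\<Sum>q\<in>{1..m}. sq.lform a q (v q)) + (\<Sum>q\<in>{1..m}. sq.lform a q (w q)))"
        unfolding v(2) w(2) using v(1) w(1) by (intro img.h_add[symmetric] img.C_sum sq.lform_Loc) auto
      also have "(\<Sum>q\<in>{1..m}. sq.lform a q (v q)) + (\<Sum>q\<in>{1..m}. sq.lform a q (w q)) = (\<Sum>q\<in>{1..m}. sq.lform a q (v q + w q))"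
        by (simp only: sq.lform_add sum.distrib)
      finally show ?thesis
        unfolding forms_submodule_iff using v(1) w(1)
        by (intro exI[of _ "\<lambda>q. v q + w q"]) (simp add: img.C_add)
    qed
  qed (use sub in simp)
qed

definition to_quot :: "('n \<times> nat \<Rightarrow> 'k) \<Rightarrow> nat \<Rightarrow> (('n \<Rightarrow> int) \<Rightarrow> 'm \<Rightarrow> 'k) \<Rightarrow> 'm set"
  where "to_quot a m u = \<Theta>M a m +>\<^bsub>M\<^esub> to_module u"

lemma presented_quot:
  assumes "general_position m a"
  shows "presented_module sq_gens sq_Rel a m (quot_module M (\<Theta>M a m)) (to_quot a m)"
proof (intro presented_module.intro squarefree_system_forms.intro squarefree_system_forms_axioms.intro
    presented_module_axioms.intro sq.squarefree_system_axioms assms)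
  let ?Q = "quot_module M (\<Theta>M a m)"
  interpret H: abelian_subgroup "\<Theta>M a m" M
    by (rule abelian_subgroupI3[OF \<Theta>M_subgroup fm.M.abelian_group_axioms])
  note simps = fm.quot_simps[of "\<Theta>M a m"]
  have smult: "s \<odot>\<^bsub>?Q\<^esub> (\<Theta>M a m +>\<^bsub>M\<^esub> x) = \<Theta>M a m +>\<^bsub>M\<^esub> s \<odot>\<^bsub>M\<^esub> x" if "x \<in> carrier M" for s x
    by (rule fm.quot_smult) (rule \<Theta>M_subgroup, erule \<Theta>M_smult, rule that)
  show "Module.module poly_ring ?Q" by (rule fm.quot_module_module) (rule \<Theta>M_subgroup, erule \<Theta>M_smult)
  show "carrier ?Q = to_quot a m ` sq.Loc {}"
    unfolding simps(1) A_RCOSETS_def' img.carrier_eq to_quot_def by blast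
  show "\<zero>\<^bsub>?Q\<^esub> = to_quot a m 0"
    unfolding simps(2) to_quot_def to_module_0 using H.a_subset fm.a_coset_add_zero by simp
  show "to_quot a m (u + v) = to_quot a m u \<oplus>\<^bsub>?Q\<^esub> to_quot a m v" if "u \<in> sq.Loc {}" "v \<in> sq.Loc {}" for u v
    unfolding simps(3) to_quot_def img.h_add[OF that] by (rule H.a_rcos_sum[symmetric]) (rule to_module_closed)+
  show "Var t \<odot>\<^bsub>?Q\<^esub> to_quot a m u = to_quot a m (shift (unit_exp t) u)" if "u \<in> sq.Loc {}" for u t
    using that unfolding to_quot_def smult[OF to_module_closed] by (simp only: Loc_eq mem_Collect_eq to_module_Var)
  show "Const r \<odot>\<^bsub>?Q\<^esub> to_quot a m u = to_quot a m (sq.uscale r u)" if "u \<in> sq.Loc {}" for u r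
    using that unfolding to_quot_def smult[OF to_module_closed] by (simp only: Loc_eq mem_Collect_eq to_module_scale sq.uscale_def)
  show "to_quot a m u = \<zero>\<^bsub>?Q\<^esub> \<longleftrightarrow>
      (\<exists>k\<in>sq.Loc_Rel {}. \<exists>v. (\<forall>q. v q \<in> sq.Loc {}) \<and> u = k + (\<Sum>q\<in>{1..m}. sq.lform a q (v q)))"
    if u: "u \<in> sq.Loc {}" for u
  proof -
    have "to_quot a m u = \<zero>\<^bsub>?Q\<^esub> \<longleftrightarrow> to_module u \<in> \<Theta>M a m"
      unfolding to_quot_def simps(2)
      using fm.a_coset_join1[OF _ to_module_closed H.a_subgroup] fm.a_coset_join2[OF to_module_closed H.a_subgroup] by blast
    \<comment> \<open>Two families represent the same element of \<open>M\<close> if and only if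
      their difference is a relation, so membership of the image in the multiples of the forms
      becomes a congruence between families.\<close>
    also have "\<dots> \<longleftrightarrow> (\<exists>v. (\<forall>q. v q \<in> sq.Loc {}) \<and> u - (\<Sum>q\<in>{1..m}. sq.lform a q (v q)) \<in> sq.Loc_Rel {})"
      unfolding forms_submodule_iff
    proof (intro ex_cong1 conj_cong refl)
      fix v :: "nat \<Rightarrow> ('n \<Rightarrow> int) \<Rightarrow> 'm \<Rightarrow> 'k" assume "\<forall>q. v q \<in> sq.Loc {}"
      then have v: "(\<Sum>q\<in>{1..m}. sq.lform a q (v q)) \<in> sq.Loc {}" by (intro img.C_sum sq.lform_Loc) blast
      show "to_module u = to_module (\<Sum>q\<in>{1..m}. sq.lform a q (v q)) \<longleftrightarrow> u - (\<Sum>q\<in>{1..m}. sq.lform a q (v q)) \<in> sq.Loc_Rel {}"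
        unfolding img.h_diff_eq[OF u v] by (rule to_module_kernel'[OF img.C_diff[OF u v]])
    qed
    also have "\<dots> \<longleftrightarrow> (\<exists>k\<in>sq.Loc_Rel {}. \<exists>v. (\<forall>q. v q \<in> sq.Loc {}) \<and> u = k + (\<Sum>q\<in>{1..m}. sq.lform a q (v q)))"
      by (metis (no_types) diff_add_cancel add_diff_cancel_right')
    finally show ?thesis .
  qed
qed

lemma dim_local_cohomology:
  assumes "pos x = {}"
  shows "local_cohomology_dim fine_deg M gr j x = enat (sq.hdim j (neg x))"
proof -
  \<comment> \<open>With \<open>m = 0\<close> no forms are imposed, and any coefficient matrix can
    be inserted.\<close>
  interpret P: presented_module sq_gens sq_Rel "\<lambda>_. 0" 0 M to_module by (rule presented_self)
  show ?thesis
    by (rule P.local_cohomology_dim_eq[where wt = "\<lambda>x. x", OF gr_eq _ P.dim_fine_piece[OF refl assms]])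
       (simp add: fine_deg_def)
qed

lemma dim_local_cohomology_mod_forms:
  assumes "general_position m a"
  shows "\<exists>i0. \<forall>i>i0. local_cohomology_dim total_deg (quot_module M (\<Theta>M a m)) (quot_grading M (\<Theta>M a m) (coarsen M gr)) j (- i) =
    enat (\<Sum>F\<in>UNIV. binom (i - 1) (int (card F) - int m - 1) * sq.hdim (j + int m) F)"
proof -
  interpret P: presented_module sq_gens sq_Rel a m "quot_module M (\<Theta>M a m)" "to_quot a m"
    by (rule presented_quot[OF assms])
  have gr: "quot_grading M (\<Theta>M a m) (coarsen M gr) e = to_quot a m ` {u \<in> sq.Loc {}. \<forall>x. u x \<noteq> 0 \<longrightarrow> tdeg x = e}" for e
    unfolding quot_grading_def coarsen_eq image_image to_quot_def ..
  have wt: "tdeg (x + (\<lambda>t. int (Poly_Mapping.lookup p t))) = tdeg x + total_deg p" for x :: "'n \<Rightarrow> int" and p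
    by (simp add: tdeg_def total_deg_def sum.distrib)
  obtain i0 where "\<forall>i>i0. subquot_dim sq.cscale (P.cs.cocycles_mod m j (- i)) (P.cs.coboundaries_mod m j (- i)) (P.predicted_dim m j i)"
    using P.dim_cohomology_mod_forms by blast
  then have "local_cohomology_dim total_deg (quot_module M (\<Theta>M a m)) (quot_grading M (\<Theta>M a m) (coarsen M gr)) j (- i) =
      enat (P.predicted_dim m j i)" if "i > i0" for i
    using that by (intro P.local_cohomology_dim_eq[where wt = tdeg, OF gr wt])
      (simp only: P.homogeneous_cocycles P.homogeneous_coboundaries)
  then show ?thesis unfolding P.predicted_dim_def by blast
qed

end

lemma sum_squarefree_degrees:
  fixes f :: "('n::finite \<Rightarrow> int) \<Rightarrow> 'b::comm_monoid_add"
  shows "(\<Sum>F\<in>squarefree_degrees. f F) = (\<Sum>A\<in>UNIV. f (nind 1 A))"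
proof (rule sum.reindex_bij_witness[of _ "nind 1" pos])
  show "nind 1 (pos F) = F" if "F \<in> squarefree_degrees" for F :: "'n \<Rightarrow> int"
  proof
    fix t show "nind 1 (pos F) t = F t" using that by (cases "F t = 0") (auto simp: squarefree_degrees_def nind_def pos_def)
  qed
  then show "f (nind 1 (pos F)) = f F" if "F \<in> squarefree_degrees" for F using that by simp
qed (auto simp: squarefree_degrees_def pos_def nind_def)

theorem theorem8p5:
  fixes M :: "(('n::{finite, linorder}, 'k::field) mpoly, 'm) module"
    and gr :: "('n \<Rightarrow> int) \<Rightarrow> 'm set"
    and m :: nat
  assumes "infinite (UNIV :: 'k set)"
    and "squarefree_module M gr"
  shows "\<exists>U :: ('n \<times> nat \<Rightarrow> 'k) set.
    zariski_open (UNIV \<times> {1..m}) U \<and> U \<noteq> {} \<and>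
    (\<forall>a\<in>U. let \<Theta>M = forms_submodule m (linear_form a) M in
      \<forall>l :: int. \<exists>i0 :: int. \<forall>i > i0.
        local_cohomology_dim total_deg (quot_module M \<Theta>M) (quot_grading M \<Theta>M (coarsen M gr)) l (- i) =
        (\<Sum>F\<in>squarefree_degrees.
          of_nat (binom (i - 1) ((\<Sum>t\<in>UNIV. F t) - int m - 1)) *
          local_cohomology_dim fine_deg M gr (l + int m) (- F)))"
proof -
  obtain G \<delta> where "squarefree_presentation M gr G \<delta>"
  proof -
    obtain G \<delta> where "graded_module fine_deg M gr" "finite G" "G \<subseteq> carrier M"
      "\<forall>g\<in>G. \<delta> g \<in> squarefree_degrees \<and> g \<in> gr (\<delta> g)" "LinearCombinations.module.span poly_ring M G = carrier M"
      "\<forall>s\<in>relations M G. \<exists>R c. finite R \<and>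
        R \<subseteq> {r \<in> relations M G. \<exists>d\<in>squarefree_degrees. homogeneous_relation \<delta> G d r} \<and>
        (\<forall>g\<in>G. s g = (\<Sum>r\<in>R. c r * r g))"
      using assms(2) unfolding squarefree_module_def by (elim conjE exE)
    then have "squarefree_presentation M gr G \<delta>" by (intro squarefree_presentation.intro) simp_all
    then show ?thesis by (rule that)
  qed
  then interpret squarefree_presentation M gr G \<delta> .
  \<comment> \<open>The open set depends on the number of forms, the variables and the field, not on
    \<open>M\<close>, and it serves all \<open>l\<close> at once.\<close>
  obtain U :: "('n \<times> nat \<Rightarrow> 'k) set" where U: "zariski_open (UNIV \<times> {1..m}) U" "U \<noteq> {}" "\<And>a. a \<in> U \<Longrightarrow> general_position m a"
    using generic_general_position[OF assms(1)] by blast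
  \<comment> \<open>All dimensions on the right are finite, so the sum of extended numbers is the
    image of a sum of natural numbers; its index is changed from squarefree degrees to the sets of
    places where they are 1.\<close>
  have rhs: "(\<Sum>F\<in>squarefree_degrees. of_nat (binom (i - 1) ((\<Sum>t\<in>UNIV. F t) - int m - 1)) *
      local_cohomology_dim fine_deg M gr (l + int m) (- F)) =
    enat (\<Sum>F\<in>UNIV. binom (i - 1) (int (card F) - int m - 1) * sq.hdim (l + int m) F)" for i l
  proof -
    have "local_cohomology_dim fine_deg M gr (l + int m) (- nind 1 A) = enat (sq.hdim (l + int m) A)" for A
    proof -
      have "pos (- nind 1 A) = {}" "neg (- nind 1 A) = A" by (auto simp: pos_def neg_def nind_def split: if_splits)
      then show ?thesis using dim_local_cohomology[of "- nind 1 A"] by simp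
    qed
    moreover have "(\<Sum>t\<in>UNIV. nind 1 A t) = int (card A)" for A :: "'n set"
      by (simp add: nind_def sum.If_cases)
    ultimately show ?thesis
      unfolding sum_squarefree_degrees by (simp flip: of_nat_eq_enat)
  qed
  show ?thesis
    unfolding Let_def rhs using U dim_local_cohomology_mod_forms by (intro exI[of _ U]) blast
qed

end
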